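(* Let $H$ be an affine algebraic group over $k$ and let $W$ be a finite dimensional rational $H$-module. Let $\epsilon\subset W$ be an $r$-dimensional subspace, let $S\subset H$ be the (reduced) stabilizer of $\epsilon$, let $Y=H\cdot\epsilon\subset\operatorname{Grass}(r,W)\subset\mathbb E(r,\mathfrak g_{W,H})$, and assume that the morphism $\phi:H/S\to Y$ induced by the orbit map is an isomorphism. Then there exists a rational $G_{W,H}$-module $M$ such that $$\mathcal{I}m^{1,Y}(M)\simeq(\gamma_r)_{|Y}\simeq\mathcal L_{H/S}(\epsilon)$$ as $H$-equivariant algebraic vector bundles on $Y$, where $\gamma_r$ is the canonical rank $r$ subbundle of $W\otimes\mathcal O_{\operatorname{Grass}(r,W)}$.
   Context: Let $k$ be an algebraically closed field of characteristic $p>0$. Lie algebras are finite dimensional restricted Lie algebras over $k$ with $p$-operation $(-)^{[p]}$; $\mathfrak u(\mathfrak g)$ is the restricted enveloping algebra. An affine algebraic group is a reduced group scheme represented by a finitely generated integral $k$-algebra. Modules are finite dimensional. An elementary subalgebra of $\mathfrak g$ is an abelian Lie subalgebra $\epsilon$ with $x^{[p]}=0$ for all $x\in\epsilon$. For $0<r<\dim\mathfrak g$, $\mathbb E(r,\mathfrak g)\subset\operatorname{Grass}(r,\mathfrak g)$ is the closed subvariety of $r$-dimensional elementary subalgebras. Image sheaves. Let $\mathcal C^o$ be the quasi-projective variety of linearly independent $r$-tuples $(X_1,\dots,X_r)$ of pairwise commuting elements of $\mathfrak g$ with $X_s^{[p]}=0$; sending a tuple to its span makes $\mathcal C^o\to\mathbb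 E(r,\mathfrak g)$ a $\mathrm{GL}_r$-torsor. Fix a basis $x_1,\dots,x_m$ of $\mathfrak g$ and let $Y_{i,s}$ be the function on $\mathcal C^o$ giving the $i$-th coordinate of $X_s$. For a locally closed subvariety $X\subset\mathbb E(r,\mathfrak g)$ let $q:\widetilde X\to X$ be the restriction of this torsor. For a finite dimensional $\mathfrak u(\mathfrak g)$-module $M$ let $\Theta_s:M\otimes\mathcal O_{\widetilde X}\to M\otimes\mathcal O_{\widetilde X}$, $m\otimes f\mapsto\sum_i x_im\otimes Y_{i,s}f$. The sum of the images of $\Theta_1,\dots,\Theta_r$ is a $\mathrm{GL}_r$-invariant coherent subsheaf of $M\otimes\mathcal O_{\widetilde X}$; by descent along $q$ it is the pull-back of a unique coherent subsheaf $\mathcal{I}m^{1,X}(M)\subset M\otimes\mathcal O_X$. Semi-direct products. $\mathbb W\simeq\mathbb G_a^{\oplus\dim W}$ is the vector group associated to $W$ and $\mathbb W_{(1)}$ its first Frobenius kernel; $G_{W,H}=\mathbb W_{(1)}\rtimes H$ and $\mathfrak g_{W,H}=\operatorname{Lie}(G_{W,H})$. The subspace $W=\operatorname{Lie}(\mathbb W_{(1)})\subset\mathfrak g_{W,H}$ is an elementary subalgebra and an ideal, so $\operatorname{Grass}(r,W)\subset\mathbb E(r,\mathfrak g_{W,H})$, and $H$ acts on it through its action on $W$. A rational $G_{W,H}$-module is a $\mathfrak u(\mathfrak g_{W,H})$-module by differentiation; $\mathcal{I}m^{1,Y}(M)$ is formed with $\mathfrak g=\mathfrak g_{W,H}$ and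 is $H$-equivariant. For a closed subgroup $S\subset H$ and a rational $S$-module $U$, $\mathcal L_{H/S}(U)$ is the $H$-equivariant vector bundle on $H/S$ of sections of $H\times^SU\to H/S$; here $\mathcal L_{H/S}(\epsilon)$ is viewed on $Y$ via $\phi$. *)

theory Defs
  imports
    "HOL-Analysis.Abstract_Topology"
    "HOL-Library.Function_Algebras"
    "HOL-Library.FuncSet"
    "HOL-Computational_Algebra.Polynomial"
begin

section \<open>Linear algebra\<close>

definition fun_scale :: "'k::field \<Rightarrow> ('x \<Rightarrow> 'k) \<Rightarrow> 'x \<Rightarrow> 'k"
  where "fun_scale c f = (\<lambda>x. c * f x)"

lemma vector_space_fun_scale: "vector_space fun_scale"
  by unfold_locales (auto simp: fun_scale_def fun_eq_iff algebra_simps)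

definition fin_dim_subspace :: "('k::field \<Rightarrow> 'v::ab_group_add \<Rightarrow> 'v) \<Rightarrow> 'v set \<Rightarrow> bool"
  where "fin_dim_subspace sc V \<longleftrightarrow> (\<exists>B. finite B \<and> V = module.span sc B)"

definition basis_of :: "('k::field \<Rightarrow> 'v::ab_group_add \<Rightarrow> 'v) \<Rightarrow> 'v set \<Rightarrow> 'v set \<Rightarrow> bool"
  where "basis_of sc B V \<longleftrightarrow>
    finite B \<and> \<not> module.dependent sc B \<and> module.span sc B = V"

definition linear_form :: "('k::field \<Rightarrow> 'v::ab_group_add \<Rightarrow> 'v) \<Rightarrow> ('v \<Rightarrow> 'k) \<Rightarrow> bool"
  where "linear_form sc l \<longleftrightarrow> Vector_Spaces.linear sc (*) l"

definition indep_tuples ::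
    "('k::field \<Rightarrow> 'v::ab_group_add \<Rightarrow> 'v) \<Rightarrow> 'v set \<Rightarrow> nat \<Rightarrow> (nat \<Rightarrow> 'v) set"
  where "indep_tuples sc V r =
    {T \<in> {..<r} \<rightarrow>\<^sub>E V. inj_on T {..<r} \<and> \<not> module.dependent sc (T ` {..<r})}"

definition tuple_span :: "('k::field \<Rightarrow> 'v::ab_group_add \<Rightarrow> 'v) \<Rightarrow> nat \<Rightarrow> (nat \<Rightarrow> 'v) \<Rightarrow> 'v set"
  where "tuple_span sc r T = module.span sc (T ` {..<r})"

definition vector_space_on ::
    "'e set \<Rightarrow> ('e \<Rightarrow> 'e \<Rightarrow> 'e) \<Rightarrow> ('k::field \<Rightarrow> 'e \<Rightarrow> 'e) \<Rightarrow> 'e \<Rightarrow> bool"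
  where "vector_space_on V add sm z \<longleftrightarrow>
    z \<in> V \<and>
    (\<forall>a\<in>V. \<forall>b\<in>V. add a b \<in> V \<and> add a b = add b a) \<and>
    (\<forall>a\<in>V. \<forall>b\<in>V. \<forall>c\<in>V. add (add a b) c = add a (add b c)) \<and>
    (\<forall>a\<in>V. add z a = a \<and> (\<exists>b\<in>V. add a b = z)) \<and>
    (\<forall>c. \<forall>a\<in>V. sm c a \<in> V) \<and>
    (\<forall>c. \<forall>a\<in>V. \<forall>b\<in>V. sm c (add a b) = add (sm c a) (sm c b)) \<and>
    (\<forall>c d. \<forall>a\<in>V. sm (c + d) a = add (sm c a) (sm d a) \<and> sm (c * d) a = sm c (sm d a)) \<and>
    (\<forall>a\<in>V. sm 1 a = a)"

text \<open>Tensor products are modelled by functions. For an algebra \<open>A\<close> of \<open>k\<close>-valued functions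
  on \<open>X\<close>, \<open>V \<otimes> A\<close> is the set of functions \<open>X \<rightarrow> V\<close> of the form \<open>x \<mapsto> \<Sum> f\<^sub>i(x) v\<^sub>i\<close>, and
  \<open>A \<otimes> B\<close> consists of the functions \<open>(x, y) \<mapsto> \<Sum> f\<^sub>i(x) g\<^sub>i(y)\<close>.\<close>

definition vec_tensor ::
    "('k::field \<Rightarrow> 'v::ab_group_add \<Rightarrow> 'v) \<Rightarrow> 'v set \<Rightarrow> ('x \<Rightarrow> 'k) set \<Rightarrow> ('x \<Rightarrow> 'v) set"
  where "vec_tensor sc V A =
    {F. \<exists>(n::nat) f v. (\<forall>i<n. f i \<in> A \<and> v i \<in> V) \<and> F = (\<lambda>x. \<Sum>i<n. sc (f i x) (v i))}"

definition fun_tensor ::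
    "('x \<Rightarrow> 'k::field) set \<Rightarrow> ('y \<Rightarrow> 'k) set \<Rightarrow> ('x \<times> 'y \<Rightarrow> 'k) set"
  where "fun_tensor A B =
    {F. \<exists>(n::nat) f g. (\<forall>i<n. f i \<in> A \<and> g i \<in> B) \<and> F = (\<lambda>(x, y). \<Sum>i<n. f i x * g i y)}"

definition fun_sum :: "('x \<Rightarrow> 'k::field) set \<Rightarrow> ('x \<Rightarrow> 'k) set \<Rightarrow> ('x \<Rightarrow> 'k) set"
  where "fun_sum I J = {\<lambda>x. f x + g x | f g. f \<in> I \<and> g \<in> J}"

inductive_set gen_alg :: "('x \<Rightarrow> 'k::field) set \<Rightarrow> ('x \<Rightarrow> 'k) set" for G
  where
    gen: "g \<in> G \<Longrightarrow> g \<in> gen_alg G"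
  | const: "(\<lambda>x. c) \<in> gen_alg G"
  | add: "f \<in> gen_alg G \<Longrightarrow> g \<in> gen_alg G \<Longrightarrow> (\<lambda>x. f x + g x) \<in> gen_alg G"
  | mult: "f \<in> gen_alg G \<Longrightarrow> g \<in> gen_alg G \<Longrightarrow> (\<lambda>x. f x * g x) \<in> gen_alg G"

definition ideal_gen :: "('x \<Rightarrow> 'k::field) set \<Rightarrow> ('x \<Rightarrow> 'k) set \<Rightarrow> ('x \<Rightarrow> 'k) set"
  where "ideal_gen A G =
    {F. \<exists>(n::nat) a g. (\<forall>i<n. a i \<in> A \<and> g i \<in> G) \<and> F = (\<lambda>x. \<Sum>i<n. a i x * g i x)}"

definition poly_funs :: "('k::field \<Rightarrow> 'v::ab_group_add \<Rightarrow> 'v) \<Rightarrow> ('v \<Rightarrow> 'k) set"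
  where "poly_funs sc = gen_alg {l. linear_form sc l}"


section \<open>Spaces with functions\<close>

text \<open>Reduced varieties over the algebraically closed field \<open>k\<close> are treated as topological spaces
  with a sheaf of \<open>k\<close>-valued functions. \<open>reg X U\<close> is meaningful for open \<open>U\<close> only; its members are
  total functions whose values outside \<open>U\<close> are irrelevant.\<close>

record ('x, 'k) fspace =
  top :: "'x topology"
  reg :: "'x set \<Rightarrow> ('x \<Rightarrow> 'k) set"

abbreviation pts :: "('x, 'k) fspace \<Rightarrow> 'x set"
  where "pts X \<equiv> topspace (top X)"

abbreviation is_open :: "('x, 'k) fspace \<Rightarrow> 'x set \<Rightarrow> bool"
  where "is_open X \<equiv> openin (top X)"

text \<open>The affine variety with coordinate algebra \<open>A\<close>: Zariski topology, and functions that
  are locally quotients of elements of \<open>A\<close>.\<close>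

definition affine_space_of :: "('x \<Rightarrow> 'k::field) set \<Rightarrow> ('x, 'k) fspace"
  where "affine_space_of A = \<lparr>
    top = topology_generated_by {{x. f x \<noteq> 0} | f. f \<in> A},
    reg = (\<lambda>U. {f. \<forall>x\<in>U. \<exists>a\<in>A. \<exists>b\<in>A. b x \<noteq> 0 \<and>
                     (\<forall>y\<in>U. b y \<noteq> 0 \<longrightarrow> f y = a y / b y)})\<rparr>"

definition sub_space :: "('x, 'k::field) fspace \<Rightarrow> 'x set \<Rightarrow> ('x, 'k) fspace"
  where "sub_space X S = \<lparr>
    top = subtopology (top X) S,
    reg = (\<lambda>U. {f. \<forall>x\<in>U. \<exists>V g. is_open X V \<and> x \<in> V \<and> g \<in> reg X V \<and>
                     (\<forall>y\<in>U \<inter> V. f y = g y)})\<rparr>"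

definition quot_topology :: "'x topology \<Rightarrow> ('x \<Rightarrow> 'y) \<Rightarrow> 'y topology"
  where "quot_topology T q =
    topology (\<lambda>U. U \<subseteq> q ` topspace T \<and> openin T {x \<in> topspace T. q x \<in> U})"

lemma istopology_quot:
  "istopology (\<lambda>U. U \<subseteq> q ` topspace T \<and> openin T {x \<in> topspace T. q x \<in> U})"
  unfolding istopology_def
proof (intro conjI allI impI; (elim conjE)?)
  fix U V
  assume "openin T {x \<in> topspace T. q x \<in> U}" "openin T {x \<in> topspace T. q x \<in> V}"
  then have "openin T ({x \<in> topspace T. q x \<in> U} \<inter> {x \<in> topspace T. q x \<in> V})" by blast
  moreover have "{x \<in> topspace T. q x \<in> U} \<inter> {x \<in> topspace T. q x \<in> V} =
      {x \<in> topspace T. q x \<in> U \<inter> V}" by auto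
  ultimately show "openin T {x \<in> topspace T. q x \<in> U \<inter> V}" by simp
next
  fix K
  assume K: "\<forall>U\<in>K. U \<subseteq> q ` topspace T \<and> openin T {x \<in> topspace T. q x \<in> U}"
  have "openin T (\<Union>U\<in>K. {x \<in> topspace T. q x \<in> U})" using K by blast
  moreover have "(\<Union>U\<in>K. {x \<in> topspace T. q x \<in> U}) = {x \<in> topspace T. q x \<in> \<Union>K}" by auto
  ultimately show "openin T {x \<in> topspace T. q x \<in> \<Union>K}" by simp
qed auto

lemma openin_quot_topology:
  "openin (quot_topology T q) U \<longleftrightarrow>
     U \<subseteq> q ` topspace T \<and> openin T {x \<in> topspace T. q x \<in> U}"
  unfolding quot_topology_def by (simp add: topology_inverse'[OF istopology_quot])

definition quot_space :: "('x, 'k::field) fspace \<Rightarrow> ('x \<Rightarrow> 'y) \<Rightarrow> ('y, 'k) fspace"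
  where "quot_space X q = \<lparr>
    top = quot_topology (top X) q,
    reg = (\<lambda>U. {f. f \<circ> q \<in> reg X {x \<in> pts X. q x \<in> U}})\<rparr>"

text \<open>The product of varieties (whose topology is finer than the product topology).\<close>

definition prod_space ::
    "('x, 'k::field) fspace \<Rightarrow> ('y, 'k) fspace \<Rightarrow> ('x \<times> 'y, 'k) fspace"
  where "prod_space X Y = \<lparr>
    top = topology_generated_by
      {{z \<in> U \<times> V. F z \<noteq> 0} | U V F.
        is_open X U \<and> is_open Y V \<and> F \<in> fun_tensor (reg X U) (reg Y V)},
    reg = (\<lambda>N. {f. \<forall>z\<in>N. \<exists>U V F D. is_open X U \<and> is_open Y V \<and> z \<in> U \<times> V \<and>
       F \<in> fun_tensor (reg X U) (reg Y V) \<and> D \<in> fun_tensor (reg X U) (reg Y V) \<and> D z \<noteq> 0 \<and>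
       (\<forall>w\<in>N \<inter> (U \<times> V). D w \<noteq> 0 \<longrightarrow> f w = F w / D w)})\<rparr>"

definition morphism :: "('x, 'k::field) fspace \<Rightarrow> ('y, 'k) fspace \<Rightarrow> ('x \<Rightarrow> 'y) \<Rightarrow> bool"
  where "morphism X Y f \<longleftrightarrow> continuous_map (top X) (top Y) f \<and>
    (\<forall>U g. is_open Y U \<longrightarrow> g \<in> reg Y U \<longrightarrow> g \<circ> f \<in> reg X {x \<in> pts X. f x \<in> U})"

definition isomorphism :: "('x, 'k::field) fspace \<Rightarrow> ('y, 'k) fspace \<Rightarrow> ('x \<Rightarrow> 'y) \<Rightarrow> bool"
  where "isomorphism X Y f \<longleftrightarrow> bij_betw f (pts X) (pts Y) \<and>
    morphism X Y f \<and> morphism Y X (inv_into (pts X) f)"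

definition vector_variety :: "('k::field \<Rightarrow> 'v::ab_group_add \<Rightarrow> 'v) \<Rightarrow> ('v, 'k) fspace"
  where "vector_variety sc = affine_space_of (poly_funs sc)"

text \<open>The affine space of \<open>r\<close>-tuples of vectors. Only its subspaces consisting of tuples
  in \<open>{..<r} \<rightarrow>\<^sub>E V\<close> with \<open>V\<close> finite dimensional are used.\<close>

definition tuple_space :: "('k::field \<Rightarrow> 'v::ab_group_add \<Rightarrow> 'v) \<Rightarrow> nat \<Rightarrow> (nat \<Rightarrow> 'v, 'k) fspace"
  where "tuple_space sc r =
    affine_space_of (gen_alg {\<lambda>T. l (T s) | l s. linear_form sc l \<and> s < r})"

text \<open>\<open>Grass(r, V)\<close> as the quotient of the variety of linearly independent \<open>r\<close>-tuples by
  \<open>GL\<^sub>r\<close>; its points are the \<open>r\<close>-dimensional subspaces of \<open>V\<close>.\<close>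

definition grass ::
    "('k::field \<Rightarrow> 'v::ab_group_add \<Rightarrow> 'v) \<Rightarrow> 'v set \<Rightarrow> nat \<Rightarrow> ('v set, 'k) fspace"
  where "grass sc V r =
    quot_space (sub_space (tuple_space sc r) (indep_tuples sc V r)) (tuple_span sc r)"


section \<open>Affine group schemes\<close>

text \<open>An affine group scheme of finite type is presented as a closed subgroup scheme of a reduced
  affine algebraic group \<open>\<Gamma>\<close>: the type \<open>'g\<close> is the group of \<open>k\<close>-points of \<open>\<Gamma>\<close>, \<open>coord\<close> is the
  algebra \<open>k[\<Gamma>]\<close> of functions on it, and \<open>ideal\<close> is the defining Hopf ideal, so that the
  coordinate algebra of the group scheme is \<open>coord / ideal\<close>.\<close>

record ('g, 'k) grp_scheme =
  gmult :: "'g \<Rightarrow> 'g \<Rightarrow> 'g"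
  gone :: 'g
  ginv :: "'g \<Rightarrow> 'g"
  coord :: "('g \<Rightarrow> 'k) set"
  ideal :: "('g \<Rightarrow> 'k) set"

definition alg_character :: "('x \<Rightarrow> 'k::field) set \<Rightarrow> (('x \<Rightarrow> 'k) \<Rightarrow> 'k) \<Rightarrow> bool"
  where "alg_character A \<chi> \<longleftrightarrow> (\<forall>c. \<chi> (\<lambda>_. c) = c) \<and>
    (\<forall>f\<in>A. \<forall>g\<in>A. \<chi> (\<lambda>x. f x + g x) = \<chi> f + \<chi> g \<and> \<chi> (\<lambda>x. f x * g x) = \<chi> f * \<chi> g)"

text \<open>The last three conditions say that the points are exactly the \<open>k\<close>-points of the spectrum
  of \<open>coord\<close>, and that multiplication and inversion are morphisms.\<close>

definition affine_algebraic_group :: "('h, 'k::field) grp_scheme \<Rightarrow> bool"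
  where "affine_algebraic_group H \<longleftrightarrow>
    Groups.group (gmult H) (gone H) (ginv H) \<and>
    ideal H = {\<lambda>_. 0} \<and>
    (\<exists>F. finite F \<and> coord H = gen_alg F) \<and>
    (\<forall>f\<in>coord H. \<forall>g\<in>coord H. (\<forall>x. f x * g x = 0) \<longrightarrow> (\<forall>x. f x = 0) \<or> (\<forall>x. g x = 0)) \<and>
    (\<forall>\<chi>. alg_character (coord H) \<chi> \<longrightarrow> (\<exists>!x. \<forall>f\<in>coord H. \<chi> f = f x)) \<and>
    (\<forall>f\<in>coord H. (\<lambda>(x, y). f (gmult H x y)) \<in> fun_tensor (coord H) (coord H)) \<and>
    (\<forall>f\<in>coord H. (\<lambda>x. f (ginv H x)) \<in> coord H)"

definition group_variety :: "('h, 'k::field) grp_scheme \<Rightarrow> ('h, 'k) fspace"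
  where "group_variety H = affine_space_of (coord H)"

definition vector_group :: "('k::field \<Rightarrow> 'w::ab_group_add \<Rightarrow> 'w) \<Rightarrow> ('w, 'k) grp_scheme"
  where "vector_group sc =
    \<lparr>gmult = (+), gone = 0, ginv = uminus, coord = poly_funs sc, ideal = {\<lambda>_. 0}\<rparr>"

definition frobenius_kernel :: "('g, 'k::field) grp_scheme \<Rightarrow> ('g, 'k) grp_scheme"
  where "frobenius_kernel G = G\<lparr>ideal := ideal_gen (coord G)
     (ideal G \<union> {\<lambda>x. f x ^ CHAR('k) | f. f \<in> coord G \<and> f (gone G) = 0})\<rparr>"

definition semidirect ::
    "('h \<Rightarrow> 'n \<Rightarrow> 'n) \<Rightarrow> ('n, 'k::field) grp_scheme \<Rightarrow> ('h, 'k) grp_scheme \<Rightarrow> ('n \<times> 'h, 'k) grp_scheme"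
  where "semidirect act N H = \<lparr>
    gmult = (\<lambda>(n, h) (n', h'). (gmult N n (act h n'), gmult H h h')),
    gone = (gone N, gone H),
    ginv = (\<lambda>(n, h). (act (ginv H h) (ginv N n), ginv H h)),
    coord = fun_tensor (coord N) (coord H),
    ideal = fun_sum (fun_tensor (ideal N) (coord H)) (fun_tensor (coord N) (ideal H))\<rparr>"

text \<open>\<open>G\<^bsub>W,H\<^esub> = \<bbbW>\<^bsub>(1)\<^esub> \<rtimes> H\<close>.\<close>

definition G_WH ::
    "('k::field \<Rightarrow> 'w::ab_group_add \<Rightarrow> 'w) \<Rightarrow> ('h \<Rightarrow> 'w \<Rightarrow> 'w) \<Rightarrow> ('h, 'k) grp_scheme \<Rightarrow>
     ('w \<times> 'h, 'k) grp_scheme"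
  where "G_WH sc act H = semidirect act (frobenius_kernel (vector_group sc)) H"

text \<open>A finite dimensional rational module, that is, a comodule \<open>\<Delta> : M \<rightarrow> M \<otimes> k[G]\<close>. It is given
  by a lift \<open>m \<mapsto> (x \<mapsto> \<rho> x m) \<in> M \<otimes> coord\<close> of \<open>\<Delta>\<close>; only the class of \<open>\<rho>\<close> modulo \<open>ideal\<close>
  matters, and coassociativity is required modulo the ideal of \<open>G \<times> G\<close>. If \<open>ideal\<close> is
  zero, \<open>\<rho>\<close> is a linear action with regular matrix coefficients.\<close>

definition rational_module ::
    "('g, 'k::field) grp_scheme \<Rightarrow> ('k \<Rightarrow> 'm::ab_group_add \<Rightarrow> 'm) \<Rightarrow> 'm set \<Rightarrow> ('g \<Rightarrow> 'm \<Rightarrow> 'm) \<Rightarrow> bool"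
  where "rational_module G sc M \<rho> \<longleftrightarrow>
    fin_dim_subspace sc M \<and>
    (\<forall>x. \<forall>m\<in>M. \<forall>m'\<in>M. \<rho> x (m + m') = \<rho> x m + \<rho> x m') \<and>
    (\<forall>x c. \<forall>m\<in>M. \<rho> x (sc c m) = sc c (\<rho> x m)) \<and>
    (\<forall>m\<in>M. (\<lambda>x. \<rho> x m) \<in> vec_tensor sc M (coord G)) \<and>
    (\<forall>m\<in>M. \<rho> (gone G) m = m) \<and>
    (\<forall>m\<in>M. (\<lambda>(x, y). \<rho> (gmult G x y) m - \<rho> x (\<rho> y m)) \<in>
       vec_tensor sc M (fun_sum (fun_tensor (ideal G) (coord G)) (fun_tensor (coord G) (ideal G))))"


section \<open>Restricted Lie algebras\<close>

record ('l, 'k) rlie =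
  lcar :: "'l set"
  lscale :: "'k \<Rightarrow> 'l \<Rightarrow> 'l"
  lbracket :: "'l \<Rightarrow> 'l \<Rightarrow> 'l"
  lpow :: "'l \<Rightarrow> 'l"

text \<open>The product \<open>(\<delta> \<otimes> \<mu>) \<circ> \<Delta>\<close> of functionals on the coordinate algebra. Functionals are
  normalised to be zero outside \<open>coord\<close>.\<close>

definition convolution ::
    "('g, 'k::field) grp_scheme \<Rightarrow> (('g \<Rightarrow> 'k) \<Rightarrow> 'k) \<Rightarrow> (('g \<Rightarrow> 'k) \<Rightarrow> 'k) \<Rightarrow> ('g \<Rightarrow> 'k) \<Rightarrow> 'k"
  where "convolution G \<delta> \<mu> =
    (\<lambda>f. if f \<in> coord G then \<delta> (\<lambda>x. \<mu> (\<lambda>y. f (gmult G x y))) else 0)"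

definition counit :: "('g, 'k::field) grp_scheme \<Rightarrow> ('g \<Rightarrow> 'k) \<Rightarrow> 'k"
  where "counit G = (\<lambda>f. if f \<in> coord G then f (gone G) else 0)"

text \<open>\<open>Lie(G)\<close>: the point derivations of \<open>k[G] = coord / ideal\<close> at the identity, with the
  commutator and the \<open>p\<close>-th power for convolution.\<close>

definition Lie :: "('g, 'k::field) grp_scheme \<Rightarrow> (('g \<Rightarrow> 'k) \<Rightarrow> 'k, 'k) rlie"
  where "Lie G = \<lparr>
    lcar = {\<delta>. (\<forall>f. f \<notin> coord G \<longrightarrow> \<delta> f = 0) \<and>
      (\<forall>f\<in>coord G. \<forall>g\<in>coord G. \<delta> (\<lambda>x. f x + g x) = \<delta> f + \<delta> g) \<and>
      (\<forall>c. \<forall>f\<in>coord G. \<delta> (\<lambda>x. c * f x) = c * \<delta> f) \<and>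
      (\<forall>f\<in>coord G. \<forall>g\<in>coord G. \<delta> (\<lambda>x. f x * g x) = f (gone G) * \<delta> g + \<delta> f * g (gone G)) \<and>
      (\<forall>f\<in>ideal G. \<delta> f = 0)},
    lscale = fun_scale,
    lbracket = (\<lambda>\<delta> \<mu>. convolution G \<delta> \<mu> - convolution G \<mu> \<delta>),
    lpow = (\<lambda>\<delta>. (convolution G \<delta> ^^ CHAR('k)) (counit G))\<rparr>"

text \<open>The identification of \<open>W\<close> with \<open>Lie(\<bbbW>\<^bsub>(1)\<^esub>) \<subseteq> Lie(G\<^bsub>W,H\<^esub>)\<close>: \<open>w\<close> is the derivative at \<open>t = 0\<close>
  along \<open>t \<mapsto> (t w, 1)\<close>. The polynomial below is unique because \<open>k\<close> is infinite.\<close>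

definition lie_W ::
    "('k::field \<Rightarrow> 'w::ab_group_add \<Rightarrow> 'w) \<Rightarrow> ('h \<Rightarrow> 'w \<Rightarrow> 'w) \<Rightarrow> ('h, 'k) grp_scheme \<Rightarrow>
     'w \<Rightarrow> ('w \<times> 'h \<Rightarrow> 'k) \<Rightarrow> 'k"
  where "lie_W sc act H w =
    (\<lambda>f. if f \<in> coord (G_WH sc act H)
         then poly (pderiv (THE P. \<forall>t. poly P t = f (sc t w, gone H))) 0 else 0)"

text \<open>The action \<open>(id \<otimes> \<delta>) \<circ> \<Delta>\<close> of \<open>\<delta> \<in> Lie(G)\<close> on a rational \<open>G\<close>-module.\<close>

definition lie_action ::
    "('k::field \<Rightarrow> 'm::ab_group_add \<Rightarrow> 'm) \<Rightarrow> 'm set \<Rightarrow> ('g \<Rightarrow> 'm \<Rightarrow> 'm) \<Rightarrow>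
     (('g \<Rightarrow> 'k) \<Rightarrow> 'k) \<Rightarrow> 'm \<Rightarrow> 'm"
  where "lie_action sc M \<rho> \<delta> m =
    (THE v. v \<in> M \<and> (\<forall>l. linear_form sc l \<longrightarrow> l v = \<delta> (\<lambda>x. l (\<rho> x m))))"

definition elementary_subalgebra :: "('l::ab_group_add, 'k::field) rlie \<Rightarrow> 'l set \<Rightarrow> bool"
  where "elementary_subalgebra L E \<longleftrightarrow>
    E \<subseteq> lcar L \<and> module.subspace (lscale L) E \<and>
    (\<forall>x\<in>E. \<forall>y\<in>E. lbracket L x y = 0) \<and> (\<forall>x\<in>E. lpow L x = 0)"

text \<open>\<open>\<bbbE>(r, L)\<close>, with the structure of a closed subvariety of \<open>Grass(r, L)\<close>.\<close>

definition elem_variety :: "('l::ab_group_add, 'k::field) rlie \<Rightarrow> nat \<Rightarrow> ('l set, 'k) fspace"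
  where "elem_variety L r =
    sub_space (grass (lscale L) (lcar L) r) {E. elementary_subalgebra L E}"

text \<open>The torsor over a subvariety \<open>X\<close> of \<open>\<bbbE>(r, L)\<close>; its projection is \<open>tuple_span\<close>.\<close>

definition elem_tuples :: "('l::ab_group_add, 'k::field) rlie \<Rightarrow> nat \<Rightarrow> (nat \<Rightarrow> 'l) set"
  where "elem_tuples L r = {T \<in> indep_tuples (lscale L) (lcar L) r.
    (\<forall>s<r. \<forall>t<r. lbracket L (T s) (T t) = 0) \<and> (\<forall>s<r. lpow L (T s) = 0)}"

definition torsor ::
    "('l::ab_group_add, 'k::field) rlie \<Rightarrow> nat \<Rightarrow> ('l set, 'k) fspace \<Rightarrow> (nat \<Rightarrow> 'l, 'k) fspace"
  where "torsor L r X =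
    sub_space (tuple_space (lscale L) r) {T \<in> elem_tuples L r. tuple_span (lscale L) r T \<in> pts X}"


section \<open>Sheaves of sections\<close>

text \<open>Sections over \<open>U\<close> are functions on \<open>U\<close>, taken to be \<open>undefined\<close> outside \<open>U\<close>.\<close>

definition free_sections ::
    "('k::field \<Rightarrow> 'm::ab_group_add \<Rightarrow> 'm) \<Rightarrow> 'm set \<Rightarrow> ('x, 'k) fspace \<Rightarrow> 'x set \<Rightarrow> ('x \<Rightarrow> 'm) set"
  where "free_sections sc M X U = (\<lambda>F. restrict F U) ` vec_tensor sc M (reg X U)"

text \<open>\<open>generated sc X S U\<close>: the sections over \<open>U\<close> of the sheaf of \<open>\<O>\<close>-submodules generated
  by the local sections \<open>S V\<close>.\<close>

definition generated ::
    "('k::field \<Rightarrow> 'm::ab_group_add \<Rightarrow> 'm) \<Rightarrow> ('x, 'k) fspace \<Rightarrow> ('x set \<Rightarrow> ('x \<Rightarrow> 'm) set) \<Rightarrow>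
     'x set \<Rightarrow> ('x \<Rightarrow> 'm) set"
  where "generated sc X S U = {F \<in> extensional U. \<forall>x\<in>U. \<exists>V (n::nat) f e.
      is_open X V \<and> x \<in> V \<and> V \<subseteq> U \<and> (\<forall>i<n. f i \<in> reg X V \<and> e i \<in> S V) \<and>
      (\<forall>y\<in>V. F y = (\<Sum>i<n. sc (f i y) (e i y)))}"

text \<open>Coherent subsheaves of \<open>M \<otimes> \<O>\<^sub>X\<close>. As \<open>X\<close> is locally Noetherian, a sheaf of submodules of
  the coherent sheaf \<open>M \<otimes> \<O>\<^sub>X\<close> is coherent if and only if it is of finite type. The value on
  sets which are not open is normalised to be empty.\<close>

definition coherent_subsheaf ::
    "('k::field \<Rightarrow> 'm::ab_group_add \<Rightarrow> 'm) \<Rightarrow> 'm set \<Rightarrow> ('x, 'k) fspace \<Rightarrow>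
     ('x set \<Rightarrow> ('x \<Rightarrow> 'm) set) \<Rightarrow> bool"
  where "coherent_subsheaf sc M X I \<longleftrightarrow>
    (\<forall>U. \<not> is_open X U \<longrightarrow> I U = {}) \<and>
    (\<forall>U. is_open X U \<longrightarrow>
      I U \<subseteq> free_sections sc M X U \<and>
      (\<lambda>x\<in>U. 0) \<in> I U \<and>
      (\<forall>s\<in>I U. \<forall>t\<in>I U. (\<lambda>x\<in>U. s x + t x) \<in> I U) \<and>
      (\<forall>f\<in>reg X U. \<forall>s\<in>I U. (\<lambda>x\<in>U. sc (f x) (s x)) \<in> I U) \<and>
      (\<forall>V. is_open X V \<longrightarrow> V \<subseteq> U \<longrightarrow> (\<forall>s\<in>I U. restrict s V \<in> I V)) \<and>
      (\<forall>s\<in>extensional U.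
        (\<forall>x\<in>U. \<exists>V. is_open X V \<and> x \<in> V \<and> V \<subseteq> U \<and> restrict s V \<in> I V) \<longrightarrow> s \<in> I U)) \<and>
    (\<forall>x\<in>pts X. \<exists>U E. is_open X U \<and> x \<in> U \<and> finite E \<and> E \<subseteq> I U \<and>
      (\<forall>V. is_open X V \<longrightarrow> V \<subseteq> U \<longrightarrow>
         I V = generated sc X (\<lambda>V'. (\<lambda>e. restrict e V') ` E) V))"

text \<open>The subsheaf of \<open>M \<otimes> \<O>\<close> on \<open>X'\<close> generated by the sections \<open>s \<circ> q\<close>: the
  pull-back of the subsheaf \<open>I\<close> of \<open>M \<otimes> \<O>\<^sub>X\<close> along the morphism \<open>q : X' \<rightarrow> X\<close>. It is used for \<open>q\<close>
  flat or \<open>I\<close> a subbundle.\<close>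

definition pullback_subsheaf ::
    "('k::field \<Rightarrow> 'm::ab_group_add \<Rightarrow> 'm) \<Rightarrow> ('y, 'k) fspace \<Rightarrow> ('x, 'k) fspace \<Rightarrow> ('y \<Rightarrow> 'x) \<Rightarrow>
     ('x set \<Rightarrow> ('x \<Rightarrow> 'm) set) \<Rightarrow> 'y set \<Rightarrow> ('y \<Rightarrow> 'm) set"
  where "pullback_subsheaf sc X' X q I =
    generated sc X' (\<lambda>V. {\<lambda>y\<in>V. s (q y) | s U. is_open X U \<and> q ` V \<subseteq> U \<and> s \<in> I U})"

text \<open>\<open>\<Theta>\<^sub>s\<close>, for a basis \<open>B\<close> of \<open>L\<close>; \<open>\<sigma>\<close> is the action of \<open>L\<close> on the module and
  \<open>representation\<close> yields the coordinate functions \<open>Y\<^bsub>i,s\<^esub>\<close>.\<close>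

definition Theta ::
    "('l::ab_group_add, 'k::field) rlie \<Rightarrow> 'l set \<Rightarrow> ('k \<Rightarrow> 'm::ab_group_add \<Rightarrow> 'm) \<Rightarrow>
     ('l \<Rightarrow> 'm \<Rightarrow> 'm) \<Rightarrow> nat \<Rightarrow> ((nat \<Rightarrow> 'l) \<Rightarrow> 'm) \<Rightarrow> (nat \<Rightarrow> 'l) \<Rightarrow> 'm"
  where "Theta L B sc \<sigma> s F =
    (\<lambda>T. \<Sum>b\<in>B. sc (module.representation (lscale L) B (T s) b) (\<sigma> b (F T)))"

definition image_on_torsor ::
    "('l::ab_group_add, 'k::field) rlie \<Rightarrow> 'l set \<Rightarrow> ('k \<Rightarrow> 'm::ab_group_add \<Rightarrow> 'm) \<Rightarrow> 'm set \<Rightarrow>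
     ('l \<Rightarrow> 'm \<Rightarrow> 'm) \<Rightarrow> nat \<Rightarrow> ('l set, 'k) fspace \<Rightarrow>
     (nat \<Rightarrow> 'l) set \<Rightarrow> ((nat \<Rightarrow> 'l) \<Rightarrow> 'm) set"
  where "image_on_torsor L B sc M \<sigma> r X =
    generated sc (torsor L r X)
      (\<lambda>V. \<Union>s\<in>{..<r}. (\<lambda>F. restrict (Theta L B sc \<sigma> s F) V) ` free_sections sc M (torsor L r X) V)"

definition image_sheaf ::
    "('l::ab_group_add, 'k::field) rlie \<Rightarrow> 'l set \<Rightarrow> ('k \<Rightarrow> 'm::ab_group_add \<Rightarrow> 'm) \<Rightarrow> 'm set \<Rightarrow>
     ('l \<Rightarrow> 'm \<Rightarrow> 'm) \<Rightarrow> nat \<Rightarrow> ('l set, 'k) fspace \<Rightarrow> 'l set set \<Rightarrow> ('l set \<Rightarrow> 'm) set"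
  where "image_sheaf L B sc M \<sigma> r X =
    (THE I. coherent_subsheaf sc M X I \<and>
       (\<forall>V. is_open (torsor L r X) V \<longrightarrow>
          pullback_subsheaf sc (torsor L r X) X (tuple_span (lscale L) r) I V =
          image_on_torsor L B sc M \<sigma> r X V))"


section \<open>Equivariant vector bundles\<close>

text \<open>A vector bundle is represented by its sheaf of sections, which are functions
  with values in a family \<open>fib\<close> of vector spaces. The group acts through
  maps \<open>fact h : fib y \<rightarrow> fib (h y)\<close>, and on sections by \<open>(h s)(y) = h (s (h\<inverse> y))\<close>.\<close>

record ('h, 'y, 'k, 'e) eq_sheaf =
  sec :: "'y set \<Rightarrow> ('y \<Rightarrow> 'e) set"
  fib :: "'y \<Rightarrow> 'e set"
  fadd :: "'e \<Rightarrow> 'e \<Rightarrow> 'e"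
  fscale :: "'k \<Rightarrow> 'e \<Rightarrow> 'e"
  fzero :: "'y \<Rightarrow> 'e"
  fact :: "'h \<Rightarrow> 'e \<Rightarrow> 'e"

definition lincomb :: "('h, 'y, 'k, 'e) eq_sheaf \<Rightarrow> 'y \<Rightarrow> nat \<Rightarrow> (nat \<Rightarrow> 'k) \<Rightarrow> (nat \<Rightarrow> 'e) \<Rightarrow> 'e"
  where "lincomb F y n c e = foldr (\<lambda>i a. fadd F (fscale F (c i) (e i)) a) [0..<n] (fzero F y)"

definition translate ::
    "('h, 'k) grp_scheme \<Rightarrow> ('h \<Rightarrow> 'y \<Rightarrow> 'y) \<Rightarrow> ('h, 'y, 'k, 'e) eq_sheaf \<Rightarrow>
     'h \<Rightarrow> 'y set \<Rightarrow> ('y \<Rightarrow> 'e) \<Rightarrow> 'y \<Rightarrow> 'e"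
  where "translate H b F h U s = (\<lambda>y\<in>b h ` U. fact F h (s (b (ginv H h) y)))"

text \<open>Vector bundles are locally free sheaves of \<open>\<O>\<close>-modules of finite rank. The
  last condition says that the action is algebraic: for a local section \<open>s\<close>,
  \<open>(h, y) \<mapsto> (h s)(y)\<close> is a section of the pull-back of the sheaf along \<open>H \<times> Y \<rightarrow> Y\<close>.\<close>

definition equivariant_vector_bundle ::
    "('h, 'k::field) grp_scheme \<Rightarrow> ('y, 'k) fspace \<Rightarrow> ('h \<Rightarrow> 'y \<Rightarrow> 'y) \<Rightarrow>
     ('h, 'y, 'k, 'e) eq_sheaf \<Rightarrow> bool"
  where "equivariant_vector_bundle H Y b F \<longleftrightarrow>
    (\<forall>y\<in>pts Y. vector_space_on (fib F y) (fadd F) (fscale F) (fzero F y)) \<and>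
    (\<forall>y\<in>pts Y. \<forall>u\<in>fib F y. \<forall>h. fact F h u \<in> fib F (b h y) \<and>
       (\<forall>v\<in>fib F y. fact F h (fadd F u v) = fadd F (fact F h u) (fact F h v)) \<and>
       (\<forall>c. fact F h (fscale F c u) = fscale F c (fact F h u)) \<and>
       fact F (gone H) u = u \<and>
       (\<forall>g. fact F (gmult H g h) u = fact F g (fact F h u))) \<and>
    (\<forall>U. is_open Y U \<longrightarrow>
      sec F U \<subseteq> Pi\<^sub>E U (fib F) \<and>
      restrict (fzero F) U \<in> sec F U \<and>
      (\<forall>s\<in>sec F U. \<forall>t\<in>sec F U. (\<lambda>y\<in>U. fadd F (s y) (t y)) \<in> sec F U) \<and>
      (\<forall>f\<in>reg Y U. \<forall>s\<in>sec F U. (\<lambda>y\<in>U. fscale F (f y) (s y)) \<in> sec F U) \<and>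
      (\<forall>V. is_open Y V \<longrightarrow> V \<subseteq> U \<longrightarrow> (\<forall>s\<in>sec F U. restrict s V \<in> sec F V)) \<and>
      (\<forall>s\<in>extensional U.
        (\<forall>y\<in>U. \<exists>V. is_open Y V \<and> y \<in> V \<and> V \<subseteq> U \<and> restrict s V \<in> sec F V) \<longrightarrow> s \<in> sec F U) \<and>
      (\<forall>h. is_open Y (b h ` U) \<and> (\<forall>s\<in>sec F U. translate H b F h U s \<in> sec F (b h ` U)))) \<and>
    (\<forall>y\<in>pts Y. \<exists>U n e. is_open Y U \<and> y \<in> U \<and> (\<forall>i<n. e i \<in> sec F U) \<and>
      (\<forall>V. is_open Y V \<longrightarrow> V \<subseteq> U \<longrightarrow> (\<forall>s\<in>sec F V.
        \<exists>c. (\<forall>i<n. c i \<in> reg Y V) \<and>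
            (\<forall>z\<in>V. s z = lincomb F z n (\<lambda>i. c i z) (\<lambda>i. e i z)) \<and>
            (\<forall>c'. (\<forall>i<n. c' i \<in> reg Y V) \<and>
                  (\<forall>z\<in>V. s z = lincomb F z n (\<lambda>i. c' i z) (\<lambda>i. e i z)) \<longrightarrow>
                  (\<forall>i<n. \<forall>z\<in>V. c' i z = c i z))))) \<and>
    (\<forall>U s h0 y0. is_open Y U \<longrightarrow> s \<in> sec F U \<longrightarrow> y0 \<in> pts Y \<longrightarrow> b (ginv H h0) y0 \<in> U \<longrightarrow>
      (\<exists>N V n c e. is_open (prod_space (group_variety H) Y) N \<and> (h0, y0) \<in> N \<and> is_open Y V \<and>
        (\<forall>i<n. c i \<in> reg (prod_space (group_variety H) Y) N \<and> e i \<in> sec F V) \<and>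
        (\<forall>(h, y)\<in>N. y \<in> V \<and> b (ginv H h) y \<in> U \<and>
           fact F h (s (b (ginv H h) y)) = lincomb F y n (\<lambda>i. c i (h, y)) (\<lambda>i. e i y))))"

definition equivariant_iso ::
    "('h, 'k::field) grp_scheme \<Rightarrow> ('y, 'k) fspace \<Rightarrow> ('h \<Rightarrow> 'y \<Rightarrow> 'y) \<Rightarrow>
     ('h, 'y, 'k, 'e) eq_sheaf \<Rightarrow> ('h, 'y, 'k, 'd) eq_sheaf \<Rightarrow> bool"
  where "equivariant_iso H Y b F F' \<longleftrightarrow>
    equivariant_vector_bundle H Y b F \<and> equivariant_vector_bundle H Y b F' \<and>
    (\<exists>\<Phi>. \<forall>U. is_open Y U \<longrightarrow>
      bij_betw (\<Phi> U) (sec F U) (sec F' U) \<and>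
      (\<forall>s\<in>sec F U. \<forall>t\<in>sec F U.
         \<Phi> U (\<lambda>y\<in>U. fadd F (s y) (t y)) = (\<lambda>y\<in>U. fadd F' (\<Phi> U s y) (\<Phi> U t y))) \<and>
      (\<forall>f\<in>reg Y U. \<forall>s\<in>sec F U.
         \<Phi> U (\<lambda>y\<in>U. fscale F (f y) (s y)) = (\<lambda>y\<in>U. fscale F' (f y) (\<Phi> U s y))) \<and>
      (\<forall>V. is_open Y V \<longrightarrow> V \<subseteq> U \<longrightarrow>
         (\<forall>s\<in>sec F U. \<Phi> V (restrict s V) = restrict (\<Phi> U s) V)) \<and>
      (\<forall>h. \<forall>s\<in>sec F U.
         \<Phi> (b h ` U) (translate H b F h U s) = translate H b F' h U (\<Phi> U s)))"

text \<open>Transport of a sheaf on \<open>X\<close> along an isomorphism \<open>j : Y \<rightarrow> X\<close>.\<close>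

definition transport ::
    "('y \<Rightarrow> 'x) \<Rightarrow> ('h, 'x, 'k, 'e) eq_sheaf \<Rightarrow> ('h, 'y, 'k, 'e) eq_sheaf"
  where "transport j F = \<lparr>
    sec = (\<lambda>U. {\<lambda>y\<in>U. s (j y) | s. s \<in> sec F (j ` U)}),
    fib = (\<lambda>y. fib F (j y)), fadd = fadd F, fscale = fscale F,
    fzero = (\<lambda>y. fzero F (j y)), fact = fact F\<rparr>"

text \<open>The image sheaf of a rational \<open>G\<^bsub>W,H\<^esub>\<close>-module on a subvariety \<open>X\<close> of \<open>\<bbbE>(r, g\<^bsub>W,H\<^esub>)\<close>.
  The group \<open>H\<close> acts on the module as the subgroup \<open>{1} \<rtimes> H\<close>.\<close>

definition image_bundle ::
    "('w::ab_group_add \<times> 'h, 'k::field) grp_scheme \<Rightarrow> (('w \<times> 'h \<Rightarrow> 'k) \<Rightarrow> 'k) set \<Rightarrow>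
     ('k \<Rightarrow> 'm::ab_group_add \<Rightarrow> 'm) \<Rightarrow> 'm set \<Rightarrow> ('w \<times> 'h \<Rightarrow> 'm \<Rightarrow> 'm) \<Rightarrow> nat \<Rightarrow>
     ((('w \<times> 'h \<Rightarrow> 'k) \<Rightarrow> 'k) set, 'k) fspace \<Rightarrow>
     ('h, (('w \<times> 'h \<Rightarrow> 'k) \<Rightarrow> 'k) set, 'k, 'm) eq_sheaf"
  where "image_bundle G B sc M \<rho> r X = \<lparr>
    sec = image_sheaf (Lie G) B sc M (lie_action sc M \<rho>) r X,
    fib = (\<lambda>_. M), fadd = (+), fscale = sc, fzero = (\<lambda>_. 0), fact = (\<lambda>h. \<rho> (0, h))\<rparr>"

definition canonical_subsheaf ::
    "('k::field \<Rightarrow> 'w::ab_group_add \<Rightarrow> 'w) \<Rightarrow> nat \<Rightarrow> 'w set set \<Rightarrow> ('w set \<Rightarrow> 'w) set"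
  where "canonical_subsheaf sc r U =
    {s \<in> free_sections sc UNIV (grass sc UNIV r) U. \<forall>y\<in>U. s y \<in> y}"

text \<open>\<open>\<gamma>\<^sub>r\<close> restricted to a subvariety \<open>Y\<close> of \<open>Grass(r, W)\<close>.\<close>

definition canonical_bundle ::
    "('k::field \<Rightarrow> 'w::ab_group_add \<Rightarrow> 'w) \<Rightarrow> ('h \<Rightarrow> 'w \<Rightarrow> 'w) \<Rightarrow> nat \<Rightarrow> ('w set, 'k) fspace \<Rightarrow>
     ('h, 'w set, 'k, 'w) eq_sheaf"
  where "canonical_bundle sc act r Y = \<lparr>
    sec = pullback_subsheaf sc Y (grass sc UNIV r) (\<lambda>y. y) (canonical_subsheaf sc r),
    fib = (\<lambda>y. y), fadd = (+), fscale = sc, fzero = (\<lambda>_. 0), fact = act\<rparr>"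

definition left_coset :: "('h, 'k) grp_scheme \<Rightarrow> 'h set \<Rightarrow> 'h \<Rightarrow> 'h set"
  where "left_coset H S h = gmult H h ` S"

definition homogeneous_space :: "('h, 'k::field) grp_scheme \<Rightarrow> 'h set \<Rightarrow> ('h set, 'k) fspace"
  where "homogeneous_space H S = quot_space (group_variety H) (left_coset H S)"

text \<open>\<open>H \<times>\<^sup>S U\<close>: the quotient of \<open>H \<times> U\<close> by \<open>(h, u) \<sim> (h s, s\<inverse> u)\<close>. The coset in \<open>H/S\<close> below a
  class \<open>c\<close> is \<open>fst ` c\<close>.\<close>

definition contracted_class ::
    "('h, 'k) grp_scheme \<Rightarrow> 'h set \<Rightarrow> ('h \<Rightarrow> 'w \<Rightarrow> 'w) \<Rightarrow> 'h \<times> 'w \<Rightarrow> ('h \<times> 'w) set"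
  where "contracted_class H S act = (\<lambda>(h, u). {(gmult H h s, act (ginv H s) u) | s. s \<in> S})"

definition contracted_product ::
    "('h, 'k::field) grp_scheme \<Rightarrow> 'h set \<Rightarrow> ('k \<Rightarrow> 'w::ab_group_add \<Rightarrow> 'w) \<Rightarrow>
     ('h \<Rightarrow> 'w \<Rightarrow> 'w) \<Rightarrow> 'w set \<Rightarrow> (('h \<times> 'w) set, 'k) fspace"
  where "contracted_product H S sc act U =
    quot_space (prod_space (group_variety H) (sub_space (vector_variety sc) U))
      (contracted_class H S act)"

text \<open>\<open>\<L>\<^bsub>H/S\<^esub>(U)\<close>: sections of \<open>H \<times>\<^sup>S U \<rightarrow> H/S\<close>, with \<open>[h, u] + [h, u'] = [h, u + u']\<close>,
  \<open>a [h, u] = [h, a u]\<close> and \<open>g [h, u] = [g h, u]\<close>.\<close>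

definition associated_bundle ::
    "('h, 'k::field) grp_scheme \<Rightarrow> 'h set \<Rightarrow> ('k \<Rightarrow> 'w::ab_group_add \<Rightarrow> 'w) \<Rightarrow>
     ('h \<Rightarrow> 'w \<Rightarrow> 'w) \<Rightarrow> 'w set \<Rightarrow> ('h, 'h set, 'k, ('h \<times> 'w) set) eq_sheaf"
  where "associated_bundle H S sc act U = \<lparr>
    sec = (\<lambda>V. {s \<in> extensional V.
      morphism (sub_space (homogeneous_space H S) V) (contracted_product H S sc act U) s \<and>
      (\<forall>v\<in>V. fst ` s v = v)}),
    fib = (\<lambda>v. {c \<in> pts (contracted_product H S sc act U). fst ` c = v}),
    fadd = (\<lambda>c d. {(h, u + u') | h u u'. (h, u) \<in> c \<and> (h, u') \<in> d}),
    fscale = (\<lambda>a c. (\<lambda>(h, u). (h, sc a u)) ` c),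
    fzero = (\<lambda>v. v \<times> {0}),
    fact = (\<lambda>g c. (\<lambda>(h, u). (gmult H g h, u)) ` c)\<rparr>"

end

theory Submission
  imports Defs
begin

text \<open>
  Let \<open>G\<close> act on \<open>M = k \<oplus> W\<close> by \<open>(w, h) (c, u) = (c, h u + c w)\<close>. Then \<open>w \<in> W = Lie \<^bold>W\<close> acts by
  \<open>(c, u) \<mapsto> (0, c w)\<close>, so at a point \<open>E \<subseteq> W\<close> the operators of a basis of \<open>E\<close> have the sum of images
  \<open>0 \<oplus> E\<close>; since the frame of the torsor over \<open>Y\<close> generates this family, the image sheaf is
  the subsheaf of sections of \<open>M\<close> with values in \<open>0 \<oplus> E\<close>, that is, \<open>\<gamma>\<^sub>r\<close>, and \<open>H\<close> acts on both in the same way.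
  The fibre of \<open>\<gamma>\<^sub>r\<close> over \<open>y = h \<epsilon>\<close> is \<open>h \<epsilon>\<close>, and \<open>u \<mapsto> [h, h\<^sup>-\<^sup>1 u]\<close> identifies it with the fibre of
  \<open>H \<times>\<^sup>S \<epsilon>\<close> over \<open>h S\<close>. Local sections of \<open>H \<rightarrow> H/S\<close> are not needed for this: a function on \<open>H/S\<close> is
  regular as soon as its pull-back to \<open>H\<close> is.
\<close>

section \<open>Linear algebra\<close>

text \<open>All sheaves are brought to one form: regular vector-valued functions with values in a
  given family of subspaces (\<open>family_sections\<close>). A sheaf given by generators equals
  such a family as soon as the generators contain a local \<open>frame\<close> of it. So the
  geometry reduces to regular local frames of the tautological family, and these come from inverting
  a matrix of regular functions. The obstacle is that the image sheaf is defined by descent and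
  lives over Lie algebra elements, that is, functionals on \<open>coord G\<close>. Hence
  \<open>W\<close> is embedded by the derivations \<open>D w\<close>, which have to be shown to
  commute and to have zero \<open>p\<close>-power, and \<open>Y\<close> is identified with its image
  \<open>Z\<close> among the elementary subalgebras, the inverse coming from a linear retraction
  \<open>ret\<close> of \<open>D\<close>. Descent also asks for uniqueness, which local sections of
  the torsor supply. The trivial summand of \<open>M\<close> contributes one vector on which
  \<open>W\<close> acts injectively, so that the image at \<open>E\<close> is a copy of
  \<open>E\<close>; as \<open>H\<close> fixes this vector, the copy is an equivariant one.\<close>

context vector_space
begin

lemma linear_form_iff:
  "linear_form scale l \<longleftrightarrow> (\<forall>x y. l (x + y) = l x + l y) \<and> (\<forall>c x. l (scale c x) = c * l x)"
proof -
  interpret p: vector_space_pair scale "(*) :: 'a \<Rightarrow> 'a \<Rightarrow> 'a"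
    by unfold_locales (auto simp: algebra_simps)
  show ?thesis unfolding linear_form_def
    by (simp add: Vector_Spaces.linear_iff vector_space_axioms p.vs2.vector_space_axioms)
qed

lemma
  assumes "linear_form scale l"
  shows linear_form_add: "l (x + y) = l x + l y"
    and linear_form_scale: "l (scale c x) = c * l x"
    and linear_form_zero: "l 0 = 0"
    and linear_form_sum: "l (\<Sum>i\<in>I. f i) = (\<Sum>i\<in>I. l (f i))"
proof -
  show 1: "l (x + y) = l x + l y" for x y using assms by (simp add: linear_form_iff)
  show 2: "l (scale c x) = c * l x" for c x using assms by (simp add: linear_form_iff)
  show 3: "l 0 = 0" using 2[of 0 0] by simp
  show "l (\<Sum>i\<in>I. f i) = (\<Sum>i\<in>I. l (f i))"
    by (induction I rule: infinite_finite_induct) (auto simp: 1 3)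
qed

lemma linear_form_extend:
  assumes "independent B"
  shows "\<exists>l. linear_form scale l \<and> (\<forall>b\<in>B. l b = g b)"
proof -
  interpret p: vector_space_pair scale "(*) :: 'a \<Rightarrow> 'a \<Rightarrow> 'a"
    by unfold_locales (auto simp: algebra_simps)
  show ?thesis using p.linear_independent_extend[OF assms, of g]
    unfolding linear_form_def by simp
qed

text \<open>A nonzero difference is an independent singleton, so some form takes the value 1 on it.
  The dimension is arbitrary: on \<open>nat \<Rightarrow> 'k\<close> this gives the uniqueness
  behind the \<open>THE\<close> in \<open>lie_action\<close>.\<close>

lemma linear_forms_separate:
  assumes "\<And>l. linear_form scale l \<Longrightarrow> l v = l w"
  shows "v = w"
proof (rule ccontr)
  assume "v \<noteq> w"
  then have "independent {v - w}" by simp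
  then obtain l where l: "linear_form scale l" "l (v - w) = 1"
    using linear_form_extend[of "{v - w}" "\<lambda>_. 1"] by auto
  have "l v = l (v - w) + l w" using linear_form_add[OF l(1), of "v - w" w] by simp
  then show False using assms[OF l(1)] l(2) by simp
qed

text \<open>The forms are defined on the whole space, so the same \<open>l\<close> can be evaluated
  on neighbouring tuples and subspaces; this is what cuts out a chart in
  \<open>grass_chart\<close>.\<close>

lemma dual_forms:
  assumes "T \<in> indep_tuples scale V r"
  shows "\<exists>l. \<forall>s<r. linear_form scale (l s) \<and> (\<forall>t<r. l s (T t) = of_bool (s = t))"
proof -
  have T: "inj_on T {..<r}" "independent (T ` {..<r})"
    using assms unfolding indep_tuples_def by auto
  have "\<exists>l. linear_form scale l \<and> (\<forall>t<r. l (T t) = of_bool (s = t))" if "s < r" for s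
  proof -
    obtain l where "linear_form scale l"
        "\<forall>b\<in>T ` {..<r}. l b = of_bool (b = T s)"
      using linear_form_extend[OF T(2), of "\<lambda>b. of_bool (b = T s)"] by blast
    then show ?thesis using T(1) that by (intro exI[of _ l]) (auto simp: inj_on_def)
  qed
  then show ?thesis by metis
qed

lemma in_tuple_span_iff:
  "v \<in> tuple_span scale r T \<longleftrightarrow> (\<exists>c. v = (\<Sum>t<r. scale (c t) (T t)))"
proof
  assume "v \<in> tuple_span scale r T"
  then show "\<exists>c. v = (\<Sum>t<r. scale (c t) (T t))"
    unfolding tuple_span_def
  proof (induction rule: span_induct_alt)
    case base
    show ?case by (intro exI[of _ "\<lambda>_. 0"]) simp
  next
    case (step c x y)
    then obtain d s where "y = (\<Sum>t<r. scale (d t) (T t))" "s < r" "x = T s" by auto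
    then have *: "scale c x + y = (\<Sum>t<r. scale (d t + (if t = s then c else 0)) (T t))"
      by (simp add: scale_left_distrib sum.distrib if_distrib[of "\<lambda>z. scale z _"] cong: if_cong)
    show ?case unfolding * by (rule exI, rule refl)
  qed
next
  assume "\<exists>c. v = (\<Sum>t<r. scale (c t) (T t))"
  then show "v \<in> tuple_span scale r T"
    unfolding tuple_span_def by (auto intro!: span_sum span_scale intro: span_base)
qed

lemma sum_of_bool_scale [simp]:
  fixes r :: nat
  shows "s < r \<Longrightarrow> (\<Sum>t<r. scale (of_bool (s = t)) (T t)) = T s"
  "s < r \<Longrightarrow> (\<Sum>t<r. scale (of_bool (t = s)) (T t)) = T s"
proof -
  have "(\<Sum>t<r. scale (of_bool (s = t)) (T t)) = (\<Sum>t<r. if t = s then T t else 0)"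
    by (rule sum.cong) auto
  moreover assume "s < r"
  ultimately show *: "(\<Sum>t<r. scale (of_bool (s = t)) (T t)) = T s" by simp
  then show "(\<Sum>t<r. scale (of_bool (t = s)) (T t)) = T s" by (simp add: eq_commute)
qed

lemma dual_forms_coeff:
  fixes r :: nat
  assumes "\<And>t. t < r \<Longrightarrow> linear_form scale (l t)"
    and "\<And>s t. s < r \<Longrightarrow> t < r \<Longrightarrow> l s (T t) = of_bool (s = t)" and "s < r"
  shows "l s (\<Sum>t<r. scale (c t) (T t)) = c s"
proof -
  have "l s (\<Sum>t<r. scale (c t) (T t)) = (\<Sum>t<r. c t * of_bool (s = t))"
    using assms by (simp add: linear_form_sum[of "l s"] linear_form_scale[of "l s"])
  also have "\<dots> = (\<Sum>t<r. if t = s then c t else 0)" by (rule sum.cong) auto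
  finally show ?thesis using assms(3) by simp
qed

lemma dual_forms_expand:
  assumes "\<And>t. t < r \<Longrightarrow> linear_form scale (l t)"
    and "\<And>s t. s < r \<Longrightarrow> t < r \<Longrightarrow> l s (T t) = of_bool (s = t)"
    and "v \<in> tuple_span scale r T"
  shows "v = (\<Sum>t<r. scale (l t v) (T t))"
proof -
  obtain c where c: "v = (\<Sum>t<r. scale (c t) (T t))" using assms(3) in_tuple_span_iff by blast
  then show ?thesis using dual_forms_coeff[OF assms(1,2)] by (auto intro!: sum.cong)
qed

text \<open>Applying to a vanishing combination the form dual to one entry isolates the coefficient
  of that entry.\<close>

lemma indep_tuples_dual:
  assumes "\<And>t. t < r \<Longrightarrow> linear_form scale (l t)"
    and "\<And>s t. s < r \<Longrightarrow> t < r \<Longrightarrow> l s (T t) = of_bool (s = t)"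
    and "T \<in> {..<r} \<rightarrow>\<^sub>E V"
  shows "T \<in> indep_tuples scale V r"
proof -
  have inj: "inj_on T {..<r}"
    using assms(2) by (auto simp: inj_on_def) (metis of_bool_eq(1,2) zero_neq_one)
  have "independent (T ` {..<r})"
    unfolding independent_explicit_finite_subsets
  proof (intro allI impI ballI)
    fix A u v
    assume A: "A \<subseteq> T ` {..<r}" "finite A" "(\<Sum>v\<in>A. scale (u v) v) = 0" "v \<in> A"
    then obtain s where s: "v = T s" "s < r" by auto
    have "0 = l s (\<Sum>v\<in>A. scale (u v) v)" using A(3) linear_form_zero assms(1) s by simp
    also have "\<dots> = (\<Sum>w\<in>A. u w * l s w)"
      using assms(1)[OF s(2)] by (simp add: linear_form_sum linear_form_scale)
    also have "\<dots> = (\<Sum>w\<in>A. if w = v then u w else 0)"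
      using A(1) s assms(2) inj by (intro sum.cong) (auto simp: inj_on_def)
    also have "\<dots> = u v" using A by simp
    finally show "u v = 0" by simp
  qed
  then show ?thesis using inj assms(3) unfolding indep_tuples_def by simp
qed

text \<open>Otherwise a vector outside the span of \<open>T'\<close> would enlarge \<open>T'\<close>
  to \<open>r + 1\<close> independent vectors inside a span of \<open>r\<close> vectors.\<close>

lemma tuple_span_eqI:
  assumes "T \<in> indep_tuples scale V r" "T' \<in> indep_tuples scale V' r"
    and "\<And>t. t < r \<Longrightarrow> T' t \<in> tuple_span scale r T"
  shows "tuple_span scale r T' = tuple_span scale r T"
proof -
  have T: "inj_on T {..<r}" "independent (T ` {..<r})"
    and T': "inj_on T' {..<r}" "independent (T' ` {..<r})"
    using assms unfolding indep_tuples_def by auto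
  have sub: "T' ` {..<r} \<subseteq> span (T ` {..<r})" using assms(3) unfolding tuple_span_def by auto
  have "span (T ` {..<r}) \<subseteq> span (T' ` {..<r})"
  proof (rule ccontr)
    assume "\<not> ?thesis"
    then obtain v where v: "v \<in> span (T ` {..<r})" "v \<notin> span (T' ` {..<r})" by blast
    then have "independent (insert v (T' ` {..<r}))" using T'(2) independent_insertI by blast
    then have "card (insert v (T' ` {..<r})) \<le> card (T ` {..<r})"
      using independent_span_bound[of "T ` {..<r}"] v sub by auto
    moreover have "v \<notin> T' ` {..<r}" using v(2) span_base[of v "T' ` {..<r}"] by auto
    ultimately show False using card_image[OF T(1)] card_image[OF T'(1)] by simp
  qed
  then show ?thesis using sub span_minimal[OF sub subspace_span] unfolding tuple_span_def by auto
qed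

lemma ex_indep_tuple:
  assumes "subspace E" "dim E = r" "0 < r" "E \<subseteq> V"
  shows "\<exists>T \<in> indep_tuples scale V r. tuple_span scale r T = E"
proof -
  obtain b where b: "b \<subseteq> E" "independent b" "span b = E" "card b = r"
    using assms basis_exists[of E] span_subspace by metis
  \<comment> \<open>An infinite set has \<open>card\<close> 0, so a positive \<open>r\<close> forces
    the basis to be finite.\<close>
  then have "finite b" using assms(3) card_ge_0_finite by auto
  then obtain f where f: "bij_betw f {..<r} b"
    using ex_bij_betw_nat_finite[of b] b(4) by (auto simp: atLeast0LessThan)
  define T where "T = restrict f {..<r}"
  have "T ` {..<r} = b" "inj_on T {..<r}" using f unfolding T_def bij_betw_def inj_on_def by auto
  moreover have "T \<in> {..<r} \<rightarrow>\<^sub>E V"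
    using \<open>T ` {..<r} = b\<close> b(1) assms(4) unfolding T_def by (auto simp: image_subset_iff subset_iff)
  ultimately show ?thesis using b unfolding indep_tuples_def tuple_span_def by auto
qed

text \<open>The coordinates on \<open>M\<close> are forms of the ambient space. Therefore a function
  with values in \<open>M\<close> has regular coordinates as soon as its composites with linear
  forms are regular.\<close>

lemma fin_dim_coords:
  assumes "fin_dim_subspace scale M"
  shows "\<exists>(n::nat) e l. (\<forall>i<n. e i \<in> M \<and> linear_form scale (l i)) \<and>
    (\<forall>i<n. \<forall>j<n. l i (e j) = of_bool (i = j)) \<and>
    (\<forall>v\<in>M. v = (\<Sum>i<n. scale (l i v) (e i)))"
proof -
  obtain B where B: "finite B" "M = span B" using assms unfolding fin_dim_subspace_def by auto
  obtain C where C: "C \<subseteq> B" "independent C" "B \<subseteq> span C"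
    using maximal_independent_subset[of B] by blast
  then have fC: "finite C" and sC: "span C = M"
    using B finite_subset span_mono span_minimal[of B "span C"] by (auto simp: antisym)
  obtain f where f: "bij_betw f {..<card C} C"
    using ex_bij_betw_nat_finite[OF fC] by (auto simp: atLeast0LessThan)
  define e where "e = restrict f {..<card C}"
  have e: "e ` {..<card C} = C" "inj_on e {..<card C}"
    using f unfolding e_def bij_betw_def inj_on_def by auto
  have et: "e \<in> indep_tuples scale M (card C)"
    unfolding indep_tuples_def using e C(2) sC span_base
    by (auto simp: e_def)
  then obtain l where l: "\<forall>s<card C. linear_form scale (l s) \<and>
      (\<forall>t<card C. l s (e t) = of_bool (s = t))"
    using dual_forms[of e M "card C"] by auto
  have "v = (\<Sum>i<card C. scale (l i v) (e i))" if "v \<in> M" for v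
    using dual_forms_expand[of "card C" l e v] l that sC e unfolding tuple_span_def by auto
  moreover have "e i \<in> M" if "i < card C" for i
    using e(1) sC span_base that by blast
  ultimately show ?thesis using l by blast
qed

end

section \<open>Algebras of functions and their tensor products\<close>

definition subalg :: "('x \<Rightarrow> 'k::field) set \<Rightarrow> bool"
  where "subalg A \<longleftrightarrow> (\<forall>c. (\<lambda>_. c) \<in> A) \<and>
    (\<forall>f\<in>A. \<forall>g\<in>A. (\<lambda>x. f x + g x) \<in> A \<and> (\<lambda>x. f x * g x) \<in> A)"

lemma
  assumes "subalg A"
  shows subalg_const: "(\<lambda>_. c) \<in> A"
    and subalg_add: "f \<in> A \<Longrightarrow> g \<in> A \<Longrightarrow> (\<lambda>x. f x + g x) \<in> A"
    and subalg_mult: "f \<in> A \<Longrightarrow> g \<in> A \<Longrightarrow> (\<lambda>x. f x * g x) \<in> A"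
  using assms by (auto simp: subalg_def)

lemma subalg_sum:
  assumes "subalg A" "\<And>i. i \<in> I \<Longrightarrow> f i \<in> A"
  shows "(\<lambda>x. \<Sum>i\<in>I. f i x) \<in> A"
  using assms(2)
  by (induction I rule: infinite_finite_induct) (auto intro!: subalg_const subalg_add assms(1))

lemma subalg_gen_alg: "subalg (gen_alg G)"
  by (auto simp: subalg_def intro: gen_alg.intros)

lemma fun_tensor_mult_memI: "f \<in> A \<Longrightarrow> g \<in> B \<Longrightarrow> (\<lambda>(x, y). f x * g y) \<in> fun_tensor A B"
  unfolding fun_tensor_def by (intro CollectI exI[of _ 1] exI[of _ "\<lambda>_. f"] exI[of _ "\<lambda>_. g"]) auto

lemma fun_tensor_add:
  assumes "F \<in> fun_tensor A B" "F' \<in> fun_tensor A B"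
  shows "(\<lambda>z. F z + F' z) \<in> fun_tensor A B"
proof -
  obtain n f g where 1: "\<forall>i<(n::nat). f i \<in> A \<and> g i \<in> B" "F = (\<lambda>(x, y). \<Sum>i<n. f i x * g i y)"
    using assms(1) unfolding fun_tensor_def by auto
  obtain m f' g' where 2: "\<forall>i<(m::nat). f' i \<in> A \<and> g' i \<in> B" "F' = (\<lambda>(x, y). \<Sum>i<m. f' i x * g' i y)"
    using assms(2) unfolding fun_tensor_def by auto
  \<comment> \<open>The two lists of pure tensors are concatenated, the second one shifted by
    \<open>n\<close>.\<close>
  define a where "a i = (if i < n then f i else f' (i - n))" for i
  define b where "b i = (if i < n then g i else g' (i - n))" for i
  have "(\<Sum>i<n + m. a i x * b i y) = (\<Sum>i<n. f i x * g i y) + (\<Sum>i<m. f' i x * g' i y)" for x y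
    by (induction m) (simp_all add: a_def b_def add.assoc)
  then have "(\<lambda>z. F z + F' z) = (\<lambda>(x, y). \<Sum>i<n + m. a i x * b i y)" using 1 2 by auto
  moreover have "\<forall>i<n + m. a i \<in> A \<and> b i \<in> B" using 1 2 by (auto simp: a_def b_def)
  ultimately show ?thesis unfolding fun_tensor_def by blast
qed

lemma fun_tensor_zero: "(\<lambda>z. 0) \<in> fun_tensor A B"
  unfolding fun_tensor_def by (intro CollectI exI[of _ 0]) auto

text \<open>Induction on the number of pure tensors, peeling off the last one; it replaces double
  sums when tensors are multiplied.\<close>

lemma fun_tensor_induct [consumes 1, case_names zero add]:
  assumes "F \<in> fun_tensor A B"
    and "P (\<lambda>_. 0)"
    and "\<And>f g F. f \<in> A \<Longrightarrow> g \<in> B \<Longrightarrow> F \<in> fun_tensor A B \<Longrightarrow> P F \<Longrightarrow> P (\<lambda>z. f (fst z) * g (snd z) + F z)"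
  shows "P F"
proof -
  obtain n f g where 1: "\<forall>i<(n::nat). f i \<in> A \<and> g i \<in> B" "F = (\<lambda>(x, y). \<Sum>i<n. f i x * g i y)"
    using assms(1) unfolding fun_tensor_def by auto
  have "P (\<lambda>(x, y). \<Sum>i<m. f i x * g i y)" if "m \<le> n" for m
    using that
  proof (induction m)
    case 0
    then show ?case using assms(2) by (simp add: case_prod_unfold)
  next
    case (Suc m)
    have "(\<lambda>(x, y). \<Sum>i<m. f i x * g i y) \<in> fun_tensor A B"
      unfolding fun_tensor_def using Suc.prems 1(1)
      by (intro CollectI exI[of _ m] exI[of _ f] exI[of _ g]) auto
    from assms(3)[OF _ _ this, of "f m" "g m"] Suc 1 show ?case
      by (simp add: case_prod_unfold add.commute)
  qed
  then show ?thesis using 1 by auto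
qed

lemma subalg_fun_tensor:
  assumes "subalg A" "subalg B"
  shows "subalg (fun_tensor A B)"
proof -
  have c: "(\<lambda>_. c) \<in> fun_tensor A B" for c
    using fun_tensor_mult_memI[OF subalg_const[OF assms(1), of c] subalg_const[OF assms(2), of 1]]
    by (simp add: case_prod_unfold)
  \<comment> \<open>A pure tensor as left factor first; a second induction then treats a general
    left factor.\<close>
  have m1: "(\<lambda>z. (f (fst z) * g (snd z)) * F z) \<in> fun_tensor A B"
    if "f \<in> A" "g \<in> B" "F \<in> fun_tensor A B" for f g F
    using that(3)
  proof (induction rule: fun_tensor_induct)
    case zero
    then show ?case using fun_tensor_zero by simp
  next
    case (add f' g' F)
    have "(\<lambda>(x, y). (f x * f' x) * (g y * g' y)) \<in> fun_tensor A B"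
      using add that assms by (intro fun_tensor_mult_memI[of "\<lambda>x. f x * f' x" _ "\<lambda>y. g y * g' y"] subalg_mult) auto
    from fun_tensor_add[OF this add(4)] show ?case
      by (simp add: case_prod_unfold algebra_simps)
  qed
  have "(\<lambda>z. F z * F' z) \<in> fun_tensor A B" if "F \<in> fun_tensor A B" "F' \<in> fun_tensor A B" for F F'
    using that(1)
  proof (induction rule: fun_tensor_induct)
    case zero
    then show ?case using fun_tensor_zero by simp
  next
    case (add f g F)
    from fun_tensor_add[OF m1[OF add(1,2) that(2)] add(4)] show ?case
      by (simp add: algebra_simps)
  qed
  then show ?thesis using c fun_tensor_add unfolding subalg_def by blast
qed

lemma fun_tensor_fst: "subalg B \<Longrightarrow> f \<in> A \<Longrightarrow> (\<lambda>z. f (fst z)) \<in> fun_tensor A B"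
  using fun_tensor_mult_memI[of f A "\<lambda>_. 1" B] subalg_const[of B 1] by (simp add: case_prod_unfold)

lemma fun_tensor_snd: "subalg A \<Longrightarrow> g \<in> B \<Longrightarrow> (\<lambda>z. g (snd z)) \<in> fun_tensor A B"
  using fun_tensor_mult_memI[of "\<lambda>_. 1" A g B] subalg_const[of A 1] by (simp add: case_prod_unfold)

section \<open>Spaces with functions\<close>

text \<open>\<open>fspace\<close> is raw data, and these are the axioms of a space with functions.
  The first clause reflects that values outside \<open>U\<close> are junk. The last one, openness of
  the nonvanishing set and regularity of the inverse there, stands in for local rings.\<close>

definition ringed :: "('x, 'k::field) fspace \<Rightarrow> bool"
  where "ringed X \<longleftrightarrow>
    (\<forall>U f g. f \<in> reg X U \<longrightarrow> (\<forall>x\<in>U. f x = g x) \<longrightarrow> g \<in> reg X U) \<and>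
    (\<forall>U. is_open X U \<longrightarrow>
      (\<forall>V f. is_open X V \<longrightarrow> V \<subseteq> U \<longrightarrow> f \<in> reg X U \<longrightarrow> f \<in> reg X V) \<and>
      (\<forall>f. (\<forall>x\<in>U. \<exists>V. is_open X V \<and> x \<in> V \<and> V \<subseteq> U \<and> f \<in> reg X V) \<longrightarrow> f \<in> reg X U) \<and>
      subalg (reg X U) \<and>
      (\<forall>f\<in>reg X U. is_open X {x \<in> U. f x \<noteq> 0} \<and> (\<lambda>x. inverse (f x)) \<in> reg X {x \<in> U. f x \<noteq> 0}))"

lemma ringedI:
  assumes "\<And>U f g. f \<in> reg X U \<Longrightarrow> (\<And>x. x \<in> U \<Longrightarrow> f x = g x) \<Longrightarrow> g \<in> reg X U"
    and "\<And>U V f. is_open X U \<Longrightarrow> is_open X V \<Longrightarrow> V \<subseteq> U \<Longrightarrow> f \<in> reg X U \<Longrightarrow> f \<in> reg X V"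
    and "\<And>U f. is_open X U \<Longrightarrow>
      (\<And>x. x \<in> U \<Longrightarrow> \<exists>V. is_open X V \<and> x \<in> V \<and> V \<subseteq> U \<and> f \<in> reg X V) \<Longrightarrow> f \<in> reg X U"
    and "\<And>U. is_open X U \<Longrightarrow> subalg (reg X U)"
    and "\<And>U f. is_open X U \<Longrightarrow> f \<in> reg X U \<Longrightarrow> is_open X {x \<in> U. f x \<noteq> 0}"
    and "\<And>U f. is_open X U \<Longrightarrow> f \<in> reg X U \<Longrightarrow> (\<lambda>x. inverse (f x)) \<in> reg X {x \<in> U. f x \<noteq> 0}"
  shows "ringed X"
  unfolding ringed_def
  apply (intro conjI allI impI ballI)
  subgoal using assms(1) by blast
  subgoal by (rule assms(2))
  subgoal using assms(3) by blast
  subgoal by (rule assms(4))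
  subgoal by (rule assms(5))
  subgoal by (rule assms(6))
  done

lemma
  assumes "ringed X"
  shows reg_cong: "f \<in> reg X U \<Longrightarrow> (\<And>x. x \<in> U \<Longrightarrow> f x = g x) \<Longrightarrow> g \<in> reg X U"
    and reg_restrict: "f \<in> reg X U \<Longrightarrow> is_open X U \<Longrightarrow> is_open X V \<Longrightarrow> V \<subseteq> U \<Longrightarrow> f \<in> reg X V"
    and reg_local: "is_open X U \<Longrightarrow>
      (\<And>x. x \<in> U \<Longrightarrow> \<exists>V. is_open X V \<and> x \<in> V \<and> V \<subseteq> U \<and> f \<in> reg X V) \<Longrightarrow> f \<in> reg X U"
    and subalg_reg: "is_open X U \<Longrightarrow> subalg (reg X U)"
    and open_nonzero: "f \<in> reg X U \<Longrightarrow> is_open X U \<Longrightarrow> is_open X {x \<in> U. f x \<noteq> 0}"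
    and reg_inverse: "f \<in> reg X U \<Longrightarrow> is_open X U \<Longrightarrow>
      (\<lambda>x. inverse (f x)) \<in> reg X {x \<in> U. f x \<noteq> 0}"
proof -
  note X = assms[unfolded ringed_def]
  show "f \<in> reg X U \<Longrightarrow> (\<And>x. x \<in> U \<Longrightarrow> f x = g x) \<Longrightarrow> g \<in> reg X U"
    using X[THEN conjunct1, rule_format, of f U g] by auto
  note X' = X[THEN conjunct2, rule_format, of U]
  show "f \<in> reg X U \<Longrightarrow> is_open X U \<Longrightarrow> is_open X V \<Longrightarrow> V \<subseteq> U \<Longrightarrow> f \<in> reg X V"
    by (rule X'[THEN conjunct1, rule_format])
  show "is_open X U \<Longrightarrow>
      (\<And>x. x \<in> U \<Longrightarrow> \<exists>V. is_open X V \<and> x \<in> V \<and> V \<subseteq> U \<and> f \<in> reg X V) \<Longrightarrow> f \<in> reg X U"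
    by (rule X'[THEN conjunct2, THEN conjunct1, rule_format])
  show "is_open X U \<Longrightarrow> subalg (reg X U)"
    by (rule X'[THEN conjunct2, THEN conjunct2, THEN conjunct1])
  show "f \<in> reg X U \<Longrightarrow> is_open X U \<Longrightarrow> is_open X {x \<in> U. f x \<noteq> 0}"
    by (rule X'[THEN conjunct2, THEN conjunct2, THEN conjunct2, rule_format, THEN conjunct1])
  show "f \<in> reg X U \<Longrightarrow> is_open X U \<Longrightarrow> (\<lambda>x. inverse (f x)) \<in> reg X {x \<in> U. f x \<noteq> 0}"
    by (rule X'[THEN conjunct2, THEN conjunct2, THEN conjunct2, rule_format, THEN conjunct2])
qed

lemma
  assumes "ringed X" "is_open X U"
  shows reg_const: "(\<lambda>_. c) \<in> reg X U"
    and reg_add: "f \<in> reg X U \<Longrightarrow> g \<in> reg X U \<Longrightarrow> (\<lambda>x. f x + g x) \<in> reg X U"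
    and reg_mult: "f \<in> reg X U \<Longrightarrow> g \<in> reg X U \<Longrightarrow> (\<lambda>x. f x * g x) \<in> reg X U"
    and reg_sum: "(\<And>i. i \<in> I \<Longrightarrow> F i \<in> reg X U) \<Longrightarrow> (\<lambda>x. \<Sum>i\<in>I. F i x) \<in> reg X U"
  using subalg_reg[OF assms]
  by (simp_all add: subalg_const subalg_add subalg_mult subalg_sum)

lemma reg_uminus:
  assumes "ringed X" "is_open X U" "f \<in> reg X U"
  shows "(\<lambda>x. - f x) \<in> reg X U"
  using reg_mult[OF assms(1,2) reg_const[OF assms(1,2), of "-1"] assms(3)] by simp

text \<open>Affine varieties and products of varieties both carry functions that are locally fractions
  of elements of given algebras \<open>A\<close> of functions on sets \<open>\<Omega>\<close>.\<close>

definition frac_space :: "('x set \<times> ('x \<Rightarrow> 'k::field) set) set \<Rightarrow> ('x, 'k) fspace"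
  where "frac_space C = \<lparr>
    top = topology_generated_by {{z \<in> \<Omega>. F z \<noteq> 0} | \<Omega> A F. (\<Omega>, A) \<in> C \<and> F \<in> A},
    reg = (\<lambda>N. {f. \<forall>z\<in>N. \<exists>\<Omega> A F D. (\<Omega>, A) \<in> C \<and> z \<in> \<Omega> \<and> F \<in> A \<and> D \<in> A \<and> D z \<noteq> 0 \<and>
      (\<forall>w\<in>N \<inter> \<Omega>. D w \<noteq> 0 \<longrightarrow> f w = F w / D w)})\<rparr>"

text \<open>Two local fractions can be compared only over a common algebra, which directedness
  provides on the intersection of their charts.\<close>

definition directed_charts :: "('x set \<times> ('x \<Rightarrow> 'k::field) set) set \<Rightarrow> bool"
  where "directed_charts C \<longleftrightarrow> (\<forall>(\<Omega>, A) \<in> C. subalg A) \<and>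
    (\<forall>(\<Omega>, A) \<in> C. \<forall>(\<Omega>', A') \<in> C. \<exists>A''. (\<Omega> \<inter> \<Omega>', A'') \<in> C \<and> A \<subseteq> A'' \<and> A' \<subseteq> A'')"

lemma affine_space_of_frac_space: "affine_space_of A = frac_space {(UNIV, A)}"
  unfolding affine_space_of_def frac_space_def Bex_def by (simp cong: conj_cong)

lemma directed_charts_single: "subalg A \<Longrightarrow> directed_charts {(UNIV, A)}"
  unfolding directed_charts_def by auto

lemma prod_space_frac_space:
  "prod_space X Y = frac_space {(U \<times> V, fun_tensor (reg X U) (reg Y V)) | U V. is_open X U \<and> is_open Y V}"
proof -
  have 1: "{{z \<in> U \<times> V. F z \<noteq> 0} | U V F.
        is_open X U \<and> is_open Y V \<and> F \<in> fun_tensor (reg X U) (reg Y V)} =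
    {{z \<in> \<Omega>. F z \<noteq> 0} | \<Omega> A F. (\<Omega>, A) \<in> {(U \<times> V, fun_tensor (reg X U) (reg Y V)) | U V. is_open X U \<and> is_open Y V} \<and> F \<in> A}"
    by blast
  show ?thesis
    unfolding prod_space_def frac_space_def 1 by simp (rule ext, rule Collect_cong, rule ball_cong, blast+)
qed

lemma fun_tensor_mono: "A \<subseteq> A' \<Longrightarrow> B \<subseteq> B' \<Longrightarrow> fun_tensor A B \<subseteq> fun_tensor A' B'"
  unfolding fun_tensor_def by (intro Collect_mono impI, elim exE conjE) blast

text \<open>Rectangles meet in rectangles. As regular functions are total functions, restriction to
  a smaller open set is an inclusion of algebras, and so is the induced map of tensor
  products.\<close>

lemma directed_charts_prod:
  assumes X: "ringed X" and Y: "ringed Y"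
  shows "directed_charts {(U \<times> V, fun_tensor (reg X U) (reg Y V)) | U V. is_open X U \<and> is_open Y V}"
    (is "directed_charts ?C")
  unfolding directed_charts_def
proof (intro conjI ballI, safe)
  fix U V assume "is_open X U" "is_open Y V"
  then show "subalg (fun_tensor (reg X U) (reg Y V))"
    using subalg_reg[OF X] subalg_reg[OF Y] subalg_fun_tensor by blast
next
  fix U V U' V' assume o: "is_open X U" "is_open Y V" "is_open X U'" "is_open Y V'"
  have "fun_tensor (reg X U) (reg Y V) \<subseteq> fun_tensor (reg X (U \<inter> U')) (reg Y (V \<inter> V'))"
    "fun_tensor (reg X U') (reg Y V') \<subseteq> fun_tensor (reg X (U \<inter> U')) (reg Y (V \<inter> V'))"
    using o by (intro fun_tensor_mono subsetI; blast intro: reg_restrict[OF X] reg_restrict[OF Y])+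
  moreover have "(U \<times> V \<inter> U' \<times> V', fun_tensor (reg X (U \<inter> U')) (reg Y (V \<inter> V'))) \<in> ?C"
    using o by (auto simp: Times_Int_Times)
  ultimately show "\<exists>A''. (U \<times> V \<inter> U' \<times> V', A'') \<in> ?C \<and> fun_tensor (reg X U) (reg Y V) \<subseteq> A'' \<and>
      fun_tensor (reg X U') (reg Y V') \<subseteq> A''" by blast
qed

text \<open>The generating sets form a basis of the topology: the nonvanishing sets of
  \<open>F\<close> and \<open>F'\<close> meet in that of \<open>F * F'\<close>, taken in the common
  chart.\<close>

lemma openin_frac_space:
  assumes C: "directed_charts C"
  shows "is_open (frac_space C) U \<longleftrightarrow>
    (\<forall>z\<in>U. \<exists>\<Omega> A F. (\<Omega>, A) \<in> C \<and> F \<in> A \<and> z \<in> \<Omega> \<and> F z \<noteq> 0 \<and> {w \<in> \<Omega>. F w \<noteq> 0} \<subseteq> U)"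
    (is "_ \<longleftrightarrow> ?R U")
proof
  assume "is_open (frac_space C) U"
  then have "generate_topology_on {{z \<in> \<Omega>. F z \<noteq> 0} | \<Omega> A F. (\<Omega>, A) \<in> C \<and> F \<in> A} U"
    by (simp add: frac_space_def openin_topology_generated_by_iff)
  then show "?R U"
  proof (induction rule: generate_topology_on.induct)
    case (Int a b)
    show ?case
    proof
      fix z assume z: "z \<in> a \<inter> b"
      obtain \<Omega> A F where 1: "(\<Omega>, A) \<in> C" "F \<in> A" "z \<in> \<Omega>" "F z \<noteq> 0" "{w \<in> \<Omega>. F w \<noteq> 0} \<subseteq> a"
        using Int z by blast
      obtain \<Omega>' A' F' where 2: "(\<Omega>', A') \<in> C" "F' \<in> A'" "z \<in> \<Omega>'" "F' z \<noteq> 0" "{w \<in> \<Omega>'. F' w \<noteq> 0} \<subseteq> b"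
        using Int z by blast
      obtain A'' where 3: "(\<Omega> \<inter> \<Omega>', A'') \<in> C" "A \<subseteq> A''" "A' \<subseteq> A''"
        using C 1(1) 2(1) unfolding directed_charts_def by blast
      then have "(\<lambda>w. F w * F' w) \<in> A''"
        using C 1(2) 2(2) subalg_mult unfolding directed_charts_def by blast
      then show "\<exists>\<Omega> A F. (\<Omega>, A) \<in> C \<and> F \<in> A \<and> z \<in> \<Omega> \<and> F z \<noteq> 0 \<and> {w \<in> \<Omega>. F w \<noteq> 0} \<subseteq> a \<inter> b"
        using 1 2 3 by - (rule exI[of _ "\<Omega> \<inter> \<Omega>'"], rule exI[of _ A''], rule exI[of _ "\<lambda>w. F w * F' w"], auto)
    qed
  next
    case (UN K)
    show ?case
    proof
      fix z assume "z \<in> \<Union>K"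
      then obtain k where "k \<in> K" "z \<in> k" by blast
      with UN obtain \<Omega> A F where "(\<Omega>, A) \<in> C" "F \<in> A" "z \<in> \<Omega>" "F z \<noteq> 0" "{w \<in> \<Omega>. F w \<noteq> 0} \<subseteq> k"
        by blast
      with \<open>k \<in> K\<close> show "\<exists>\<Omega> A F. (\<Omega>, A) \<in> C \<and> F \<in> A \<and> z \<in> \<Omega> \<and> F z \<noteq> 0 \<and> {w \<in> \<Omega>. F w \<noteq> 0} \<subseteq> \<Union>K"
        by blast
    qed
  qed auto
next
  assume R: "?R U"
  show "is_open (frac_space C) U"
  proof (subst openin_subopen, intro ballI)
    fix z assume "z \<in> U"
    with R obtain \<Omega> A F where 1: "(\<Omega>, A) \<in> C" "F \<in> A" "z \<in> \<Omega>" "F z \<noteq> 0" "{w \<in> \<Omega>. F w \<noteq> 0} \<subseteq> U"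
      by blast
    then have "is_open (frac_space C) {w \<in> \<Omega>. F w \<noteq> 0}"
      unfolding frac_space_def
      by (auto simp: openin_topology_generated_by_iff intro!: generate_topology_on.Basis)
    with 1 show "\<exists>T. is_open (frac_space C) T \<and> z \<in> T \<and> T \<subseteq> U" by blast
  qed
qed

lemma reg_frac_space:
  "f \<in> reg (frac_space C) N \<longleftrightarrow> (\<forall>z\<in>N. \<exists>\<Omega> A F D. (\<Omega>, A) \<in> C \<and> z \<in> \<Omega> \<and> F \<in> A \<and> D \<in> A \<and> D z \<noteq> 0 \<and>
      (\<forall>w\<in>N \<inter> \<Omega>. D w \<noteq> 0 \<longrightarrow> f w = F w / D w))"
  by (simp add: frac_space_def)

lemma topspace_frac_space:
  assumes C: "directed_charts C"
  shows "pts (frac_space C) = (\<Union>(\<Omega>, A) \<in> C. \<Omega>)"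
proof -
  have "(\<lambda>_. 1) \<in> A" if "(\<Omega>, A) \<in> C" for \<Omega> A
    using C that subalg_const unfolding directed_charts_def by blast
  note one = this
  have "is_open (frac_space C) (\<Union>(\<Omega>, A) \<in> C. \<Omega>)"
    unfolding openin_frac_space[OF C]
  proof
    fix z assume "z \<in> (\<Union>(\<Omega>, A) \<in> C. \<Omega>)"
    then obtain \<Omega> A where *: "(\<Omega>, A) \<in> C" "z \<in> \<Omega>" by auto
    then show "\<exists>\<Omega> A F. (\<Omega>, A) \<in> C \<and> F \<in> A \<and> z \<in> \<Omega> \<and> F z \<noteq> 0 \<and>
        {w \<in> \<Omega>. F w \<noteq> 0} \<subseteq> (\<Union>(\<Omega>, A) \<in> C. \<Omega>)"
      by - (rule exI[of _ \<Omega>], rule exI[of _ A], rule exI[of _ "\<lambda>_. 1"], use one in auto)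
  qed
  moreover have "pts (frac_space C) \<subseteq> (\<Union>(\<Omega>, A) \<in> C. \<Omega>)"
    using openin_topspace[of "top (frac_space C)"] unfolding openin_frac_space[OF C] by fast
  ultimately show ?thesis using openin_subset by blast
qed

lemma ringed_frac_space:
  assumes C: "directed_charts C"
  shows "ringed (frac_space C)"
proof (rule ringedI)
  fix U and f g :: "'a \<Rightarrow> 'b"
  assume f: "f \<in> reg (frac_space C) U" and eq: "\<And>x. x \<in> U \<Longrightarrow> f x = g x"
  show "g \<in> reg (frac_space C) U" unfolding reg_frac_space
  proof
    fix z assume "z \<in> U"
    then obtain \<Omega> A F D where "(\<Omega>, A) \<in> C \<and> z \<in> \<Omega> \<and> F \<in> A \<and> D \<in> A \<and> D z \<noteq> 0"
      "\<forall>w\<in>U \<inter> \<Omega>. D w \<noteq> 0 \<longrightarrow> f w = F w / D w"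
      using f unfolding reg_frac_space by blast
    then show "\<exists>\<Omega> A F D. (\<Omega>, A) \<in> C \<and> z \<in> \<Omega> \<and> F \<in> A \<and> D \<in> A \<and> D z \<noteq> 0 \<and>
      (\<forall>w\<in>U \<inter> \<Omega>. D w \<noteq> 0 \<longrightarrow> g w = F w / D w)"
      by - (rule exI[of _ \<Omega>], rule exI[of _ A], rule exI[of _ F], rule exI[of _ D], simp add: eq)
  qed
next
  fix U V and f :: "'a \<Rightarrow> 'b"
  assume f: "f \<in> reg (frac_space C) U" and V: "V \<subseteq> U"
  show "f \<in> reg (frac_space C) V"
    unfolding reg_frac_space
  proof
    fix z assume "z \<in> V"
    then obtain \<Omega> A F D where "(\<Omega>, A) \<in> C \<and> z \<in> \<Omega> \<and> F \<in> A \<and> D \<in> A \<and> D z \<noteq> 0 \<and>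
      (\<forall>w\<in>U \<inter> \<Omega>. D w \<noteq> 0 \<longrightarrow> f w = F w / D w)"
      using f V unfolding reg_frac_space by blast
    with V show "\<exists>\<Omega> A F D. (\<Omega>, A) \<in> C \<and> z \<in> \<Omega> \<and> F \<in> A \<and> D \<in> A \<and> D z \<noteq> 0 \<and>
      (\<forall>w\<in>V \<inter> \<Omega>. D w \<noteq> 0 \<longrightarrow> f w = F w / D w)"
      by - (rule exI[of _ \<Omega>], rule exI[of _ A], rule exI[of _ F], rule exI[of _ D], blast)
  qed
next
  fix U and f :: "'a \<Rightarrow> 'b"
  assume U: "is_open (frac_space C) U"
    and loc: "\<And>x. x \<in> U \<Longrightarrow> \<exists>V. is_open (frac_space C) V \<and> x \<in> V \<and> V \<subseteq> U \<and> f \<in> reg (frac_space C) V"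
  show "f \<in> reg (frac_space C) U"
    unfolding reg_frac_space
  proof
    fix z assume "z \<in> U"
    then obtain V where V: "is_open (frac_space C) V" "z \<in> V" "V \<subseteq> U" "f \<in> reg (frac_space C) V"
      using loc by blast
    obtain \<Omega> A F D where 1: "(\<Omega>, A) \<in> C" "z \<in> \<Omega>" "F \<in> A" "D \<in> A" "D z \<noteq> 0"
        "\<forall>w\<in>V \<inter> \<Omega>. D w \<noteq> 0 \<longrightarrow> f w = F w / D w"
      using V(2,4) unfolding reg_frac_space by blast
    obtain \<Omega>' A' E where 2: "(\<Omega>', A') \<in> C" "E \<in> A'" "z \<in> \<Omega>'" "E z \<noteq> 0" "{w \<in> \<Omega>'. E w \<noteq> 0} \<subseteq> V"
      using V(1,2) unfolding openin_frac_space[OF C] by blast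
    obtain A'' where 3: "(\<Omega> \<inter> \<Omega>', A'') \<in> C" "A \<subseteq> A''" "A' \<subseteq> A''"
      using C 1(1) 2(1) unfolding directed_charts_def by blast
    then have s: "subalg A''" using C unfolding directed_charts_def by blast
    \<comment> \<open>Multiplying numerator and denominator by \<open>E\<close> confines the
      fraction to \<open>V\<close>, where it is known to represent \<open>f\<close>.\<close>
    show "\<exists>\<Omega> A F D. (\<Omega>, A) \<in> C \<and> z \<in> \<Omega> \<and> F \<in> A \<and> D \<in> A \<and> D z \<noteq> 0 \<and>
      (\<forall>w\<in>U \<inter> \<Omega>. D w \<noteq> 0 \<longrightarrow> f w = F w / D w)"
      using 1 2 3 subalg_mult[OF s, of F E] subalg_mult[OF s, of D E]
      by - (rule exI[of _ "\<Omega> \<inter> \<Omega>'"], rule exI[of _ A''], rule exI[of _ "\<lambda>w. F w * E w"], rule exI[of _ "\<lambda>w. D w * E w"], auto)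
  qed
next
  fix U assume U: "is_open (frac_space C) U"
  have two: "\<exists>\<Omega> A F D F' D'. (\<Omega>, A) \<in> C \<and> z \<in> \<Omega> \<and> F \<in> A \<and> D \<in> A \<and> D z \<noteq> 0 \<and> F' \<in> A \<and> D' \<in> A \<and>
      D' z \<noteq> 0 \<and> subalg A \<and> (\<forall>w\<in>U \<inter> \<Omega>. D w \<noteq> 0 \<longrightarrow> f w = F w / D w) \<and>
      (\<forall>w\<in>U \<inter> \<Omega>. D' w \<noteq> 0 \<longrightarrow> g w = F' w / D' w)"
    if f: "f \<in> reg (frac_space C) U" and g: "g \<in> reg (frac_space C) U" and z: "z \<in> U" for f g z
  proof -
    obtain \<Omega> A F D where 1: "(\<Omega>, A) \<in> C" "z \<in> \<Omega>" "F \<in> A" "D \<in> A" "D z \<noteq> 0"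
        "\<forall>w\<in>U \<inter> \<Omega>. D w \<noteq> 0 \<longrightarrow> f w = F w / D w"
      using f z unfolding reg_frac_space by blast
    obtain \<Omega>' A' F' D' where 2: "(\<Omega>', A') \<in> C" "z \<in> \<Omega>'" "F' \<in> A'" "D' \<in> A'" "D' z \<noteq> 0"
        "\<forall>w\<in>U \<inter> \<Omega>'. D' w \<noteq> 0 \<longrightarrow> g w = F' w / D' w"
      using g z unfolding reg_frac_space by blast
    obtain A'' where 3: "(\<Omega> \<inter> \<Omega>', A'') \<in> C" "A \<subseteq> A''" "A' \<subseteq> A''"
      using C 1(1) 2(1) unfolding directed_charts_def by blast
    then have s: "subalg A''" using C unfolding directed_charts_def by blast
    show ?thesis
      by (rule exI[of _ "\<Omega> \<inter> \<Omega>'"], rule exI[of _ A''], rule exI[of _ F], rule exI[of _ D],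
          rule exI[of _ F'], rule exI[of _ D']) (use 1 2 3 s in auto)
  qed
  show "subalg (reg (frac_space C) U)"
    unfolding subalg_def
  proof (intro conjI allI ballI)
    fix c
    show "(\<lambda>_. c) \<in> reg (frac_space C) U"
      unfolding reg_frac_space
    proof
      fix z assume "z \<in> U"
      then obtain \<Omega> A where 2: "(\<Omega>, A) \<in> C" "z \<in> \<Omega>"
        using U unfolding openin_frac_space[OF C] by blast
      moreover have "subalg A" using C 2(1) unfolding directed_charts_def by blast
      ultimately show "\<exists>\<Omega> A F D. (\<Omega>, A) \<in> C \<and> z \<in> \<Omega> \<and> F \<in> A \<and> D \<in> A \<and> D z \<noteq> 0 \<and>
        (\<forall>w\<in>U \<inter> \<Omega>. D w \<noteq> 0 \<longrightarrow> c = F w / D w)"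
        by - (rule exI[of _ \<Omega>], rule exI[of _ A], rule exI[of _ "\<lambda>_. c"], rule exI[of _ "\<lambda>_. 1"], (auto simp: subalg_const))
    qed
  next
    fix f g :: "'a \<Rightarrow> 'b" assume fg: "f \<in> reg (frac_space C) U" "g \<in> reg (frac_space C) U"
    show "(\<lambda>x. f x + g x) \<in> reg (frac_space C) U"
      unfolding reg_frac_space
    proof
      fix z assume z: "z \<in> U"
      obtain \<Omega> A F D F' D' where 1: "(\<Omega>, A) \<in> C" "z \<in> \<Omega>" "F \<in> A" "D \<in> A" "D z \<noteq> 0" "F' \<in> A" "D' \<in> A"
        "D' z \<noteq> 0" "subalg A" "\<forall>w\<in>U \<inter> \<Omega>. D w \<noteq> 0 \<longrightarrow> f w = F w / D w"
        "\<forall>w\<in>U \<inter> \<Omega>. D' w \<noteq> 0 \<longrightarrow> g w = F' w / D' w"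
        using two[OF fg z] by blast
      show "\<exists>\<Omega> A F D. (\<Omega>, A) \<in> C \<and> z \<in> \<Omega> \<and> F \<in> A \<and> D \<in> A \<and> D z \<noteq> 0 \<and>
          (\<forall>w\<in>U \<inter> \<Omega>. D w \<noteq> 0 \<longrightarrow> f w + g w = F w / D w)"
        by (rule exI[of _ \<Omega>], rule exI[of _ A], rule exI[of _ "\<lambda>w. F w * D' w + F' w * D w"],
            rule exI[of _ "\<lambda>w. D w * D' w"])
          (use 1 in \<open>auto simp: subalg_mult subalg_add field_simps\<close>)
    qed
    show "(\<lambda>x. f x * g x) \<in> reg (frac_space C) U"
      unfolding reg_frac_space
    proof
      fix z assume z: "z \<in> U"
      obtain \<Omega> A F D F' D' where 1: "(\<Omega>, A) \<in> C" "z \<in> \<Omega>" "F \<in> A" "D \<in> A" "D z \<noteq> 0" "F' \<in> A" "D' \<in> A"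
        "D' z \<noteq> 0" "subalg A" "\<forall>w\<in>U \<inter> \<Omega>. D w \<noteq> 0 \<longrightarrow> f w = F w / D w"
        "\<forall>w\<in>U \<inter> \<Omega>. D' w \<noteq> 0 \<longrightarrow> g w = F' w / D' w"
        using two[OF fg z] by blast
      show "\<exists>\<Omega> A F D. (\<Omega>, A) \<in> C \<and> z \<in> \<Omega> \<and> F \<in> A \<and> D \<in> A \<and> D z \<noteq> 0 \<and>
          (\<forall>w\<in>U \<inter> \<Omega>. D w \<noteq> 0 \<longrightarrow> f w * g w = F w / D w)"
        by (rule exI[of _ \<Omega>], rule exI[of _ A], rule exI[of _ "\<lambda>w. F w * F' w"],
            rule exI[of _ "\<lambda>w. D w * D' w"])
          (use 1 in \<open>auto simp: subalg_mult\<close>)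
    qed
  qed
next
  fix U and f :: "'a \<Rightarrow> 'b" assume U: "is_open (frac_space C) U" and f: "f \<in> reg (frac_space C) U"
  show "is_open (frac_space C) {x \<in> U. f x \<noteq> 0}"
    unfolding openin_frac_space[OF C]
  proof
    fix z assume z: "z \<in> {x \<in> U. f x \<noteq> 0}"
    obtain \<Omega> A F D where 1: "(\<Omega>, A) \<in> C" "z \<in> \<Omega>" "F \<in> A" "D \<in> A" "D z \<noteq> 0"
        "\<forall>w\<in>U \<inter> \<Omega>. D w \<noteq> 0 \<longrightarrow> f w = F w / D w"
      using f z unfolding reg_frac_space by blast
    obtain \<Omega>' A' E where 2: "(\<Omega>', A') \<in> C" "E \<in> A'" "z \<in> \<Omega>'" "E z \<noteq> 0" "{w \<in> \<Omega>'. E w \<noteq> 0} \<subseteq> U"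
      using U z unfolding openin_frac_space[OF C] by blast
    obtain A'' where 3: "(\<Omega> \<inter> \<Omega>', A'') \<in> C" "A \<subseteq> A''" "A' \<subseteq> A''"
      using C 1(1) 2(1) unfolding directed_charts_def by blast
    then have s: "subalg A''" using C unfolding directed_charts_def by blast
    \<comment> \<open>The factor \<open>E\<close> keeps the basic open set inside \<open>U\<close>,
      \<open>D\<close> makes the fraction valid there, and \<open>F\<close> makes it
      nonzero.\<close>
    show "\<exists>\<Omega> A F. (\<Omega>, A) \<in> C \<and> F \<in> A \<and> z \<in> \<Omega> \<and> F z \<noteq> 0 \<and> {w \<in> \<Omega>. F w \<noteq> 0} \<subseteq> {x \<in> U. f x \<noteq> 0}"
      by (rule exI[of _ "\<Omega> \<inter> \<Omega>'"], rule exI[of _ A''], rule exI[of _ "\<lambda>w. F w * (D w * E w)"])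
        (use 1 2 3 z s in \<open>auto intro!: subalg_mult\<close>)
  qed
  show "(\<lambda>x. inverse (f x)) \<in> reg (frac_space C) {x \<in> U. f x \<noteq> 0}"
    unfolding reg_frac_space
  proof
    fix z assume z: "z \<in> {x \<in> U. f x \<noteq> 0}"
    obtain \<Omega> A F D where 1: "(\<Omega>, A) \<in> C" "z \<in> \<Omega>" "F \<in> A" "D \<in> A" "D z \<noteq> 0"
        "\<forall>w\<in>U \<inter> \<Omega>. D w \<noteq> 0 \<longrightarrow> f w = F w / D w"
      using f z unfolding reg_frac_space by blast
    moreover from 1 have s: "subalg A" using C unfolding directed_charts_def by blast
    \<comment> \<open>The inverse is written as \<open>D * D\<close> over \<open>F * D\<close>
      instead of \<open>D\<close> over \<open>F\<close>: the extra factor excludes the points with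
      \<open>D w = 0\<close>, where the fraction says nothing about \<open>f\<close>.\<close>
    ultimately show "\<exists>\<Omega> A F D. (\<Omega>, A) \<in> C \<and> z \<in> \<Omega> \<and> F \<in> A \<and> D \<in> A \<and> D z \<noteq> 0 \<and>
      (\<forall>w\<in>{x \<in> U. f x \<noteq> 0} \<inter> \<Omega>. D w \<noteq> 0 \<longrightarrow> inverse (f w) = F w / D w)"
      using z by - (rule exI[of _ \<Omega>], rule exI[of _ A], rule exI[of _ "\<lambda>w. D w * D w"],
        rule exI[of _ "\<lambda>w. F w * D w"], auto simp: subalg_mult)
  qed
qed

lemma ringed_affine: "subalg A \<Longrightarrow> ringed (affine_space_of A)"
  unfolding affine_space_of_frac_space by (intro ringed_frac_space directed_charts_single)

lemma pts_affine: "subalg A \<Longrightarrow> pts (affine_space_of A) = UNIV"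
  unfolding affine_space_of_frac_space by (simp add: topspace_frac_space directed_charts_single)

lemma reg_affineI: "subalg A \<Longrightarrow> f \<in> A \<Longrightarrow> f \<in> reg (affine_space_of A) U"
  unfolding affine_space_of_def
  by (simp, intro ballI bexI[of _ f] bexI[of _ "\<lambda>_. 1"]) (auto simp: subalg_const)

lemma ringed_prod: "ringed X \<Longrightarrow> ringed Y \<Longrightarrow> ringed (prod_space X Y)"
  unfolding prod_space_frac_space by (intro ringed_frac_space directed_charts_prod)

lemma pts_prod:
  assumes "ringed X" "ringed Y"
  shows "pts (prod_space X Y) = pts X \<times> pts Y"
proof -
  have "pts (prod_space X Y) = (\<Union>{U \<times> V | U V. is_open X U \<and> is_open Y V})"
    unfolding prod_space_frac_space topspace_frac_space[OF directed_charts_prod[OF assms]] by auto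
  also have "\<dots> = pts X \<times> pts Y"
    using openin_topspace[of "top X"] openin_topspace[of "top Y"]
      openin_subset[of "top X"] openin_subset[of "top Y"] by blast
  finally show ?thesis .
qed

lemma openin_prod_Times:
  assumes "ringed X" "ringed Y" "is_open X U" "is_open Y V"
  shows "is_open (prod_space X Y) (U \<times> V)"
  unfolding prod_space_frac_space openin_frac_space[OF directed_charts_prod[OF assms(1,2)]]
proof
  fix z assume z: "z \<in> U \<times> V"
  have "(\<lambda>_. 1) \<in> fun_tensor (reg X U) (reg Y V)"
    using assms by (intro subalg_const subalg_fun_tensor subalg_reg)
  then show "\<exists>\<Omega> A F. (\<Omega>, A) \<in> {(U \<times> V, fun_tensor (reg X U) (reg Y V)) |U V. is_open X U \<and> is_open Y V} \<and>
             F \<in> A \<and> z \<in> \<Omega> \<and> F z \<noteq> 0 \<and> {w \<in> \<Omega>. F w \<noteq> 0} \<subseteq> U \<times> V"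
    using z assms
    by - (rule exI[of _ "U \<times> V"], rule exI[of _ "fun_tensor (reg X U) (reg Y V)"], rule exI[of _ "\<lambda>_. 1"], auto)
qed

lemma reg_frac_spaceI:
  assumes "directed_charts C" "(\<Omega>, A) \<in> C" "F \<in> A"
  shows "F \<in> reg (frac_space C) \<Omega>"
proof -
  have "(\<lambda>_. 1) \<in> A" using assms(1,2) subalg_const unfolding directed_charts_def by blast
  then show ?thesis
    unfolding reg_frac_space
    by - (rule ballI, rule exI[of _ \<Omega>], rule exI[of _ A], rule exI[of _ F], rule exI[of _ "\<lambda>_. 1"],
      use assms in simp)
qed

lemma reg_prodI:
  assumes "ringed X" "ringed Y" "is_open X U" "is_open Y V" "F \<in> fun_tensor (reg X U) (reg Y V)"
  shows "F \<in> reg (prod_space X Y) (U \<times> V)"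
  unfolding prod_space_frac_space
  by (rule reg_frac_spaceI[OF directed_charts_prod[OF assms(1,2)] _ assms(5)]) (use assms in blast)

section \<open>Subspaces and quotients\<close>

lemma pts_sub_space [simp]: "pts (sub_space X S) = pts X \<inter> S"
  by (simp add: sub_space_def)

lemma openin_sub_space: "is_open (sub_space X S) U \<longleftrightarrow> (\<exists>V. is_open X V \<and> U = V \<inter> S)"
  by (simp add: sub_space_def openin_subtopology)

lemma reg_sub_space: "f \<in> reg (sub_space X S) U \<longleftrightarrow>
    (\<forall>x\<in>U. \<exists>V g. is_open X V \<and> x \<in> V \<and> g \<in> reg X V \<and> (\<forall>y\<in>U \<inter> V. f y = g y))"
  by (simp add: sub_space_def)

lemma reg_sub_spaceI:
  assumes "is_open X V" "f \<in> reg X V" "U \<subseteq> V"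
  shows "f \<in> reg (sub_space X S) U"
  unfolding reg_sub_space using assms by (intro ballI, intro exI[of _ V] exI[of _ f]) auto

lemma ringed_sub_space:
  assumes X: "ringed X"
  shows "ringed (sub_space X S)"
proof (rule ringedI)
  fix U and f g :: "'a \<Rightarrow> 'b"
  assume f: "f \<in> reg (sub_space X S) U" and eq: "\<And>x. x \<in> U \<Longrightarrow> f x = g x"
  show "g \<in> reg (sub_space X S) U" unfolding reg_sub_space
  proof
    fix x assume "x \<in> U"
    then obtain V a where "is_open X V" "x \<in> V" "a \<in> reg X V" "\<forall>y\<in>U \<inter> V. f y = a y"
      using f unfolding reg_sub_space by blast
    then show "\<exists>V a. is_open X V \<and> x \<in> V \<and> a \<in> reg X V \<and> (\<forall>y\<in>U \<inter> V. g y = a y)"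
      by - (rule exI[of _ V], rule exI[of _ a], simp add: eq[symmetric])
  qed
next
  fix U V and f :: "'a \<Rightarrow> 'b"
  assume f: "f \<in> reg (sub_space X S) U" and V: "V \<subseteq> U"
  show "f \<in> reg (sub_space X S) V" unfolding reg_sub_space
  proof
    fix x assume "x \<in> V"
    then have "x \<in> U" using V by auto
    then obtain W a where "is_open X W" "x \<in> W" "a \<in> reg X W" "\<forall>y\<in>U \<inter> W. f y = a y"
      using f unfolding reg_sub_space by blast
    with V show "\<exists>W a. is_open X W \<and> x \<in> W \<and> a \<in> reg X W \<and> (\<forall>y\<in>V \<inter> W. f y = a y)"
      by - (rule exI[of _ W], rule exI[of _ a], blast)
  qed
next
  fix U and f :: "'a \<Rightarrow> 'b"
  assume loc: "\<And>x. x \<in> U \<Longrightarrow> \<exists>V. is_open (sub_space X S) V \<and> x \<in> V \<and> V \<subseteq> U \<and> f \<in> reg (sub_space X S) V"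
    and U: "is_open (sub_space X S) U"
  show "f \<in> reg (sub_space X S) U"
    unfolding reg_sub_space
  proof
    fix x assume "x \<in> U"
    then obtain V where V: "is_open (sub_space X S) V" "x \<in> V" "V \<subseteq> U" "f \<in> reg (sub_space X S) V"
      using loc by blast
    obtain V' where V': "is_open X V'" "V = V' \<inter> S" using V(1) unfolding openin_sub_space by blast
    obtain U' where U': "U = U' \<inter> S" using U unfolding openin_sub_space by blast
    obtain W g where W: "is_open X W" "x \<in> W" "g \<in> reg X W" "\<forall>y\<in>V \<inter> W. f y = g y"
      using V(2,4) unfolding reg_sub_space by blast
    \<comment> \<open>\<open>g\<close> is known to agree with \<open>f\<close> only inside
      \<open>V\<close>, so it is cut down to the open set \<open>V'\<close> that defines
      \<open>V\<close>.\<close>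
    have "g \<in> reg X (W \<inter> V')" using W V' by (intro reg_restrict[OF X W(3)] openin_Int) auto
    moreover have "\<forall>y\<in>U \<inter> (W \<inter> V'). f y = g y" using W V' U' by blast
    ultimately show "\<exists>V g. is_open X V \<and> x \<in> V \<and> g \<in> reg X V \<and> (\<forall>y\<in>U \<inter> V. f y = g y)"
      using W V V' by - (rule exI[of _ "W \<inter> V'"], rule exI[of _ g], auto)
  qed
next
  fix U assume U: "is_open (sub_space X S) U"
  have two: "\<exists>V a b. is_open X V \<and> x \<in> V \<and> a \<in> reg X V \<and> b \<in> reg X V \<and> (\<forall>y\<in>U \<inter> V. f y = a y \<and> g y = b y)"
    if f: "f \<in> reg (sub_space X S) U" and g: "g \<in> reg (sub_space X S) U" and "x \<in> U" for f g x
  proof -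
    obtain V a where V: "is_open X V" "x \<in> V" "a \<in> reg X V" "\<forall>y\<in>U \<inter> V. f y = a y"
      using f \<open>x \<in> U\<close> unfolding reg_sub_space by blast
    obtain W b where W: "is_open X W" "x \<in> W" "b \<in> reg X W" "\<forall>y\<in>U \<inter> W. g y = b y"
      using g \<open>x \<in> U\<close> unfolding reg_sub_space by blast
    show ?thesis
      by (rule exI[of _ "V \<inter> W"], rule exI[of _ a], rule exI[of _ b])
        (use V W reg_restrict[OF X V(3), of "V \<inter> W"] reg_restrict[OF X W(3), of "V \<inter> W"] in auto)
  qed
  show "subalg (reg (sub_space X S) U)"
    unfolding subalg_def
  proof (intro conjI allI ballI)
    fix c
    have "U \<subseteq> pts X" using openin_subset[OF U] by auto
    then show "(\<lambda>_. c) \<in> reg (sub_space X S) U"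
      by (rule reg_sub_spaceI[OF openin_topspace reg_const[OF X openin_topspace]])
  next
    fix f g :: "'a \<Rightarrow> 'b" assume fg: "f \<in> reg (sub_space X S) U" "g \<in> reg (sub_space X S) U"
    show "(\<lambda>x. f x + g x) \<in> reg (sub_space X S) U" unfolding reg_sub_space
    proof
      fix x assume x: "x \<in> U"
      obtain V a b where "is_open X V" "x \<in> V" "a \<in> reg X V" "b \<in> reg X V" "\<forall>y\<in>U \<inter> V. f y = a y \<and> g y = b y"
        using two[OF fg x] by blast
      then show "\<exists>V h. is_open X V \<and> x \<in> V \<and> h \<in> reg X V \<and> (\<forall>y\<in>U \<inter> V. f y + g y = h y)"
        by - (rule exI[of _ V], rule exI[of _ "\<lambda>y. a y + b y"], (auto intro: reg_add[OF X]))
    qed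
    show "(\<lambda>x. f x * g x) \<in> reg (sub_space X S) U" unfolding reg_sub_space
    proof
      fix x assume x: "x \<in> U"
      obtain V a b where "is_open X V" "x \<in> V" "a \<in> reg X V" "b \<in> reg X V" "\<forall>y\<in>U \<inter> V. f y = a y \<and> g y = b y"
        using two[OF fg x] by blast
      then show "\<exists>V h. is_open X V \<and> x \<in> V \<and> h \<in> reg X V \<and> (\<forall>y\<in>U \<inter> V. f y * g y = h y)"
        by - (rule exI[of _ V], rule exI[of _ "\<lambda>y. a y * b y"], (auto intro: reg_mult[OF X]))
    qed
  qed
next
  fix U and f :: "'a \<Rightarrow> 'b" assume U: "is_open (sub_space X S) U" and f: "f \<in> reg (sub_space X S) U"
  obtain U' where U': "is_open X U'" "U = U' \<inter> S" using U unfolding openin_sub_space by blast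
  show "is_open (sub_space X S) {x \<in> U. f x \<noteq> 0}"
  proof (subst openin_subopen, intro ballI)
    fix x assume x: "x \<in> {x \<in> U. f x \<noteq> 0}"
    then obtain V a where V: "is_open X V" "x \<in> V" "a \<in> reg X V" "\<forall>y\<in>U \<inter> V. f y = a y"
      using f unfolding reg_sub_space by blast
    have "is_open (sub_space X S) ({y \<in> V. a y \<noteq> 0} \<inter> U' \<inter> S)"
      unfolding openin_sub_space using open_nonzero[OF X V(3,1)] U'(1) by blast
    then show "\<exists>T. is_open (sub_space X S) T \<and> x \<in> T \<and> T \<subseteq> {x \<in> U. f x \<noteq> 0}"
      using V U' x by - (rule exI[of _ "{y \<in> V. a y \<noteq> 0} \<inter> U' \<inter> S"], auto)
  qed
  show "(\<lambda>x. inverse (f x)) \<in> reg (sub_space X S) {x \<in> U. f x \<noteq> 0}"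
    unfolding reg_sub_space
  proof
    fix x assume x: "x \<in> {x \<in> U. f x \<noteq> 0}"
    then obtain V a where V: "is_open X V" "x \<in> V" "a \<in> reg X V" "\<forall>y\<in>U \<inter> V. f y = a y"
      using f unfolding reg_sub_space by blast
    show "\<exists>V g. is_open X V \<and> x \<in> V \<and> g \<in> reg X V \<and> (\<forall>y\<in>{x \<in> U. f x \<noteq> 0} \<inter> V. inverse (f y) = g y)"
      by (rule exI[of _ "{y \<in> V. a y \<noteq> 0}"], rule exI[of _ "\<lambda>y. inverse (a y)"])
        (use V x open_nonzero[OF X V(3,1)] reg_inverse[OF X V(3,1)] in auto)
  qed
qed

lemma openin_quot_space: "is_open (quot_space X q) U \<longleftrightarrow>
    U \<subseteq> q ` pts X \<and> is_open X {x \<in> pts X. q x \<in> U}"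
  by (simp add: quot_space_def openin_quot_topology)

lemma reg_quot_space: "f \<in> reg (quot_space X q) U \<longleftrightarrow> (\<lambda>x. f (q x)) \<in> reg X {x \<in> pts X. q x \<in> U}"
  by (simp add: quot_space_def comp_def)

lemma pts_quot_space [simp]: "pts (quot_space X q) = q ` pts X"
proof -
  have "{x \<in> pts X. q x \<in> q ` pts X} = pts X" by auto
  then have "is_open (quot_space X q) (q ` pts X)" unfolding openin_quot_space by simp
  moreover have "pts (quot_space X q) \<subseteq> q ` pts X"
    using openin_topspace[of "top (quot_space X q)"] unfolding openin_quot_space by blast
  ultimately show ?thesis using openin_subset by blast
qed

text \<open>Open sets and functions of the quotient are defined by pull-back, so each axiom is the
  axiom of \<open>X\<close> on the preimage of \<open>U\<close>.\<close>

lemma ringed_quot_space: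
  assumes X: "ringed X"
  shows "ringed (quot_space X q)"
proof (rule ringedI)
  fix U and f g :: "'c \<Rightarrow> 'b"
  assume "f \<in> reg (quot_space X q) U" "\<And>x. x \<in> U \<Longrightarrow> f x = g x"
  then show "g \<in> reg (quot_space X q) U" unfolding reg_quot_space
    by (elim reg_cong[OF X]) auto
next
  fix U V and f :: "'c \<Rightarrow> 'b"
  assume "f \<in> reg (quot_space X q) U" "V \<subseteq> U" "is_open (quot_space X q) U" "is_open (quot_space X q) V"
  then show "f \<in> reg (quot_space X q) V" unfolding reg_quot_space openin_quot_space
    by (elim reg_restrict[OF X]) auto
next
  fix U and f :: "'c \<Rightarrow> 'b"
  assume loc: "\<And>x. x \<in> U \<Longrightarrow> \<exists>V. is_open (quot_space X q) V \<and> x \<in> V \<and> V \<subseteq> U \<and> f \<in> reg (quot_space X q) V"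
    and U: "is_open (quot_space X q) U"
  show "f \<in> reg (quot_space X q) U"
    unfolding reg_quot_space
  proof (rule reg_local[OF X])
    show "is_open X {x \<in> pts X. q x \<in> U}" using U unfolding openin_quot_space by blast
    fix x assume "x \<in> {x \<in> pts X. q x \<in> U}"
    then obtain V where "is_open (quot_space X q) V" "q x \<in> V" "V \<subseteq> U" "f \<in> reg (quot_space X q) V" "x \<in> pts X"
      using loc by blast
    then show "\<exists>V. is_open X V \<and> x \<in> V \<and> V \<subseteq> {x \<in> pts X. q x \<in> U} \<and> (\<lambda>x. f (q x)) \<in> reg X V"
      unfolding reg_quot_space openin_quot_space
      by - (rule exI[of _ "{x \<in> pts X. q x \<in> V}"], auto)
  qed
next
  fix U assume U: "is_open (quot_space X q) U"
  then have o: "is_open X {x \<in> pts X. q x \<in> U}" using openin_quot_space by blast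
  show "subalg (reg (quot_space X q) U)"
    unfolding subalg_def Ball_def reg_quot_space
    by (auto intro: reg_const[OF X o] reg_add[OF X o] reg_mult[OF X o])
next
  fix U and f :: "'c \<Rightarrow> 'b" assume U: "is_open (quot_space X q) U" and f: "f \<in> reg (quot_space X q) U"
  then have o: "is_open X {x \<in> pts X. q x \<in> U}" using openin_quot_space by blast
  have f': "(\<lambda>x. f (q x)) \<in> reg X {x \<in> pts X. q x \<in> U}" using f by (simp add: reg_quot_space)
  have e: "{x \<in> pts X. q x \<in> {y \<in> U. f y \<noteq> 0}} = {x \<in> {x \<in> pts X. q x \<in> U}. f (q x) \<noteq> 0}" by auto
  show "is_open (quot_space X q) {x \<in> U. f x \<noteq> 0}"
    using open_nonzero[OF X f' o] U unfolding openin_quot_space e by blast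
  show "(\<lambda>x. inverse (f x)) \<in> reg (quot_space X q) {x \<in> U. f x \<noteq> 0}"
    unfolding reg_quot_space e using reg_inverse[OF X f' o] by simp
qed

section \<open>Local morphisms and regular vector-valued functions\<close>

text \<open>A morphism defined on an open set \<open>N\<close>, but stated on \<open>X\<close>
  itself. Composition, restriction and gluing then never change the underlying space.\<close>

definition local_morphism ::
    "('x, 'k::field) fspace \<Rightarrow> 'x set \<Rightarrow> ('y, 'k) fspace \<Rightarrow> ('x \<Rightarrow> 'y) \<Rightarrow> bool"
  where "local_morphism X N Y f \<longleftrightarrow> is_open X N \<and> f ` N \<subseteq> pts Y \<and>
    (\<forall>U. is_open Y U \<longrightarrow> is_open X {x \<in> N. f x \<in> U} \<and>
      (\<forall>g\<in>reg Y U. (\<lambda>x. g (f x)) \<in> reg X {x \<in> N. f x \<in> U}))"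

lemma local_morphismI:
  assumes "is_open X N" "f ` N \<subseteq> pts Y"
    and "\<And>U. is_open Y U \<Longrightarrow> is_open X {x \<in> N. f x \<in> U}"
    and "\<And>U g. is_open Y U \<Longrightarrow> g \<in> reg Y U \<Longrightarrow> (\<lambda>x. g (f x)) \<in> reg X {x \<in> N. f x \<in> U}"
  shows "local_morphism X N Y f"
  using assms unfolding local_morphism_def by simp

lemma
  assumes "local_morphism X N Y f"
  shows local_morphism_open: "is_open X N"
    and local_morphism_pts: "x \<in> N \<Longrightarrow> f x \<in> pts Y"
    and local_morphism_vimage: "is_open Y U \<Longrightarrow> is_open X {x \<in> N. f x \<in> U}"
    and local_morphism_reg: "is_open Y U \<Longrightarrow> g \<in> reg Y U \<Longrightarrow> (\<lambda>x. g (f x)) \<in> reg X {x \<in> N. f x \<in> U}"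
  using assms unfolding local_morphism_def by (simp_all add: image_subset_iff)

lemma morphism_iff: "morphism X Y f \<longleftrightarrow> local_morphism X (pts X) Y f"
  unfolding morphism_def local_morphism_def continuous_map_def comp_def
  by (simp add: Pi_iff image_subset_iff) blast

lemma local_morphism_comp:
  assumes f: "local_morphism X N Y f" and g: "local_morphism Y N' Z g"
  shows "local_morphism X {x \<in> N. f x \<in> N'} Z (\<lambda>x. g (f x))"
proof (rule local_morphismI)
  show "is_open X {x \<in> N. f x \<in> N'}"
    by (rule local_morphism_vimage[OF f local_morphism_open[OF g]])
  show "(\<lambda>x. g (f x)) ` {x \<in> N. f x \<in> N'} \<subseteq> pts Z"
    using local_morphism_pts[OF g] by auto
  fix U assume U: "is_open Z U"
  have e: "{x \<in> {x \<in> N. f x \<in> N'}. g (f x) \<in> U} = {x \<in> N. f x \<in> {y \<in> N'. g y \<in> U}}" by auto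
  note o = local_morphism_vimage[OF g U]
  show "is_open X {x \<in> {x \<in> N. f x \<in> N'}. g (f x) \<in> U}"
    unfolding e by (rule local_morphism_vimage[OF f o])
  fix h assume h: "h \<in> reg Z U"
  show "(\<lambda>x. h (g (f x))) \<in> reg X {x \<in> {x \<in> N. f x \<in> N'}. g (f x) \<in> U}"
    unfolding e by (rule local_morphism_reg[OF f o local_morphism_reg[OF g U h]])
qed

lemma local_morphism_comp':
  assumes f: "local_morphism X N Y f" and g: "local_morphism Y N' Z g" and sub: "f ` N \<subseteq> N'"
  shows "local_morphism X N Z (\<lambda>x. g (f x))"
proof -
  have "{x \<in> N. f x \<in> N'} = N" using sub by auto
  then show ?thesis using local_morphism_comp[OF f g] by simp
qed

lemma local_morphism_restrict:
  assumes X: "ringed X" and f: "local_morphism X N Y f" and N': "is_open X N'" "N' \<subseteq> N"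
  shows "local_morphism X N' Y f"
proof (rule local_morphismI)
  show "is_open X N'" by fact
  show "f ` N' \<subseteq> pts Y" using local_morphism_pts[OF f] N'(2) by auto
  fix U assume U: "is_open Y U"
  have e: "{x \<in> N'. f x \<in> U} = {x \<in> N. f x \<in> U} \<inter> N'" using N'(2) by auto
  note o = local_morphism_vimage[OF f U]
  show o': "is_open X {x \<in> N'. f x \<in> U}" unfolding e by (rule openin_Int[OF o N'(1)])
  fix g assume g: "g \<in> reg Y U"
  show "(\<lambda>x. g (f x)) \<in> reg X {x \<in> N'. f x \<in> U}"
    by (rule reg_restrict[OF X local_morphism_reg[OF f U g] o o']) (simp add: e)
qed

lemma local_morphism_cong:
  assumes X: "ringed X" and f: "local_morphism X N Y f" and eq: "\<And>x. x \<in> N \<Longrightarrow> f x = g x"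
  shows "local_morphism X N Y g"
proof (rule local_morphismI)
  show "is_open X N" by (rule local_morphism_open[OF f])
  show "g ` N \<subseteq> pts Y" using local_morphism_pts[OF f] eq by auto
  fix U assume U: "is_open Y U"
  have e: "{x \<in> N. g x \<in> U} = {x \<in> N. f x \<in> U}" using eq by auto
  show "is_open X {x \<in> N. g x \<in> U}" unfolding e by (rule local_morphism_vimage[OF f U])
  fix h assume "h \<in> reg Y U"
  then show "(\<lambda>x. h (g x)) \<in> reg X {x \<in> N. g x \<in> U}"
    unfolding e by (rule reg_cong[OF X local_morphism_reg[OF f U]]) (simp add: eq)
qed

lemma local_morphism_local:
  assumes X: "ringed X" and loc: "\<And>x. x \<in> N \<Longrightarrow> \<exists>N'. x \<in> N' \<and> N' \<subseteq> N \<and> local_morphism X N' Y f"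
  shows "local_morphism X N Y f"
proof (rule local_morphismI)
  show "is_open X N"
  proof (subst openin_subopen, rule ballI)
    fix x assume "x \<in> N"
    from loc[OF this] show "\<exists>T. is_open X T \<and> x \<in> T \<and> T \<subseteq> N"
      by (elim exE conjE) (intro exI conjI, erule local_morphism_open)
  qed
  show "f ` N \<subseteq> pts Y"
  proof
    fix y assume "y \<in> f ` N"
    then obtain x where x: "x \<in> N" "y = f x" by auto
    from loc[OF x(1)] show "y \<in> pts Y" unfolding x(2)
      by (elim exE conjE) (rule local_morphism_pts)
  qed
  fix U assume U: "is_open Y U"
  have loc': "\<exists>N'. is_open X {x \<in> N'. f x \<in> U} \<and> x \<in> {x \<in> N'. f x \<in> U} \<and>
      {x \<in> N'. f x \<in> U} \<subseteq> {x \<in> N. f x \<in> U} \<and> local_morphism X N' Y f" if x: "x \<in> {x \<in> N. f x \<in> U}" for x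
  proof -
    obtain N' where "x \<in> N'" "N' \<subseteq> N" "local_morphism X N' Y f" using loc[of x] x by auto
    then show ?thesis using x local_morphism_vimage[of X N' Y f, OF _ U]
      by (intro exI[of _ N']) auto
  qed
  show o: "is_open X {x \<in> N. f x \<in> U}"
  proof (subst openin_subopen, rule ballI)
    fix x assume "x \<in> {x \<in> N. f x \<in> U}"
    from loc'[OF this] show "\<exists>T. is_open X T \<and> x \<in> T \<and> T \<subseteq> {x \<in> N. f x \<in> U}" by (elim exE conjE) blast
  qed
  fix g assume g: "g \<in> reg Y U"
  show "(\<lambda>x. g (f x)) \<in> reg X {x \<in> N. f x \<in> U}"
  proof (rule reg_local[OF X o])
    fix x assume "x \<in> {x \<in> N. f x \<in> U}"
    from loc'[OF this]
    obtain N' where N': "is_open X {x \<in> N'. f x \<in> U}" "x \<in> {x \<in> N'. f x \<in> U}"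
      "{x \<in> N'. f x \<in> U} \<subseteq> {x \<in> N. f x \<in> U}" "local_morphism X N' Y f"
      by (elim exE conjE)
    then show "\<exists>V. is_open X V \<and> x \<in> V \<and> V \<subseteq> {x \<in> N. f x \<in> U} \<and> (\<lambda>x. g (f x)) \<in> reg X V"
      using local_morphism_reg[OF N'(4) U g] by (intro exI[of _ "{x \<in> N'. f x \<in> U}"]) simp
  qed
qed

text \<open>Functions on the subspace extend locally to \<open>Y\<close>, where \<open>f\<close>
  pulls them back; regularity is then glued on \<open>X\<close>.\<close>

lemma local_morphism_into_sub:
  assumes X: "ringed X" and f: "local_morphism X N Y f" and S: "f ` N \<subseteq> S"
  shows "local_morphism X N (sub_space Y S) f"
proof (rule local_morphismI)
  show "is_open X N" by (rule local_morphism_open[OF f])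
  show "f ` N \<subseteq> pts (sub_space Y S)" using local_morphism_pts[OF f] S by auto
  fix U assume "is_open (sub_space Y S) U"
  then obtain V where V: "is_open Y V" "U = V \<inter> S" unfolding openin_sub_space by auto
  have e: "{x \<in> N. f x \<in> U} = {x \<in> N. f x \<in> V}" using V(2) S by auto
  show o: "is_open X {x \<in> N. f x \<in> U}" unfolding e by (rule local_morphism_vimage[OF f V(1)])
  fix g assume g: "g \<in> reg (sub_space Y S) U"
  show "(\<lambda>x. g (f x)) \<in> reg X {x \<in> N. f x \<in> U}"
  proof (rule reg_local[OF X o])
    fix x assume x: "x \<in> {x \<in> N. f x \<in> U}"
    then have "f x \<in> U" by simp
    then obtain W a where W: "is_open Y W" "f x \<in> W" "a \<in> reg Y W" "\<forall>y\<in>U \<inter> W. g y = a y"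
      using g unfolding reg_sub_space by blast
    let ?N = "{x \<in> N. f x \<in> U} \<inter> {x \<in> N. f x \<in> W}"
    have o1: "is_open X {x \<in> N. f x \<in> W}" by (rule local_morphism_vimage[OF f W(1)])
    have o2: "is_open X ?N" by (rule openin_Int[OF o o1])
    have "(\<lambda>x. a (f x)) \<in> reg X ?N"
      by (rule reg_restrict[OF X local_morphism_reg[OF f W(1,3)] o1 o2]) simp
    then have "(\<lambda>x. g (f x)) \<in> reg X ?N" by (rule reg_cong[OF X]) (simp add: W(4))
    then show "\<exists>V. is_open X V \<and> x \<in> V \<and> V \<subseteq> {x \<in> N. f x \<in> U} \<and> (\<lambda>x. g (f x)) \<in> reg X V"
      using o2 x W(2) by (intro exI[of _ ?N]) auto
  qed
qed

lemma local_morphism_from_sub: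
  assumes f: "local_morphism X N Y f"
  shows "local_morphism (sub_space X S) (N \<inter> S) Y f"
proof (rule local_morphismI)
  show "is_open (sub_space X S) (N \<inter> S)"
    unfolding openin_sub_space using local_morphism_open[OF f] by blast
  show "f ` (N \<inter> S) \<subseteq> pts Y" using local_morphism_pts[OF f] by auto
  fix U assume U: "is_open Y U"
  have e: "{x \<in> N \<inter> S. f x \<in> U} = {x \<in> N. f x \<in> U} \<inter> S" by auto
  note o = local_morphism_vimage[OF f U]
  show "is_open (sub_space X S) {x \<in> N \<inter> S. f x \<in> U}"
    unfolding e openin_sub_space using o by blast
  fix g assume g: "g \<in> reg Y U"
  show "(\<lambda>x. g (f x)) \<in> reg (sub_space X S) {x \<in> N \<inter> S. f x \<in> U}"
    by (rule reg_sub_spaceI[OF o local_morphism_reg[OF f U g]]) auto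
qed

lemma local_morphism_id: "ringed X \<Longrightarrow> is_open X N \<Longrightarrow> local_morphism X N X (\<lambda>x. x)"
proof (rule local_morphismI)
  fix U g assume X: "ringed X" and N: "is_open X N" and U: "is_open X U"
  have e: "{x \<in> N. x \<in> U} = N \<inter> U" by auto
  show o: "is_open X {x \<in> N. x \<in> U}" unfolding e by (rule openin_Int[OF N U])
  assume "g \<in> reg X U"
  then show "(\<lambda>x. g x) \<in> reg X {x \<in> N. x \<in> U}" by (rule reg_restrict[OF X _ U o]) auto
qed (auto dest: openin_subset)

lemma local_morphism_incl:
  assumes "ringed X"
  shows "local_morphism (sub_space X S) (pts (sub_space X S)) X (\<lambda>x. x)"
  using local_morphism_from_sub[OF local_morphism_id[OF assms openin_topspace], of S] by simp

lemma openin_sub_open: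
  "is_open X V \<Longrightarrow> is_open (sub_space X V) U \<longleftrightarrow> is_open X U \<and> U \<subseteq> V"
  by (auto simp: sub_space_def openin_open_subtopology)

lemma reg_sub_open:
  assumes X: "ringed X" and V: "is_open X V" and U: "is_open X U" "U \<subseteq> V"
  shows "reg (sub_space X V) U = reg X U"
proof
  show "reg X U \<subseteq> reg (sub_space X V) U" using reg_sub_spaceI[OF U(1)] by auto
  show "reg (sub_space X V) U \<subseteq> reg X U"
  proof
    fix f assume f: "f \<in> reg (sub_space X V) U"
    show "f \<in> reg X U"
    proof (rule reg_local[OF X U(1)])
      fix x assume x: "x \<in> U"
      then obtain W g where W: "is_open X W" "x \<in> W" "g \<in> reg X W" "\<forall>y\<in>U \<inter> W. f y = g y"
        using f unfolding reg_sub_space by blast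
      have o: "is_open X (U \<inter> W)" by (rule openin_Int[OF U(1) W(1)])
      have "g \<in> reg X (U \<inter> W)" by (rule reg_restrict[OF X W(3,1) o]) simp
      then have "f \<in> reg X (U \<inter> W)" by (rule reg_cong[OF X]) (simp add: W(4))
      then show "\<exists>V. is_open X V \<and> x \<in> V \<and> V \<subseteq> U \<and> f \<in> reg X V"
        using o x W(2) by (intro exI[of _ "U \<inter> W"]) auto
    qed
  qed
qed

text \<open>Sections in \<open>associated_bundle\<close> are morphisms on an open subspace of the
  homogeneous space; this moves them into the language of \<open>local_morphism\<close>.\<close>

lemma local_morphism_sub_open:
  assumes X: "ringed X" and V: "is_open X V"
  shows "morphism (sub_space X V) Y f \<longleftrightarrow> local_morphism X V Y f"
proof -
  have p: "pts (sub_space X V) = V" using openin_subset[OF V] by auto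
  show ?thesis
    unfolding morphism_iff p local_morphism_def openin_sub_open[OF V]
    using reg_sub_open[OF X V] V by auto
qed

lemma local_morphism_quot_map:
  "local_morphism X (pts X) (quot_space X q) q"
  by (rule local_morphismI) (auto simp: openin_quot_space reg_quot_space)

text \<open>Universal property of the quotient. It carries the charts of the Grassmannian, the
  evaluation \<open>ev\<close> on the contracted product, and the sections over the homogeneous
  space.\<close>

lemma local_morphism_from_quot:
  assumes V: "V \<subseteq> q ` pts X" and f: "local_morphism X {x \<in> pts X. q x \<in> V} Y (\<lambda>x. f (q x))"
  shows "local_morphism (quot_space X q) V Y f"
proof (rule local_morphismI)
  show "is_open (quot_space X q) V"
    unfolding openin_quot_space using V local_morphism_open[OF f] by simp
  show "f ` V \<subseteq> pts Y" using local_morphism_pts[OF f] V by auto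
  fix U assume U: "is_open Y U"
  have e: "{x \<in> pts X. q x \<in> {y \<in> V. f y \<in> U}} = {x \<in> {x \<in> pts X. q x \<in> V}. f (q x) \<in> U}" by auto
  show "is_open (quot_space X q) {y \<in> V. f y \<in> U}"
    unfolding openin_quot_space e using local_morphism_vimage[OF f U] V by auto
  fix g assume g: "g \<in> reg Y U"
  show "(\<lambda>x. g (f x)) \<in> reg (quot_space X q) {y \<in> V. f y \<in> U}"
    unfolding reg_quot_space e by (rule local_morphism_reg[OF f U g])
qed

text \<open>Topology and functions of a fraction space are made from the algebras of its charts, and
  regular functions on \<open>X\<close> can be inverted where they do not vanish; so testing the
  elements of these algebras suffices.\<close>

lemma local_morphism_into_frac:
  assumes X: "ringed X" and C: "directed_charts C" and N: "is_open X N"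
    and cov: "\<And>x. x \<in> N \<Longrightarrow> \<exists>\<Omega> A. (\<Omega>, A) \<in> C \<and> f x \<in> \<Omega>"
    and o: "\<And>\<Omega> A. (\<Omega>, A) \<in> C \<Longrightarrow> is_open X {x \<in> N. f x \<in> \<Omega>}"
    and r: "\<And>\<Omega> A F. (\<Omega>, A) \<in> C \<Longrightarrow> F \<in> A \<Longrightarrow> (\<lambda>x. F (f x)) \<in> reg X {x \<in> N. f x \<in> \<Omega>}"
  shows "local_morphism X N (frac_space C) f"
proof (rule local_morphismI)
  show "is_open X N" by fact
  show "f ` N \<subseteq> pts (frac_space C)" unfolding topspace_frac_space[OF C] using cov by fastforce
  fix U assume U: "is_open (frac_space C) U"
  show oU: "is_open X {x \<in> N. f x \<in> U}"
  proof (subst openin_subopen, intro ballI)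
    fix x assume x: "x \<in> {x \<in> N. f x \<in> U}"
    then have "f x \<in> U" by simp
    then obtain \<Omega> A F where 1: "(\<Omega>, A) \<in> C" "F \<in> A" "f x \<in> \<Omega>" "F (f x) \<noteq> 0" "{w \<in> \<Omega>. F w \<noteq> 0} \<subseteq> U"
      using U unfolding openin_frac_space[OF C] by blast
    have "is_open X {y \<in> {x \<in> N. f x \<in> \<Omega>}. F (f y) \<noteq> 0}"
      by (rule open_nonzero[OF X r[OF 1(1,2)] o[OF 1(1)]])
    then show "\<exists>T. is_open X T \<and> x \<in> T \<and> T \<subseteq> {x \<in> N. f x \<in> U}"
      using 1 x by (intro exI[of _ "{y \<in> {x \<in> N. f x \<in> \<Omega>}. F (f y) \<noteq> 0}"]) auto
  qed
  fix g assume g: "g \<in> reg (frac_space C) U"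
  show "(\<lambda>x. g (f x)) \<in> reg X {x \<in> N. f x \<in> U}"
  proof (rule reg_local[OF X oU])
    fix x assume x: "x \<in> {x \<in> N. f x \<in> U}"
    then have "f x \<in> U" by simp
    then obtain \<Omega> A F D where 1: "(\<Omega>, A) \<in> C" "f x \<in> \<Omega>" "F \<in> A" "D \<in> A" "D (f x) \<noteq> 0"
        "\<forall>w\<in>U \<inter> \<Omega>. D w \<noteq> 0 \<longrightarrow> g w = F w / D w"
      using g unfolding reg_frac_space by blast
    let ?M = "{x \<in> N. f x \<in> \<Omega>}"
    let ?V = "{y \<in> ?M. D (f y) \<noteq> 0}"
    note oM = o[OF 1(1)] and rD = r[OF 1(1,4)] and rF = r[OF 1(1,3)]
    have oV: "is_open X ?V" by (rule open_nonzero[OF X rD oM])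
    have oW: "is_open X (?V \<inter> {x \<in> N. f x \<in> U})" by (rule openin_Int[OF oV oU])
    have "(\<lambda>x. F (f x) * inverse (D (f x))) \<in> reg X ?V"
      by (rule reg_mult[OF X oV reg_restrict[OF X rF oM oV] reg_inverse[OF X rD oM]]) auto
    then have "(\<lambda>x. F (f x) * inverse (D (f x))) \<in> reg X (?V \<inter> {x \<in> N. f x \<in> U})"
      by (rule reg_restrict[OF X _ oV oW]) auto
    then have "(\<lambda>x. g (f x)) \<in> reg X (?V \<inter> {x \<in> N. f x \<in> U})"
      by (rule reg_cong[OF X]) (simp add: 1(6) divide_inverse)
    then show "\<exists>V. is_open X V \<and> x \<in> V \<and> V \<subseteq> {x \<in> N. f x \<in> U} \<and> (\<lambda>x. g (f x)) \<in> reg X V"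
      using oW x 1 by (intro exI[of _ "?V \<inter> {x \<in> N. f x \<in> U}"]) auto
  qed
qed

lemma reg_gen_alg:
  assumes X: "ringed X" and N: "is_open X N" and G: "\<And>g. g \<in> G \<Longrightarrow> (\<lambda>x. g (f x)) \<in> reg X N"
    and F: "F \<in> gen_alg G"
  shows "(\<lambda>x. F (f x)) \<in> reg X N"
  using F
proof (induction rule: gen_alg.induct)
  case (gen g)
  then show ?case by (rule G)
next
  case (const c)
  show ?case by (rule reg_const[OF X N])
next
  case (add f g)
  show ?case by (rule reg_add[OF X N add.IH])
next
  case (mult f g)
  show ?case by (rule reg_mult[OF X N mult.IH])
qed

lemma local_morphism_into_affine:
  assumes X: "ringed X" and N: "is_open X N" and G: "\<And>g. g \<in> G \<Longrightarrow> (\<lambda>x. g (f x)) \<in> reg X N"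
  shows "local_morphism X N (affine_space_of (gen_alg G)) f"
  unfolding affine_space_of_frac_space
  by (rule local_morphism_into_frac[OF X directed_charts_single[OF subalg_gen_alg] N])
    (use N reg_gen_alg[OF X N, of G f] G in simp_all)

lemma local_morphism_into_prod:
  assumes X: "ringed X" and Y1: "ringed Y1" and Y2: "ringed Y2"
    and f1: "local_morphism X N Y1 f1" and f2: "local_morphism X N Y2 f2"
  shows "local_morphism X N (prod_space Y1 Y2) (\<lambda>x. (f1 x, f2 x))"
  unfolding prod_space_frac_space
proof (rule local_morphism_into_frac[OF X directed_charts_prod[OF Y1 Y2] local_morphism_open[OF f1]])
  let ?C = "{(U \<times> V, fun_tensor (reg Y1 U) (reg Y2 V)) |U V. is_open Y1 U \<and> is_open Y2 V}"
  fix x assume "x \<in> N"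
  then have "(f1 x, f2 x) \<in> pts Y1 \<times> pts Y2"
    using local_morphism_pts[OF f1] local_morphism_pts[OF f2] by simp
  moreover have "(pts Y1 \<times> pts Y2, fun_tensor (reg Y1 (pts Y1)) (reg Y2 (pts Y2))) \<in> ?C"
    by (intro CollectI exI[of _ "pts Y1"] exI[of _ "pts Y2"]) simp
  ultimately show "\<exists>\<Omega> A. (\<Omega>, A) \<in> ?C \<and> (f1 x, f2 x) \<in> \<Omega>" by (intro exI conjI)
next
  let ?C = "{(U \<times> V, fun_tensor (reg Y1 U) (reg Y2 V)) |U V. is_open Y1 U \<and> is_open Y2 V}"
  fix \<Omega> A assume "(\<Omega>, A) \<in> ?C"
  then obtain U V where UV: "is_open Y1 U" "is_open Y2 V" "\<Omega> = U \<times> V" "A = fun_tensor (reg Y1 U) (reg Y2 V)"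
    by auto
  note o1 = local_morphism_vimage[OF f1 UV(1)] and o2 = local_morphism_vimage[OF f2 UV(2)]
  have e: "{x \<in> N. (f1 x, f2 x) \<in> \<Omega>} = {x \<in> N. f1 x \<in> U} \<inter> {x \<in> N. f2 x \<in> V}" using UV(3) by auto
  show o: "is_open X {x \<in> N. (f1 x, f2 x) \<in> \<Omega>}" unfolding e by (rule openin_Int[OF o1 o2])
  fix F assume "F \<in> A"
  then have "F \<in> fun_tensor (reg Y1 U) (reg Y2 V)" using UV(4) by simp
  then show "(\<lambda>x. F (f1 x, f2 x)) \<in> reg X {x \<in> N. (f1 x, f2 x) \<in> \<Omega>}"
  proof (induction rule: fun_tensor_induct)
    case zero
    show ?case by (rule reg_const[OF X o])
  next
    case (add f g F)
    have "(\<lambda>x. f (f1 x)) \<in> reg X {x \<in> N. (f1 x, f2 x) \<in> \<Omega>}"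
      by (rule reg_restrict[OF X local_morphism_reg[OF f1 UV(1) add(1)] o1 o]) (simp add: e)
    moreover have "(\<lambda>x. g (f2 x)) \<in> reg X {x \<in> N. (f1 x, f2 x) \<in> \<Omega>}"
      by (rule reg_restrict[OF X local_morphism_reg[OF f2 UV(2) add(2)] o2 o]) (simp add: e)
    ultimately show ?case using reg_add[OF X o reg_mult[OF X o] add(4)] by simp
  qed
qed

lemma local_morphism_fst:
  assumes X: "ringed X" and Y: "ringed Y"
  shows "local_morphism (prod_space X Y) (pts X \<times> pts Y) X fst"
proof (rule local_morphismI)
  show "is_open (prod_space X Y) (pts X \<times> pts Y)" by (intro openin_prod_Times X Y openin_topspace)
  show "fst ` (pts X \<times> pts Y) \<subseteq> pts X" by auto
  fix U assume U: "is_open X U"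
  have e: "{z \<in> pts X \<times> pts Y. fst z \<in> U} = U \<times> pts Y" using openin_subset[OF U] by auto
  show "is_open (prod_space X Y) {z \<in> pts X \<times> pts Y. fst z \<in> U}"
    unfolding e by (intro openin_prod_Times X Y U openin_topspace)
  fix g assume "g \<in> reg X U"
  then show "(\<lambda>z. g (fst z)) \<in> reg (prod_space X Y) {z \<in> pts X \<times> pts Y. fst z \<in> U}"
    unfolding e by (intro reg_prodI X Y U openin_topspace fun_tensor_fst subalg_reg)
qed

lemma local_morphism_snd:
  assumes X: "ringed X" and Y: "ringed Y"
  shows "local_morphism (prod_space X Y) (pts X \<times> pts Y) Y snd"
proof (rule local_morphismI)
  show "is_open (prod_space X Y) (pts X \<times> pts Y)" by (intro openin_prod_Times X Y openin_topspace)
  show "snd ` (pts X \<times> pts Y) \<subseteq> pts Y" by auto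
  fix V assume V: "is_open Y V"
  have e: "{z \<in> pts X \<times> pts Y. snd z \<in> V} = pts X \<times> V" using openin_subset[OF V] by auto
  show "is_open (prod_space X Y) {z \<in> pts X \<times> pts Y. snd z \<in> V}"
    unfolding e by (intro openin_prod_Times X Y V openin_topspace)
  fix g assume "g \<in> reg Y V"
  then show "(\<lambda>z. g (snd z)) \<in> reg (prod_space X Y) {z \<in> pts X \<times> pts Y. snd z \<in> V}"
    unfolding e by (intro reg_prodI X Y V openin_topspace fun_tensor_snd subalg_reg)
qed

text \<open>Regularity is tested by linear forms instead of coordinates. This requires no basis and
  makes sense in the space of functionals on functions on \<open>'w \<times> 'h\<close>, which need
  not be finite dimensional. For a finite dimensional \<open>M\<close> it agrees with the tensor
  description, see \<open>free_sections_eq\<close>.\<close>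

definition vreg ::
    "('k::field \<Rightarrow> 'v::ab_group_add \<Rightarrow> 'v) \<Rightarrow> ('x, 'k) fspace \<Rightarrow> 'x set \<Rightarrow> ('x \<Rightarrow> 'v) \<Rightarrow> bool"
  where "vreg sc X U F \<longleftrightarrow> (\<forall>l. linear_form sc l \<longrightarrow> (\<lambda>x. l (F x)) \<in> reg X U)"

lemma vregD: "vreg sc X U F \<Longrightarrow> linear_form sc l \<Longrightarrow> (\<lambda>x. l (F x)) \<in> reg X U"
  by (simp add: vreg_def)

lemma vreg_cong: "ringed X \<Longrightarrow> vreg sc X U F \<Longrightarrow> (\<And>x. x \<in> U \<Longrightarrow> F x = G x) \<Longrightarrow> vreg sc X U G"
  unfolding vreg_def by (intro allI impI, rule reg_cong, assumption, blast) simp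

lemma vreg_restrict:
  "ringed X \<Longrightarrow> vreg sc X U F \<Longrightarrow> is_open X U \<Longrightarrow> is_open X V \<Longrightarrow> V \<subseteq> U \<Longrightarrow> vreg sc X V F"
  unfolding vreg_def by (intro allI impI, rule reg_restrict) auto

lemma vreg_local:
  assumes "ringed X" "is_open X U"
    and "\<And>x. x \<in> U \<Longrightarrow> \<exists>V. is_open X V \<and> x \<in> V \<and> V \<subseteq> U \<and> vreg sc X V F"
  shows "vreg sc X U F"
  unfolding vreg_def
proof (intro allI impI)
  fix l assume l: "linear_form sc l"
  show "(\<lambda>x. l (F x)) \<in> reg X U"
  proof (rule reg_local[OF assms(1,2)])
    fix x assume "x \<in> U"
    from assms(3)[OF this] obtain V where "is_open X V" "x \<in> V" "V \<subseteq> U" "vreg sc X V F" by auto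
    then show "\<exists>V. is_open X V \<and> x \<in> V \<and> V \<subseteq> U \<and> (\<lambda>x. l (F x)) \<in> reg X V"
      using vregD[OF _ l] by (intro exI[of _ V]) simp
  qed
qed

lemma vreg_comp:
  assumes f: "local_morphism X N Y f" and F: "vreg sc Y U F" and U: "is_open Y U"
  shows "vreg sc X {x \<in> N. f x \<in> U} (\<lambda>x. F (f x))"
  unfolding vreg_def
proof (intro allI impI)
  fix l assume "linear_form sc l"
  from local_morphism_reg[OF f U vregD[OF F this]]
  show "(\<lambda>x. l (F (f x))) \<in> reg X {x \<in> N. f x \<in> U}" .
qed

lemma vreg_comp':
  assumes f: "local_morphism X N Y f" and F: "vreg sc Y U F" and U: "is_open Y U" and "f ` N \<subseteq> U"
  shows "vreg sc X N (\<lambda>x. F (f x))"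
proof -
  have "{x \<in> N. f x \<in> U} = N" using assms(4) by auto
  then show ?thesis using vreg_comp[OF f F U] by simp
qed

context vector_space
begin

lemma
  assumes X: "ringed X" and U: "is_open X U"
  shows vreg_const: "vreg scale X U (\<lambda>_. v)"
    and vreg_add: "vreg scale X U F \<Longrightarrow> vreg scale X U G \<Longrightarrow> vreg scale X U (\<lambda>x. F x + G x)"
    and vreg_scale: "f \<in> reg X U \<Longrightarrow> vreg scale X U F \<Longrightarrow> vreg scale X U (\<lambda>x. scale (f x) (F x))"
  unfolding vreg_def
  by (simp_all add: linear_form_add linear_form_scale reg_const[OF X U] reg_add[OF X U] reg_mult[OF X U])

lemma vreg_sum:
  assumes X: "ringed X" and U: "is_open X U" and "\<And>i. i \<in> I \<Longrightarrow> vreg scale X U (F i)"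
  shows "vreg scale X U (\<lambda>x. \<Sum>i\<in>I. F i x)"
  using assms(3)
  by (induction I rule: infinite_finite_induct) (simp_all add: vreg_const[OF X U] vreg_add[OF X U])

end

lemma vreg_linear:
  assumes "Vector_Spaces.linear sc sc' g" "vreg sc X U F"
  shows "vreg sc' X U (\<lambda>x. g (F x))"
  unfolding vreg_def
proof (intro allI impI)
  fix l assume l: "linear_form sc' l"
  have "linear_form sc (l \<circ> g)"
    using Vector_Spaces.linear_compose[OF assms(1) l[unfolded linear_form_def]]
    unfolding linear_form_def .
  from vregD[OF assms(2) this] show "(\<lambda>x. l (g (F x))) \<in> reg X U" by simp
qed

section \<open>Vector spaces and spaces of tuples as varieties\<close>

lemma subalg_poly_funs: "subalg (poly_funs sc)"
  unfolding poly_funs_def by (rule subalg_gen_alg)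

lemma ringed_vector_variety: "ringed (vector_variety sc)"
  unfolding vector_variety_def by (rule ringed_affine[OF subalg_poly_funs])

lemma pts_vector_variety [simp]: "pts (vector_variety sc) = UNIV"
  unfolding vector_variety_def by (rule pts_affine[OF subalg_poly_funs])

lemma vreg_vector_variety: "vreg sc (vector_variety sc) U (\<lambda>v. v)"
  unfolding vreg_def vector_variety_def
  by (intro allI impI reg_affineI[OF subalg_poly_funs]) (auto simp: poly_funs_def intro: gen_alg.gen)

lemma local_morphism_vector_variety:
  assumes "ringed X" "is_open X N" "vreg sc X N f"
  shows "local_morphism X N (vector_variety sc) f"
  unfolding vector_variety_def poly_funs_def
  by (rule local_morphism_into_affine[OF assms(1,2)]) (auto intro: vregD[OF assms(3)])

lemma ringed_tuple_space: "ringed (tuple_space sc r)"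
  unfolding tuple_space_def by (rule ringed_affine[OF subalg_gen_alg])

lemma pts_tuple_space [simp]: "pts (tuple_space sc r) = UNIV"
  unfolding tuple_space_def by (rule pts_affine[OF subalg_gen_alg])

lemma vreg_tuple_space: "s < r \<Longrightarrow> vreg sc (tuple_space sc r) U (\<lambda>T. T s)"
  unfolding vreg_def tuple_space_def
  by (intro allI impI reg_affineI[OF subalg_gen_alg]) (auto intro: gen_alg.gen)

lemma local_morphism_tuple_space:
  assumes "ringed X" "is_open X N" "\<And>s. s < r \<Longrightarrow> vreg sc X N (\<lambda>x. f x s)"
  shows "local_morphism X N (tuple_space sc r) f"
  unfolding tuple_space_def
  by (rule local_morphism_into_affine[OF assms(1,2)]) (auto intro: vregD[OF assms(3)])

text \<open>The common shape of all sheaves of the proof: the canonical bundle has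
  \<open>P y = y\<close>, the image sheaf on \<open>Z\<close> has \<open>P = PZ\<close>, and on the
  torsor both the pull-back and the image have \<open>PZ\<close> composed with the
  projection.\<close>

definition family_sections ::
    "('k::field \<Rightarrow> 'm::ab_group_add \<Rightarrow> 'm) \<Rightarrow> ('x, 'k) fspace \<Rightarrow> ('x \<Rightarrow> 'm set) \<Rightarrow> 'x set \<Rightarrow> ('x \<Rightarrow> 'm) set"
  where "family_sections sc X P U = {s \<in> extensional U. vreg sc X U s \<and> (\<forall>x\<in>U. s x \<in> P x)}"

text \<open>A regular generating family together with a choice of coefficients that sends regular
  sections to regular functions. The coefficient map receives the point \<open>x\<close> because on
  the torsor the coefficients with respect to the entries of the tuple vary with the tuple.\<close>

definition frame ::
    "('k::field \<Rightarrow> 'm::ab_group_add \<Rightarrow> 'm) \<Rightarrow> ('x, 'k) fspace \<Rightarrow> ('x \<Rightarrow> 'm set) \<Rightarrow> 'x set \<Rightarrow>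
     nat \<Rightarrow> (nat \<Rightarrow> 'x \<Rightarrow> 'm) \<Rightarrow> (nat \<Rightarrow> 'x \<Rightarrow> 'm \<Rightarrow> 'k) \<Rightarrow> bool"
  where "frame sc X P N n e \<gamma> \<longleftrightarrow> is_open X N \<and>
    (\<forall>i<n. vreg sc X N (e i) \<and> (\<forall>x\<in>N. e i x \<in> P x)) \<and>
    (\<forall>x\<in>N. \<forall>v\<in>P x. v = (\<Sum>i<n. sc (\<gamma> i x v) (e i x))) \<and>
    (\<forall>i<n. \<forall>V s. is_open X V \<longrightarrow> V \<subseteq> N \<longrightarrow> vreg sc X V s \<longrightarrow> (\<lambda>x. \<gamma> i x (s x)) \<in> reg X V)"

lemma
  assumes "frame sc X P N n e \<gamma>"
  shows frame_open: "is_open X N"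
    and frame_vreg: "i < n \<Longrightarrow> vreg sc X N (e i)"
    and frame_mem: "i < n \<Longrightarrow> x \<in> N \<Longrightarrow> e i x \<in> P x"
    and frame_expand: "x \<in> N \<Longrightarrow> v \<in> P x \<Longrightarrow> v = (\<Sum>i<n. sc (\<gamma> i x v) (e i x))"
    and frame_coeff: "i < n \<Longrightarrow> is_open X V \<Longrightarrow> V \<subseteq> N \<Longrightarrow> vreg sc X V s \<Longrightarrow> (\<lambda>x. \<gamma> i x (s x)) \<in> reg X V"
  using assms unfolding frame_def by simp_all

lemma restrict_family_sections:
  assumes "ringed X" "is_open X U" "is_open X V" "V \<subseteq> U" "s \<in> family_sections sc X P U"
  shows "restrict s V \<in> family_sections sc X P V"
proof -
  have "vreg sc X V s"
    using assms vreg_restrict[of X sc U s V] unfolding family_sections_def by simp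
  then have "vreg sc X V (restrict s V)" by (rule vreg_cong[OF assms(1)]) simp
  then show ?thesis using assms(4,5) unfolding family_sections_def by auto
qed

context vector_space
begin

lemma subspace_fin_dim: "fin_dim_subspace scale M \<Longrightarrow> subspace M"
  unfolding fin_dim_subspace_def by auto

lemma vec_tensorI:
  assumes M: "fin_dim_subspace scale M" and "\<And>x. F x \<in> M"
    and "\<And>l. linear_form scale l \<Longrightarrow> (\<lambda>x. l (F x)) \<in> A"
  shows "F \<in> vec_tensor scale M A"
proof -
  obtain n :: nat and e l where *: "\<forall>i<n. e i \<in> M \<and> linear_form scale (l i)"
    "\<forall>v\<in>M. v = (\<Sum>i<n. scale (l i v) (e i))"
    using fin_dim_coords[OF M] by metis
  have "F = (\<lambda>x. \<Sum>i<n. scale (l i (F x)) (e i))" using *(2) assms(2) by auto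
  then show ?thesis
    unfolding vec_tensor_def using * assms(3)
    by (intro CollectI exI[of _ n] exI[of _ "\<lambda>i x. l i (F x)"] exI[of _ e]) auto
qed

lemma free_sections_eq:
  assumes X: "ringed X" and U: "is_open X U" and M: "fin_dim_subspace scale M"
  shows "free_sections scale M X U = family_sections scale X (\<lambda>_. M) U"
proof (intro equalityI subsetI)
  fix s assume "s \<in> free_sections scale M X U"
  then obtain n :: nat and f v where *: "\<forall>i<n. f i \<in> reg X U \<and> v i \<in> M"
    "s = restrict (\<lambda>x. \<Sum>i<n. scale (f i x) (v i)) U"
    unfolding free_sections_def vec_tensor_def by auto
  have "vreg scale X U (\<lambda>x. \<Sum>i<n. scale (f i x) (v i))"
    using *(1) by (intro vreg_sum[OF X U] vreg_scale[OF X U] vreg_const[OF X U]) auto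
  then have "vreg scale X U s" by (rule vreg_cong[OF X]) (simp add: *(2))
  moreover have "s x \<in> M" if "x \<in> U" for x
    using that *(1) unfolding *(2)
    by (auto intro!: subspace_sum[OF subspace_fin_dim[OF M]] subspace_scale[OF subspace_fin_dim[OF M]])
  ultimately show "s \<in> family_sections scale X (\<lambda>_. M) U" unfolding family_sections_def *(2) by simp
next
  fix s assume s: "s \<in> family_sections scale X (\<lambda>_. M) U"
  then have s': "s \<in> extensional U" "\<forall>x\<in>U. s x \<in> M" "vreg scale X U s"
    unfolding family_sections_def by auto
  obtain n :: nat and e l where *: "\<forall>i<n. e i \<in> M \<and> linear_form scale (l i)"
    "\<forall>v\<in>M. v = (\<Sum>i<n. scale (l i v) (e i))"
    using fin_dim_coords[OF M] by metis
  have "(\<lambda>x. \<Sum>i<n. scale (l i (s x)) (e i)) \<in> vec_tensor scale M (reg X U)"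
    unfolding vec_tensor_def using * vregD[OF s'(3)]
    by (intro CollectI exI[of _ n] exI[of _ "\<lambda>i x. l i (s x)"] exI[of _ e]) auto
  moreover have "s = restrict (\<lambda>x. \<Sum>i<n. scale (l i (s x)) (e i)) U"
  proof
    fix x show "s x = restrict (\<lambda>x. \<Sum>i<n. scale (l i (s x)) (e i)) U x"
      using s'(1,2) *(2) by (cases "x \<in> U") (auto simp: extensional_def)
  qed
  ultimately show "s \<in> free_sections scale M X U" unfolding free_sections_def by blast
qed

lemma family_sections_local:
  assumes X: "ringed X" and U: "is_open X U" and s: "s \<in> extensional U"
    and loc: "\<And>x. x \<in> U \<Longrightarrow> \<exists>V. is_open X V \<and> x \<in> V \<and> V \<subseteq> U \<and> restrict s V \<in> family_sections scale X P V"
  shows "s \<in> family_sections scale X P U"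
proof -
  have "vreg scale X U s"
  proof (rule vreg_local[OF X U])
    fix x assume "x \<in> U"
    from loc[OF this] obtain V where V: "is_open X V" "x \<in> V" "V \<subseteq> U"
      "restrict s V \<in> family_sections scale X P V" by auto
    then have "vreg scale X V (restrict s V)" unfolding family_sections_def by simp
    then have "vreg scale X V s" by (rule vreg_cong[OF X]) simp
    with V show "\<exists>V. is_open X V \<and> x \<in> V \<and> V \<subseteq> U \<and> vreg scale X V s" by auto
  qed
  moreover have "s x \<in> P x" if "x \<in> U" for x
    using loc[OF that] unfolding family_sections_def by auto
  ultimately show ?thesis using s unfolding family_sections_def by simp
qed

lemma
  assumes X: "ringed X" and U: "is_open X U" and P: "\<And>x. x \<in> U \<Longrightarrow> subspace (P x)"
  shows family_sections_zero: "(\<lambda>x\<in>U. 0) \<in> family_sections scale X P U"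
    and family_sections_add: "s \<in> family_sections scale X P U \<Longrightarrow> t \<in> family_sections scale X P U \<Longrightarrow>
      (\<lambda>x\<in>U. s x + t x) \<in> family_sections scale X P U"
    and family_sections_scale: "f \<in> reg X U \<Longrightarrow> s \<in> family_sections scale X P U \<Longrightarrow>
      (\<lambda>x\<in>U. scale (f x) (s x)) \<in> family_sections scale X P U"
proof -
  show "(\<lambda>x\<in>U. 0) \<in> family_sections scale X P U"
    using vreg_cong[OF X vreg_const[OF X U, of 0], of "\<lambda>x\<in>U. 0"] P subspace_0
    unfolding family_sections_def by auto
  show "(\<lambda>x\<in>U. s x + t x) \<in> family_sections scale X P U"
    if "s \<in> family_sections scale X P U" "t \<in> family_sections scale X P U"
    using that vreg_cong[OF X vreg_add[OF X U, of s t], of "\<lambda>x\<in>U. s x + t x"] P subspace_add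
    unfolding family_sections_def by auto
  show "(\<lambda>x\<in>U. scale (f x) (s x)) \<in> family_sections scale X P U"
    if "f \<in> reg X U" "s \<in> family_sections scale X P U"
    using that vreg_cong[OF X vreg_scale[OF X U, of f s], of "\<lambda>x\<in>U. scale (f x) (s x)"] P subspace_scale
    unfolding family_sections_def by auto
qed

text \<open>A section with values in the family expands in a frame with regular coefficients, and
  conversely the family is closed under regular combinations and under gluing. This computes the
  canonical bundle, the two sheaves on the torsor, and the finite type condition for
  \<open>J\<close>.\<close>

lemma generated_eq_family_sections:
  assumes X: "ringed X" and U: "is_open X U"
    and P: "\<And>x. x \<in> U \<Longrightarrow> subspace (P x)"
    and S: "\<And>V. is_open X V \<Longrightarrow> V \<subseteq> U \<Longrightarrow> S V \<subseteq> family_sections scale X P V"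
    and fr: "\<And>x. x \<in> U \<Longrightarrow> \<exists>N n e \<gamma>. x \<in> N \<and> frame scale X P N n e \<gamma> \<and>
      (\<forall>V. is_open X V \<longrightarrow> V \<subseteq> N \<longrightarrow> V \<subseteq> U \<longrightarrow> (\<forall>i<n. restrict (e i) V \<in> S V))"
  shows "generated scale X S U = family_sections scale X P U"
proof (intro equalityI subsetI)
  fix F assume F: "F \<in> generated scale X S U"
  show "F \<in> family_sections scale X P U"
  proof (rule family_sections_local[OF X U])
    show "F \<in> extensional U" using F unfolding generated_def by simp
    fix x assume x: "x \<in> U"
    from F x obtain V and n :: nat and f e where V: "is_open X V" "x \<in> V" "V \<subseteq> U"
      "\<forall>i<n. f i \<in> reg X V \<and> e i \<in> S V" "\<forall>y\<in>V. F y = (\<Sum>i<n. scale (f i y) (e i y))"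
      unfolding generated_def by blast
    have e: "e i \<in> family_sections scale X P V" if "i < n" for i using V(4) S[OF V(1,3)] that by auto
    have "vreg scale X V (\<lambda>y. \<Sum>i<n. scale (f i y) (e i y))"
      using V(4) e by (intro vreg_sum[OF X V(1)] vreg_scale[OF X V(1)]) (auto simp: family_sections_def)
    then have "vreg scale X V (restrict F V)" by (rule vreg_cong[OF X]) (use V(5) in auto)
    moreover have "F y \<in> P y" if "y \<in> V" for y
    proof -
      have "subspace (P y)" using P V(3) that by auto
      then show ?thesis using V(5) that e
        by (auto simp: family_sections_def intro!: subspace_sum subspace_scale)
    qed
    ultimately have "restrict F V \<in> family_sections scale X P V" unfolding family_sections_def by simp
    with V show "\<exists>V. is_open X V \<and> x \<in> V \<and> V \<subseteq> U \<and> restrict F V \<in> family_sections scale X P V" by auto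
  qed
next
  fix F assume F: "F \<in> family_sections scale X P U"
  then have F': "F \<in> extensional U" "vreg scale X U F" "\<forall>x\<in>U. F x \<in> P x"
    unfolding family_sections_def by auto
  have "\<exists>V (n::nat) f e. is_open X V \<and> x \<in> V \<and> V \<subseteq> U \<and> (\<forall>i<n. f i \<in> reg X V \<and> e i \<in> S V) \<and>
      (\<forall>y\<in>V. F y = (\<Sum>i<n. scale (f i y) (e i y)))" if x: "x \<in> U" for x
  proof -
    from fr[OF x] obtain N n e \<gamma> where N: "x \<in> N" "frame scale X P N n e \<gamma>"
      "\<forall>V. is_open X V \<longrightarrow> V \<subseteq> N \<longrightarrow> V \<subseteq> U \<longrightarrow> (\<forall>i<n. restrict (e i) V \<in> S V)" by auto
    have o: "is_open X (N \<inter> U)" by (rule openin_Int[OF frame_open[OF N(2)] U])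
    have v: "vreg scale X (N \<inter> U) F" by (rule vreg_restrict[OF X F'(2) U o]) auto
    show ?thesis
    proof (rule exI[of _ "N \<inter> U"], rule exI[of _ n], rule exI[of _ "\<lambda>i x. \<gamma> i x (F x)"],
        rule exI[of _ "\<lambda>i. restrict (e i) (N \<inter> U)"], intro conjI allI impI ballI)
      show "is_open X (N \<inter> U)" by fact
      show "x \<in> N \<inter> U" using x N by simp
      fix i assume i: "i < n"
      show "(\<lambda>x. \<gamma> i x (F x)) \<in> reg X (N \<inter> U)" by (rule frame_coeff[OF N(2) i o _ v]) simp
      show "restrict (e i) (N \<inter> U) \<in> S (N \<inter> U)" using N(3) o i by simp
    next
      fix y assume "y \<in> N \<inter> U"
      then show "F y = (\<Sum>i<n. scale (\<gamma> i y (F y)) (restrict (e i) (N \<inter> U) y))"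
        using frame_expand[OF N(2), of y "F y"] F'(3) by simp
    qed simp
  qed
  then show "F \<in> generated scale X S U" unfolding generated_def using F'(1) by simp
qed

end

section \<open>Charts of the Grassmannian\<close>

text \<open>Induction on the size of the matrix: the Schur complement is invertible near \<open>x0\<close>.\<close>

lemma local_right_inverse_at_one:
  fixes a :: "nat \<Rightarrow> nat \<Rightarrow> 'x \<Rightarrow> 'k::field"
  assumes X: "ringed X" and U: "is_open X U" "x0 \<in> U"
    and a: "\<And>s t. s < n \<Longrightarrow> t < n \<Longrightarrow> a s t \<in> reg X U"
    and one: "\<And>s t. s < n \<Longrightarrow> t < n \<Longrightarrow> a s t x0 = of_bool (s = t)"
  shows "\<exists>N b. is_open X N \<and> x0 \<in> N \<and> N \<subseteq> U \<and> (\<forall>t<n. \<forall>u<n. b t u \<in> reg X N) \<and>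
    (\<forall>x\<in>N. \<forall>s<n. \<forall>u<n. (\<Sum>t<n. a s t x * b t u x) = of_bool (s = u))"
  using a one
proof (induction n)
  case 0
  then show ?case using U by auto
next
  case (Suc n)
  then obtain N b where N: "is_open X N" "x0 \<in> N" "N \<subseteq> U" "\<forall>t<n. \<forall>u<n. b t u \<in> reg X N"
    and b: "\<forall>x\<in>N. \<forall>s<n. \<forall>u<n. (\<Sum>t<n. a s t x * b t u x) = of_bool (s = u)"
    using Suc.IH by auto
  \<comment> \<open>\<open>b\<close> is a right inverse of the upper left block. Then
    \<open>y\<close> is the last row times \<open>b\<close>, \<open>z\<close> is \<open>b\<close>
    times the last column, and \<open>d\<close> is the Schur complement.\<close>
  define y where "y u x = (\<Sum>t<n. a n t x * b t u x)" for u x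
  define z where "z t x = (\<Sum>u<n. b t u x * a u n x)" for t x
  define d where "d x = a n n x - (\<Sum>t<n. y t x * a t n x)" for x
  have aN: "a s t \<in> reg X N" if "s < Suc n" "t < Suc n" for s t
    by (rule reg_restrict[OF X Suc.prems(1)[OF that] U(1) N(1,3)])
  have bN: "b t u \<in> reg X N" if "t < n" "u < n" for t u using N(4) that by simp
  have yN: "y u \<in> reg X N" if "u < n" for u
    unfolding y_def[abs_def] using that
    by (intro reg_sum[OF X N(1)] reg_mult[OF X N(1)] aN bN) auto
  have zN: "z t \<in> reg X N" if "t < n" for t
    unfolding z_def[abs_def] using that
    by (intro reg_sum[OF X N(1)] reg_mult[OF X N(1)] aN bN) auto
  have "(\<lambda>x. a n n x + - (\<Sum>t<n. y t x * a t n x)) \<in> reg X N"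
    by (intro reg_add[OF X N(1)] reg_uminus[OF X N(1)] reg_sum[OF X N(1)] reg_mult[OF X N(1)] aN yN) auto
  then have dN: "d \<in> reg X N" unfolding d_def[abs_def] by simp
  \<comment> \<open>At \<open>x0\<close> the last row vanishes off the diagonal, so the Schur
    complement is 1 there and invertible nearby.\<close>
  have "y t x0 = 0" if "t < n" for t using Suc.prems(2) by (simp add: y_def)
  then have d0: "d x0 = 1" using Suc.prems(2) by (simp add: d_def)
  define N' where "N' = {x \<in> N. d x \<noteq> 0}"
  have N': "is_open X N'" unfolding N'_def by (rule open_nonzero[OF X dN N(1)])
  have i: "(\<lambda>x. inverse (d x)) \<in> reg X N'" unfolding N'_def by (rule reg_inverse[OF X dN N(1)])
  have sub: "f \<in> reg X N'" if "f \<in> reg X N" for f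
    by (rule reg_restrict[OF X that N(1) N']) (simp add: N'_def)
  \<comment> \<open>The block formula for the inverse, written with the inverse of
    \<open>d\<close>.\<close>
  define b' where "b' t u = (if t < n then if u < n then (\<lambda>x. b t u x + z t x * y u x * inverse (d x))
      else (\<lambda>x. - (z t x * inverse (d x)))
    else if u < n then (\<lambda>x. - (y u x * inverse (d x))) else (\<lambda>x. inverse (d x)))" for t u
  have "b' t u \<in> reg X N'" if "t < Suc n" "u < Suc n" for t u
    unfolding b'_def
    by (auto intro!: reg_add[OF X N'] reg_mult[OF X N'] reg_uminus[OF X N'] i sub[OF bN] sub[OF yN] sub[OF zN])
  moreover have "(\<Sum>t<Suc n. a s t x * b' t u x) = of_bool (s = u)"
    if x: "x \<in> N'" and s: "s < Suc n" and u: "u < Suc n" for x s u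
  proof -
    have xN: "x \<in> N" and d: "d x \<noteq> 0" using x unfolding N'_def by auto
    \<comment> \<open>The upper block times \<open>z\<close> returns the last column; the last row
      times \<open>z\<close> is what \<open>d\<close> subtracts from the corner entry.\<close>
    have az: "(\<Sum>t<n. a s t x * z t x) = (if s < n then a s n x else (\<Sum>u<n. y u x * a u n x))"
    proof -
      have "(\<Sum>t<n. a s t x * z t x) = (\<Sum>u<n. (\<Sum>t<n. a s t x * b t u x) * a u n x)"
        unfolding z_def sum_distrib_left sum_distrib_right
        by (subst sum.swap) (simp add: mult.assoc)
      also have "\<dots> = (if s < n then a s n x else (\<Sum>u<n. y u x * a u n x))"
      proof (cases "s < n")
        case True
        then have "(\<Sum>u<n. (\<Sum>t<n. a s t x * b t u x) * a u n x) = (\<Sum>u<n. if u = s then a u n x else 0)"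
          using b xN by (intro sum.cong) auto
        then show ?thesis using True by simp
      next
        case False
        then have "s = n" using s by simp
        then show ?thesis by (simp add: y_def)
      qed
      finally show ?thesis .
    qed
    show ?thesis
    proof (cases "u < n")
      case True
      have "(\<Sum>t<n. a s t x * b' t u x) = (\<Sum>t<n. a s t x * b t u x + (a s t x * z t x) * (y u x * inverse (d x)))"
        using True by (intro sum.cong) (auto simp: b'_def algebra_simps)
      also have "\<dots> = (\<Sum>t<n. a s t x * b t u x) + (\<Sum>t<n. a s t x * z t x) * (y u x * inverse (d x))"
        by (simp add: sum.distrib sum_distrib_right)
      finally have 1: "(\<Sum>t<Suc n. a s t x * b' t u x) =
          (\<Sum>t<n. a s t x * b t u x) + (\<Sum>t<n. a s t x * z t x) * (y u x * inverse (d x)) -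
          a s n x * (y u x * inverse (d x))"
        using True by (simp add: b'_def)
      show ?thesis
      proof (cases "s < n")
        case s': True
        then show ?thesis unfolding 1 az using b xN True by simp
      next
        case False
        then have sn: "s = n" using s by simp
        have e: "(\<Sum>u<n. y u x * a u n x) = a n n x - d x" by (simp add: d_def)
        have "(\<Sum>t<n. a n t x * b t u x) = y u x" by (simp add: y_def)
        then show ?thesis unfolding 1 az using d True sn e by (simp add: left_diff_distrib)
      qed
    next
      case False
      then have un: "u = n" using u by simp
      have "(\<Sum>t<n. a s t x * b' t u x) = - ((\<Sum>t<n. a s t x * z t x) * inverse (d x))"
        unfolding sum_distrib_right sum_negf[symmetric] using un
        by (intro sum.cong) (auto simp: b'_def)
      then have 1: "(\<Sum>t<Suc n. a s t x * b' t u x) =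
          (a s n x - (\<Sum>t<n. a s t x * z t x)) * inverse (d x)"
        using un by (simp add: b'_def left_diff_distrib)
      show ?thesis
      proof (cases "s < n")
        case True
        then show ?thesis unfolding 1 az using un by simp
      next
        case False
        then have sn: "s = n" using s by simp
        have e: "a n n x - (\<Sum>u<n. y u x * a u n x) = d x" by (simp add: d_def)
        show ?thesis unfolding 1 az using d un sn by (simp add: e)
      qed
    qed
  qed
  moreover have "x0 \<in> N'" "N' \<subseteq> U" using N d0 unfolding N'_def by auto
  ultimately show ?case using N' by (intro exI[of _ N'] exI[of _ b']) blast
qed

text \<open>Multiplying by the constant matrix \<open>c\<close>, a right inverse at
  \<open>x0\<close>, gives a matrix which is the identity at \<open>x0\<close>.\<close>

lemma local_right_inverse:
  fixes a :: "nat \<Rightarrow> nat \<Rightarrow> 'x \<Rightarrow> 'k::field"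
  assumes X: "ringed X" and U: "is_open X U" "x0 \<in> U"
    and a: "\<And>s t. s < n \<Longrightarrow> t < n \<Longrightarrow> a s t \<in> reg X U"
    and c: "\<And>s u. s < n \<Longrightarrow> u < n \<Longrightarrow> (\<Sum>t<n. a s t x0 * c t u) = of_bool (s = u)"
  shows "\<exists>N b. is_open X N \<and> x0 \<in> N \<and> N \<subseteq> U \<and> (\<forall>t<n. \<forall>u<n. b t u \<in> reg X N) \<and>
    (\<forall>x\<in>N. \<forall>s<n. \<forall>u<n. (\<Sum>t<n. a s t x * b t u x) = of_bool (s = u))"
proof -
  define a' where "a' s u x = (\<Sum>t<n. a s t x * c t u)" for s u x
  have "a' s u \<in> reg X U" if "s < n" "u < n" for s u
    unfolding a'_def[abs_def] using that a
    by (intro reg_sum[OF X U(1)] reg_mult[OF X U(1)] reg_const[OF X U(1)]) auto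
  then obtain N b where N: "is_open X N" "x0 \<in> N" "N \<subseteq> U" "\<forall>t<n. \<forall>u<n. b t u \<in> reg X N"
    and b: "\<forall>x\<in>N. \<forall>s<n. \<forall>u<n. (\<Sum>t<n. a' s t x * b t u x) = of_bool (s = u)"
    using local_right_inverse_at_one[OF X U, of n a'] c unfolding a'_def by auto
  define b' where "b' t u x = (\<Sum>v<n. c t v * b v u x)" for t u x
  have "b' t u \<in> reg X N" if "t < n" "u < n" for t u
    unfolding b'_def[abs_def] using that N(4)
    by (intro reg_sum[OF X N(1)] reg_mult[OF X N(1)] reg_const[OF X N(1)]) auto
  moreover have "(\<Sum>t<n. a s t x * b' t u x) = of_bool (s = u)" if "x \<in> N" "s < n" "u < n" for x s u
  proof -
    have "(\<Sum>t<n. a s t x * b' t u x) = (\<Sum>v<n. a' s v x * b v u x)"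
      unfolding a'_def b'_def sum_distrib_left sum_distrib_right
      by (subst sum.swap) (simp add: mult.assoc)
    then show ?thesis using b that by simp
  qed
  ultimately show ?thesis using N by (intro exI[of _ N] exI[of _ b']) blast
qed

abbreviation tuple_variety ::
    "('k::field \<Rightarrow> 'v::ab_group_add \<Rightarrow> 'v) \<Rightarrow> 'v set \<Rightarrow> nat \<Rightarrow> (nat \<Rightarrow> 'v, 'k) fspace"
  where "tuple_variety sc V r \<equiv> sub_space (tuple_space sc r) (indep_tuples sc V r)"

lemma ringed_tuple_variety: "ringed (tuple_variety sc V r)"
  by (intro ringed_sub_space ringed_tuple_space)

lemma ringed_grass: "ringed (grass sc V r)"
  unfolding grass_def by (intro ringed_quot_space ringed_tuple_variety)

lemma pts_grass: "pts (grass sc V r) = tuple_span sc r ` indep_tuples sc V r"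
  unfolding grass_def by simp

lemma local_morphism_tuple_span:
  "local_morphism (tuple_variety sc V r) (indep_tuples sc V r) (grass sc V r) (tuple_span sc r)"
  using local_morphism_quot_map[of "tuple_variety sc V r" "tuple_span sc r"]
  unfolding grass_def by simp

lemma vreg_tuple_variety:
  assumes "s < r" "is_open (tuple_variety sc V r) U"
  shows "vreg sc (tuple_variety sc V r) U (\<lambda>T. T s)"
proof -
  have "vreg sc (tuple_variety sc V r) (indep_tuples sc V r) (\<lambda>T. T s)"
    using vreg_comp'[OF local_morphism_incl[OF ringed_tuple_space] vreg_tuple_space[OF assms(1)], where U = UNIV]
      openin_topspace[of "top (tuple_space sc r)"] by simp
  then show ?thesis
    using vreg_restrict[OF ringed_tuple_variety _ _ assms(2)] openin_subset[OF assms(2)]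
      openin_topspace[of "top (tuple_variety sc V r)"] by simp
qed

lemma local_morphism_tuple_variety:
  assumes "ringed X" "is_open X N" "\<And>s. s < r \<Longrightarrow> vreg sc X N (\<lambda>x. f x s)"
    and "\<And>x. x \<in> N \<Longrightarrow> f x \<in> indep_tuples sc V r"
  shows "local_morphism X N (tuple_variety sc V r) f"
  by (rule local_morphism_into_sub[OF assms(1) local_morphism_tuple_space[OF assms(1-3)]])
    (use assms(4) in auto)

lemma local_morphism_into_grass:
  assumes "ringed X" "is_open X N" "\<And>s. s < r \<Longrightarrow> vreg sc X N (\<lambda>x. f x s)"
    and "\<And>x. x \<in> N \<Longrightarrow> f x \<in> indep_tuples sc V r"
  shows "local_morphism X N (grass sc V r) (\<lambda>x. tuple_span sc r (f x))"
  by (rule local_morphism_comp'[OF local_morphism_tuple_variety[OF assms] local_morphism_tuple_span])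
    (use assms(4) in auto)

context vector_space
begin

lemma tuple_span_subset:
  assumes "subspace V" "T \<in> indep_tuples scale V r"
  shows "tuple_span scale r T \<subseteq> V"
  using assms unfolding tuple_span_def indep_tuples_def by (intro span_minimal) auto

lemma tuple_span_base: "t < r \<Longrightarrow> T t \<in> tuple_span scale r T"
  unfolding tuple_span_def by (intro span_base) auto

text \<open>The chart consists of the subspaces on which the forms \<open>l\<close> are coordinates;
  each has exactly one basis \<open>\<sigma> E\<close> dual to \<open>l\<close>. To express this
  basis through an arbitrary tuple \<open>T'\<close> spanning \<open>E\<close> one inverts the
  matrix of the \<open>l s (T' t)\<close>, which is possible with regular entries. The last clause
  keeps the matrix \<open>b\<close>, since the torsor needs this change of frame explicitly.\<close>

lemma grass_chart:
  assumes V: "subspace V" and T0: "T0 \<in> indep_tuples scale V r"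
    and l: "\<And>s. s < r \<Longrightarrow> linear_form scale (l s)"
      "\<And>s t. s < r \<Longrightarrow> t < r \<Longrightarrow> l s (T0 t) = of_bool (s = t)"
  shows "\<exists>N \<sigma>. is_open (grass scale V r) N \<and> tuple_span scale r T0 \<in> N \<and> \<sigma> (tuple_span scale r T0) = T0 \<and>
    local_morphism (grass scale V r) N (tuple_variety scale V r) \<sigma> \<and>
    (\<forall>E\<in>N. \<sigma> E \<in> indep_tuples scale V r \<and> tuple_span scale r (\<sigma> E) = E \<and>
      (\<forall>s<r. \<forall>t<r. l s (\<sigma> E t) = of_bool (s = t))) \<and>
    (\<forall>T\<in>indep_tuples scale V r. tuple_span scale r T \<in> N \<longrightarrow>
      (\<exists>N' b. is_open (tuple_variety scale V r) N' \<and> T \<in> N' \<and>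
        (\<forall>u<r. \<forall>t<r. b u t \<in> reg (tuple_variety scale V r) N') \<and>
        (\<forall>T'\<in>N'. tuple_span scale r T' \<in> N \<and>
          (\<forall>t<r. \<sigma> (tuple_span scale r T') t = (\<Sum>u<r. scale (b u t T') (T' u))))))"
proof -
  let ?TV = "tuple_variety scale V r" and ?G = "grass scale V r" and ?q = "tuple_span scale r"
  \<comment> \<open>\<open>v\<close> is the member with index \<open>t\<close> of the basis of
    \<open>E\<close> dual to \<open>l\<close>.\<close>
  define P where "P E v t \<longleftrightarrow> v \<in> E \<and> (\<forall>s<r. l s v = of_bool (s = t))" for E v t
  define N where "N = {E \<in> pts ?G. \<forall>t<r. \<exists>v. P E v t}"
  define \<sigma> where "\<sigma> E = (\<lambda>t\<in>{..<r}. SOME v. P E v t)" for E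
  have P\<sigma>: "P E (\<sigma> E t) t" if "E \<in> N" "t < r" for E t
    using that someI_ex[of "\<lambda>v. P E v t"] unfolding N_def \<sigma>_def by auto
  have \<sigma>1: "\<sigma> E \<in> indep_tuples scale V r \<and> ?q (\<sigma> E) = E" if E: "E \<in> N" for E
  proof -
    obtain T where T: "T \<in> indep_tuples scale V r" "E = ?q T"
      using E unfolding N_def pts_grass by auto
    have "\<sigma> E \<in> {..<r} \<rightarrow>\<^sub>E V"
      using P\<sigma>[OF E] tuple_span_subset[OF V T(1)] T(2) unfolding P_def by (auto simp: \<sigma>_def)
    then have i: "\<sigma> E \<in> indep_tuples scale V r"
      using P\<sigma>[OF E] by (intro indep_tuples_dual[of r l]) (auto simp: l P_def)
    moreover have "?q (\<sigma> E) = ?q T"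
      by (rule tuple_span_eqI[OF T(1) i]) (use P\<sigma>[OF E] T(2) in \<open>auto simp: P_def\<close>)
    ultimately show ?thesis using T(2) by simp
  qed
  have uniq: "v = \<sigma> E t" if E: "E \<in> N" and t: "t < r" and v: "P E v t" for E v t
  proof -
    have "v \<in> ?q (\<sigma> E)" using v \<sigma>1[OF E] by (simp add: P_def)
    then have "v = (\<Sum>s<r. scale (l s v) (\<sigma> E s))"
      using P\<sigma>[OF E] by (intro dual_forms_expand) (auto simp: l P_def)
    also have "\<dots> = (\<Sum>s<r. scale (of_bool (s = t)) (\<sigma> E s))"
      using v by (intro sum.cong) (auto simp: P_def)
    finally show ?thesis using t by simp
  qed
  have core: "\<exists>N' b. is_open ?TV N' \<and> T \<in> N' \<and> (\<forall>u<r. \<forall>t<r. b u t \<in> reg ?TV N') \<and>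
      (\<forall>T'\<in>N'. ?q T' \<in> N \<and> (\<forall>t<r. \<sigma> (?q T') t = (\<Sum>u<r. scale (b u t T') (T' u))))"
    if T: "T \<in> indep_tuples scale V r" and qT: "?q T \<in> N" for T
  proof -
    have "\<forall>t<r. \<exists>c. \<sigma> (?q T) t = (\<Sum>u<r. scale (c u) (T u))"
      using P\<sigma>[OF qT] in_tuple_span_iff unfolding P_def by blast
    then obtain c where c: "\<sigma> (?q T) t = (\<Sum>u<r. scale (c t u) (T u))" if "t < r" for t
      by metis
    have o: "is_open ?TV (indep_tuples scale V r)"
      using openin_topspace[of "top ?TV"] by simp
    \<comment> \<open>The coefficients of the dual basis in terms of \<open>T\<close> invert the
      matrix at \<open>T\<close>; this is the pointwise inverse from which
      \<open>local_right_inverse\<close> starts.\<close>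
    have cc: "(\<Sum>t<r. l s (T t) * c u t) = of_bool (s = u)" if "s < r" "u < r" for s u
    proof -
      have "l s (\<sigma> (?q T) u) = (\<Sum>t<r. c u t * l s (T t))"
        unfolding c[OF that(2)] using l(1)[OF that(1)] by (simp add: linear_form_sum linear_form_scale)
      then show ?thesis using P\<sigma>[OF qT that(2)] that by (simp add: P_def mult.commute)
    qed
    have aa: "(\<lambda>T. l s (T t)) \<in> reg ?TV (indep_tuples scale V r)" if "s < r" "t < r" for s t
      by (rule vregD[OF vreg_tuple_variety[OF that(2) o] l(1)[OF that(1)]])
    have "\<exists>N' b. is_open ?TV N' \<and> T \<in> N' \<and> N' \<subseteq> indep_tuples scale V r \<and>
      (\<forall>t<r. \<forall>u<r. b t u \<in> reg ?TV N') \<and>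
      (\<forall>x\<in>N'. \<forall>s<r. \<forall>u<r. (\<Sum>t<r. l s (x t) * b t u x) = of_bool (s = u))"
      by (rule local_right_inverse[OF ringed_tuple_variety o T, where n = r and
          a = "\<lambda>s t T. l s (T t)" and c = "\<lambda>t u. c u t"]; rule aa cc; assumption)
    then obtain N' b where N': "is_open ?TV N'" "T \<in> N'" "N' \<subseteq> indep_tuples scale V r"
      "\<forall>t<r. \<forall>u<r. b t u \<in> reg ?TV N'"
      "\<forall>x\<in>N'. \<forall>s<r. \<forall>u<r. (\<Sum>t<r. l s (x t) * b t u x) = of_bool (s = u)"
      by (elim exE conjE)
    have "?q T' \<in> N \<and> (\<forall>t<r. \<sigma> (?q T') t = (\<Sum>u<r. scale (b u t T') (T' u)))" if T': "T' \<in> N'" for T'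
    proof -
      have PT: "P (?q T') (\<Sum>u<r. scale (b u t T') (T' u)) t" if t: "t < r" for t
        unfolding P_def
      proof (intro conjI allI impI)
        show "(\<Sum>u<r. scale (b u t T') (T' u)) \<in> ?q T'"
          unfolding in_tuple_span_iff by (rule exI, rule refl)
        fix s assume s: "s < r"
        have "l s (\<Sum>u<r. scale (b u t T') (T' u)) = (\<Sum>u<r. l s (T' u) * b u t T')"
          using l(1)[OF s] by (simp add: linear_form_sum linear_form_scale mult.commute)
        then show "l s (\<Sum>u<r. scale (b u t T') (T' u)) = of_bool (s = t)"
          using N'(5) T' s t by simp
      qed
      have "?q T' \<in> N" unfolding N_def pts_grass using PT T' N'(3) by blast
      with uniq[OF this _ PT] show ?thesis by simp
    qed
    then show ?thesis using N' by (intro exI[of _ N'] exI[of _ b]) simp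
  qed
  \<comment> \<open>Upstairs the map is a combination of the entries of the tuple with the regular
    coefficients \<open>b\<close>; it then descends to the Grassmannian.\<close>
  have lm: "local_morphism ?TV {T \<in> pts ?TV. ?q T \<in> N} ?TV (\<lambda>T. \<sigma> (?q T))"
  proof (rule local_morphism_local[OF ringed_tuple_variety])
    fix T assume "T \<in> {T \<in> pts ?TV. ?q T \<in> N}"
    then have "T \<in> indep_tuples scale V r" "?q T \<in> N" by auto
    from core[OF this] obtain N' b where N': "is_open ?TV N'" "T \<in> N'"
        "\<forall>u<r. \<forall>t<r. b u t \<in> reg ?TV N'"
        "\<forall>T'\<in>N'. ?q T' \<in> N \<and> (\<forall>t<r. \<sigma> (?q T') t = (\<Sum>u<r. scale (b u t T') (T' u)))" by auto
    have "local_morphism ?TV N' ?TV (\<lambda>T. \<sigma> (?q T))"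
    proof (rule local_morphism_tuple_variety[OF ringed_tuple_variety N'(1)])
      fix s assume s: "s < r"
      have "vreg scale ?TV N' (\<lambda>T'. \<Sum>u<r. scale (b u s T') (T' u))"
        using N'(3) s by (intro vreg_sum[OF ringed_tuple_variety N'(1)]
          vreg_scale[OF ringed_tuple_variety N'(1)] vreg_tuple_variety N'(1)) auto
      then show "vreg scale ?TV N' (\<lambda>T. \<sigma> (?q T) s)"
        by (rule vreg_cong[OF ringed_tuple_variety]) (use N'(4) s in simp)
    next
      fix T' assume "T' \<in> N'"
      then show "\<sigma> (?q T') \<in> indep_tuples scale V r" using N'(4) \<sigma>1 by blast
    qed
    moreover have "N' \<subseteq> {T \<in> pts ?TV. ?q T \<in> N}"
      using N'(4) openin_subset[OF N'(1)] by auto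
    ultimately show "\<exists>N'. T \<in> N' \<and> N' \<subseteq> {T \<in> pts ?TV. ?q T \<in> N} \<and> local_morphism ?TV N' ?TV (\<lambda>T. \<sigma> (?q T))"
      using N'(2) by (intro exI[of _ N']) simp
  qed
  have lm': "local_morphism ?G N ?TV \<sigma>"
    unfolding grass_def
    by (rule local_morphism_from_quot[OF _ lm]) (auto simp: N_def pts_grass)
  have PT0: "P (?q T0) (T0 t) t" if "t < r" for t
    using that l(2) tuple_span_base unfolding P_def by auto
  then have "\<forall>t<r. \<exists>v. P (?q T0) v t" by (intro allI impI exI)
  then have N0: "?q T0 \<in> N" unfolding N_def pts_grass using T0 by simp
  have "\<sigma> (?q T0) = T0"
  proof
    fix t show "\<sigma> (?q T0) t = T0 t"
    proof (cases "t < r")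
      case True
      then show ?thesis using uniq[OF N0 True PT0[OF True]] by simp
    next
      case False
      \<comment> \<open>Beyond \<open>r\<close> both tuples have the value \<open>undefined\<close>,
        by extensionality.\<close>
      moreover have "T0 \<in> {..<r} \<rightarrow>\<^sub>E V" using T0 unfolding indep_tuples_def by simp
      ultimately show ?thesis by (simp add: \<sigma>_def PiE_arb[of T0])
    qed
  qed
  moreover have "l s (\<sigma> E t) = of_bool (s = t)" if "E \<in> N" "s < r" "t < r" for E s t
    using P\<sigma>[OF that(1,3)] that(2) by (simp add: P_def)
  ultimately show ?thesis
    using N0 lm' local_morphism_open[OF lm'] \<sigma>1
    by - (rule exI[of _ N], rule exI[of _ \<sigma>], intro conjI ballI allI impI, ((rule core; assumption) | simp)+)
qed

text \<open>The basis \<open>\<sigma>\<close> of the chart pulled back along \<open>f\<close>. A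
  general \<open>f\<close> covers the identity of a Grassmannian, the inclusions of \<open>Y\<close>
  and \<open>Z\<close>, and families moved by the group.\<close>

lemma grass_dual_frame:
  assumes V: "subspace V" and X: "ringed X" and f: "local_morphism X N0 (grass scale V r) f"
    and x: "x \<in> N0"
  shows "\<exists>N e l. is_open X N \<and> x \<in> N \<and> N \<subseteq> N0 \<and>
    (\<forall>s<r. linear_form scale (l s) \<and> vreg scale X N (e s)) \<and>
    (\<forall>z\<in>N. (\<forall>s<r. e s z \<in> f z \<and> (\<forall>t<r. l s (e t z) = of_bool (s = t))) \<and>
      (\<lambda>t\<in>{..<r}. e t z) \<in> indep_tuples scale V r \<and> tuple_span scale r (\<lambda>t\<in>{..<r}. e t z) = f z \<and>
      (\<forall>v\<in>f z. v = (\<Sum>s<r. scale (l s v) (e s z))))"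
proof -
  let ?TV = "tuple_variety scale V r" and ?G = "grass scale V r"
  obtain T0 where T0: "T0 \<in> indep_tuples scale V r" "f x = tuple_span scale r T0"
    using local_morphism_pts[OF f x] unfolding pts_grass by auto
  obtain l where l: "\<forall>s<r. linear_form scale (l s) \<and> (\<forall>t<r. l s (T0 t) = of_bool (s = t))"
    using dual_forms[OF T0(1)] by auto
  obtain N \<sigma> where N: "is_open ?G N" "f x \<in> N" "local_morphism ?G N ?TV \<sigma>"
    "\<forall>E\<in>N. \<sigma> E \<in> indep_tuples scale V r \<and> tuple_span scale r (\<sigma> E) = E \<and>
      (\<forall>s<r. \<forall>t<r. l s (\<sigma> E t) = of_bool (s = t))"
    using grass_chart[OF V T0(1), of l] l T0(2) by auto
  let ?N = "{z \<in> N0. f z \<in> N}"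
  have o: "is_open X ?N" by (rule local_morphism_vimage[OF f N(1)])
  have lm: "local_morphism X ?N ?TV (\<lambda>z. \<sigma> (f z))" by (rule local_morphism_comp[OF f N(3)])
  have oT: "is_open ?TV (indep_tuples scale V r)" using openin_topspace[of "top ?TV"] by simp
  have "vreg scale X ?N (\<lambda>z. \<sigma> (f z) s)" if "s < r" for s
    by (rule vreg_comp'[OF lm vreg_tuple_variety[OF that oT] oT]) (use N(4) in auto)
  moreover have "(\<lambda>t\<in>{..<r}. \<sigma> (f z) t) = \<sigma> (f z)" if "z \<in> ?N" for z
    using N(4) that unfolding indep_tuples_def by (auto simp: fun_eq_iff PiE_def extensional_def)
  moreover have "v = (\<Sum>s<r. scale (l s v) (\<sigma> (f z) s))" if "z \<in> ?N" "v \<in> f z" for z v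
    by (rule dual_forms_expand) (use l N(4) that in auto)
  moreover have "\<sigma> (f z) s \<in> f z" if "z \<in> ?N" "s < r" for z s
    using N(4) that tuple_span_base[of s r "\<sigma> (f z)"] by auto
  ultimately show ?thesis
    using o x N(2,4) l by (intro exI[of _ ?N] exI[of _ "\<lambda>s z. \<sigma> (f z) s"] exI[of _ l]) auto
qed

end

lemma linear_tuple_span:
  assumes "Vector_Spaces.linear sc1 sc2 g"
  shows "tuple_span sc2 r (\<lambda>t\<in>{..<r}. g (T t)) = g ` tuple_span sc1 r T"
proof -
  interpret Vector_Spaces.linear sc1 sc2 g by fact
  have "(\<lambda>t\<in>{..<r}. g (T t)) ` {..<r} = g ` T ` {..<r}" by auto
  then show ?thesis unfolding tuple_span_def by (simp add: span_image)
qed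

lemma linear_indep_tuples:
  assumes g: "Vector_Spaces.linear sc1 sc2 g" and T: "T \<in> indep_tuples sc1 V1 r"
    and inj: "inj_on g (tuple_span sc1 r T)" and sub: "g ` V1 \<subseteq> V2"
  shows "(\<lambda>t\<in>{..<r}. g (T t)) \<in> indep_tuples sc2 V2 r"
proof -
  interpret Vector_Spaces.linear sc1 sc2 g by fact
  interpret p: vector_space_pair sc1 sc2 by unfold_locales
  have e: "(\<lambda>t\<in>{..<r}. g (T t)) ` {..<r} = g ` T ` {..<r}" by auto
  have T': "inj_on T {..<r}" "\<not> module.dependent sc1 (T ` {..<r})" "T \<in> {..<r} \<rightarrow>\<^sub>E V1"
    using T unfolding indep_tuples_def by auto
  have "inj_on (\<lambda>t. g (T t)) {..<r}"
    using comp_inj_on[OF T'(1) inj_on_subset[OF inj]] vs1.tuple_span_base by (auto simp: comp_def)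
  moreover have "\<not> module.dependent sc2 (g ` T ` {..<r})"
    using p.linear_independent_injective_image[OF g T'(2)] inj
    unfolding tuple_span_def by simp
  ultimately show ?thesis
    unfolding indep_tuples_def mem_Collect_eq e using T'(3) sub
    by (auto simp: inj_on_def PiE_def Pi_def image_subset_iff)
qed

text \<open>Apply \<open>g x\<close> to a regular local basis of \<open>f x\<close>. The dependence
  on \<open>x\<close> is for the group action; constant families give the embedding by
  \<open>D\<close> and the way back by \<open>ret\<close>.\<close>

lemma local_morphism_grass_image:
  assumes X: "ringed X" and vs1: "vector_space sc1" and V1: "module.subspace sc1 V1"
    and f: "local_morphism X N (grass sc1 V1 r) f"
    and lin: "\<And>x. x \<in> N \<Longrightarrow> Vector_Spaces.linear sc1 sc2 (g x)"
    and g: "\<And>N' F. is_open X N' \<Longrightarrow> N' \<subseteq> N \<Longrightarrow> vreg sc1 X N' F \<Longrightarrow> vreg sc2 X N' (\<lambda>x. g x (F x))"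
    and indep: "\<And>x T. x \<in> N \<Longrightarrow> T \<in> indep_tuples sc1 V1 r \<Longrightarrow> tuple_span sc1 r T = f x \<Longrightarrow>
      (\<lambda>t\<in>{..<r}. g x (T t)) \<in> indep_tuples sc2 V2 r"
  shows "local_morphism X N (grass sc2 V2 r) (\<lambda>x. g x ` f x)"
proof (rule local_morphism_local[OF X])
  interpret vs1: vector_space sc1 by fact
  fix x assume x: "x \<in> N"
  obtain N' e l where N': "is_open X N'" "x \<in> N'" "N' \<subseteq> N" "\<forall>s<r. linear_form sc1 (l s) \<and> vreg sc1 X N' (e s)"
    "\<forall>z\<in>N'. (\<forall>s<r. e s z \<in> f z \<and> (\<forall>t<r. l s (e t z) = of_bool (s = t))) \<and>
      (\<lambda>t\<in>{..<r}. e t z) \<in> indep_tuples sc1 V1 r \<and> tuple_span sc1 r (\<lambda>t\<in>{..<r}. e t z) = f z \<and>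
      (\<forall>v\<in>f z. v = (\<Sum>s<r. sc1 (l s v) (e s z)))"
    using vs1.grass_dual_frame[OF V1 X f x] by auto
  let ?T = "\<lambda>z. \<lambda>t\<in>{..<r}. g z ((\<lambda>t\<in>{..<r}. e t z) t)"
  have "local_morphism X N' (grass sc2 V2 r) (\<lambda>z. tuple_span sc2 r (?T z))"
  proof (rule local_morphism_into_grass[OF X N'(1)])
    fix s assume "s < r"
    then show "vreg sc2 X N' (\<lambda>z. ?T z s)"
      using g[OF N'(1,3), of "e s"] N'(4) by simp
  next
    fix z assume z: "z \<in> N'"
    then have "z \<in> N" "(\<lambda>t\<in>{..<r}. e t z) \<in> indep_tuples sc1 V1 r"
      "tuple_span sc1 r (\<lambda>t\<in>{..<r}. e t z) = f z"
      using N'(3,5) by blast+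
    then show "?T z \<in> indep_tuples sc2 V2 r" by (rule indep)
  qed
  then have "local_morphism X N' (grass sc2 V2 r) (\<lambda>x. g x ` f x)"
  proof (rule local_morphism_cong[OF X])
    fix z assume z: "z \<in> N'"
    then have "z \<in> N" using N'(3) by auto
    show "tuple_span sc2 r (?T z) = g z ` f z"
      unfolding linear_tuple_span[OF lin[OF \<open>z \<in> N\<close>]] using bspec[OF N'(5) z] by metis
  qed
  then show "\<exists>N'. x \<in> N' \<and> N' \<subseteq> N \<and> local_morphism X N' (grass sc2 V2 r) (\<lambda>x. g x ` f x)"
    using N' by auto
qed

section \<open>Equivariant bundles and their transfer along fibrewise maps\<close>

lemma
  assumes "vector_space_on V add sm z"
  shows vector_space_on_zero: "z \<in> V"
    and vector_space_on_add: "a \<in> V \<Longrightarrow> b \<in> V \<Longrightarrow> add a b \<in> V"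
    and vector_space_on_scale: "a \<in> V \<Longrightarrow> sm c a \<in> V"
  using assms unfolding vector_space_on_def by auto

lemma lincomb_mem:
  assumes "vector_space_on (fib F y) (fadd F) (fscale F) (fzero F y)" "\<And>i. i < n \<Longrightarrow> e i \<in> fib F y"
  shows "lincomb F y n c e \<in> fib F y"
proof -
  have "foldr (\<lambda>i a. fadd F (fscale F (c i) (e i)) a) xs (fzero F y) \<in> fib F y" if "set xs \<subseteq> {..<n}" for xs
    using that assms(2)
    by (induction xs) (auto intro: vector_space_on_zero[OF assms(1)]
        vector_space_on_add[OF assms(1)] vector_space_on_scale[OF assms(1)])
  note * = this
  have "set [0..<n] \<subseteq> {..<n}" by auto
  from *[OF this] show ?thesis unfolding lincomb_def .
qed

lemma lincomb_map:
  assumes F: "vector_space_on (fib F y) (fadd F) (fscale F) (fzero F y)"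
    and e: "\<And>i. i < n \<Longrightarrow> e i \<in> fib F y"
    and add: "\<And>u v. u \<in> fib F y \<Longrightarrow> v \<in> fib F y \<Longrightarrow> \<theta> (fadd F u v) = fadd F' (\<theta> u) (\<theta> v)"
    and scale: "\<And>c u. u \<in> fib F y \<Longrightarrow> \<theta> (fscale F c u) = fscale F' c (\<theta> u)"
    and zero: "\<theta> (fzero F y) = fzero F' y"
  shows "lincomb F' y n c (\<lambda>i. \<theta> (e i)) = \<theta> (lincomb F y n c e)"
proof -
  have "foldr (\<lambda>i a. fadd F' (fscale F' (c i) (\<theta> (e i))) a) xs (fzero F' y) =
      \<theta> (foldr (\<lambda>i a. fadd F (fscale F (c i) (e i)) a) xs (fzero F y)) \<and>
      foldr (\<lambda>i a. fadd F (fscale F (c i) (e i)) a) xs (fzero F y) \<in> fib F y"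
    if "set xs \<subseteq> {..<n}" for xs
    using that
  proof (induction xs)
    case Nil
    then show ?case using zero vector_space_on_zero[OF F] by simp
  next
    case (Cons i xs)
    then have "e i \<in> fib F y" using e by simp
    then show ?case using Cons
      by (simp add: add scale vector_space_on_scale[OF F] vector_space_on_add[OF F])
  qed
  note * = this
  have "set [0..<n] \<subseteq> {..<n}" by auto
  from *[OF this] show ?thesis unfolding lincomb_def by (rule conjunct1)
qed

text \<open>This and the next three definitions name the conditions that make up
  \<open>equivariant_vector_bundle\<close>, so that each can be proved or transported
  separately.\<close>

definition section_axioms ::
    "('h, 'k::field) grp_scheme \<Rightarrow> ('y, 'k) fspace \<Rightarrow> ('h \<Rightarrow> 'y \<Rightarrow> 'y) \<Rightarrow>
     ('h, 'y, 'k, 'e) eq_sheaf \<Rightarrow> 'y set \<Rightarrow> bool"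
  where "section_axioms H Y b F U \<longleftrightarrow>
      sec F U \<subseteq> Pi\<^sub>E U (fib F) \<and>
      restrict (fzero F) U \<in> sec F U \<and>
      (\<forall>s\<in>sec F U. \<forall>t\<in>sec F U. (\<lambda>y\<in>U. fadd F (s y) (t y)) \<in> sec F U) \<and>
      (\<forall>f\<in>reg Y U. \<forall>s\<in>sec F U. (\<lambda>y\<in>U. fscale F (f y) (s y)) \<in> sec F U) \<and>
      (\<forall>V. is_open Y V \<longrightarrow> V \<subseteq> U \<longrightarrow> (\<forall>s\<in>sec F U. restrict s V \<in> sec F V)) \<and>
      (\<forall>s\<in>extensional U.
        (\<forall>y\<in>U. \<exists>V. is_open Y V \<and> y \<in> V \<and> V \<subseteq> U \<and> restrict s V \<in> sec F V) \<longrightarrow> s \<in> sec F U) \<and>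
      (\<forall>h. is_open Y (b h ` U) \<and> (\<forall>s\<in>sec F U. translate H b F h U s \<in> sec F (b h ` U)))"

definition fibre_axioms ::
    "('h, 'k::field) grp_scheme \<Rightarrow> ('y, 'k) fspace \<Rightarrow> ('h \<Rightarrow> 'y \<Rightarrow> 'y) \<Rightarrow>
     ('h, 'y, 'k, 'e) eq_sheaf \<Rightarrow> bool"
  where "fibre_axioms H Y b F \<longleftrightarrow>
    (\<forall>y\<in>pts Y. vector_space_on (fib F y) (fadd F) (fscale F) (fzero F y)) \<and>
    (\<forall>y\<in>pts Y. \<forall>u\<in>fib F y. \<forall>h. fact F h u \<in> fib F (b h y) \<and>
       (\<forall>v\<in>fib F y. fact F h (fadd F u v) = fadd F (fact F h u) (fact F h v)) \<and>
       (\<forall>c. fact F h (fscale F c u) = fscale F c (fact F h u)) \<and>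
       fact F (gone H) u = u \<and>
       (\<forall>g. fact F (gmult H g h) u = fact F g (fact F h u)))"

definition trivializes ::
    "('y, 'k::field) fspace \<Rightarrow> ('h, 'y, 'k, 'e) eq_sheaf \<Rightarrow> 'y \<Rightarrow> 'y set \<Rightarrow> nat \<Rightarrow> (nat \<Rightarrow> 'y \<Rightarrow> 'e) \<Rightarrow> bool"
  where "trivializes Y F y U n e \<longleftrightarrow> is_open Y U \<and> y \<in> U \<and> (\<forall>i<n. e i \<in> sec F U) \<and>
      (\<forall>V. is_open Y V \<longrightarrow> V \<subseteq> U \<longrightarrow> (\<forall>s\<in>sec F V.
        \<exists>c. (\<forall>i<n. c i \<in> reg Y V) \<and>
            (\<forall>z\<in>V. s z = lincomb F z n (\<lambda>i. c i z) (\<lambda>i. e i z)) \<and>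
            (\<forall>c'. (\<forall>i<n. c' i \<in> reg Y V) \<and>
                  (\<forall>z\<in>V. s z = lincomb F z n (\<lambda>i. c' i z) (\<lambda>i. e i z)) \<longrightarrow>
                  (\<forall>i<n. \<forall>z\<in>V. c' i z = c i z))))"

definition algebraic_at ::
    "('h, 'k::field) grp_scheme \<Rightarrow> ('y, 'k) fspace \<Rightarrow> ('h \<Rightarrow> 'y \<Rightarrow> 'y) \<Rightarrow>
     ('h, 'y, 'k, 'e) eq_sheaf \<Rightarrow> 'y set \<Rightarrow> ('y \<Rightarrow> 'e) \<Rightarrow> 'h \<Rightarrow> 'y \<Rightarrow> bool"
  where "algebraic_at H Y b F U s h0 y0 \<longleftrightarrow>
      (\<exists>N V n c e. is_open (prod_space (group_variety H) Y) N \<and> (h0, y0) \<in> N \<and> is_open Y V \<and>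
        (\<forall>i<n. c i \<in> reg (prod_space (group_variety H) Y) N \<and> e i \<in> sec F V) \<and>
        (\<forall>(h, y)\<in>N. y \<in> V \<and> b (ginv H h) y \<in> U \<and>
           fact F h (s (b (ginv H h) y)) = lincomb F y n (\<lambda>i. c i (h, y)) (\<lambda>i. e i y)))"

lemma equivariant_vector_bundle_iff:
  "equivariant_vector_bundle H Y b F \<longleftrightarrow> fibre_axioms H Y b F \<and>
    (\<forall>U. is_open Y U \<longrightarrow> section_axioms H Y b F U) \<and>
    (\<forall>y\<in>pts Y. \<exists>U n e. trivializes Y F y U n e) \<and>
    (\<forall>U s h0 y0. is_open Y U \<longrightarrow> s \<in> sec F U \<longrightarrow> y0 \<in> pts Y \<longrightarrow> b (ginv H h0) y0 \<in> U \<longrightarrow>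
      algebraic_at H Y b F U s h0 y0)"
  unfolding equivariant_vector_bundle_def fibre_axioms_def section_axioms_def trivializes_def
    algebraic_at_def
  by (rule iffI; elim conjE; intro conjI; assumption)

lemma sections_fib: "section_axioms H Y b F U \<Longrightarrow> s \<in> sec F U \<Longrightarrow> y \<in> U \<Longrightarrow> s y \<in> fib F y"
  and sections_ext: "section_axioms H Y b F U \<Longrightarrow> s \<in> sec F U \<Longrightarrow> s \<in> extensional U"
  unfolding section_axioms_def by (auto dest!: subsetD simp: PiE_def)

lemma
  assumes "section_axioms H Y b F U"
  shows sections_zero: "restrict (fzero F) U \<in> sec F U"
    and sections_add: "s \<in> sec F U \<Longrightarrow> t \<in> sec F U \<Longrightarrow> (\<lambda>y\<in>U. fadd F (s y) (t y)) \<in> sec F U"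
    and sections_scale: "f \<in> reg Y U \<Longrightarrow> s \<in> sec F U \<Longrightarrow> (\<lambda>y\<in>U. fscale F (f y) (s y)) \<in> sec F U"
    and sections_restrict: "is_open Y V \<Longrightarrow> V \<subseteq> U \<Longrightarrow> s \<in> sec F U \<Longrightarrow> restrict s V \<in> sec F V"
    and sections_glue: "s \<in> extensional U \<Longrightarrow>
      (\<And>y. y \<in> U \<Longrightarrow> \<exists>V. is_open Y V \<and> y \<in> V \<and> V \<subseteq> U \<and> restrict s V \<in> sec F V) \<Longrightarrow> s \<in> sec F U"
    and sections_image_open: "is_open Y (b h ` U)"
    and sections_translate: "s \<in> sec F U \<Longrightarrow> translate H b F h U s \<in> sec F (b h ` U)"
  using assms unfolding section_axioms_def by simp_all

text \<open>Sections of \<open>F'\<close> are the images of sections of \<open>F\<close> under a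
  fibrewise injective linear map that commutes with the action, so every condition on
  \<open>F'\<close> is read off from \<open>F\<close>. The map may miss part of the fibre:
  \<open>image_bundle\<close> has the constant fibre \<open>M\<close>, whereas its sections take
  values in much smaller subspaces.\<close>

lemma equivariant_transfer:
  assumes F: "equivariant_vector_bundle H Y b F"
    and b: "\<And>h y. y \<in> pts Y \<Longrightarrow> b (ginv H h) (b h y) = y"
      "\<And>h y. y \<in> pts Y \<Longrightarrow> b h (b (ginv H h) y) = y"
    and F': "fibre_axioms H Y b F'"
    and \<theta>: "\<And>y u. y \<in> pts Y \<Longrightarrow> u \<in> fib F y \<Longrightarrow> \<theta> y u \<in> fib F' y"
    and inj: "\<And>y. y \<in> pts Y \<Longrightarrow> inj_on (\<theta> y) (fib F y)"
    and add: "\<And>y u v. y \<in> pts Y \<Longrightarrow> u \<in> fib F y \<Longrightarrow> v \<in> fib F y \<Longrightarrow>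
      \<theta> y (fadd F u v) = fadd F' (\<theta> y u) (\<theta> y v)"
    and scale: "\<And>y c u. y \<in> pts Y \<Longrightarrow> u \<in> fib F y \<Longrightarrow> \<theta> y (fscale F c u) = fscale F' c (\<theta> y u)"
    and zero: "\<And>y. y \<in> pts Y \<Longrightarrow> \<theta> y (fzero F y) = fzero F' y"
    and act: "\<And>h y u. y \<in> pts Y \<Longrightarrow> u \<in> fib F y \<Longrightarrow> fact F' h (\<theta> y u) = \<theta> (b h y) (fact F h u)"
    and sec': "\<And>U. is_open Y U \<Longrightarrow> sec F' U = (\<lambda>s. \<lambda>y\<in>U. \<theta> y (s y)) ` sec F U"
  shows "equivariant_iso H Y b F F'"
proof -
  define T where "T U s = (\<lambda>y\<in>U. \<theta> y (s y))" for U s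
  have sec'': "sec F' U = T U ` sec F U" if "is_open Y U" for U
    using sec'[OF that] unfolding T_def .
  have fF: "fibre_axioms H Y b F" and sF: "\<And>U. is_open Y U \<Longrightarrow> section_axioms H Y b F U"
    and tF: "\<And>y. y \<in> pts Y \<Longrightarrow> \<exists>U n e. trivializes Y F y U n e"
    and aF: "\<And>U s h0 y0. is_open Y U \<Longrightarrow> s \<in> sec F U \<Longrightarrow> y0 \<in> pts Y \<Longrightarrow> b (ginv H h0) y0 \<in> U \<Longrightarrow>
      algebraic_at H Y b F U s h0 y0"
    using F unfolding equivariant_vector_bundle_iff by simp_all
  have vF: "vector_space_on (fib F y) (fadd F) (fscale F) (fzero F y)" if "y \<in> pts Y" for y
    using fF that unfolding fibre_axioms_def by simp
  have sub: "y \<in> pts Y" if "is_open Y U" "y \<in> U" for U y using openin_subset[OF that(1)] that(2) by auto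
  have mem: "s y \<in> fib F y" if "is_open Y U" "s \<in> sec F U" "y \<in> U" for U s y
    by (rule sections_fib[OF sF[OF that(1)] that(2,3)])
  have lin: "lincomb F' y n c (\<lambda>i. \<theta> y (e i)) = \<theta> y (lincomb F y n c e)"
    if "y \<in> pts Y" "\<And>i. i < n \<Longrightarrow> e i \<in> fib F y" for y n c e
    by (rule lincomb_map[OF vF[OF that(1)] that(2)]) (use add scale zero that(1) in auto)
  have T_add: "T U (\<lambda>y\<in>U. fadd F (s y) (t y)) = (\<lambda>y\<in>U. fadd F' (T U s y) (T U t y))"
    if "is_open Y U" "s \<in> sec F U" "t \<in> sec F U" for U s t
    unfolding T_def using mem[OF that(1)] that sub[OF that(1)] by (auto simp: add intro!: restrict_ext)
  have T_scale: "T U (\<lambda>y\<in>U. fscale F (f y) (s y)) = (\<lambda>y\<in>U. fscale F' (f y) (T U s y))"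
    if "is_open Y U" "s \<in> sec F U" for U s f
    unfolding T_def using mem[OF that(1)] that sub[OF that(1)] by (auto simp: scale intro!: restrict_ext)
  have T_restrict: "T V (restrict s V) = restrict (T U s) V" if "V \<subseteq> U" for U V s
    unfolding T_def using that by (auto simp: fun_eq_iff)
  have T_translate: "T (b h ` U) (translate H b F h U s) = translate H b F' h U (T U s)"
    if U: "is_open Y U" "s \<in> sec F U" for h U s
    unfolding T_def translate_def
  proof (rule restrict_ext)
    fix y assume "y \<in> b h ` U"
    then obtain x where x: "x \<in> U" "y = b h x" by auto
    then show "\<theta> y ((\<lambda>y\<in>b h ` U. fact F h (s (b (ginv H h) y))) y) =
        fact F' h ((\<lambda>y\<in>U. \<theta> y (s y)) (b (ginv H h) y))"
      using b(1)[OF sub[OF U(1)]] act[OF sub[OF U(1)] mem[OF U]] by simp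
  qed
  have T_inj: "s = t" if U: "is_open Y U" "s \<in> sec F U" "t \<in> sec F U" "T U s = T U t" for U s t
  proof (rule extensionalityI)
    show "s \<in> extensional U" "t \<in> extensional U" using sections_ext[OF sF[OF U(1)]] U(2,3) by auto
    fix y assume y: "y \<in> U"
    have "\<theta> y (s y) = \<theta> y (t y)" using fun_cong[OF U(4), of y] y by (simp add: T_def)
    then show "s y = t y"
      using inj_onD[OF inj[OF sub[OF U(1) y]]] mem[OF U(1)] U(2,3) y by auto
  qed
  have sF': "section_axioms H Y b F' U" if U: "is_open Y U" for U
    unfolding section_axioms_def
  proof (intro conjI allI impI ballI)
    show "sec F' U \<subseteq> Pi\<^sub>E U (fib F')"
      unfolding sec''[OF U] T_def using \<theta>[OF sub[OF U]] mem[OF U] by auto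
    have "T U (restrict (fzero F) U) = restrict (fzero F') U"
      unfolding T_def using zero[OF sub[OF U]] by (auto intro!: restrict_ext)
    then show "restrict (fzero F') U \<in> sec F' U"
      unfolding sec''[OF U] using sections_zero[OF sF[OF U]] by (metis imageI)
    fix s' assume s': "s' \<in> sec F' U"
    then obtain s where s: "s \<in> sec F U" "s' = T U s" unfolding sec''[OF U] by auto
    show "(\<lambda>y\<in>U. fscale F' (f y) (s' y)) \<in> sec F' U" if "f \<in> reg Y U" for f
      unfolding s(2) T_scale[OF U s(1), symmetric] sec''[OF U]
      by (intro imageI sections_scale[OF sF[OF U] that s(1)])
    show "restrict s' V \<in> sec F' V" if V: "is_open Y V" "V \<subseteq> U" for V
      unfolding s(2) T_restrict[OF V(2), symmetric] sec''[OF V(1)]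
      by (intro imageI sections_restrict[OF sF[OF U] V s(1)])
    show "translate H b F' h U s' \<in> sec F' (b h ` U)" for h
      unfolding s(2) T_translate[OF U s(1), symmetric] sec''[OF sections_image_open[OF sF[OF U]]]
      by (intro imageI sections_translate[OF sF[OF U] s(1)])
    fix t' assume "t' \<in> sec F' U"
    then obtain t where t: "t \<in> sec F U" "t' = T U t" unfolding sec''[OF U] by auto
    show "(\<lambda>y\<in>U. fadd F' (s' y) (t' y)) \<in> sec F' U"
      unfolding s(2) t(2) T_add[OF U s(1) t(1), symmetric] sec''[OF U]
      by (intro imageI sections_add[OF sF[OF U] s(1) t(1)])
  next
    show "is_open Y (b h ` U)" for h by (rule sections_image_open[OF sF[OF U]])
  next
    fix s' assume s': "s' \<in> extensional U"
      and loc: "\<forall>y\<in>U. \<exists>V. is_open Y V \<and> y \<in> V \<and> V \<subseteq> U \<and> restrict s' V \<in> sec F' V"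
    \<comment> \<open>Locally \<open>s'\<close> comes from sections of \<open>F\<close>. As
      \<open>\<theta>\<close> is injective on fibres, its fibrewise inverse makes these sections
      agree on overlaps, and they glue to \<open>t\<close>.\<close>
    define t where "t = (\<lambda>y\<in>U. inv_into (fib F y) (\<theta> y) (s' y))"
    have loc': "\<exists>V. is_open Y V \<and> y \<in> V \<and> V \<subseteq> U \<and> restrict t V \<in> sec F V \<and> T V t = restrict s' V"
      if "y \<in> U" for y
    proof -
      obtain V where V: "is_open Y V" "y \<in> V" "V \<subseteq> U" "restrict s' V \<in> sec F' V"
        using loc \<open>y \<in> U\<close> by blast
      then obtain s where s: "s \<in> sec F V" "restrict s' V = T V s" unfolding sec''[OF V(1)] by auto
      have e: "t z = s z" if z: "z \<in> V" for z
      proof -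
        have "s' z = \<theta> z (s z)" using fun_cong[OF s(2), of z] z by (simp add: T_def)
        then show ?thesis
          using inv_into_f_f[OF inj[OF sub[OF V(1) z]] mem[OF V(1) s(1) z]] z V(3) by (auto simp: t_def)
      qed
      have "restrict t V = s"
        by (rule extensionalityI[of _ V]) (use e sections_ext[OF sF[OF V(1)] s(1)] in auto)
      moreover have "T V t = restrict s' V" unfolding s(2) T_def using e by (auto intro!: restrict_ext)
      ultimately show ?thesis using V s(1) by (intro exI[of _ V]) simp
    qed
    have "t \<in> sec F U"
    proof (rule sections_glue[OF sF[OF U]])
      show "t \<in> extensional U" by (simp add: t_def)
      fix y assume "y \<in> U"
      from loc'[OF this] show "\<exists>V. is_open Y V \<and> y \<in> V \<and> V \<subseteq> U \<and> restrict t V \<in> sec F V"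
        by (elim exE conjE) (intro exI conjI)
    qed
    moreover have "T U t = s'"
    proof (rule extensionalityI[of _ U])
      fix y assume y: "y \<in> U"
      from loc'[OF y] obtain V where "y \<in> V" "T V t = restrict s' V" by (elim exE conjE)
      then have "T V t y = s' y" by simp
      then show "T U t y = s' y" using \<open>y \<in> V\<close> y by (simp add: T_def)
    qed (use s' in \<open>auto simp: T_def\<close>)
    ultimately show "s' \<in> sec F' U" unfolding sec''[OF U] by (metis imageI)
  qed
  have tF': "\<exists>U n e. trivializes Y F' y U n e" if y: "y \<in> pts Y" for y
  proof -
    obtain U n e where U: "trivializes Y F y U n e" using tF[OF y] by auto
    then have oU: "is_open Y U" and yU: "y \<in> U" and e: "\<And>i. i < n \<Longrightarrow> e i \<in> sec F U"
      unfolding trivializes_def by simp_all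
    have "trivializes Y F' y U n (\<lambda>i. T U (e i))"
      unfolding trivializes_def
    proof (intro conjI allI impI ballI)
      show "is_open Y U" "y \<in> U" by fact+
      show "T U (e i) \<in> sec F' U" if "i < n" for i unfolding sec''[OF oU] by (intro imageI e that)
      fix V s' assume V: "is_open Y V" "V \<subseteq> U" and "s' \<in> sec F' V"
      then obtain s where s: "s \<in> sec F V" "s' = T V s" unfolding sec''[OF V(1)] by auto
      have "\<exists>c. (\<forall>i<n. c i \<in> reg Y V) \<and>
            (\<forall>z\<in>V. s z = lincomb F z n (\<lambda>i. c i z) (\<lambda>i. e i z)) \<and>
            (\<forall>c'. (\<forall>i<n. c' i \<in> reg Y V) \<and>
                  (\<forall>z\<in>V. s z = lincomb F z n (\<lambda>i. c' i z) (\<lambda>i. e i z)) \<longrightarrow>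
                  (\<forall>i<n. \<forall>z\<in>V. c' i z = c i z))"
        using U V s(1) unfolding trivializes_def by simp
      then obtain c where c: "\<forall>i<n. c i \<in> reg Y V"
        "\<forall>z\<in>V. s z = lincomb F z n (\<lambda>i. c i z) (\<lambda>i. e i z)"
        "\<forall>c'. (\<forall>i<n. c' i \<in> reg Y V) \<and> (\<forall>z\<in>V. s z = lincomb F z n (\<lambda>i. c' i z) (\<lambda>i. e i z)) \<longrightarrow>
                  (\<forall>i<n. \<forall>z\<in>V. c' i z = c i z)" by (elim exE conjE)
      have ez: "e i z \<in> fib F z" if "i < n" "z \<in> V" for i z
        using mem[OF oU e[OF that(1)]] that(2) V(2) by auto
      have L: "lincomb F' z n d (\<lambda>i. T U (e i) z) = \<theta> z (lincomb F z n d (\<lambda>i. e i z))" if z: "z \<in> V" for z d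
      proof -
        have "(\<lambda>i. T U (e i) z) = (\<lambda>i. \<theta> z (e i z))" using z V(2) by (auto simp: T_def)
        then show ?thesis using lin[OF sub[OF V(1) z] ez[OF _ z]] by simp
      qed
      \<comment> \<open>By injectivity an expansion in the transported frame is the same as one in
        the original frame, so existence and uniqueness of the coefficients carry over.\<close>
      have iff: "s' z = lincomb F' z n d (\<lambda>i. T U (e i) z) \<longleftrightarrow> s z = lincomb F z n d (\<lambda>i. e i z)"
        if z: "z \<in> V" for z d
        unfolding L[OF z]
        using inj_on_eq_iff[OF inj[OF sub[OF V(1) z]] mem[OF V(1) s(1) z]
            lincomb_mem[OF vF[OF sub[OF V(1) z]] ez[OF _ z]]] z s(2)
        by (simp add: T_def)
      show "\<exists>c. (\<forall>i<n. c i \<in> reg Y V) \<and>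
            (\<forall>z\<in>V. s' z = lincomb F' z n (\<lambda>i. c i z) (\<lambda>i. T U (e i) z)) \<and>
            (\<forall>c'. (\<forall>i<n. c' i \<in> reg Y V) \<and>
                  (\<forall>z\<in>V. s' z = lincomb F' z n (\<lambda>i. c' i z) (\<lambda>i. T U (e i) z)) \<longrightarrow>
                  (\<forall>i<n. \<forall>z\<in>V. c' i z = c i z))"
        using c by (intro exI[of _ c]) (simp add: iff)
    qed
    then show ?thesis by (intro exI)
  qed
  have aF': "algebraic_at H Y b F' U s' h0 y0"
    if U: "is_open Y U" and s': "s' \<in> sec F' U" and y0: "y0 \<in> pts Y" "b (ginv H h0) y0 \<in> U" for U s' h0 y0
  proof -
    obtain s where s: "s \<in> sec F U" "s' = T U s" using s' unfolding sec''[OF U] by auto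
    obtain N V n c e where N: "is_open (prod_space (group_variety H) Y) N" "(h0, y0) \<in> N" "is_open Y V"
        "\<forall>i<n. c i \<in> reg (prod_space (group_variety H) Y) N \<and> e i \<in> sec F V"
        "\<forall>(h, y)\<in>N. y \<in> V \<and> b (ginv H h) y \<in> U \<and>
           fact F h (s (b (ginv H h) y)) = lincomb F y n (\<lambda>i. c i (h, y)) (\<lambda>i. e i y)"
      using aF[OF U s(1) y0] unfolding algebraic_at_def by (elim exE conjE)
    have "y \<in> V \<and> b (ginv H h) y \<in> U \<and>
        fact F' h (s' (b (ginv H h) y)) = lincomb F' y n (\<lambda>i. c i (h, y)) (\<lambda>i. T V (e i) y)"
      if hy: "(h, y) \<in> N" for h y
    proof -
      have 1: "y \<in> V" "b (ginv H h) y \<in> U"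
        "fact F h (s (b (ginv H h) y)) = lincomb F y n (\<lambda>i. c i (h, y)) (\<lambda>i. e i y)"
        using N(5) hy by auto
      have y: "y \<in> pts Y" by (rule sub[OF N(3) 1(1)])
      let ?x = "b (ginv H h) y"
      have x: "?x \<in> pts Y" by (rule sub[OF U 1(2)])
      have ey: "e i y \<in> fib F y" if "i < n" for i using mem[OF N(3) _ 1(1)] N(4) that by simp
      have "fact F' h (s' ?x) = \<theta> y (lincomb F y n (\<lambda>i. c i (h, y)) (\<lambda>i. e i y))"
        using act[OF x mem[OF U s(1) 1(2)]] 1(2,3) s(2) by (simp add: T_def b(2)[OF y])
      also have "\<dots> = lincomb F' y n (\<lambda>i. c i (h, y)) (\<lambda>i. \<theta> y (e i y))"
        using lin[OF y ey] by simp
      also have "\<dots> = lincomb F' y n (\<lambda>i. c i (h, y)) (\<lambda>i. T V (e i) y)"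
        using 1(1) by (simp add: T_def)
      finally show ?thesis using 1 by simp
    qed
    moreover have "\<forall>i<n. c i \<in> reg (prod_space (group_variety H) Y) N \<and> T V (e i) \<in> sec F' V"
      using N(4) unfolding sec''[OF N(3)] by simp
    ultimately show ?thesis
      unfolding algebraic_at_def using N(1-3)
      by - (rule exI[of _ N], rule exI[of _ V], rule exI[of _ n], rule exI[of _ c],
          rule exI[of _ "\<lambda>i. T V (e i)"], auto)
  qed
  have "equivariant_vector_bundle H Y b F'"
    unfolding equivariant_vector_bundle_iff using F' sF' tF' aF' by simp
  moreover have "bij_betw (T U) (sec F U) (sec F' U)" if "is_open Y U" for U
    unfolding bij_betw_def sec''[OF that] using T_inj[OF that] by (auto intro!: inj_onI)
  ultimately show ?thesis
    unfolding equivariant_iso_def using F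
    by (intro conjI exI[of _ T] allI impI ballI)
      (simp_all add: T_add T_scale T_restrict T_translate)
qed

text \<open>The theorem starts its first isomorphism at the image bundle, whereas
  \<open>equivariant_transfer\<close> starts at the canonical bundle.\<close>

lemma equivariant_iso_sym:
  assumes "equivariant_iso H Y b F F'"
  shows "equivariant_iso H Y b F' F"
proof -
  obtain \<Phi> where F: "equivariant_vector_bundle H Y b F" and F': "equivariant_vector_bundle H Y b F'"
    and \<Phi>0: "\<forall>U. is_open Y U \<longrightarrow> bij_betw (\<Phi> U) (sec F U) (sec F' U) \<and>
      (\<forall>s\<in>sec F U. \<forall>t\<in>sec F U.
         \<Phi> U (\<lambda>y\<in>U. fadd F (s y) (t y)) = (\<lambda>y\<in>U. fadd F' (\<Phi> U s y) (\<Phi> U t y))) \<and>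
      (\<forall>f\<in>reg Y U. \<forall>s\<in>sec F U.
         \<Phi> U (\<lambda>y\<in>U. fscale F (f y) (s y)) = (\<lambda>y\<in>U. fscale F' (f y) (\<Phi> U s y))) \<and>
      (\<forall>V. is_open Y V \<longrightarrow> V \<subseteq> U \<longrightarrow>
         (\<forall>s\<in>sec F U. \<Phi> V (restrict s V) = restrict (\<Phi> U s) V)) \<and>
      (\<forall>h. \<forall>s\<in>sec F U.
         \<Phi> (b h ` U) (translate H b F h U s) = translate H b F' h U (\<Phi> U s))"
    using assms unfolding equivariant_iso_def by (elim exE conjE)
  note \<Phi> = \<Phi>0[THEN spec, THEN mp]
  have sF: "\<And>U. is_open Y U \<Longrightarrow> section_axioms H Y b F U"
    using F unfolding equivariant_vector_bundle_iff by simp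
  define \<Psi> where "\<Psi> U = inv_into (sec F U) (\<Phi> U)" for U
  have \<Psi>\<Phi>: "\<Psi> U (\<Phi> U s) = s" if "is_open Y U" "s \<in> sec F U" for U s
    unfolding \<Psi>_def using \<Phi>[OF that(1)] that(2) by (auto intro!: bij_betw_inv_into_left)
  have ex: "\<exists>s\<in>sec F U. s' = \<Phi> U s" if "is_open Y U" "s' \<in> sec F' U" for U s'
    using \<Phi>[OF that(1)] that(2) unfolding bij_betw_def by auto
  have "bij_betw (\<Psi> U) (sec F' U) (sec F U)" if "is_open Y U" for U
    unfolding \<Psi>_def using \<Phi>[OF that] by (auto intro!: bij_betw_inv_into)
  moreover have "\<Psi> U (\<lambda>y\<in>U. fadd F' (s' y) (t' y)) = (\<lambda>y\<in>U. fadd F (\<Psi> U s' y) (\<Psi> U t' y))"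
    if U: "is_open Y U" and s': "s' \<in> sec F' U" and t': "t' \<in> sec F' U" for U s' t'
  proof -
    obtain s t where s: "s \<in> sec F U" "s' = \<Phi> U s" and t: "t \<in> sec F U" "t' = \<Phi> U t"
      using ex[OF U s'] ex[OF U t'] by auto
    have "\<Phi> U (\<lambda>y\<in>U. fadd F (s y) (t y)) = (\<lambda>y\<in>U. fadd F' (s' y) (t' y))"
      using \<Phi>[OF U] s t by simp
    then show ?thesis
      using \<Psi>\<Phi>[OF U sections_add[OF sF[OF U] s(1) t(1)]] \<Psi>\<Phi>[OF U s(1)] \<Psi>\<Phi>[OF U t(1)] s(2) t(2) by simp
  qed
  moreover have "\<Psi> U (\<lambda>y\<in>U. fscale F' (f y) (s' y)) = (\<lambda>y\<in>U. fscale F (f y) (\<Psi> U s' y))"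
    if U: "is_open Y U" and f: "f \<in> reg Y U" and s': "s' \<in> sec F' U" for U f s'
  proof -
    obtain s where s: "s \<in> sec F U" "s' = \<Phi> U s" using ex[OF U s'] by auto
    have "\<Phi> U (\<lambda>y\<in>U. fscale F (f y) (s y)) = (\<lambda>y\<in>U. fscale F' (f y) (s' y))"
      using \<Phi>[OF U] s f by simp
    then show ?thesis
      using \<Psi>\<Phi>[OF U sections_scale[OF sF[OF U] f s(1)]] \<Psi>\<Phi>[OF U s(1)] s(2) by simp
  qed
  moreover have "\<Psi> V (restrict s' V) = restrict (\<Psi> U s') V"
    if U: "is_open Y U" and V: "is_open Y V" "V \<subseteq> U" and s': "s' \<in> sec F' U" for U V s'
  proof -
    obtain s where s: "s \<in> sec F U" "s' = \<Phi> U s" using ex[OF U s'] by auto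
    have "\<Phi> V (restrict s V) = restrict s' V" using \<Phi>[OF U] s V by simp
    then show ?thesis
      using \<Psi>\<Phi>[OF V(1) sections_restrict[OF sF[OF U] V s(1)]] \<Psi>\<Phi>[OF U s(1)] s(2) by simp
  qed
  moreover have "\<Psi> (b h ` U) (translate H b F' h U s') = translate H b F h U (\<Psi> U s')"
    if U: "is_open Y U" and s': "s' \<in> sec F' U" for U h s'
  proof -
    obtain s where s: "s \<in> sec F U" "s' = \<Phi> U s" using ex[OF U s'] by auto
    have "\<Phi> (b h ` U) (translate H b F h U s) = translate H b F' h U s'" using \<Phi>[OF U] s by simp
    then show ?thesis
      using \<Psi>\<Phi>[OF sections_image_open[OF sF[OF U], of h] sections_translate[OF sF[OF U] s(1)]] \<Psi>\<Phi>[OF U s(1)] s(2)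
      by simp
  qed
  ultimately show ?thesis
    unfolding equivariant_iso_def using F F'
    by (intro conjI exI[of _ \<Psi>] allI impI ballI) simp_all
qed

lemma local_morphism_into_affine':
  assumes X: "ringed X" and N: "is_open X N" and A: "subalg A"
    and f: "\<And>F. F \<in> A \<Longrightarrow> (\<lambda>x. F (f x)) \<in> reg X N"
  shows "local_morphism X N (affine_space_of A) f"
  unfolding affine_space_of_frac_space
  by (rule local_morphism_into_frac[OF X directed_charts_single[OF A] N])
    (use N f in simp_all)

lemma lincomb_eq_sum:
  fixes F :: "('h, 'y, 'k, 'e::comm_monoid_add) eq_sheaf"
  assumes "fadd F = (+)" "fzero F = (\<lambda>_. 0)"
  shows "lincomb F y n c e = (\<Sum>i<n. fscale F (c i) (e i))"
  unfolding lincomb_def assms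
proof (induction n)
  case (Suc n)
  \<comment> \<open>Moves the start value out of the fold: in \<open>lincomb\<close> the last
    summand is the innermost one.\<close>
  have *: "foldr (\<lambda>i. (+) (f i)) xs a = foldr (\<lambda>i. (+) (f i)) xs 0 + a" for f :: "nat \<Rightarrow> 'e" and xs a
    by (induction xs) (simp_all add: add.assoc)
  show ?case using Suc by (simp add: *[of _ _ "fscale F (c n) (e n)"])
qed simp

lemma vector_space_on_subspace:
  assumes "vector_space sc" "module.subspace sc V"
  shows "vector_space_on V (+) sc 0"
proof -
  interpret vector_space sc by fact
  have "\<exists>b\<in>V. a + b = 0" if "a \<in> V" for a
    using subspace_neg[OF assms(2) that] by (intro bexI[of _ "- a"]) auto
  then show ?thesis
    unfolding vector_space_on_def
    using subspace_0[OF assms(2)] subspace_add[OF assms(2)] subspace_scale[OF assms(2)]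
    by (simp add: add.commute add.assoc scale_right_distrib scale_left_distrib)
qed

section \<open>The canonical bundle on a stable subvariety\<close>

locale rational_rep = vector_space scW
  for scW :: "'k::field \<Rightarrow> 'w::ab_group_add \<Rightarrow> 'w" +
  fixes H :: "('h, 'k) grp_scheme" and act :: "'h \<Rightarrow> 'w \<Rightarrow> 'w"
  assumes H: "affine_algebraic_group H"
    and fin_dim: "fin_dim_subspace scW UNIV"
    and W: "rational_module H scW UNIV act"
begin

sublocale H: group "gmult H" "gone H" "ginv H"
  using H unfolding affine_algebraic_group_def by simp

lemma subalg_coord: "subalg (coord H)"
  using H subalg_gen_alg unfolding affine_algebraic_group_def by auto

lemma coord_inv: "f \<in> coord H \<Longrightarrow> (\<lambda>x. f (ginv H x)) \<in> coord H"
  using H unfolding affine_algebraic_group_def by simp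

lemma coord_mult: "f \<in> coord H \<Longrightarrow> (\<lambda>(x, y). f (gmult H x y)) \<in> fun_tensor (coord H) (coord H)"
  using H unfolding affine_algebraic_group_def by simp

lemma ideal_H: "ideal H = {\<lambda>_. 0}"
  using H unfolding affine_algebraic_group_def by simp

lemma linear_act: "Vector_Spaces.linear scW scW (act h)"
  using W vector_space_axioms unfolding rational_module_def Vector_Spaces.linear_iff by simp

lemma act_add: "act h (u + v) = act h u + act h v"
  and act_scale: "act h (scW c u) = scW c (act h u)"
  using W unfolding rational_module_def by simp_all

lemma act_zero: "act h 0 = 0"
  using act_scale[of h 0 0] by simp

lemma act_sum: "act h (\<Sum>i\<in>I. f i) = (\<Sum>i\<in>I. act h (f i))"
  by (induction I rule: infinite_finite_induct) (simp_all add: act_add act_zero)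

lemma act_one: "act (gone H) u = u"
  using W unfolding rational_module_def by simp

text \<open>Coassociativity is required modulo the ideal of the product group. Since
  \<open>ideal H\<close> is zero, both summands of that ideal vanish and the congruence is an
  equality.\<close>

lemma act_mult: "act (gmult H g h) u = act g (act h u)"
proof -
  have z: "F = (\<lambda>_. 0)" if "F \<in> fun_tensor {\<lambda>_. 0} (coord H)" for F :: "'h \<times> 'h \<Rightarrow> 'k"
    using that by (induction rule: fun_tensor_induct) (simp_all add: fun_eq_iff)
  have z': "F = (\<lambda>_. 0)" if "F \<in> fun_tensor (coord H) {\<lambda>_. 0}" for F :: "'h \<times> 'h \<Rightarrow> 'k"
    using that by (induction rule: fun_tensor_induct) (simp_all add: fun_eq_iff)
  have zero: "F = (\<lambda>_. 0)" if "F \<in> fun_sum (fun_tensor (ideal H) (coord H)) (fun_tensor (coord H) (ideal H))" for F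
    using that z z' unfolding ideal_H fun_sum_def by fastforce
  have t: "(\<lambda>(x, y). act (gmult H x y) u - act x (act y u)) \<in>
    vec_tensor scW UNIV (fun_sum (fun_tensor (ideal H) (coord H)) (fun_tensor (coord H) (ideal H)))"
    using W unfolding rational_module_def by simp
  obtain n :: nat and f v where fv: "\<forall>i<n. f i \<in> fun_sum (fun_tensor (ideal H) (coord H))
      (fun_tensor (coord H) (ideal H)) \<and> v i \<in> UNIV"
    "(\<lambda>(x, y). act (gmult H x y) u - act x (act y u)) = (\<lambda>x. \<Sum>i<n. scW (f i x) (v i))"
    using t unfolding vec_tensor_def mem_Collect_eq by (elim exE conjE)
  have "f i = (\<lambda>_. 0)" if "i < n" for i using zero fv(1) that by simp
  then have "(\<Sum>i<n. scW (f i (g, h)) (v i)) = 0" by (intro sum.neutral) simp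
  then show ?thesis using fun_cong[OF fv(2), of "(g, h)"] by simp
qed

lemma act_inv [simp]: "act (ginv H h) (act h u) = u" "act h (act (ginv H h) u) = u"
  unfolding act_mult[symmetric] by (simp_all add: act_one)

lemma image_act_mult: "act (gmult H g h) ` E = act g ` act h ` E"
  by (auto simp: act_mult image_image)

lemma image_act_inv [simp]: "act (ginv H h) ` act h ` E = E" "act h ` act (ginv H h) ` E = E"
  by (auto simp: image_image)

lemma inj_act: "inj (act h)"
  by (rule inj_on_inverseI[of _ "act (ginv H h)"]) simp

lemma mem_image_act: "u \<in> act h ` E \<longleftrightarrow> act (ginv H h) u \<in> E"
  by (metis act_inv image_iff)

lemma coord_act: "linear_form scW l \<Longrightarrow> (\<lambda>h. l (act h u)) \<in> coord H"
proof -
  assume l: "linear_form scW l"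
  have "(\<lambda>h. act h u) \<in> vec_tensor scW UNIV (coord H)"
    using W unfolding rational_module_def by simp
  then obtain n :: nat and f v where "\<forall>i<n. f i \<in> coord H" "\<And>h. act h u = (\<Sum>i<n. scW (f i h) (v i))"
    unfolding vec_tensor_def by (auto simp: fun_eq_iff)
  then have "(\<lambda>h. \<Sum>i<n. f i h * l (v i)) \<in> coord H"
    by (intro subalg_sum[OF subalg_coord] subalg_mult[OF subalg_coord] subalg_const[OF subalg_coord]) auto
  then show ?thesis
    using \<open>\<And>h. act h u = _\<close> by (simp add: linear_form_sum[OF l] linear_form_scale[OF l])
qed

lemma ringed_H: "ringed (group_variety H)"
  unfolding group_variety_def by (rule ringed_affine[OF subalg_coord])

lemma pts_H [simp]: "pts (group_variety H) = UNIV"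
  unfolding group_variety_def by (rule pts_affine[OF subalg_coord])

lemma local_morphism_into_H:
  "ringed X \<Longrightarrow> is_open X N \<Longrightarrow> (\<And>F. F \<in> coord H \<Longrightarrow> (\<lambda>x. F (f x)) \<in> reg X N) \<Longrightarrow>
    local_morphism X N (group_variety H) f"
  unfolding group_variety_def by (rule local_morphism_into_affine'[OF _ _ subalg_coord])

lemma local_morphism_const: "ringed X \<Longrightarrow> is_open X N \<Longrightarrow> local_morphism X N (group_variety H) (\<lambda>_. h)"
  by (intro local_morphism_into_H reg_const)

lemma reg_coord:
  assumes X: "ringed X" and a: "local_morphism X N (group_variety H) a" and f: "f \<in> coord H"
  shows "(\<lambda>x. f (a x)) \<in> reg X N"
proof -
  have "f \<in> reg (group_variety H) UNIV"
    unfolding group_variety_def by (rule reg_affineI[OF subalg_coord f])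
  from local_morphism_reg[OF a _ this] show ?thesis
    using openin_topspace[of "top (group_variety H)"] by simp
qed

lemma local_morphism_inv:
  assumes X: "ringed X" and a: "local_morphism X N (group_variety H) a"
  shows "local_morphism X N (group_variety H) (\<lambda>x. ginv H (a x))"
  by (rule local_morphism_into_H[OF X local_morphism_open[OF a]]) (rule reg_coord[OF X a coord_inv])

text \<open>Expanding \<open>F x\<close> in a basis turns the result into products of coordinates of
  \<open>F\<close> with matrix coefficients of \<open>act\<close>, which lie in
  \<open>coord H\<close>.\<close>

lemma vreg_act:
  assumes X: "ringed X" and a: "local_morphism X N (group_variety H) a" and F: "vreg scW X N F"
  shows "vreg scW X N (\<lambda>x. act (a x) (F x))"
  unfolding vreg_def
proof (intro allI impI)
  fix l assume l: "linear_form scW l"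
  obtain n :: nat and e m where *: "\<forall>i<n. linear_form scW (m i)" "\<And>v. v = (\<Sum>i<n. scW (m i v) (e i))"
    using fin_dim_coords[OF fin_dim] by blast
  note o = local_morphism_open[OF a]
  have "l (act (a x) (F x)) = (\<Sum>i<n. m i (F x) * l (act (a x) (e i)))" for x
  proof -
    have "l (act (a x) (F x)) = l (act (a x) (\<Sum>i<n. scW (m i (F x)) (e i)))" using *(2)[of "F x"] by simp
    also have "\<dots> = l (\<Sum>i<n. scW (m i (F x)) (act (a x) (e i)))"
      by (simp add: act_sum act_scale)
    finally show ?thesis by (simp add: linear_form_sum[OF l] linear_form_scale[OF l])
  qed
  moreover have "(\<lambda>x. \<Sum>i<n. m i (F x) * l (act (a x) (e i))) \<in> reg X N"
    by (intro reg_sum[OF X o] reg_mult[OF X o] vregD[OF F] reg_coord[OF X a coord_act[OF l]]) (simp add: *)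
  ultimately show "(\<lambda>x. l (act (a x) (F x))) \<in> reg X N" by simp
qed

lemma local_morphism_act:
  assumes X: "ringed X" and a: "local_morphism X N (group_variety H) a"
    and f: "local_morphism X N (grass scW UNIV r) f"
  shows "local_morphism X N (grass scW UNIV r) (\<lambda>x. act (a x) ` f x)"
proof (rule local_morphism_grass_image[OF X vector_space_axioms subspace_UNIV f linear_act])
  fix N' and F :: "'a \<Rightarrow> 'w" assume "is_open X N'" "N' \<subseteq> N" "vreg scW X N' F"
  then show "vreg scW X N' (\<lambda>x. act (a x) (F x))"
    using vreg_act[OF X local_morphism_restrict[OF X a]] by simp
next
  fix x and T :: "nat \<Rightarrow> 'w" assume "T \<in> indep_tuples scW UNIV r"
  then show "(\<lambda>t\<in>{..<r}. act (a x) (T t)) \<in> indep_tuples scW UNIV r"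
    by (rule linear_indep_tuples[OF linear_act]) (auto intro: inj_on_subset[OF inj_act])
qed

end

text \<open>The canonical bundle is treated over any \<open>H\<close>-stable set of subspaces; the
  orbit is an instance.\<close>

locale stable_subvariety = rational_rep scW H act
  for scW :: "'k::field \<Rightarrow> 'w::ab_group_add \<Rightarrow> 'w" and H :: "('h, 'k) grp_scheme" and act +
  fixes r :: nat and Orb :: "'w set set"
  assumes stable: "E \<in> Orb \<Longrightarrow> act h ` E \<in> Orb"
begin

definition "Y = sub_space (grass scW UNIV r) Orb"

lemma ringed_Y: "ringed Y"
  unfolding Y_def by (intro ringed_sub_space ringed_grass)

lemma pts_Y: "pts Y = pts (grass scW UNIV r) \<inter> Orb"
  unfolding Y_def by simp

lemma local_morphism_Y_grass: "local_morphism Y (pts Y) (grass scW UNIV r) (\<lambda>y. y)"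
  unfolding Y_def by (rule local_morphism_incl[OF ringed_grass])

lemma subspace_Y: "y \<in> pts Y \<Longrightarrow> subspace y"
  unfolding pts_Y pts_grass tuple_span_def by auto

lemma local_morphism_act_Y:
  assumes X: "ringed X" and a: "local_morphism X N (group_variety H) a" and f: "local_morphism X N Y f"
  shows "local_morphism X N Y (\<lambda>x. act (a x) ` f x)"
  unfolding Y_def
proof (rule local_morphism_into_sub[OF X local_morphism_act[OF X a]])
  show "local_morphism X N (grass scW UNIV r) f"
    by (rule local_morphism_comp'[OF f local_morphism_Y_grass]) (use local_morphism_pts[OF f] in auto)
  show "(\<lambda>x. act (a x) ` f x) ` N \<subseteq> Orb"
    using local_morphism_pts[OF f] stable unfolding pts_Y by auto
qed

lemma local_morphism_translate: "local_morphism Y (pts Y) Y (\<lambda>y. act h ` y)"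
  by (rule local_morphism_act_Y[OF ringed_Y local_morphism_const[OF ringed_Y openin_topspace]
        local_morphism_id[OF ringed_Y openin_topspace]])

lemma act_Y: "y \<in> pts Y \<Longrightarrow> act h ` y \<in> pts Y"
  by (rule local_morphism_pts[OF local_morphism_translate])

lemma image_translate:
  assumes "U \<subseteq> pts Y"
  shows "(\<lambda>y. act h ` y) ` U = {y \<in> pts Y. act (ginv H h) ` y \<in> U}"
proof
  show "(\<lambda>y. act h ` y) ` U \<subseteq> {y \<in> pts Y. act (ginv H h) ` y \<in> U}" using act_Y assms by auto
  show "{y \<in> pts Y. act (ginv H h) ` y \<in> U} \<subseteq> (\<lambda>y. act h ` y) ` U"
  proof
    fix y assume "y \<in> {y \<in> pts Y. act (ginv H h) ` y \<in> U}"
    then show "y \<in> (\<lambda>y. act h ` y) ` U" by (intro image_eqI[of _ _ "act (ginv H h) ` y"]) auto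
  qed
qed

lemma open_translate: "is_open Y U \<Longrightarrow> is_open Y ((\<lambda>y. act h ` y) ` U)"
  by (subst image_translate[OF openin_subset]) (assumption, rule local_morphism_vimage[OF local_morphism_translate])

lemma dual_frame:
  assumes "x \<in> pts Y"
  shows "\<exists>N e l. is_open Y N \<and> x \<in> N \<and>
    (\<forall>s<r. linear_form scW (l s) \<and> vreg scW Y N (e s)) \<and>
    (\<forall>z\<in>N. (\<forall>s<r. e s z \<in> z \<and> (\<forall>t<r. l s (e t z) = of_bool (s = t))) \<and>
      (\<forall>v\<in>z. v = (\<Sum>s<r. scW (l s v) (e s z))))"
proof -
  obtain N e l where N: "is_open Y N" "x \<in> N" "\<forall>s<r. linear_form scW (l s) \<and> vreg scW Y N (e s)"
    "\<forall>z\<in>N. (\<forall>s<r. e s z \<in> z \<and> (\<forall>t<r. l s (e t z) = of_bool (s = t))) \<and>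
      (\<lambda>t\<in>{..<r}. e t z) \<in> indep_tuples scW UNIV r \<and> tuple_span scW r (\<lambda>t\<in>{..<r}. e t z) = z \<and>
      (\<forall>v\<in>z. v = (\<Sum>s<r. scW (l s v) (e s z)))"
    using grass_dual_frame[OF subspace_UNIV ringed_Y local_morphism_Y_grass assms] by (elim exE conjE)
  have "\<forall>z\<in>N. (\<forall>s<r. e s z \<in> z \<and> (\<forall>t<r. l s (e t z) = of_bool (s = t))) \<and>
      (\<forall>v\<in>z. v = (\<Sum>s<r. scW (l s v) (e s z)))"
  proof
    fix z assume "z \<in> N"
    from bspec[OF N(4) this]
    show "(\<forall>s<r. e s z \<in> z \<and> (\<forall>t<r. l s (e t z) = of_bool (s = t))) \<and>
      (\<forall>v\<in>z. v = (\<Sum>s<r. scW (l s v) (e s z)))" by (elim conjE) (intro conjI)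
  qed
  with N(1-3) show ?thesis by (intro exI conjI)
qed

abbreviation "K \<equiv> family_sections scW Y (\<lambda>y. y)"

text \<open>The generators of the pull-back are restrictions of sections over open sets of the
  Grassmannian. Hence the frame is taken on the Grassmannian and restricted to \<open>Y\<close>
  afterwards.\<close>

lemma sec_canonical_bundle:
  assumes U: "is_open Y U"
  shows "sec (canonical_bundle scW act r Y) U = K U"
proof -
  let ?G = "grass scW UNIV r"
  let ?S = "\<lambda>V. {\<lambda>y\<in>V. s ((\<lambda>y. y) y) | s U. is_open ?G U \<and> (\<lambda>y. y) ` V \<subseteq> U \<and> s \<in> canonical_subsheaf scW r U}"
  have "generated scW Y ?S U = K U"
  proof (rule generated_eq_family_sections[OF ringed_Y U])
    fix x assume "x \<in> U"
    then show "subspace x" using subspace_Y openin_subset[OF U] by auto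
  next
    fix V assume V: "is_open Y V" "V \<subseteq> U"
    show "?S V \<subseteq> K V"
    proof
      fix t assume "t \<in> ?S V"
      then obtain s U' where s: "t = restrict s V" "is_open ?G U'" "V \<subseteq> U'" "s \<in> canonical_subsheaf scW r U'"
        by auto
      then have s': "vreg scW ?G U' s" "\<forall>y\<in>U'. s y \<in> y"
        using free_sections_eq[OF ringed_grass s(2) fin_dim]
        unfolding canonical_subsheaf_def family_sections_def by auto
      have "vreg scW Y V s"
        by (rule vreg_comp'[OF local_morphism_restrict[OF ringed_Y local_morphism_Y_grass V(1)] s'(1) s(2)])
          (use s(3) openin_subset[OF V(1)] in auto)
      then have "vreg scW Y V (restrict s V)" by (rule vreg_cong[OF ringed_Y]) simp
      then show "t \<in> K V" unfolding family_sections_def s(1) using s'(2) s(3) by auto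
    qed
  next
    fix x assume x: "x \<in> U"
    then have xY: "x \<in> pts Y" using openin_subset[OF U] by auto
    then have xG: "x \<in> pts ?G" unfolding pts_Y by simp
    obtain N e l where N: "is_open ?G N" "x \<in> N" "\<forall>s<r. linear_form scW (l s) \<and> vreg scW ?G N (e s)"
      "\<forall>z\<in>N. (\<forall>s<r. e s z \<in> z \<and> (\<forall>t<r. l s (e t z) = of_bool (s = t))) \<and>
        (\<lambda>t\<in>{..<r}. e t z) \<in> indep_tuples scW UNIV r \<and> tuple_span scW r (\<lambda>t\<in>{..<r}. e t z) = z \<and>
        (\<forall>v\<in>z. v = (\<Sum>s<r. scW (l s v) (e s z)))"
      using grass_dual_frame[OF subspace_UNIV ringed_grass local_morphism_id[OF ringed_grass openin_topspace] xG]
      by (elim exE conjE)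
    let ?N = "{z \<in> pts Y. z \<in> N}"
    have oN: "is_open Y ?N" by (rule local_morphism_vimage[OF local_morphism_Y_grass N(1)])
    have "frame scW Y (\<lambda>y. y) ?N r e (\<lambda>i _. l i)"
      unfolding frame_def
    proof (intro conjI allI impI ballI)
      show "is_open Y ?N" by fact
      fix i assume i: "i < r"
      show "vreg scW Y ?N (e i)"
        using vreg_comp[OF local_morphism_Y_grass _ N(1), where sc = scW and F = "e i"] N(3) i by simp
      show "e i y \<in> y" if "y \<in> ?N" for y using N(4) i that by auto
      show "(\<lambda>x. l i (s x)) \<in> reg Y V" if "vreg scW Y V s" for V s
        using vregD[OF that] N(3) i by simp
    next
      show "v = (\<Sum>i<r. scW (l i v) (e i y))" if "y \<in> ?N" "v \<in> y" for y v
        using bspec[OF N(4), of y] that by simp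
    qed
    moreover have "restrict (e i) V \<in> ?S V" if "V \<subseteq> ?N" "i < r" for V i
    proof -
      have "vreg scW ?G N (restrict (e i) N)"
        by (rule vreg_cong[OF ringed_grass, where F = "e i"]) (use N(3) that in auto)
      then have "restrict (e i) N \<in> canonical_subsheaf scW r N"
        unfolding canonical_subsheaf_def free_sections_eq[OF ringed_grass N(1) fin_dim] family_sections_def
        using N(4) that by simp
      moreover have "restrict (e i) V = (\<lambda>y\<in>V. (restrict (e i) N) ((\<lambda>y. y) y))"
        using that(1) by (auto simp: fun_eq_iff)
      moreover have "(\<lambda>y. y) ` V \<subseteq> N" using that(1) by auto
      ultimately show ?thesis using N(1) by blast
    qed
    ultimately show "\<exists>N n e \<gamma>. x \<in> N \<and> frame scW Y (\<lambda>y. y) N n e \<gamma> \<and>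
      (\<forall>V. is_open Y V \<longrightarrow> V \<subseteq> N \<longrightarrow> V \<subseteq> U \<longrightarrow> (\<forall>i<n. restrict (e i) V \<in> ?S V))"
      using xY N(2)
      by - (rule exI[of _ ?N], rule exI[of _ r], rule exI[of _ e], rule exI[of _ "\<lambda>i _. l i"], simp)
  qed
  then show ?thesis unfolding canonical_bundle_def pullback_subsheaf_def by simp
qed

lemma equivariant_canonical_bundle:
  "equivariant_vector_bundle H Y (\<lambda>h y. act h ` y) (canonical_bundle scW act r Y)"
  (is "equivariant_vector_bundle H Y ?b ?F")
proof -
  have F: "fib ?F = (\<lambda>y. y)" "fadd ?F = (+)" "fscale ?F = scW" "fzero ?F = (\<lambda>_. 0)" "fact ?F = act"
    by (simp_all add: canonical_bundle_def)
  note lc = lincomb_eq_sum[of ?F, OF F(2,4), unfolded F(3)]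
  note R = ringed_Y
  let ?P = "prod_space (group_variety H) Y"
  have RP: "ringed ?P" by (rule ringed_prod[OF ringed_H R])
  have f1: "fibre_axioms H Y ?b ?F"
    unfolding fibre_axioms_def F
    using vector_space_on_subspace[OF vector_space_axioms subspace_Y]
    by (auto simp: act_add act_scale act_one act_mult)
  have f2: "section_axioms H Y ?b ?F U" if U: "is_open Y U" for U
  proof -
    have sub: "subspace y" if "y \<in> U" for y
      by (rule subspace_Y) (rule subsetD[OF openin_subset[OF U] that])
    have a1: "K U \<subseteq> Pi\<^sub>E U (\<lambda>y. y)"
      by (rule subsetI) (simp add: family_sections_def PiE_iff)
    have a2: "(\<lambda>y\<in>U. 0) \<in> K U"
      using family_sections_zero[where P = "\<lambda>y. y", OF R U] sub by simp
    have a3: "(\<lambda>y\<in>U. s y + t y) \<in> K U" if "s \<in> K U" "t \<in> K U" for s t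
      using family_sections_add[where P = "\<lambda>y. y", OF R U _ that] sub by simp
    have a4: "(\<lambda>y\<in>U. scW (f y) (s y)) \<in> K U" if "f \<in> reg Y U" "s \<in> K U" for f s
      using family_sections_scale[where P = "\<lambda>y. y", OF R U _ that] sub by simp
    have a5: "restrict s V \<in> sec ?F V" if "is_open Y V" "V \<subseteq> U" "s \<in> K U" for V s
      unfolding sec_canonical_bundle[OF that(1)] by (rule restrict_family_sections[OF R U that])
    \<comment> \<open>The translate is \<open>s\<close> composed with the morphism given by the
      inverse of \<open>h\<close>, followed by the action of the fixed element
      \<open>h\<close>.\<close>
    have a6: "translate H ?b ?F h U s \<in> sec ?F (?b h ` U)" if s: "s \<in> K U" for h s
      unfolding sec_canonical_bundle[OF open_translate[OF U]]
    proof -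
      let ?V = "?b h ` U"
      note oV = open_translate[OF U, of h]
      have Vp: "?V \<subseteq> pts Y" by (rule openin_subset[OF oV])
      have 1: "local_morphism Y ?V Y (\<lambda>y. act (ginv H h) ` y)"
        by (rule local_morphism_restrict[OF R local_morphism_translate oV Vp])
      have 2: "vreg scW Y U s" using s unfolding family_sections_def by simp
      have "vreg scW Y ?V (\<lambda>y. s (act (ginv H h) ` y))"
        by (rule vreg_comp'[OF 1 2 U]) auto
      from vreg_act[OF R local_morphism_const[OF R oV] this]
      have "vreg scW Y ?V (translate H ?b ?F h U s)"
        by (rule vreg_cong[OF R]) (simp add: translate_def F)
      then show "translate H ?b ?F h U s \<in> K ?V"
        using s unfolding family_sections_def translate_def F by auto
    qed
    have a7: "s \<in> K U" if s: "s \<in> extensional U"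
      and loc: "\<forall>y\<in>U. \<exists>V. is_open Y V \<and> y \<in> V \<and> V \<subseteq> U \<and> restrict s V \<in> sec ?F V" for s
    proof (rule family_sections_local[OF R U s])
      fix y assume "y \<in> U"
      from bspec[OF loc this] obtain V where "is_open Y V" "y \<in> V" "V \<subseteq> U" "restrict s V \<in> sec ?F V"
        by (elim exE conjE)
      then show "\<exists>V. is_open Y V \<and> y \<in> V \<and> V \<subseteq> U \<and> restrict s V \<in> K V"
        using sec_canonical_bundle by (intro exI[of _ V]) simp
    qed
    show ?thesis
      unfolding section_axioms_def sec_canonical_bundle[OF U] F
      using a1 a2 a3 a4 a5 a6 a7 open_translate[OF U] by simp
  qed
  have f3: "\<exists>U n e. trivializes Y ?F y U n e" if y: "y \<in> pts Y" for y
  proof -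
    obtain N e l where N: "is_open Y N" "y \<in> N" "\<forall>s<r. linear_form scW (l s) \<and> vreg scW Y N (e s)"
      "\<forall>z\<in>N. (\<forall>s<r. e s z \<in> z \<and> (\<forall>t<r. l s (e t z) = of_bool (s = t))) \<and>
        (\<forall>v\<in>z. v = (\<Sum>s<r. scW (l s v) (e s z)))"
      using dual_frame[OF y] by (elim exE conjE)
    have "trivializes Y ?F y N r (\<lambda>i. restrict (e i) N)"
      unfolding trivializes_def lc
    proof (intro conjI allI impI ballI)
      show "is_open Y N" "y \<in> N" by fact+
      show "restrict (e i) N \<in> sec ?F N" if "i < r" for i
        unfolding sec_canonical_bundle[OF N(1)] family_sections_def
        using N(3,4) that vreg_cong[OF R, of scW N "e i" "restrict (e i) N"] by auto
      fix V s assume V: "is_open Y V" "V \<subseteq> N" and "s \<in> sec ?F V"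
      then have s: "vreg scW Y V s" "\<forall>z\<in>V. s z \<in> z"
        unfolding sec_canonical_bundle[OF V(1)] family_sections_def by auto
      have 1: "(\<lambda>z. l i (s z)) \<in> reg Y V" if "i < r" for i using vregD[OF s(1)] N(3) that by simp
      have 2: "s z = (\<Sum>i<r. scW (l i (s z)) (restrict (e i) N z))" if "z \<in> V" for z
        using N(4) s(2) that V(2) by auto
      \<comment> \<open>The dual forms recover the coefficients from the section, whence their
        uniqueness.\<close>
      have 3: "c i = l i (s z)" if z: "z \<in> V" and "s z = (\<Sum>i<r. scW (c i) (restrict (e i) N z))" "i < r" for z c i
        unfolding that(2)
        by (rule dual_forms_coeff[symmetric]) (use N(3,4) z V(2) that(3) in auto)
      show "\<exists>c. (\<forall>i<r. c i \<in> reg Y V) \<and> (\<forall>z\<in>V. s z = (\<Sum>i<r. scW (c i z) (restrict (e i) N z))) \<and>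
        (\<forall>c'. (\<forall>i<r. c' i \<in> reg Y V) \<and> (\<forall>z\<in>V. s z = (\<Sum>i<r. scW (c' i z) (restrict (e i) N z))) \<longrightarrow>
          (\<forall>i<r. \<forall>z\<in>V. c' i z = c i z))"
        by (rule exI[of _ "\<lambda>i z. l i (s z)"], intro conjI allI impI ballI)
          (erule 1, erule 2, elim conjE, rule 3, assumption, erule (1) bspec)
    qed
    then show ?thesis by (intro exI)
  qed
  have f4: "algebraic_at H Y ?b ?F U s h0 y0"
    if U: "is_open Y U" and s: "s \<in> sec ?F U" and y0: "y0 \<in> pts Y" "act (ginv H h0) ` y0 \<in> U" for U s h0 y0
  proof -
    obtain V e l where V: "is_open Y V" "y0 \<in> V" "\<forall>s<r. linear_form scW (l s) \<and> vreg scW Y V (e s)"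
      "\<forall>z\<in>V. (\<forall>s<r. e s z \<in> z \<and> (\<forall>t<r. l s (e t z) = of_bool (s = t))) \<and>
        (\<forall>v\<in>z. v = (\<Sum>s<r. scW (l s v) (e s z)))"
      using dual_frame[OF y0(1)] by (elim exE conjE)
    have s': "vreg scW Y U s" "\<forall>z\<in>U. s z \<in> z"
      using s unfolding sec_canonical_bundle[OF U] family_sections_def by auto
    let ?A = "UNIV \<times> pts Y :: ('h \<times> 'w set) set"
    have f: "local_morphism ?P ?A (group_variety H) fst" "local_morphism ?P ?A Y snd"
      using local_morphism_fst[OF ringed_H R] local_morphism_snd[OF ringed_H R] by simp_all
    have m: "local_morphism ?P ?A Y (\<lambda>z. act (ginv H (fst z)) ` snd z)"
      by (rule local_morphism_act_Y[OF RP local_morphism_inv[OF RP f(1)] f(2)])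
    define N1 where "N1 = {z \<in> ?A. act (ginv H (fst z)) ` snd z \<in> U}"
    define N where "N = N1 \<inter> {z \<in> ?A. snd z \<in> V}"
    have o1: "is_open ?P N1" unfolding N1_def by (rule local_morphism_vimage[OF m U])
    have o: "is_open ?P N" unfolding N_def
      by (intro openin_Int o1 local_morphism_vimage[OF f(2) V(1)])
    have "vreg scW ?P N1 (\<lambda>z. s (act (ginv H (fst z)) ` snd z))"
      unfolding N1_def by (rule vreg_comp[OF m s'(1) U])
    then have "vreg scW ?P N (\<lambda>z. s (act (ginv H (fst z)) ` snd z))"
      by (rule vreg_restrict[OF RP _ o1 o]) (simp add: N_def)
    moreover have "local_morphism ?P N (group_variety H) fst"
      by (rule local_morphism_restrict[OF RP f(1) o]) (auto simp: N_def)
    ultimately have v: "vreg scW ?P N (\<lambda>z. act (fst z) (s (act (ginv H (fst z)) ` snd z)))"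
      by (intro vreg_act[OF RP])
    \<comment> \<open>The translated section is a regular function on the product with values in
      \<open>y\<close>, so the forms dual to a frame near \<open>y0\<close> yield its
      coefficients.\<close>
    define c where "c i z = l i (act (fst z) (s (act (ginv H (fst z)) ` snd z)))" for i z
    have c: "c i \<in> reg ?P N" if "i < r" for i
      unfolding c_def[abs_def] using vregD[OF v] V(3) that by simp
    have ei: "restrict (e i) V \<in> sec ?F V" if "i < r" for i
      unfolding sec_canonical_bundle[OF V(1)] family_sections_def
      using V(3,4) that vreg_cong[OF R, of scW V "e i" "restrict (e i) V"] by auto
    have main: "y \<in> V \<and> act (ginv H h) ` y \<in> U \<and>
      act h (s (act (ginv H h) ` y)) = (\<Sum>i<r. scW (c i (h, y)) (restrict (e i) V y))" if "(h, y) \<in> N" for h y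
    proof -
      have y: "y \<in> V" "act (ginv H h) ` y \<in> U" using that unfolding N_def N1_def by auto
      have "s (act (ginv H h) ` y) \<in> act (ginv H h) ` y" using s'(2) y(2) by simp
      then have "act h (s (act (ginv H h) ` y)) \<in> act h ` act (ginv H h) ` y" by (rule imageI)
      then have "act h (s (act (ginv H h) ` y)) \<in> y" by simp
      then show ?thesis using V(4) y unfolding c_def by simp
    qed
    have N0: "(h0, y0) \<in> N" using V(2) y0 unfolding N_def N1_def by simp
    have "\<forall>(h, y)\<in>N. y \<in> V \<and> act (ginv H h) ` y \<in> U \<and>
      act h (s (act (ginv H h) ` y)) = (\<Sum>i<r. scW (c i (h, y)) (restrict (e i) V y))"
      unfolding Ball_def split_paired_All case_prod_conv by (intro allI impI, rule main)
    with N0 show ?thesis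
      unfolding algebraic_at_def lc F
      by - (rule exI[of _ N], rule exI[of _ V], rule exI[of _ r], rule exI[of _ c],
          rule exI[of _ "\<lambda>i. restrict (e i) V"], intro conjI allI impI,
          rule o, assumption, rule V(1), erule c, erule ei, assumption)
  qed
  show ?thesis
    unfolding equivariant_vector_bundle_iff
    by (intro conjI allI impI ballI) (rule f1, erule f2, erule f3, rule f4)
qed

end

lemma vector_space_on_image:
  assumes V: "vector_space_on V add sm z"
    and add: "\<And>u v. u \<in> V \<Longrightarrow> v \<in> V \<Longrightarrow> add' (\<theta> u) (\<theta> v) = \<theta> (add u v)"
    and sm: "\<And>c u. u \<in> V \<Longrightarrow> sm' c (\<theta> u) = \<theta> (sm c u)"
  shows "vector_space_on (\<theta> ` V) add' sm' (\<theta> z)"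
proof -
  note v = V[unfolded vector_space_on_def]
  have neg: "\<exists>b\<in>V. add a b = z" if "a \<in> V" for a using v that by blast
  have "\<exists>b\<in>\<theta> ` V. add' (\<theta> a) b = \<theta> z" if a: "a \<in> V" for a
  proof -
    obtain b where "b \<in> V" "add a b = z" using neg[OF a] by auto
    then show ?thesis using add[OF a] by (intro bexI[of _ "\<theta> b"]) simp_all
  qed
  moreover have "add a (add b c) = add b (add a c)" if "a \<in> V" "b \<in> V" "c \<in> V" for a b c
  proof -
    have "add a b = add b a" using v that by blast
    then have "add (add a b) c = add (add b a) c" by simp
    moreover have "add (add a b) c = add a (add b c)" "add (add b a) c = add b (add a c)"
      using v that by blast+
    ultimately show ?thesis by simp
  qed
  moreover have "add a z = a" if a: "a \<in> V" for a
  proof -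
    have "add a z = add z a" "add z a = a" using v a by blast+
    then show ?thesis by simp
  qed
  ultimately show ?thesis
    unfolding vector_space_on_def ball_simps(9) using v by (simp add: add sm)
qed

text \<open>Used for the contracted product, whose operations act on sets of pairs: being images of
  the operations of \<open>F\<close>, they inherit the axioms.\<close>

lemma fibre_axioms_transfer:
  assumes F: "fibre_axioms H Y b F" and bY: "\<And>h y. y \<in> pts Y \<Longrightarrow> b h y \<in> pts Y"
    and fib': "\<And>y. y \<in> pts Y \<Longrightarrow> fib F' y = \<theta> y ` fib F y"
    and one: "\<And>y. y \<in> pts Y \<Longrightarrow> b (gone H) y = y"
    and mult: "\<And>g h y. y \<in> pts Y \<Longrightarrow> b (gmult H g h) y = b g (b h y)"
    and add: "\<And>y u v. y \<in> pts Y \<Longrightarrow> u \<in> fib F y \<Longrightarrow> v \<in> fib F y \<Longrightarrow>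
      \<theta> y (fadd F u v) = fadd F' (\<theta> y u) (\<theta> y v)"
    and scale: "\<And>y c u. y \<in> pts Y \<Longrightarrow> u \<in> fib F y \<Longrightarrow> \<theta> y (fscale F c u) = fscale F' c (\<theta> y u)"
    and zero: "\<And>y. y \<in> pts Y \<Longrightarrow> \<theta> y (fzero F y) = fzero F' y"
    and act: "\<And>h y u. y \<in> pts Y \<Longrightarrow> u \<in> fib F y \<Longrightarrow> fact F' h (\<theta> y u) = \<theta> (b h y) (fact F h u)"
  shows "fibre_axioms H Y b F'"
  unfolding fibre_axioms_def
proof (intro conjI ballI)
  fix y assume y: "y \<in> pts Y"
  have v: "vector_space_on (fib F y) (fadd F) (fscale F) (fzero F y)"
    using F y unfolding fibre_axioms_def by simp
  show "vector_space_on (fib F' y) (fadd F') (fscale F') (fzero F' y)"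
    unfolding fib'[OF y] zero[OF y, symmetric]
    by (rule vector_space_on_image[OF v]) (simp_all add: add[OF y] scale[OF y])
  have a: "\<forall>u\<in>fib F y. \<forall>h. fact F h u \<in> fib F (b h y) \<and>
       (\<forall>v\<in>fib F y. fact F h (fadd F u v) = fadd F (fact F h u) (fact F h v)) \<and>
       (\<forall>c. fact F h (fscale F c u) = fscale F c (fact F h u)) \<and>
       fact F (gone H) u = u \<and>
       (\<forall>g. fact F (gmult H g h) u = fact F g (fact F h u))"
    using F y unfolding fibre_axioms_def by simp
  fix u' assume "u' \<in> fib F' y"
  then obtain u where u: "u \<in> fib F y" "u' = \<theta> y u" unfolding fib'[OF y] by auto
  note au = bspec[OF a u(1)]
  show "\<forall>h. fact F' h u' \<in> fib F' (b h y) \<and>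
       (\<forall>v\<in>fib F' y. fact F' h (fadd F' u' v) = fadd F' (fact F' h u') (fact F' h v)) \<and>
       (\<forall>c. fact F' h (fscale F' c u') = fscale F' c (fact F' h u')) \<and>
       fact F' (gone H) u' = u' \<and>
       (\<forall>g. fact F' (gmult H g h) u' = fact F' g (fact F' h u'))"
  proof (intro allI conjI ballI)
    fix h
    have hu: "fact F h u \<in> fib F (b h y)" using au by simp
    note hy = bY[OF y, of h]
    show "fact F' h u' \<in> fib F' (b h y)" unfolding u(2) act[OF y u(1)] fib'[OF hy] using hu by simp
    show "fact F' h (fscale F' c u') = fscale F' c (fact F' h u')" for c
      unfolding u(2) act[OF y u(1)] scale[OF y u(1), symmetric] scale[OF hy hu, symmetric]
      using act[OF y vector_space_on_scale[OF v u(1)]] au by simp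
    show "fact F' (gone H) u' = u'"
      unfolding u(2) act[OF y u(1)] one[OF y] using au by simp
    show "fact F' (gmult H g h) u' = fact F' g (fact F' h u')" for g
      unfolding u(2) act[OF y u(1)] act[OF hy hu] mult[OF y] using au by simp
    fix v' assume "v' \<in> fib F' y"
    then obtain w where w: "w \<in> fib F y" "v' = \<theta> y w" unfolding fib'[OF y] by auto
    have hw: "fact F h w \<in> fib F (b h y)" using bspec[OF a w(1)] by simp
    show "fact F' h (fadd F' u' v') = fadd F' (fact F' h u') (fact F' h v')"
      unfolding u(2) w(2) act[OF y u(1)] act[OF y w(1)] add[OF y u(1) w(1), symmetric] add[OF hy hu hw, symmetric]
      using act[OF y vector_space_on_add[OF v u(1) w(1)]] au w(1) by simp
  qed
qed

section \<open>The orbit and the contracted product\<close>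

locale orbit = rational_rep scW H act
  for scW :: "'k::field \<Rightarrow> 'w::ab_group_add \<Rightarrow> 'w" and H :: "('h, 'k) grp_scheme" and act +
  fixes r :: nat and \<epsilon> :: "'w set"
  assumes r: "0 < r" and eps: "subspace \<epsilon>" "dim \<epsilon> = r"
begin

sublocale stable_subvariety scW H act r "range (\<lambda>h. act h ` \<epsilon>)"
proof
  fix E h assume "E \<in> range (\<lambda>h. act h ` \<epsilon>)"
  then obtain g where "E = act g ` \<epsilon>" by auto
  then have "act h ` E = act (gmult H h g) ` \<epsilon>" by (simp add: image_act_mult)
  then show "act h ` E \<in> range (\<lambda>h. act h ` \<epsilon>)" by blast
qed

lemma pts_Y_orbit: "pts Y = range (\<lambda>h. act h ` \<epsilon>)"
proof -
  have "act h ` \<epsilon> \<in> pts (grass scW UNIV r)" for h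
  proof -
    obtain T where T: "T \<in> indep_tuples scW UNIV r" "tuple_span scW r T = \<epsilon>"
      using ex_indep_tuple[OF eps r subset_UNIV] by auto
    have "(\<lambda>t\<in>{..<r}. act h (T t)) \<in> indep_tuples scW UNIV r"
      by (rule linear_indep_tuples[OF linear_act T(1)]) (auto intro: inj_on_subset[OF inj_act])
    moreover have "tuple_span scW r (\<lambda>t\<in>{..<r}. act h (T t)) = act h ` \<epsilon>"
      unfolding linear_tuple_span[OF linear_act] T(2) ..
    ultimately show ?thesis unfolding pts_grass by (metis imageI)
  qed
  then show ?thesis unfolding pts_Y by auto
qed

end

locale homogeneous_orbit = orbit scW H act r \<epsilon>
  for scW :: "'k::field \<Rightarrow> 'w::ab_group_add \<Rightarrow> 'w" and H :: "('h, 'k) grp_scheme" and act r \<epsilon> +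
  fixes S :: "'h set" and \<phi> :: "'h set \<Rightarrow> 'w set"
  assumes S: "S = {h. act h ` \<epsilon> = \<epsilon>}"
    and phi: "\<phi> = (\<lambda>c. \<Union>h\<in>c. act h ` \<epsilon>)"
    and phi_iso: "isomorphism (homogeneous_space H S) Y \<phi>"
begin

abbreviation "X \<equiv> homogeneous_space H S"
abbreviation "CP \<equiv> contracted_product H S scW act \<epsilon>"
abbreviation "j \<equiv> inv_into (pts X) \<phi>"

text \<open>The class in the contracted product corresponding to \<open>u \<in> y\<close>, where \<open>y\<close> lies in the orbit.\<close>

definition cls :: "'w set \<Rightarrow> 'w \<Rightarrow> ('h \<times> 'w) set"
  where "cls y u = {(h, act (ginv H h) u) | h. act h ` \<epsilon> = y}"

text \<open>The evaluation map from the contracted product to \<open>W\<close>: all representatives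
  \<open>(h, u)\<close> of a class give the same vector \<open>act h u\<close>.\<close>

definition ev :: "('h \<times> 'w) set \<Rightarrow> 'w"
  where "ev c = (THE w. \<forall>(h, u)\<in>c. w = act h u)"

lemma left_coset_eq: "left_coset H S h = {g. act g ` \<epsilon> = act h ` \<epsilon>}"
proof (intro equalityI subsetI)
  fix g assume "g \<in> left_coset H S h"
  then obtain s where "act s ` \<epsilon> = \<epsilon>" "g = gmult H h s" unfolding left_coset_def S by auto
  then show "g \<in> {g. act g ` \<epsilon> = act h ` \<epsilon>}" by (simp add: image_act_mult)
next
  fix g assume "g \<in> {g. act g ` \<epsilon> = act h ` \<epsilon>}"
  then have "act (gmult H (ginv H h) g) ` \<epsilon> = \<epsilon>" by (simp add: image_act_mult)
  moreover have "g = gmult H h (gmult H (ginv H h) g)" by (simp add: H.assoc[symmetric])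
  ultimately show "g \<in> left_coset H S h" unfolding left_coset_def S by blast
qed

lemma pts_X: "pts X = range (left_coset H S)"
  unfolding homogeneous_space_def by simp

lemma phi_left_coset: "\<phi> (left_coset H S h) = act h ` \<epsilon>"
  unfolding phi left_coset_eq by auto

lemma ringed_X: "ringed X"
  unfolding homogeneous_space_def by (rule ringed_quot_space[OF ringed_H])

lemma bij_phi: "bij_betw \<phi> (pts X) (pts Y)"
  using phi_iso unfolding isomorphism_def by simp

lemma j_eq: "y \<in> pts Y \<Longrightarrow> j y = {h. act h ` \<epsilon> = y}"
proof -
  assume "y \<in> pts Y"
  then obtain h where h: "y = act h ` \<epsilon>" unfolding pts_Y_orbit by auto
  have "j (\<phi> (left_coset H S h)) = left_coset H S h"
    by (rule inv_into_f_f[OF bij_betw_imp_inj_on[OF bij_phi]]) (simp add: pts_X)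
  then show ?thesis unfolding h phi_left_coset by (simp add: left_coset_eq)
qed

lemma phi_j: "y \<in> pts Y \<Longrightarrow> \<phi> (j y) = y"
  using bij_betw_inv_into_right[OF bij_phi] .

lemma j_phi: "v \<in> pts X \<Longrightarrow> j (\<phi> v) = v"
  using bij_betw_inv_into_left[OF bij_phi] .

lemma local_morphism_phi: "local_morphism X (pts X) Y \<phi>"
  and local_morphism_j: "local_morphism Y (pts Y) X j"
  using phi_iso unfolding isomorphism_def morphism_iff by simp_all

lemma j_image:
  assumes "U \<subseteq> pts Y"
  shows "j ` U = {v \<in> pts X. \<phi> v \<in> U}"
proof (intro equalityI subsetI)
  fix v assume "v \<in> j ` U"
  then show "v \<in> {v \<in> pts X. \<phi> v \<in> U}"
    using assms phi_j local_morphism_pts[OF local_morphism_j] by auto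
next
  fix v assume "v \<in> {v \<in> pts X. \<phi> v \<in> U}"
  then show "v \<in> j ` U" using j_phi[of v] by (intro image_eqI[of _ _ "\<phi> v"]) simp_all
qed

text \<open>Substituting \<open>g = h s\<close>, the representative \<open>(h s, s^-1 u)\<close>
  becomes \<open>(g, g^-1 (h u))\<close>. So the class depends only on the translate of
  \<open>\<epsilon>\<close> by \<open>h\<close> and on the vector \<open>act h u\<close>.\<close>

lemma contracted_class_eq: "contracted_class H S act (h, u) = cls (act h ` \<epsilon>) (act h u)"
proof (intro equalityI subsetI)
  fix z assume "z \<in> contracted_class H S act (h, u)"
  then obtain s where s: "s \<in> S" "z = (gmult H h s, act (ginv H s) u)"
    unfolding contracted_class_def by auto
  have "act (ginv H (gmult H h s)) (act h u) = act (ginv H s) u"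
    by (simp add: H.inverse_distrib_swap act_mult)
  moreover have "act (gmult H h s) ` \<epsilon> = act h ` \<epsilon>" using s(1) unfolding S by (simp add: image_act_mult)
  ultimately show "z \<in> cls (act h ` \<epsilon>) (act h u)" unfolding cls_def s(2) by auto
next
  fix z assume "z \<in> cls (act h ` \<epsilon>) (act h u)"
  then obtain g where g: "act g ` \<epsilon> = act h ` \<epsilon>" "z = (g, act (ginv H g) (act h u))"
    unfolding cls_def by auto
  let ?s = "gmult H (ginv H h) g"
  have "act ?s ` \<epsilon> = \<epsilon>" using g(1) by (simp add: image_act_mult)
  moreover have "gmult H h ?s = g" by (simp add: H.assoc[symmetric])
  moreover have "act (ginv H ?s) u = act (ginv H g) (act h u)"
    by (simp add: H.inverse_distrib_swap act_mult)
  ultimately show "z \<in> contracted_class H S act (h, u)" unfolding contracted_class_def S g(2) by force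
qed

abbreviation "VE \<equiv> sub_space (vector_variety scW) \<epsilon>"

lemma ringed_VE: "ringed VE"
  by (intro ringed_sub_space ringed_vector_variety)

lemma pts_prod_VE: "pts (prod_space (group_variety H) VE) = UNIV \<times> \<epsilon>"
  using pts_prod[OF ringed_H ringed_VE] by simp

lemma pts_CP: "pts CP = (\<Union>y\<in>pts Y. cls y ` y)"
proof -
  have "pts CP = contracted_class H S act ` (UNIV \<times> \<epsilon>)"
    unfolding contracted_product_def by (simp add: pts_prod_VE)
  also have "\<dots> = (\<Union>y\<in>pts Y. cls y ` y)"
  proof (intro equalityI subsetI)
    fix c assume "c \<in> contracted_class H S act ` (UNIV \<times> \<epsilon>)"
    then obtain h u where "u \<in> \<epsilon>" "c = contracted_class H S act (h, u)" by auto
    then show "c \<in> (\<Union>y\<in>pts Y. cls y ` y)" unfolding pts_Y_orbit contracted_class_eq by auto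
  next
    fix c assume "c \<in> (\<Union>y\<in>pts Y. cls y ` y)"
    then obtain h u where "u \<in> \<epsilon>" "c = cls (act h ` \<epsilon>) (act h u)" unfolding pts_Y_orbit by auto
    then show "c \<in> contracted_class H S act ` (UNIV \<times> \<epsilon>)"
      unfolding contracted_class_eq[symmetric] by blast
  qed
  finally show ?thesis .
qed

lemma fst_cls: "fst ` cls y u = {h. act h ` \<epsilon> = y}"
  unfolding cls_def by (auto simp: image_iff)

lemma ev_cls: "y \<in> pts Y \<Longrightarrow> ev (cls y u) = u"
  unfolding ev_def cls_def pts_Y_orbit by (rule the_equality) auto

lemma fib_assoc:
  assumes y: "y \<in> pts Y"
  shows "{c \<in> pts CP. fst ` c = j y} = cls y ` y"
proof (intro equalityI subsetI)
  fix c assume "c \<in> {c \<in> pts CP. fst ` c = j y}"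
  then obtain y' u where c: "y' \<in> pts Y" "u \<in> y'" "c = cls y' u" "fst ` c = j y"
    unfolding pts_CP by auto
  then have "{h. act h ` \<epsilon> = y'} = {h. act h ` \<epsilon> = y}" by (simp add: fst_cls j_eq[OF y])
  then have "y' = y" using c(1) unfolding pts_Y_orbit by auto
  then show "c \<in> cls y ` y" using c by simp
next
  fix c assume "c \<in> cls y ` y"
  then obtain u where u: "u \<in> y" "c = cls y u" by auto
  then have "c \<in> pts CP" unfolding pts_CP using y by auto
  then show "c \<in> {c \<in> pts CP. fst ` c = j y}" unfolding u(2) by (simp add: fst_cls j_eq[OF y])
qed

lemma local_morphism_orbit_map: "local_morphism (group_variety H) UNIV Y (\<lambda>h. act h ` \<epsilon>)"
proof -
  have 1: "local_morphism (group_variety H) UNIV X (left_coset H S)"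
    using local_morphism_quot_map[of "group_variety H" "left_coset H S"]
    unfolding homogeneous_space_def by simp
  have "local_morphism (group_variety H) UNIV Y (\<lambda>h. \<phi> (left_coset H S h))"
    by (rule local_morphism_comp'[OF 1 local_morphism_phi]) (auto simp: pts_X)
  then show ?thesis by (simp add: phi_left_coset)
qed

text \<open>Upstairs this is the action map from the product of \<open>H\<close> and
  \<open>\<epsilon>\<close> to \<open>W\<close>; it is constant on classes and therefore
  descends.\<close>

lemma local_morphism_ev: "local_morphism CP (pts CP) (vector_variety scW) ev"
proof -
  let ?P = "prod_space (group_variety H) VE"
  have RP: "ringed ?P" by (rule ringed_prod[OF ringed_H ringed_VE])
  have oP: "is_open ?P (UNIV \<times> \<epsilon>)" using openin_topspace[of "top ?P"] by (simp add: pts_prod_VE)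
  have f: "local_morphism ?P (UNIV \<times> \<epsilon>) (group_variety H) fst" "local_morphism ?P (UNIV \<times> \<epsilon>) VE snd"
    using local_morphism_fst[OF ringed_H ringed_VE] local_morphism_snd[OF ringed_H ringed_VE] by simp_all
  have s: "local_morphism ?P (UNIV \<times> \<epsilon>) (vector_variety scW) snd"
    using local_morphism_comp'[OF f(2) local_morphism_incl[OF ringed_vector_variety]] by fastforce
  have ou: "is_open (vector_variety scW) UNIV" using openin_topspace[of "top (vector_variety scW)"] by simp
  have "vreg scW ?P (UNIV \<times> \<epsilon>) (\<lambda>z. act (fst z) (snd z))"
    by (rule vreg_act[OF RP f(1) vreg_comp'[OF s vreg_vector_variety ou]]) simp
  then have "local_morphism ?P (UNIV \<times> \<epsilon>) (vector_variety scW) (\<lambda>z. act (fst z) (snd z))"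
    by (rule local_morphism_vector_variety[OF RP oP])
  then have "local_morphism ?P (UNIV \<times> \<epsilon>) (vector_variety scW) (\<lambda>z. ev (contracted_class H S act z))"
  proof (rule local_morphism_cong[OF RP])
    fix z :: "'h \<times> 'w"
    have "act (fst z) ` \<epsilon> \<in> pts Y" unfolding pts_Y_orbit by simp
    then show "act (fst z) (snd z) = ev (contracted_class H S act z)"
      using ev_cls contracted_class_eq[of "fst z" "snd z"] by simp
  qed
  moreover have "{x \<in> pts ?P. contracted_class H S act x \<in> pts CP} = UNIV \<times> \<epsilon>"
    unfolding contracted_product_def by (auto simp: pts_prod_VE)
  ultimately show ?thesis
    unfolding contracted_product_def
    by (intro local_morphism_from_quot) (simp_all add: pts_prod_VE)
qed

text \<open>Composition with \<open>ev\<close> leads from the contracted product to the canonical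
  bundle, and lifting to \<open>H\<close> leads back. Both halves of \<open>phi_iso\<close> enter:
  the inverse map \<open>j\<close> is regular in the first inclusion, \<open>\<phi>\<close> is
  regular in the second.\<close>

lemma sec_associated:
  assumes U: "is_open Y U"
  shows "sec (transport j (associated_bundle H S scW act \<epsilon>)) U = (\<lambda>t. \<lambda>y\<in>U. cls y (t y)) ` K U"
proof -
  let ?V = "j ` U"
  have Up: "U \<subseteq> pts Y" by (rule openin_subset[OF U])
  have V: "is_open X ?V" unfolding j_image[OF Up] by (rule local_morphism_vimage[OF local_morphism_phi U])
  have s: "sec (transport j (associated_bundle H S scW act \<epsilon>)) U =
    {\<lambda>y\<in>U. s (j y) | s. s \<in> extensional ?V \<and> local_morphism X ?V CP s \<and> (\<forall>v\<in>?V. fst ` s v = v)}"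
    unfolding transport_def associated_bundle_def local_morphism_sub_open[OF ringed_X V, symmetric] by simp
  show ?thesis
    unfolding s
  proof (intro equalityI subsetI)
    fix s' assume "s' \<in> {\<lambda>y\<in>U. s (j y) | s. s \<in> extensional ?V \<and> local_morphism X ?V CP s \<and> (\<forall>v\<in>?V. fst ` s v = v)}"
    then obtain s where s: "s' = (\<lambda>y\<in>U. s (j y))" "local_morphism X ?V CP s" "\<forall>v\<in>?V. fst ` s v = v" by auto
    define t where "t = (\<lambda>y\<in>U. ev (s (j y)))"
    have st: "s (j y) = cls y (t y) \<and> t y \<in> y" if y: "y \<in> U" for y
    proof -
      have "s (j y) \<in> {c \<in> pts CP. fst ` c = j y}"
        using local_morphism_pts[OF s(2)] s(3) y by auto
      then have "s (j y) \<in> cls y ` y" using fib_assoc[of y] Up y by blast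
      then obtain u where u: "u \<in> y" "s (j y) = cls y u" by auto
      then show ?thesis using ev_cls[of y u] Up y by (auto simp: t_def)
    qed
    have jU: "local_morphism Y U X j" by (rule local_morphism_restrict[OF ringed_Y local_morphism_j U Up])
    have "local_morphism Y U CP (\<lambda>y. s (j y))" by (rule local_morphism_comp'[OF jU s(2)]) simp
    then have "local_morphism Y U (vector_variety scW) (\<lambda>y. ev (s (j y)))"
      by (rule local_morphism_comp'[OF _ local_morphism_ev]) (use local_morphism_pts[OF s(2)] in auto)
    from vreg_comp'[OF this vreg_vector_variety[of _ UNIV]]
    have "vreg scW Y U (\<lambda>y. ev (s (j y)))" using openin_topspace[of "top (vector_variety scW)"] by simp
    then have "vreg scW Y U t" by (rule vreg_cong[OF ringed_Y]) (simp add: t_def)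
    then have "t \<in> K U" using st unfolding family_sections_def by (simp add: t_def)
    moreover have "s' = (\<lambda>y\<in>U. cls y (t y))" unfolding s(1) using st by (intro restrict_ext) simp
    ultimately show "s' \<in> (\<lambda>t. \<lambda>y\<in>U. cls y (t y)) ` K U" by blast
  next
    fix s' assume "s' \<in> (\<lambda>t. \<lambda>y\<in>U. cls y (t y)) ` K U"
    then obtain t where t: "s' = (\<lambda>y\<in>U. cls y (t y))" "vreg scW Y U t" "\<forall>y\<in>U. t y \<in> y"
      unfolding family_sections_def by auto
    define s where "s = (\<lambda>v\<in>?V. cls (\<phi> v) (t (\<phi> v)))"
    let ?N = "{h. act h ` \<epsilon> \<in> U}"
    have N: "is_open (group_variety H) ?N"
      using local_morphism_vimage[OF local_morphism_orbit_map U] by simp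
    have id: "local_morphism (group_variety H) ?N (group_variety H) (\<lambda>h. h)"
      by (rule local_morphism_id[OF ringed_H N])
    have om: "local_morphism (group_variety H) ?N Y (\<lambda>h. act h ` \<epsilon>)"
      by (rule local_morphism_restrict[OF ringed_H local_morphism_orbit_map N]) simp
    \<comment> \<open>The second component of the lift of the section to the product of
      \<open>H\<close> and \<open>\<epsilon>\<close>. It lies in \<open>\<epsilon>\<close> because
      the value of \<open>t\<close> lies in the translate of \<open>\<epsilon>\<close> by
      \<open>h\<close>.\<close>
    have "vreg scW (group_variety H) ?N (\<lambda>h. act (ginv H h) (t (act h ` \<epsilon>)))"
      by (rule vreg_act[OF ringed_H local_morphism_inv[OF ringed_H id] vreg_comp'[OF om t(2) U]]) auto
    then have v: "local_morphism (group_variety H) ?N VE (\<lambda>h. act (ginv H h) (t (act h ` \<epsilon>)))"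
      using t(3) by (intro local_morphism_into_sub[OF ringed_H] local_morphism_vector_variety[OF ringed_H N])
        (auto simp: mem_image_act)
    have p: "local_morphism (group_variety H) ?N (prod_space (group_variety H) VE)
        (\<lambda>h. (h, act (ginv H h) (t (act h ` \<epsilon>))))"
      by (rule local_morphism_into_prod[OF ringed_H ringed_H ringed_VE id v])
    have q: "local_morphism (prod_space (group_variety H) VE) (UNIV \<times> \<epsilon>) CP (contracted_class H S act)"
      using local_morphism_quot_map[of "prod_space (group_variety H) VE" "contracted_class H S act"]
      unfolding contracted_product_def by (simp add: pts_prod_VE)
    have "local_morphism (group_variety H) ?N CP
        (\<lambda>h. contracted_class H S act (h, act (ginv H h) (t (act h ` \<epsilon>))))"
      by (rule local_morphism_comp'[OF p q]) (use local_morphism_pts[OF p] in \<open>auto simp: pts_prod_VE\<close>)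
    then have "local_morphism (group_variety H) ?N CP (\<lambda>h. s (left_coset H S h))"
    proof (rule local_morphism_cong[OF ringed_H])
      fix h assume "h \<in> ?N"
      then have "left_coset H S h \<in> ?V" unfolding j_image[OF Up] by (simp add: pts_X phi_left_coset)
      then show "contracted_class H S act (h, act (ginv H h) (t (act h ` \<epsilon>))) = s (left_coset H S h)"
        by (simp add: s_def contracted_class_eq phi_left_coset)
    qed
    moreover have "{x \<in> pts (group_variety H). left_coset H S x \<in> ?V} = ?N"
      unfolding j_image[OF Up] by (auto simp: pts_X phi_left_coset)
    moreover have "?V \<subseteq> left_coset H S ` pts (group_variety H)"
    proof -
      have "?V \<subseteq> pts X" unfolding j_image[OF Up] by auto
      also have "pts X = left_coset H S ` pts (group_variety H)" by (simp add: pts_X)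
      finally show ?thesis .
    qed
    ultimately have "local_morphism (quot_space (group_variety H) (left_coset H S)) ?V CP s"
      by (intro local_morphism_from_quot) simp_all
    then have "local_morphism X ?V CP s" unfolding homogeneous_space_def[symmetric] .
    moreover have "fst ` s v = v" if v: "v \<in> ?V" for v
    proof -
      obtain y where y: "y \<in> U" "v = j y" using v by auto
      then have "y \<in> pts Y" using Up by auto
      then show ?thesis using v by (simp add: s_def y(2) phi_j fst_cls) (simp add: j_eq)
    qed
    moreover have "s' = (\<lambda>y\<in>U. s (j y))"
      unfolding t(1) using phi_j Up by (intro restrict_ext) (auto simp: s_def)
    moreover have "s \<in> extensional ?V" by (simp add: s_def)
    ultimately show "s' \<in> {\<lambda>y\<in>U. s (j y) | s. s \<in> extensional ?V \<and> local_morphism X ?V CP s \<and> (\<forall>v\<in>?V. fst ` s v = v)}"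
      by blast
  qed
qed

lemma canonical_iso_associated:
  "equivariant_iso H Y (\<lambda>h y. act h ` y) (canonical_bundle scW act r Y)
    (transport j (associated_bundle H S scW act \<epsilon>))"
proof -
  let ?F = "canonical_bundle scW act r Y" and ?F' = "transport j (associated_bundle H S scW act \<epsilon>)"
  let ?b = "\<lambda>h y. act h ` y"
  have F: "fib ?F = (\<lambda>y. y)" "fadd ?F = (+)" "fscale ?F = scW" "fzero ?F = (\<lambda>_. 0)" "fact ?F = act"
    by (simp_all add: canonical_bundle_def)
  have F': "fib ?F' y = {c \<in> pts CP. fst ` c = j y}" "fzero ?F' y = j y \<times> {0}"
    "fadd ?F' c d = {(h, u + u') | h u u'. (h, u) \<in> c \<and> (h, u') \<in> d}"
    "fscale ?F' a c = (\<lambda>(h, u). (h, scW a u)) ` c"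
    "fact ?F' g c = (\<lambda>(h, u). (gmult H g h, u)) ` c" for y c d a g
    by (simp_all add: transport_def associated_bundle_def)
  have fib: "fib ?F' y = cls y ` fib ?F y" if "y \<in> pts Y" for y
    unfolding F F' by (rule fib_assoc[OF that])
  \<comment> \<open>Classes over the same point have the same first components, so representatives
    can be added over a common \<open>h\<close>.\<close>
  have add: "cls y (fadd ?F u v) = fadd ?F' (cls y u) (cls y v)" for y u v
    unfolding F F' cls_def by (auto simp: act_add)
  have scale: "cls y (fscale ?F c u) = fscale ?F' c (cls y u)" for y c u
    unfolding F F' cls_def by (force simp: act_scale)
  have zero: "cls y (fzero ?F y) = fzero ?F' y" if "y \<in> pts Y" for y
    unfolding F F' cls_def j_eq[OF that] by (auto simp: act_zero)
  have act: "fact ?F' g (cls y u) = cls (act g ` y) (fact ?F g u)" for g y u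
  proof (intro equalityI subsetI)
    fix z assume "z \<in> fact ?F' g (cls y u)"
    then obtain h where "act h ` \<epsilon> = y" "z = (gmult H g h, act (ginv H h) u)"
      unfolding F' cls_def by auto
    then show "z \<in> cls (act g ` y) (fact ?F g u)"
      unfolding F cls_def by (auto simp: image_act_mult H.inverse_distrib_swap act_mult)
  next
    fix z assume "z \<in> cls (act g ` y) (fact ?F g u)"
    then obtain h where h: "act h ` \<epsilon> = act g ` y" "z = (h, act (ginv H h) (act g u))"
      unfolding F cls_def by auto
    let ?h = "gmult H (ginv H g) h"
    have "(?h, act (ginv H ?h) u) \<in> cls y u" unfolding cls_def using h(1) by (auto simp: image_act_mult)
    moreover have "z = (\<lambda>(h, u). (gmult H g h, u)) (?h, act (ginv H ?h) u)"
      using h(2) by (simp add: H.assoc[symmetric] H.inverse_distrib_swap act_mult)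
    ultimately show "z \<in> fact ?F' g (cls y u)" unfolding F' by blast
  qed
  have eF: "equivariant_vector_bundle H Y ?b ?F" by (rule equivariant_canonical_bundle)
  then have fF: "fibre_axioms H Y ?b ?F" unfolding equivariant_vector_bundle_iff by simp
  have one: "act (gone H) ` y = y" for y by (auto simp: act_one)
  show ?thesis
  proof (rule equivariant_transfer[where \<theta> = cls, OF eF])
    show "fibre_axioms H Y ?b ?F'"
      by (rule fibre_axioms_transfer[where \<theta> = cls, OF fF])
        (simp_all add: act_Y fib one image_act_mult add scale zero act)
    show "inj_on (cls y) (fib ?F y)" if "y \<in> pts Y" for y
      by (rule inj_on_inverseI[of _ ev]) (rule ev_cls[OF that])
    show "sec ?F' U = (\<lambda>s. \<lambda>y\<in>U. cls y (s y)) ` sec ?F U" if "is_open Y U" for U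
      unfolding sec_canonical_bundle[OF that] by (rule sec_associated[OF that])
  qed (simp_all add: fib add scale zero act)
qed

end

section \<open>The Lie algebra of the vector group\<close>

text \<open>Over a finite field, 1 plus the product of all the linear factors \<open>X - a\<close>
  has positive degree and no root.\<close>

lemma infinite_alg_closed: "infinite (UNIV :: 'k::alg_closed_field set)"
proof
  assume fin: "finite (UNIV :: 'k set)"
  define p where "p = (\<Prod>a\<in>(UNIV :: 'k set). [:- a, 1:]) + 1"
  have "degree (\<Prod>a\<in>(UNIV :: 'k set). [:- a, 1:]) = card (UNIV :: 'k set)"
    by (subst degree_prod_eq_sum_degree) auto
  moreover have "card (UNIV :: 'k set) > 0" using fin by (simp add: card_gt_0_iff)
  ultimately have "degree p > 0" unfolding p_def by (subst degree_add_eq_left) auto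
  then obtain x where "poly p x = 0" using alg_closed_imp_poly_has_root by blast
  moreover have "poly (\<Prod>a\<in>(UNIV :: 'k set). [:- a, 1:]) x = 0"
    unfolding poly_prod using fin by (subst prod_zero_iff) auto
  ultimately show False unfolding p_def by simp
qed

lemma poly_eqI_alg_closed:
  fixes P Q :: "'k::alg_closed_field poly"
  assumes "\<And>t. poly P t = poly Q t"
  shows "P = Q"
proof (rule ccontr)
  assume "P \<noteq> Q"
  then have "finite {t. poly (P - Q) t = 0}" by (intro poly_roots_finite) simp
  then have "finite (UNIV :: 'k set)" using assms by simp
  with infinite_alg_closed show False by (rule notE)
qed

text \<open>Differentiation commutes with translation. This is what turns iterated convolution along
  the curve \<open>t w\<close> into iterated differentiation.\<close>

lemma higher_pderiv_shift:
  fixes P :: "'k::field poly"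
  shows "(pderiv ^^ n) (pcompose P [:s, 1:]) = pcompose ((pderiv ^^ n) P) [:s, 1:]"
  by (induction n) (simp_all add: pderiv_pcompose pderiv_pCons)

text \<open>With \<open>p\<close> the characteristic, each coefficient of the \<open>p\<close>-th
  derivative carries a product of \<open>p\<close> consecutive integers, which is divisible by
  \<open>p!\<close> and hence by \<open>p\<close>.\<close>

lemma higher_pderiv_CHAR:
  fixes P :: "'k::field poly"
  assumes "CHAR('k) > 0"
  shows "(pderiv ^^ CHAR('k)) P = 0"
proof (rule poly_eqI)
  fix n
  have "(pochhammer (of_nat (Suc n)) CHAR('k) :: 'k) = of_nat (pochhammer (Suc n) CHAR('k))"
    by (rule pochhammer_of_nat)
  also have "\<dots> = 0"
  proof -
    \<comment> \<open>This is the factorial; plain \<open>fact\<close> denotes the action on the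
      fibres in the record \<open>eq_sheaf\<close>.\<close>
    have "semiring_char_0_class.fact CHAR('k) dvd (pochhammer (int (Suc n)) CHAR('k))"
      by (rule fact_dvd_pochhammer)
    moreover have "int CHAR('k) dvd semiring_char_0_class.fact CHAR('k)"
      using dvd_fact[of "CHAR('k)" "CHAR('k)"] assms by (metis One_nat_def Suc_leI int_dvd_int_iff of_nat_fact order_refl)
    ultimately have "int CHAR('k) dvd int (pochhammer (Suc n) CHAR('k))"
      unfolding pochhammer_of_nat[symmetric] by (rule dvd_trans[rotated])
    then show ?thesis by (simp add: of_nat_eq_0_iff_char_dvd)
  qed
  finally show "coeff ((pderiv ^^ CHAR('k)) P) n = coeff 0 n" by (simp add: coeff_higher_pderiv)
qed

locale char_p_rep = rational_rep scW H act
  for scW :: "'k::alg_closed_field \<Rightarrow> 'w::ab_group_add \<Rightarrow> 'w" and H :: "('h, 'k) grp_scheme" and act +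
  assumes char: "CHAR('k) > 0"
begin

abbreviation "G \<equiv> G_WH scW act H"
abbreviation "D \<equiv> lie_W scW act H"

lemma G_simps: "coord G = fun_tensor (poly_funs scW) (coord H)"
  "gone G = (0, gone H)" "gmult G (w, h) (w', h') = (w + act h w', gmult H h h')"
  unfolding G_WH_def semidirect_def frobenius_kernel_def vector_group_def by simp_all

lemma subalg_G: "subalg (coord G)"
  unfolding G_simps by (intro subalg_fun_tensor subalg_poly_funs subalg_coord)

lemma linear_form_G: "linear_form scW l \<Longrightarrow> (\<lambda>z. l (fst z)) \<in> coord G"
  unfolding G_simps
  by (intro fun_tensor_fst subalg_coord) (auto simp: poly_funs_def intro: gen_alg.gen)

lemma coord_H_G: "b \<in> coord H \<Longrightarrow> (\<lambda>z. b (snd z)) \<in> coord G"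
  unfolding G_simps by (intro fun_tensor_snd subalg_poly_funs)

text \<open>\<open>coord G\<close> is generated as an algebra by the linear forms on
  \<open>W\<close> and the functions on \<open>H\<close>, so statements about derivations reduce to
  these two kinds of generators.\<close>

lemma coord_G_induct [consumes 1, case_names const form coordH add mult]:
  assumes "f \<in> coord G"
    and const: "\<And>c. P (\<lambda>_. c)"
    and form: "\<And>l. linear_form scW l \<Longrightarrow> P (\<lambda>z. l (fst z))"
    and coordH: "\<And>b. b \<in> coord H \<Longrightarrow> P (\<lambda>z. b (snd z))"
    and add: "\<And>f g. f \<in> coord G \<Longrightarrow> g \<in> coord G \<Longrightarrow> P f \<Longrightarrow> P g \<Longrightarrow> P (\<lambda>z. f z + g z)"
    and mult: "\<And>f g. f \<in> coord G \<Longrightarrow> g \<in> coord G \<Longrightarrow> P f \<Longrightarrow> P g \<Longrightarrow> P (\<lambda>z. f z * g z)"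
  shows "P f"
proof -
  have a: "P (\<lambda>z. a (fst z)) \<and> (\<lambda>z. a (fst z)) \<in> coord G" if "a \<in> poly_funs scW" for a
    using that unfolding poly_funs_def
  proof (induction rule: gen_alg.induct)
    case (gen g)
    then show ?case using form linear_form_G by simp
  next
    case (const c)
    show ?case using assms(2) subalg_const[OF subalg_G] by simp
  next
    case (add f g)
    then show ?case using assms(5) subalg_add[OF subalg_G] by simp
  next
    case (mult f g)
    then show ?case using assms(6) subalg_mult[OF subalg_G] by simp
  qed
  show ?thesis
    using assms(1)[unfolded G_simps(1)]
  proof (induction rule: fun_tensor_induct)
    case zero
    show ?case by (rule const)
  next
    case (add f g F)
    have "(\<lambda>z. f (fst z) * g (snd z)) \<in> coord G"
      using a[OF add(1)] coord_H_G[OF add(2)] subalg_mult[OF subalg_G] by simp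
    moreover have "P (\<lambda>z. f (fst z) * g (snd z))"
      using mult[OF conjunct2[OF a[OF add(1)]] coord_H_G[OF add(2)] conjunct1[OF a[OF add(1)]] coordH[OF add(2)]] .
    ultimately show ?case using assms(5)[OF _ add(3)[folded G_simps(1)]] add(4) by simp
  qed
qed

text \<open>Existence for the \<open>THE\<close> in \<open>lie_W\<close>; its uniqueness is
  \<open>poly_eqI_alg_closed\<close>.\<close>

lemma curve_poly: "f \<in> coord G \<Longrightarrow> \<exists>P. \<forall>t. poly P t = f (scW t w, gone H)"
proof (induction rule: coord_G_induct)
  case (const c)
  show ?case by (rule exI[of _ "[:c:]"]) simp
next
  case (form l)
  then show ?case by (intro exI[of _ "[:0, l w:]"]) (simp add: linear_form_scale)
next
  case (coordH b)
  show ?case by (rule exI[of _ "[:b (gone H):]"]) simp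
next
  case (add f g)
  then obtain P Q where "\<forall>t. poly P t = f (scW t w, gone H)" "\<forall>t. poly Q t = g (scW t w, gone H)" by auto
  then show ?case by (intro exI[of _ "P + Q"]) simp
next
  case (mult f g)
  then obtain P Q where "\<forall>t. poly P t = f (scW t w, gone H)" "\<forall>t. poly Q t = g (scW t w, gone H)" by auto
  then show ?case by (intro exI[of _ "P * Q"]) simp
qed

lemma D_eq:
  assumes "f \<in> coord G" "\<And>t. poly P t = f (scW t w, gone H)"
  shows "D w f = poly (pderiv P) 0"
proof -
  have "(THE P. \<forall>t. poly P t = f (scW t w, gone H)) = P"
    by (rule the_equality) (use assms(2) poly_eqI_alg_closed in \<open>metis+\<close>)
  then show ?thesis unfolding lie_W_def using assms(1) by simp
qed

lemma D_outside: "f \<notin> coord G \<Longrightarrow> D w f = 0"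
  unfolding lie_W_def by simp

text \<open>\<open>D w\<close> sees a function only along the curve \<open>t w\<close>. In
  \<open>bracket_D\<close> this lets an identity that holds only on such curves be
  differentiated.\<close>

lemma D_cong:
  assumes "f \<in> coord G" "g \<in> coord G" "\<And>t. f (scW t w, gone H) = g (scW t w, gone H)"
  shows "D w f = D w g"
proof -
  obtain P where "\<forall>t. poly P t = f (scW t w, gone H)" using curve_poly[OF assms(1)] by blast
  then show ?thesis using D_eq[OF assms(1), of P w] D_eq[OF assms(2), of P w] assms(3) by simp
qed

lemma
  assumes f: "f \<in> coord G" and g: "g \<in> coord G"
  shows D_add: "D w (\<lambda>x. f x + g x) = D w f + D w g"
    and D_mult: "D w (\<lambda>x. f x * g x) = f (gone G) * D w g + D w f * g (gone G)"
proof -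
  obtain P where P: "\<forall>t. poly P t = f (scW t w, gone H)" using curve_poly[OF f] by blast
  obtain Q where Q: "\<forall>t. poly Q t = g (scW t w, gone H)" using curve_poly[OF g] by blast
  have 1: "D w f = poly (pderiv P) 0" "D w g = poly (pderiv Q) 0" using D_eq f g P Q by blast+
  show "D w (\<lambda>x. f x + g x) = D w f + D w g"
    using D_eq[OF subalg_add[OF subalg_G f g], of "P + Q" w] P Q 1 by (simp add: pderiv_add)
  have "poly P 0 = f (gone G)" "poly Q 0 = g (gone G)"
    using P Q by (simp_all add: G_simps)
  then show "D w (\<lambda>x. f x * g x) = f (gone G) * D w g + D w f * g (gone G)"
    using D_eq[OF subalg_mult[OF subalg_G f g], of "P * Q" w] P Q 1
    by (simp add: pderiv_mult algebra_simps)
qed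

lemma D_const: "D w (\<lambda>_. c) = 0"
  using D_eq[OF subalg_const[OF subalg_G], of "[:c:]" c w] by simp

lemma D_coord_H: "b \<in> coord H \<Longrightarrow> D w (\<lambda>z. b (snd z)) = 0"
  using D_eq[OF coord_H_G, of b "[:b (gone H):]" w] by simp

lemma D_form: "linear_form scW l \<Longrightarrow> D w (\<lambda>z. l (fst z)) = l w"
  using D_eq[OF linear_form_G, of l "[:0, l w:]" w] by (simp add: linear_form_scale pderiv_pCons)

lemma D_smult: "f \<in> coord G \<Longrightarrow> D w (\<lambda>x. c * f x) = c * D w f"
  using D_mult[OF subalg_const[OF subalg_G, of c], of f w] by (simp add: D_const)

lemma D_sum:
  assumes "\<And>i. i \<in> I \<Longrightarrow> f i \<in> coord G"
  shows "D w (\<lambda>x. \<Sum>i\<in>I. f i x) = (\<Sum>i\<in>I. D w (f i))"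
  using assms
proof (induction I rule: infinite_finite_induct)
  case (insert i I)
  then have "D w (\<lambda>x. f i x + (\<Sum>i\<in>I. f i x)) = D w (f i) + D w (\<lambda>x. \<Sum>i\<in>I. f i x)"
    by (intro D_add subalg_sum[OF subalg_G]) auto
  then show ?case using insert by simp
qed (simp_all add: D_const)

text \<open>The curves along \<open>u\<close>, \<open>v\<close> and \<open>u + v\<close> cannot be
  compared directly for a general function. But both sides satisfy the product rule at the identity,
  so agreement on generators is enough.\<close>

lemma D_vector_add: "D (u + v) = D u + D v"
proof
  fix f show "D (u + v) f = (D u + D v) f"
  proof (cases "f \<in> coord G")
    case True
    then show ?thesis
    proof (induction rule: coord_G_induct)
      case (form l)
      then show ?case by (simp add: D_form linear_form_add)
    qed (simp_all add: D_const D_coord_H D_add D_mult algebra_simps)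
  qed (simp add: D_outside)
qed

lemma D_vector_scale: "D (scW c u) = fun_scale c (D u)"
proof
  fix f show "D (scW c u) f = fun_scale c (D u) f"
  proof (cases "f \<in> coord G")
    case True
    then show ?thesis
    proof (induction rule: coord_G_induct)
      case (form l)
      then show ?case by (simp add: D_form linear_form_scale fun_scale_def)
    qed (simp_all add: D_const D_coord_H D_add D_mult algebra_simps fun_scale_def)
  qed (simp add: D_outside fun_scale_def)
qed

lemma linear_D: "Vector_Spaces.linear scW fun_scale D"
  unfolding Vector_Spaces.linear_iff
  using vector_space_axioms vector_space_fun_scale D_vector_add D_vector_scale by blast

lemma inj_D: "inj D"
proof (rule injI)
  fix u v assume "D u = D v"
  show "u = v"
  proof (rule linear_forms_separate)
    fix l assume l: "linear_form scW l"
    have "D u (\<lambda>z. l (fst z)) = D v (\<lambda>z. l (fst z))" using \<open>D u = D v\<close> by simp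
    then show "l u = l v" using l by (simp add: D_form)
  qed
qed

lemma ideal_G_simp: "ideal G = fun_sum (fun_tensor (ideal_gen (poly_funs scW)
    ({\<lambda>_. 0} \<union> {\<lambda>x. f x ^ CHAR('k) | f. f \<in> poly_funs scW \<and> f 0 = 0})) (coord H))
    (fun_tensor (poly_funs scW) {\<lambda>_. 0})"
  unfolding G_WH_def semidirect_def frobenius_kernel_def vector_group_def ideal_H by simp

lemma poly_funs_G: "a \<in> poly_funs scW \<Longrightarrow> (\<lambda>z. a (fst z)) \<in> coord G"
  unfolding G_simps by (rule fun_tensor_fst[OF subalg_coord])

lemma subalg_power: "subalg A \<Longrightarrow> f \<in> A \<Longrightarrow> (\<lambda>x. f x ^ n) \<in> A"
  by (induction n) (auto simp: subalg_const subalg_mult)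

lemma D_power:
  assumes "f \<in> coord G"
  shows "D w (\<lambda>x. f x ^ n) = of_nat n * f (gone G) ^ (n - 1) * D w f"
proof (induction n)
  case (Suc n)
  have "D w (\<lambda>x. f x * f x ^ n) = f (gone G) * D w (\<lambda>x. f x ^ n) + D w f * f (gone G) ^ n"
    by (rule D_mult[OF assms subalg_power[OF subalg_G assms]])
  then show ?case using Suc by (cases n) (simp_all add: algebra_simps)
qed (simp add: D_const)

text \<open>In characteristic \<open>p\<close> the derivative of a \<open>p\<close>-th power is
  zero. For multiples of such powers the product rule also uses that the generators vanish at 0,
  which is why \<open>gen\<close> and \<open>I\<close> carry a third conjunct.\<close>

lemma D_ideal:
  assumes "f \<in> ideal G"
  shows "f \<in> coord G \<and> D w f = 0"
proof -
  let ?I = "ideal_gen (poly_funs scW) ({\<lambda>_. 0} \<union> {\<lambda>x. f x ^ CHAR('k) | f. f \<in> poly_funs scW \<and> f 0 = 0})"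
  have gen: "(\<lambda>z. g (fst z)) \<in> coord G \<and> D w (\<lambda>z. g (fst z)) = 0 \<and> g 0 = 0"
    if "g \<in> {\<lambda>_. 0} \<union> {\<lambda>x. f x ^ CHAR('k) | f. f \<in> poly_funs scW \<and> f 0 = 0}" for g
  proof (cases "g = (\<lambda>_. 0)")
    case True
    then show ?thesis using subalg_const[OF subalg_G, of 0] by (simp add: D_const)
  next
    case False
    then obtain f where f: "g = (\<lambda>x. f x ^ CHAR('k))" "f \<in> poly_funs scW" "f 0 = 0" using \<open>g \<in> _\<close> by auto
    then show ?thesis
      using D_power[OF poly_funs_G[OF f(2)], of w "CHAR('k)"] subalg_power[OF subalg_G poly_funs_G[OF f(2)]] char
      by (simp add: power_0_left)
  qed
  have I: "(\<lambda>z. g (fst z)) \<in> coord G \<and> D w (\<lambda>z. g (fst z)) = 0 \<and> g 0 = 0" if gI: "g \<in> ?I" for g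
  proof -
    obtain n :: nat and a h where g0: "\<forall>i<n. a i \<in> poly_funs scW \<and>
        h i \<in> {\<lambda>_. 0} \<union> {\<lambda>x. f x ^ CHAR('k) | f. f \<in> poly_funs scW \<and> f 0 = 0}"
      "g = (\<lambda>x. \<Sum>i<n. a i x * h i x)"
      using gI unfolding ideal_gen_def mem_Collect_eq by (elim exE conjE)
    have g: "g = (\<lambda>x. \<Sum>i<n. a i x * h i x)"
      "\<And>i. i < n \<Longrightarrow> a i \<in> poly_funs scW"
      "\<And>i. i < n \<Longrightarrow> h i \<in> {\<lambda>_. 0} \<union> {\<lambda>x. f x ^ CHAR('k) | f. f \<in> poly_funs scW \<and> f 0 = 0}"
      using g0 by blast+
    have h: "(\<lambda>z. h i (fst z)) \<in> coord G \<and> D w (\<lambda>z. h i (fst z)) = 0 \<and> h i 0 = 0" if "i < n" for i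
      by (rule gen[OF g(3)[OF that]])
    have m: "(\<lambda>z. a i (fst z) * h i (fst z)) \<in> coord G" if "i < n" for i
      by (rule subalg_mult[OF subalg_G poly_funs_G[OF g(2)[OF that]] conjunct1[OF h[OF that]]])
    have "D w (\<lambda>z. \<Sum>i<n. a i (fst z) * h i (fst z)) = (\<Sum>i<n. D w (\<lambda>z. a i (fst z) * h i (fst z)))"
      using m by (intro D_sum) auto
    also have "\<dots> = 0"
    proof (rule sum.neutral, rule ballI)
      fix i assume "i \<in> {..<n}"
      then have i: "i < n" by simp
      show "D w (\<lambda>z. a i (fst z) * h i (fst z)) = 0"
        using D_mult[OF poly_funs_G[OF g(2)[OF i]] conjunct1[OF h[OF i]], of w] h[OF i]
        by (simp add: G_simps)
    qed
    finally show ?thesis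
      using subalg_sum[OF subalg_G, of "{..<n}" "\<lambda>i z. a i (fst z) * h i (fst z)"] m h
      unfolding g(1) by simp
  qed
  have t: "F \<in> coord G \<and> D w F = 0" if "F \<in> fun_tensor ?I (coord H)" for F
    using that
  proof (induction rule: fun_tensor_induct)
    case zero
    then show ?case using subalg_const[OF subalg_G] by (simp add: D_const)
  next
    case (add f g F)
    have 1: "(\<lambda>z. f (fst z)) \<in> coord G" "D w (\<lambda>z. f (fst z)) = 0" "f 0 = 0" using I[OF add(1)] by auto
    have 2: "(\<lambda>z. f (fst z) * g (snd z)) \<in> coord G"
      by (rule subalg_mult[OF subalg_G 1(1) coord_H_G[OF add(2)]])
    have "D w (\<lambda>z. f (fst z) * g (snd z)) = 0"
      using D_mult[OF 1(1) coord_H_G[OF add(2)], of w] 1 by (simp add: G_simps)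
    then show ?case using D_add[OF 2, of F w] subalg_add[OF subalg_G 2, of F] add(4) by simp
  qed
  have z: "F = (\<lambda>_. 0)" if "F \<in> fun_tensor (poly_funs scW) {\<lambda>_. 0}" for F :: "'w \<times> 'h \<Rightarrow> 'k"
    using that by (induction rule: fun_tensor_induct) (simp_all add: fun_eq_iff)
  obtain f1 f2 where "f = (\<lambda>x. f1 x + f2 x)" "f1 \<in> fun_tensor ?I (coord H)"
    "f2 \<in> fun_tensor (poly_funs scW) {\<lambda>_. 0}"
    using assms unfolding ideal_G_simp fun_sum_def by auto
  then show ?thesis using t[of f1] z[of f2] by simp
qed

lemma D_mem: "D w \<in> lcar (Lie G)"
  unfolding Lie_def using D_outside D_add D_mult D_smult D_ideal by simp

text \<open>Checked on generators. For a linear form \<open>l\<close>, the value at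
  \<open>w + h w'\<close> is \<open>l w\<close> plus a sum of matrix coefficients of
  \<open>act\<close> in \<open>h\<close> times coordinates of \<open>w'\<close>.\<close>

lemma comult_G: "f \<in> coord G \<Longrightarrow> (\<lambda>z. f (gmult G (fst z) (snd z))) \<in> fun_tensor (coord G) (coord G)"
proof (induction rule: coord_G_induct)
  note sT = subalg_fun_tensor[OF subalg_G subalg_G]
  {
    case (const c)
    show ?case by (rule subalg_const[OF sT])
  next
    case (form l)
    obtain n :: nat and e m where *: "\<forall>i<n. linear_form scW (m i)" "\<And>v. v = (\<Sum>i<n. scW (m i v) (e i))"
      using fin_dim_coords[OF fin_dim] by blast
    have "l (fst (gmult G x y)) = l (fst x) + (\<Sum>i<n. l (act (snd x) (e i)) * m i (fst y))" for x y
    proof -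
      have "l (act (snd x) (fst y)) = l (act (snd x) (\<Sum>i<n. scW (m i (fst y)) (e i)))"
        using *(2)[of "fst y"] by simp
      also have "\<dots> = (\<Sum>i<n. l (act (snd x) (e i)) * m i (fst y))"
        by (simp add: act_sum act_scale linear_form_sum[OF form] linear_form_scale[OF form] mult.commute)
      finally have "l (act (snd x) (fst y)) = (\<Sum>i<n. l (act (snd x) (e i)) * m i (fst y))" .
      then show ?thesis by (cases x; cases y) (simp add: G_simps linear_form_add[OF form])
    qed
    moreover have "(\<lambda>z. l (fst (fst z)) + (\<Sum>i<n. l (act (snd (fst z)) (e i)) * m i (fst (snd z))))
        \<in> fun_tensor (coord G) (coord G)"
      using * form
      by (intro subalg_add[OF sT] subalg_sum[OF sT] subalg_mult[OF sT]
          fun_tensor_fst[OF subalg_G, of "\<lambda>z. l (fst z)"] linear_form_G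
          fun_tensor_fst[OF subalg_G, of "\<lambda>z. l (act (snd z) (e _))"] coord_H_G coord_act
          fun_tensor_snd[OF subalg_G, of "\<lambda>z. m _ (fst z)"]) auto
    ultimately show ?case by simp
  next
    case (coordH b)
    have "(\<lambda>z. F (snd (fst z), snd (snd z))) \<in> fun_tensor (coord G) (coord G)"
      if "F \<in> fun_tensor (coord H) (coord H)" for F
      using that
    proof (induction rule: fun_tensor_induct)
      case zero
      show ?case by (rule subalg_const[OF sT])
    next
      case (add f g F)
      have "(\<lambda>z. f (snd (fst z)) * g (snd (snd z))) \<in> fun_tensor (coord G) (coord G)"
        using fun_tensor_fst[OF subalg_G coord_H_G[OF add(1)]] fun_tensor_snd[OF subalg_G coord_H_G[OF add(2)]]
        by (rule subalg_mult[OF sT])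
      from subalg_add[OF sT this add(4)] show ?case by simp
    qed
    from this[OF coord_mult[OF coordH]] show ?case
      by (simp add: case_prod_unfold G_WH_def semidirect_def)
  next
    case (add f g)
    then show ?case using subalg_add[OF sT] by simp
  next
    case (mult f g)
    then show ?case using subalg_mult[OF sT] by simp
  }
qed

lemma comult_sum:
  assumes "f \<in> coord G"
  shows "\<exists>(n::nat) a b. (\<forall>i<n. a i \<in> coord G \<and> b i \<in> coord G) \<and>
    (\<forall>x y. f (gmult G x y) = (\<Sum>i<n. a i x * b i y))"
proof -
  obtain n :: nat and a b where "\<forall>i<n. a i \<in> coord G \<and> b i \<in> coord G"
    "(\<lambda>z. f (gmult G (fst z) (snd z))) = (\<lambda>(x, y). \<Sum>i<n. a i x * b i y)"
    using comult_G[OF assms] unfolding fun_tensor_def mem_Collect_eq by (elim exE conjE)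
  then show ?thesis by (intro exI conjI) (assumption, auto simp: fun_eq_iff)
qed

section \<open>Convolution of functionals on the coordinate algebra\<close>

definition functional :: "(('w \<times> 'h \<Rightarrow> 'k) \<Rightarrow> 'k) \<Rightarrow> bool"
  where "functional \<mu> \<longleftrightarrow> (\<forall>f\<in>coord G. \<forall>g\<in>coord G. \<mu> (\<lambda>x. f x + g x) = \<mu> f + \<mu> g) \<and>
    (\<forall>c. \<forall>f\<in>coord G. \<mu> (\<lambda>x. c * f x) = c * \<mu> f)"

lemma functional_sum:
  assumes \<mu>: "functional \<mu>" and f: "\<And>i. i \<in> I \<Longrightarrow> f i \<in> coord G"
  shows "\<mu> (\<lambda>x. \<Sum>i\<in>I. c i * f i x) = (\<Sum>i\<in>I. c i * \<mu> (f i))"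
  using f
proof (induction I rule: infinite_finite_induct)
  case (insert i I)
  have 1: "(\<lambda>x. c i * f i x) \<in> coord G"
    using insert by (intro subalg_mult[OF subalg_G] subalg_const[OF subalg_G]) auto
  have 2: "(\<lambda>x. \<Sum>i\<in>I. c i * f i x) \<in> coord G"
    using insert by (intro subalg_sum[OF subalg_G] subalg_mult[OF subalg_G] subalg_const[OF subalg_G]) auto
  have "\<mu> (\<lambda>x. c i * f i x + (\<Sum>i\<in>I. c i * f i x)) = \<mu> (\<lambda>x. c i * f i x) + \<mu> (\<lambda>x. \<Sum>i\<in>I. c i * f i x)"
    using \<mu> 1 2 unfolding functional_def by simp
  also have "\<mu> (\<lambda>x. c i * f i x) = c i * \<mu> (f i)"
    using \<mu> insert unfolding functional_def by simp
  finally show ?case using insert by simp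
next
  case empty
  have "\<mu> (\<lambda>x. 0 * 0) = 0 * \<mu> (\<lambda>_. 0)"
    by (rule conjunct2[OF \<mu>[unfolded functional_def], rule_format, OF subalg_const[OF subalg_G]])
  then show ?case by simp
next
  case (infinite I)
  have "\<mu> (\<lambda>x. 0 * 0) = 0 * \<mu> (\<lambda>_. 0)"
    by (rule conjunct2[OF \<mu>[unfolded functional_def], rule_format, OF subalg_const[OF subalg_G]])
  then show ?case using infinite by simp
qed

lemma functional_Lie: "\<delta> \<in> lcar (Lie G) \<Longrightarrow> functional \<delta>"
  unfolding functional_def Lie_def by simp

lemma functional_counit: "functional (counit G)"
  unfolding functional_def counit_def
  using subalg_add[OF subalg_G] subalg_mult[OF subalg_G subalg_const[OF subalg_G]] by auto

text \<open>Convolution in Sweedler form, for a chosen expansion of the comultiplication of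
  \<open>f\<close>.\<close>

lemma convolution_eq:
  assumes \<delta>: "functional \<delta>" and \<mu>: "functional \<mu>" and f: "f \<in> coord G"
    and ab: "\<And>i. i < (n::nat) \<Longrightarrow> a i \<in> coord G" "\<And>i. i < n \<Longrightarrow> b i \<in> coord G"
    "\<And>x y. f (gmult G x y) = (\<Sum>i<n. a i x * b i y)"
  shows "(\<lambda>x. \<mu> (\<lambda>y. f (gmult G x y))) = (\<lambda>x. \<Sum>i<n. \<mu> (b i) * a i x)"
    and "convolution G \<delta> \<mu> f = (\<Sum>i<n. \<mu> (b i) * \<delta> (a i))"
proof -
  show 1: "(\<lambda>x. \<mu> (\<lambda>y. f (gmult G x y))) = (\<lambda>x. \<Sum>i<n. \<mu> (b i) * a i x)"
    unfolding ab(3) using functional_sum[OF \<mu>, of "{..<n}" b] ab(2) by (simp add: mult.commute)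
  show "convolution G \<delta> \<mu> f = (\<Sum>i<n. \<mu> (b i) * \<delta> (a i))"
    unfolding convolution_def 1 using f functional_sum[OF \<delta>, of "{..<n}" a] ab(1) by simp
qed

lemma functional_mem:
  assumes \<mu>: "functional \<mu>" and f: "f \<in> coord G"
  shows "(\<lambda>x. \<mu> (\<lambda>y. f (gmult G x y))) \<in> coord G" "(\<lambda>y. f (gmult G x y)) \<in> coord G"
proof -
  obtain n :: nat and a b where ab: "\<forall>i<n. a i \<in> coord G \<and> b i \<in> coord G"
    "\<forall>x y. f (gmult G x y) = (\<Sum>i<n. a i x * b i y)"
    using comult_sum[OF f] by (elim exE conjE)
  have 1: "(\<lambda>x. \<mu> (\<lambda>y. f (gmult G x y))) = (\<lambda>x. \<Sum>i<n. \<mu> (b i) * a i x)"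
    by (rule convolution_eq(1)[OF \<mu> \<mu> f]) (use ab in auto)
  show "(\<lambda>x. \<mu> (\<lambda>y. f (gmult G x y))) \<in> coord G"
    unfolding 1 using ab(1)
    by (intro subalg_sum[OF subalg_G] subalg_mult[OF subalg_G] subalg_const[OF subalg_G]) auto
  have 2: "(\<lambda>y. f (gmult G x y)) = (\<lambda>y. \<Sum>i<n. a i x * b i y)"
    by (rule ext) (rule ab(2)[rule_format])
  show "(\<lambda>y. f (gmult G x y)) \<in> coord G"
    unfolding 2 using ab(1)
    by (intro subalg_sum[OF subalg_G] subalg_mult[OF subalg_G] subalg_const[OF subalg_G]) auto
qed

lemma functional_convolution:
  assumes \<delta>: "functional \<delta>" and \<mu>: "functional \<mu>"
  shows "functional (convolution G \<delta> \<mu>)"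
  unfolding functional_def
proof (intro conjI ballI allI)
  fix f assume f: "f \<in> coord G"
  note m = functional_mem[OF \<mu> f]
  show "convolution G \<delta> \<mu> (\<lambda>x. c * f x) = c * convolution G \<delta> \<mu> f" for c
    unfolding convolution_def
    using \<delta> \<mu> f m subalg_mult[OF subalg_G subalg_const[OF subalg_G, of c] f] unfolding functional_def by simp
  fix g assume g: "g \<in> coord G"
  show "convolution G \<delta> \<mu> (\<lambda>x. f x + g x) = convolution G \<delta> \<mu> f + convolution G \<delta> \<mu> g"
    unfolding convolution_def
    using \<delta> \<mu> f g m functional_mem[OF \<mu> g] subalg_add[OF subalg_G f g] unfolding functional_def by simp
qed

lemma gmult_W: "gmult G (scW s u, gone H) (scW t v, gone H) = (scW s u + scW t v, gone H)"
  by (simp add: G_simps act_one H.group_left_neutral)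

text \<open>On the points \<open>s u\<close> and \<open>t v\<close> the group law is addition in
  \<open>W\<close>, which is commutative, so the two Sweedler sums agree there. Applying
  \<open>D u\<close> in the variable \<open>s\<close> with \<open>t\<close> fixed, and then
  \<open>D v\<close> in \<open>t\<close>, replaces these values by derivatives.\<close>

lemma bracket_D: "lbracket (Lie G) (D u) (D v) = 0"
proof -
  have "convolution G (D u) (D v) f = convolution G (D v) (D u) f" for f
  proof (cases "f \<in> coord G")
    case True
    obtain n :: nat and a b where ab: "\<forall>i<n. a i \<in> coord G \<and> b i \<in> coord G"
      "\<forall>x y. f (gmult G x y) = (\<Sum>i<n. a i x * b i y)"
      using comult_sum[OF True] by (elim exE conjE)
    have fD: "functional (D w)" for w by (rule functional_Lie[OF D_mem])
    have c: "convolution G (D w) (D w') f = (\<Sum>i<n. D w' (b i) * D w (a i))" for w w'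
      by (rule convolution_eq(2)[OF fD fD True]) (use ab in auto)
    have sw: "(\<Sum>i<n. b i (scW t v, gone H) * a i (scW s u, gone H)) =
        (\<Sum>i<n. a i (scW t v, gone H) * b i (scW s u, gone H))" for s t
    proof -
      have "(\<Sum>i<n. a i (scW s u, gone H) * b i (scW t v, gone H)) =
          (\<Sum>i<n. a i (scW t v, gone H) * b i (scW s u, gone H))"
        using ab(2)[rule_format, symmetric] by (simp add: gmult_W add.commute)
      then show ?thesis by (simp add: mult.commute)
    qed
    have mem: "(\<lambda>x. \<Sum>i<n. k i * a i x) \<in> coord G" "(\<lambda>x. \<Sum>i<n. k i * b i x) \<in> coord G" for k
      using ab(1) by (intro subalg_sum[OF subalg_G] subalg_mult[OF subalg_G] subalg_const[OF subalg_G]; auto)+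
    have sum: "D w (\<lambda>x. \<Sum>i<n. k i * a i x) = (\<Sum>i<n. k i * D w (a i))"
      "D w (\<lambda>x. \<Sum>i<n. k i * b i x) = (\<Sum>i<n. k i * D w (b i))" for w k
      using ab(1) by (intro functional_sum[OF fD]; auto)+
    have "(\<Sum>i<n. b i (scW t v, gone H) * D u (a i)) = (\<Sum>i<n. a i (scW t v, gone H) * D u (b i))" for t
      using D_cong[OF mem(1)[of "\<lambda>i. b i (scW t v, gone H)"] mem(2)[of "\<lambda>i. a i (scW t v, gone H)"], of u]
        sw unfolding sum by simp
    then have "D v (\<lambda>x. \<Sum>i<n. D u (a i) * b i x) = D v (\<lambda>x. \<Sum>i<n. D u (b i) * a i x)"
      by (intro D_cong mem) (simp add: mult.commute)
    then show ?thesis unfolding c sum by (simp add: mult.commute)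
  qed (simp add: convolution_def)
  then show ?thesis unfolding Lie_def by (simp add: fun_eq_iff)
qed

text \<open>The curve \<open>t w\<close> is a one-parameter subgroup: translation by
  \<open>s w\<close> replaces \<open>P\<close> by its shift by \<open>s\<close>, so one more
  convolution is one more derivative. Linearity of the iterated functional is carried along because
  it keeps the intermediate functions in \<open>coord G\<close>.\<close>

lemma higher_convolution_D:
  "functional ((convolution G (D w) ^^ n) (counit G)) \<and>
   (\<forall>f\<in>coord G. \<forall>P. (\<forall>t. poly P t = f (scW t w, gone H)) \<longrightarrow>
     (convolution G (D w) ^^ n) (counit G) f = poly ((pderiv ^^ n) P) 0)"
proof (induction n)
  case 0
  show ?case using functional_counit by (auto simp: counit_def G_simps)
next
  case (Suc n)
  let ?\<mu> = "(convolution G (D w) ^^ n) (counit G)"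
  have \<mu>: "functional ?\<mu>" using Suc by simp
  have fD: "functional (D w)" by (rule functional_Lie[OF D_mem])
  have "convolution G (D w) ?\<mu> f = poly (pderiv ((pderiv ^^ n) P)) 0"
    if f: "f \<in> coord G" and P: "\<forall>t. poly P t = f (scW t w, gone H)" for f P
  proof -
    let ?g = "\<lambda>x. ?\<mu> (\<lambda>y. f (gmult G x y))"
    have "D w ?g = poly (pderiv ((pderiv ^^ n) P)) 0"
    proof (rule D_eq[OF functional_mem(1)[OF \<mu> f]])
      fix s
      have "poly (pcompose P [:s, 1:]) t = f (gmult G (scW s w, gone H) (scW t w, gone H))" for t
        using P by (simp add: gmult_W poly_pcompose scale_left_distrib)
      then have "?g (scW s w, gone H) = poly ((pderiv ^^ n) (pcompose P [:s, 1:])) 0"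
        by (rule conjunct2[OF Suc.IH, rule_format, OF functional_mem(2)[OF \<mu> f]])
      then show "poly ((pderiv ^^ n) P) s = ?g (scW s w, gone H)"
        by (simp add: higher_pderiv_shift poly_pcompose)
    qed
    then show ?thesis using f by (simp add: convolution_def)
  qed
  then show ?case using functional_convolution[OF fD \<mu>] by simp
qed

lemma lpow_D: "lpow (Lie G) (D w) = 0"
proof
  fix f
  obtain n where n: "CHAR('k) = Suc n" using char gr0_implies_Suc by blast
  show "lpow (Lie G) (D w) f = 0 f"
  proof (cases "f \<in> coord G")
    case True
    obtain P where "\<forall>t. poly P t = f (scW t w, gone H)" using curve_poly[OF True] by blast
    then have "(convolution G (D w) ^^ CHAR('k)) (counit G) f = poly ((pderiv ^^ CHAR('k)) P) 0"
      using higher_convolution_D True by blast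
    then show ?thesis unfolding Lie_def by (simp add: higher_pderiv_CHAR[OF char])
  next
    case False
    then show ?thesis unfolding Lie_def n by (simp add: convolution_def)
  qed
qed

end

section \<open>The extension of the trivial module by W\<close>

lemma sum_fun_apply: "(\<Sum>i\<in>I. f i) x = (\<Sum>i\<in>I. f i x :: 'a::comm_monoid_add)"
  by (induction I rule: infinite_finite_induct) simp_all

text \<open>A basis of \<open>W\<close> with dual coordinates is fixed because the theorem asks for
  a module inside \<open>nat \<Rightarrow> 'k\<close>.\<close>

locale extension_module = char_p_rep scW H act
  for scW :: "'k::alg_closed_field \<Rightarrow> 'w::ab_group_add \<Rightarrow> 'w" and H :: "('h, 'k) grp_scheme" and act +
  fixes n :: nat and e :: "nat \<Rightarrow> 'w" and m :: "nat \<Rightarrow> 'w \<Rightarrow> 'k"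
  assumes m: "i < n \<Longrightarrow> linear_form scW (m i)"
    and dual: "i < n \<Longrightarrow> j < n \<Longrightarrow> m i (e j) = of_bool (i = j)"
    and expand: "v = (\<Sum>i<n. scW (m i v) (e i))"
begin

sublocale FM: vector_space "fun_scale :: 'k \<Rightarrow> (nat \<Rightarrow> 'k) \<Rightarrow> nat \<Rightarrow> 'k"
  by (rule vector_space_fun_scale)

sublocale FL: vector_space "fun_scale :: 'k \<Rightarrow> (('w \<times> 'h \<Rightarrow> 'k) \<Rightarrow> 'k) \<Rightarrow> ('w \<times> 'h \<Rightarrow> 'k) \<Rightarrow> 'k"
  by (rule vector_space_fun_scale)

text \<open>The module \<open>M = k \<oplus> W\<close> in coordinates: \<open>e0 = (1, 0)\<close>, \<open>\<kappa> u = (0, u)\<close> and \<open>pr (c, u) = u\<close>.\<close>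

definition e0 :: "nat \<Rightarrow> 'k" where "e0 = (\<lambda>i. of_bool (i = 0))"

definition \<kappa> :: "'w \<Rightarrow> nat \<Rightarrow> 'k"
  where "\<kappa> u = (\<lambda>i. if 0 < i \<and> i \<le> n then m (i - 1) u else 0)"

definition pr :: "(nat \<Rightarrow> 'k) \<Rightarrow> 'w"
  where "pr v = (\<Sum>i<n. scW (v (Suc i)) (e i))"

definition M :: "(nat \<Rightarrow> 'k) set" where "M = {v. \<forall>i>n. v i = 0}"

definition \<rho> :: "'w \<times> 'h \<Rightarrow> (nat \<Rightarrow> 'k) \<Rightarrow> nat \<Rightarrow> 'k"
  where "\<rho> z v = fun_scale (v 0) e0 + \<kappa> (act (snd z) (pr v) + scW (v 0) (fst z))"

lemma kappa_add: "\<kappa> (u + v) = \<kappa> u + \<kappa> v"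
  and kappa_scale: "\<kappa> (scW c u) = fun_scale c (\<kappa> u)"
proof -
  have "m (i - 1) (u + v) = m (i - 1) u + m (i - 1) v \<and> m (i - 1) (scW c u) = c * m (i - 1) u"
    if "0 < i" "i \<le> n" for i
    using linear_form_add[OF m] linear_form_scale[OF m] that by simp
  then show "\<kappa> (u + v) = \<kappa> u + \<kappa> v" "\<kappa> (scW c u) = fun_scale c (\<kappa> u)"
    unfolding \<kappa>_def fun_scale_def by (auto simp: fun_eq_iff)
qed

lemma linear_kappa: "Vector_Spaces.linear scW fun_scale \<kappa>"
  unfolding Vector_Spaces.linear_iff
  using vector_space_axioms vector_space_fun_scale kappa_add kappa_scale by blast

lemma kappa_zero: "\<kappa> 0 = 0"
  using kappa_scale[of 0 0] by (simp add: fun_scale_def fun_eq_iff)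

lemma kappa_sum: "\<kappa> (\<Sum>i\<in>I. f i) = (\<Sum>i\<in>I. \<kappa> (f i))"
  by (induction I rule: infinite_finite_induct) (simp_all add: kappa_add kappa_zero)

lemma kappa_0: "\<kappa> u 0 = 0"
  by (simp add: \<kappa>_def)

lemma pr_kappa: "pr (\<kappa> u) = u"
  unfolding pr_def \<kappa>_def by (subst (2) expand[of u]) simp

lemma pr_add: "pr (u + v) = pr u + pr v"
  unfolding pr_def by (simp add: scale_left_distrib sum.distrib)

lemma pr_scale: "pr (fun_scale c v) = scW c (pr v)"
  unfolding pr_def fun_scale_def by (simp add: scale_sum_right)

lemma pr_e0: "pr e0 = 0"
  unfolding pr_def e0_def by simp

lemma kappa_mem: "\<kappa> u \<in> M" and e0_mem: "e0 \<in> M"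
  unfolding \<kappa>_def e0_def M_def by auto

lemma subspace_M: "FM.subspace M"
  unfolding FM.subspace_def M_def fun_scale_def by auto

lemma M_expand: "v \<in> M \<Longrightarrow> v = fun_scale (v 0) e0 + \<kappa> (pr v)"
proof
  fix i assume v: "v \<in> M"
  show "v i = (fun_scale (v 0) e0 + \<kappa> (pr v)) i"
  proof (cases "0 < i \<and> i \<le> n")
    case True
    have "m (i - 1) (pr v) = v (Suc (i - 1))"
      unfolding pr_def by (rule dual_forms_coeff) (use True m dual in auto)
    then show ?thesis using True by (simp add: \<kappa>_def e0_def fun_scale_def)
  next
    case False
    then show ?thesis using v by (auto simp: \<kappa>_def e0_def fun_scale_def M_def)
  qed
qed

lemma kappa_pr: "\<kappa> (pr v) = (\<Sum>i<n. fun_scale (v (Suc i)) (\<kappa> (e i)))"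
  unfolding pr_def by (simp add: kappa_sum kappa_scale)

lemma fin_dim_M: "fin_dim_subspace fun_scale M"
  unfolding fin_dim_subspace_def
proof (intro exI conjI)
  let ?B = "insert e0 (\<kappa> ` e ` {..<n})"
  show "finite ?B" by simp
  show "M = FM.span ?B"
  proof
    show "FM.span ?B \<subseteq> M"
      by (rule FM.span_minimal[OF _ subspace_M]) (use e0_mem kappa_mem in auto)
    show "M \<subseteq> FM.span ?B"
    proof
      fix v assume "v \<in> M"
      then have "v = fun_scale (v 0) e0 + (\<Sum>i<n. fun_scale (v (Suc i)) (\<kappa> (e i)))"
        using M_expand kappa_pr by metis
      also have "\<dots> \<in> FM.span ?B"
        by (intro FM.span_add FM.span_scale FM.span_sum) (auto intro: FM.span_base)
      finally show "v \<in> FM.span ?B" .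
    qed
  qed
qed

lemma rho_0: "\<rho> z v 0 = v 0"
  unfolding \<rho>_def by (simp add: fun_scale_def e0_def kappa_0)

lemma pr_rho: "pr (\<rho> z v) = act (snd z) (pr v) + scW (v 0) (fst z)"
  unfolding \<rho>_def by (simp add: pr_add pr_scale pr_e0 pr_kappa)

lemma rho_mem: "\<rho> z v \<in> M"
  unfolding \<rho>_def by (intro FM.subspace_add[OF subspace_M] FM.subspace_scale[OF subspace_M] e0_mem kappa_mem)

lemma rho_add: "\<rho> z (u + v) = \<rho> z u + \<rho> z v"
proof -
  have "fun_scale (u 0 + v 0) e0 = fun_scale (u 0) e0 + fun_scale (v 0) e0"
    by (rule FM.scale_left_distrib)
  then show ?thesis
    unfolding \<rho>_def by (simp add: pr_add act_add scale_left_distrib kappa_add add_ac)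
qed

lemma rho_scale: "\<rho> z (fun_scale c v) = fun_scale c (\<rho> z v)"
  unfolding \<rho>_def pr_scale act_scale
  by (simp add: FM.scale_right_distrib kappa_add kappa_scale) (simp add: fun_scale_def mult.assoc)

lemma rho_one: "v \<in> M \<Longrightarrow> \<rho> (gone G) v = v"
  using M_expand[of v] unfolding \<rho>_def by (simp add: G_simps act_one)

text \<open>\<open>\<rho>\<close> is an action of all points of the ambient semidirect product of
  \<open>W\<close> and \<open>H\<close>, so coassociativity holds exactly and the error term in
  \<open>rational_module\<close> is the empty sum.\<close>

lemma rho_mult: "\<rho> (gmult G x y) v = \<rho> x (\<rho> y v)"
proof -
  have "act (snd (gmult G x y)) (pr v) + scW (v 0) (fst (gmult G x y)) =
      act (snd x) (pr (\<rho> y v)) + scW (\<rho> y v 0) (fst x)"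
    unfolding pr_rho rho_0
    by (cases x; cases y) (simp add: G_simps act_mult act_add act_scale scale_right_distrib add_ac)
  then show ?thesis unfolding \<rho>_def[of "gmult G x y" v] \<rho>_def[of x "\<rho> y v"] rho_0 by simp
qed

lemma rho_kappa: "\<rho> (0, h) (\<kappa> u) = \<kappa> (act h u)"
  unfolding \<rho>_def by (simp add: kappa_0 pr_kappa)

text \<open>The matrix coefficients of \<open>\<rho>\<close> at \<open>v\<close> in the directions
  of \<open>W\<close>.\<close>

definition coeff_fun :: "(nat \<Rightarrow> 'k) \<Rightarrow> nat \<Rightarrow> 'w \<times> 'h \<Rightarrow> 'k"
  where "coeff_fun v i z = m i (act (snd z) (pr v) + scW (v 0) (fst z))"

lemma coeff_fun_eq: "i < n \<Longrightarrow> coeff_fun v i = (\<lambda>z. m i (act (snd z) (pr v)) + v 0 * m i (fst z))"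
  unfolding coeff_fun_def using linear_form_add[OF m] linear_form_scale[OF m] by simp

lemma coeff_fun_mem:
  assumes i: "i < n"
  shows "coeff_fun v i \<in> coord G"
  unfolding coeff_fun_eq[OF i]
  by (intro subalg_add[OF subalg_G] subalg_mult[OF subalg_G] subalg_const[OF subalg_G]
      linear_form_G[OF m[OF i]] coord_H_G[OF coord_act[OF m[OF i]]])

lemma rho_form:
  assumes l: "linear_form fun_scale l"
  shows "l (\<rho> z v) = v 0 * l e0 + (\<Sum>i<n. l (\<kappa> (e i)) * coeff_fun v i z)"
proof -
  have "\<rho> z v = fun_scale (v 0) e0 + (\<Sum>i<n. fun_scale (coeff_fun v i z) (\<kappa> (e i)))"
    unfolding \<rho>_def coeff_fun_def kappa_scale[symmetric] kappa_sum[symmetric] expand[symmetric] ..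
  then show ?thesis
    by (simp add: FM.linear_form_add[OF l] FM.linear_form_scale[OF l] FM.linear_form_sum[OF l] mult.commute)
qed

lemma rational_module_M: "rational_module G fun_scale M \<rho>"
  unfolding rational_module_def
proof (intro conjI allI ballI)
  show "fin_dim_subspace fun_scale M" by (rule fin_dim_M)
  fix v assume v: "v \<in> M"
  show "\<rho> x (v + v') = \<rho> x v + \<rho> x v'" for x v' by (rule rho_add)
  show "\<rho> x (fun_scale c v) = fun_scale c (\<rho> x v)" for x c by (rule rho_scale)
  show "\<rho> (gone G) v = v" by (rule rho_one[OF v])
  show "(\<lambda>x. \<rho> x v) \<in> vec_tensor fun_scale M (coord G)"
  proof (rule FM.vec_tensorI[OF fin_dim_M rho_mem])
    fix l :: "(nat \<Rightarrow> 'k) \<Rightarrow> 'k" assume l: "linear_form fun_scale l"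
    show "(\<lambda>x. l (\<rho> x v)) \<in> coord G"
      unfolding rho_form[OF l]
      by (intro subalg_add[OF subalg_G] subalg_sum[OF subalg_G] subalg_mult[OF subalg_G]
          subalg_const[OF subalg_G] coeff_fun_mem) auto
  qed
  have "(\<lambda>(x, y). \<rho> (gmult G x y) v - \<rho> x (\<rho> y v)) = (\<lambda>_. 0)"
    by (simp add: rho_mult case_prod_unfold)
  then show "(\<lambda>(x, y). \<rho> (gmult G x y) v - \<rho> x (\<rho> y v)) \<in>
      vec_tensor fun_scale M (fun_sum (fun_tensor (ideal G) (coord G)) (fun_tensor (coord G) (ideal G)))"
    unfolding vec_tensor_def by (intro CollectI exI[of _ 0]) simp
qed

abbreviation "\<sigma> \<equiv> lie_action fun_scale M \<rho>"

text \<open>From \<open>1 * 1 = 1\<close> the product rule gives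
  \<open>\<delta> 1 = \<delta> 1 + \<delta> 1\<close>.\<close>

lemma Lie_const:
  assumes "\<delta> \<in> lcar (Lie G)"
  shows "\<delta> (\<lambda>_. c) = 0"
proof -
  have c: "(\<lambda>_. c) \<in> coord G" for c by (rule subalg_const[OF subalg_G])
  have L: "\<And>f g. f \<in> coord G \<Longrightarrow> g \<in> coord G \<Longrightarrow> \<delta> (\<lambda>x. f x * g x) = f (gone G) * \<delta> g + \<delta> f * g (gone G)"
    using assms unfolding Lie_def by simp
  have "\<delta> (\<lambda>_. 1 * 1) = 1 * \<delta> (\<lambda>_. 1) + \<delta> (\<lambda>_. 1) * 1" by (rule L[OF c c])
  then have "\<delta> (\<lambda>_. 1) = \<delta> (\<lambda>_. 1) + \<delta> (\<lambda>_. 1)" by (simp only: mult_1_left mult_1_right)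
  then have "\<delta> (\<lambda>_. 1) = 0" by (simp only: add_cancel_right_right)
  moreover have "\<And>c f. f \<in> coord G \<Longrightarrow> \<delta> (\<lambda>x. c * f x) = c * \<delta> f"
    using assms unfolding Lie_def by simp
  from this[OF c] have "\<delta> (\<lambda>_. c * 1) = c * \<delta> (\<lambda>_. 1)" .
  ultimately show ?thesis by simp
qed

text \<open>Solves the \<open>THE\<close> in \<open>lie_action\<close>. The vector is read off from
  the expansion \<open>rho_form\<close>, whose constant term is killed by \<open>Lie_const\<close>,
  and linear forms separate vectors.\<close>

lemma lie_action_eq:
  assumes \<delta>: "\<delta> \<in> lcar (Lie G)"
  shows "\<sigma> \<delta> v = \<kappa> (\<Sum>i<n. scW (\<delta> (coeff_fun v i)) (e i))"
proof -
  let ?v = "\<kappa> (\<Sum>i<n. scW (\<delta> (coeff_fun v i)) (e i))"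
  have f: "functional \<delta>" by (rule functional_Lie[OF \<delta>])
  have v: "l ?v = \<delta> (\<lambda>x. l (\<rho> x v))" if l: "linear_form fun_scale l" for l :: "(nat \<Rightarrow> 'k) \<Rightarrow> 'k"
  proof -
    have 1: "(\<lambda>x. \<Sum>i<n. l (\<kappa> (e i)) * coeff_fun v i x) \<in> coord G"
      by (intro subalg_sum[OF subalg_G] subalg_mult[OF subalg_G] subalg_const[OF subalg_G] coeff_fun_mem) auto
    have "\<delta> (\<lambda>x. l (\<rho> x v)) = \<delta> (\<lambda>_. v 0 * l e0) + \<delta> (\<lambda>x. \<Sum>i<n. l (\<kappa> (e i)) * coeff_fun v i x)"
      unfolding rho_form[OF l] using f 1 subalg_const[OF subalg_G] unfolding functional_def by simp
    also have "\<dots> = (\<Sum>i<n. l (\<kappa> (e i)) * \<delta> (coeff_fun v i))"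
      using functional_sum[OF f, of "{..<n}" "coeff_fun v"] coeff_fun_mem by (simp add: Lie_const[OF \<delta>])
    also have "\<dots> = l ?v"
      by (simp add: kappa_sum kappa_scale FM.linear_form_sum[OF l] FM.linear_form_scale[OF l] mult.commute)
    finally show ?thesis by simp
  qed
  show ?thesis
    unfolding lie_action_def
  proof (rule the_equality)
    show "?v \<in> M \<and> (\<forall>l. linear_form fun_scale l \<longrightarrow> l ?v = \<delta> (\<lambda>x. l (\<rho> x v)))"
      using kappa_mem v by simp
    fix u assume "u \<in> M \<and> (\<forall>l. linear_form fun_scale l \<longrightarrow> l u = \<delta> (\<lambda>x. l (\<rho> x v)))"
    then show "u = ?v" by (intro FM.linear_forms_separate) (simp add: v)
  qed
qed

text \<open>\<open>D w\<close> kills functions of \<open>h\<close> alone, so of each matrix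
  coefficient only the part linear in the \<open>W\<close>-component survives.\<close>

lemma lie_action_D: "\<sigma> (D w) v = \<kappa> (scW (v 0) w)"
proof -
  have "D w (coeff_fun v i) = v 0 * m i w" if i: "i < n" for i
  proof -
    have 1: "(\<lambda>z. m i (act (snd z) (pr v))) \<in> coord G" by (rule coord_H_G[OF coord_act[OF m[OF i]]])
    have 2: "(\<lambda>z. v 0 * m i (fst z)) \<in> coord G"
      by (intro subalg_mult[OF subalg_G] subalg_const[OF subalg_G] linear_form_G m i)
    show ?thesis
      unfolding coeff_fun_eq[OF i] D_add[OF 1 2] D_smult[OF linear_form_G[OF m[OF i]]]
      using D_coord_H[OF coord_act[OF m[OF i]]] by (simp add: D_form[OF m[OF i]])
  qed
  then have "\<sigma> (D w) v = \<kappa> (\<Sum>i<n. scW (v 0 * m i w) (e i))"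
    unfolding lie_action_eq[OF D_mem] by simp
  also have "(\<Sum>i<n. scW (v 0 * m i w) (e i)) = scW (v 0) (\<Sum>i<n. scW (m i w) (e i))"
    by (simp add: scale_sum_right)
  finally show ?thesis using expand[of w] by simp
qed

text \<open>Eliminates the basis \<open>B\<close>: the action is linear in the Lie algebra element,
  so the coordinate functions recombine to \<open>T s\<close>.\<close>

lemma Theta_eq:
  assumes B: "basis_of fun_scale B (lcar (Lie G))" and T: "T s \<in> lcar (Lie G)"
  shows "Theta (Lie G) B fun_scale \<sigma> s F T = \<sigma> (T s) (F T)"
proof -
  have B': "finite B" "FL.independent B" "FL.span B = lcar (Lie G)"
    using B unfolding basis_of_def by auto
  have bl: "b \<in> lcar (Lie G)" if "b \<in> B" for b using FL.span_base[OF that] B'(3) by simp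
  let ?r = "FL.representation B (T s)"
  have r: "(\<Sum>b\<in>B. fun_scale (?r b) b) = T s"
    using FL.sum_representation_eq[OF B'(2) _ B'(1) order_refl] T B'(3) by simp
  have Ts: "T s f = (\<Sum>b\<in>B. ?r b * b f)" for f
    using fun_cong[OF r, of f] by (simp add: sum_fun_apply fun_scale_def)
  have "Theta (Lie G) B fun_scale \<sigma> s F T = (\<Sum>b\<in>B. fun_scale (?r b) (\<sigma> b (F T)))"
    unfolding Theta_def by (simp add: Lie_def)
  also have "\<dots> = (\<Sum>b\<in>B. \<kappa> (\<Sum>i<n. scW (?r b * b (coeff_fun (F T) i)) (e i)))"
    by (rule sum.cong) (simp_all add: lie_action_eq[OF bl] kappa_scale[symmetric] scale_sum_right)
  also have "\<dots> = \<kappa> (\<Sum>i<n. scW (\<Sum>b\<in>B. ?r b * b (coeff_fun (F T) i)) (e i))"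
    by (subst kappa_sum[symmetric], subst sum.swap) (simp only: scale_sum_left)
  also have "\<dots> = \<sigma> (T s) (F T)"
    by (simp only: lie_action_eq[OF T] Ts)
  finally show ?thesis .
qed

end

section \<open>The image sheaf\<close>

text \<open>Local sections of the torsor let one pull a relation between pulled-back sections back down.\<close>

lemma coherent_subsheaf_pullback_subset:
  fixes sc :: "'k::field \<Rightarrow> 'm::ab_group_add \<Rightarrow> 'm"
  assumes sc: "vector_space sc" and X: "ringed X" and T: "ringed T" and q: "local_morphism T (pts T) X q"
    and sec: "\<And>x. x \<in> pts X \<Longrightarrow> \<exists>N \<tau>. x \<in> N \<and> local_morphism X N T \<tau> \<and> (\<forall>z\<in>N. q (\<tau> z) = z)"
    and I: "coherent_subsheaf sc M X I" and I': "coherent_subsheaf sc M X I'"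
    and pb: "\<And>V. is_open T V \<Longrightarrow> pullback_subsheaf sc T X q I V = pullback_subsheaf sc T X q I' V"
  shows "I U \<subseteq> I' U"
proof -
  interpret vector_space sc by fact
  show ?thesis
  proof (cases "is_open X U")
    case False
    then show ?thesis using I unfolding coherent_subsheaf_def by simp
  next
    case U: True
    have ax: "(\<lambda>x\<in>U. 0) \<in> I' U"
        "s \<in> I' U \<Longrightarrow> t \<in> I' U \<Longrightarrow> (\<lambda>x\<in>U. s x + t x) \<in> I' U"
        "f \<in> reg X U \<Longrightarrow> s \<in> I' U \<Longrightarrow> (\<lambda>x\<in>U. sc (f x) (s x)) \<in> I' U"
        "is_open X V \<Longrightarrow> V \<subseteq> U \<Longrightarrow> s \<in> I' U \<Longrightarrow> restrict s V \<in> I' V"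
        "s \<in> extensional U \<Longrightarrow>
          (\<forall>x\<in>U. \<exists>V. is_open X V \<and> x \<in> V \<and> V \<subseteq> U \<and> restrict s V \<in> I' V) \<Longrightarrow> s \<in> I' U"
      if "is_open X U" for U V s t f
      using I' that unfolding coherent_subsheaf_def by simp_all
    show ?thesis
    proof
      fix s assume s: "s \<in> I U"
      have "I U \<subseteq> free_sections sc M X U" using I U unfolding coherent_subsheaf_def by simp
      then have sext: "s \<in> extensional U" using s unfolding free_sections_def by auto
      let ?U = "{t \<in> pts T. q t \<in> U}"
      have oU: "is_open T ?U" by (rule local_morphism_vimage[OF q U])
      \<comment> \<open>The pulled-back section is itself a generator: a single summand with
        coefficient 1.\<close>
      have "(\<lambda>t\<in>?U. s (q t)) \<in> pullback_subsheaf sc T X q I ?U"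
        unfolding pullback_subsheaf_def generated_def
      proof (rule CollectI, intro conjI ballI)
        fix t assume t: "t \<in> ?U"
        have i: "is_open X U \<and> q ` ?U \<subseteq> U \<and> s \<in> I U" using U s by auto
        have e: "(\<lambda>y\<in>?U. s (q y)) \<in> {\<lambda>y\<in>?U. s (q y) |s U. is_open X U \<and> q ` ?U \<subseteq> U \<and> s \<in> I U}"
          by (rule CollectI, rule exI[of _ s], rule exI[of _ U]) (use i in simp)
        show "\<exists>V (n::nat) f e. is_open T V \<and> t \<in> V \<and> V \<subseteq> ?U \<and>
          (\<forall>i<n. f i \<in> reg T V \<and> e i \<in> {\<lambda>y\<in>V. s (q y) |s U. is_open X U \<and> q ` V \<subseteq> U \<and> s \<in> I U}) \<and>
          (\<forall>y\<in>V. (\<lambda>t\<in>?U. s (q t)) y = (\<Sum>i<n. sc (f i y) (e i y)))"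
        proof (rule exI[of _ ?U], rule exI[of _ 1], rule exI[of _ "\<lambda>_ _. 1"],
            rule exI[of _ "\<lambda>_. \<lambda>y\<in>?U. s (q y)"], intro conjI allI impI ballI)
          show "(\<lambda>_. 1) \<in> reg T ?U" by (rule reg_const[OF T oU])
          show "(\<lambda>y\<in>?U. s (q y)) \<in> {\<lambda>y\<in>?U. s (q y) |s U. is_open X U \<and> q ` ?U \<subseteq> U \<and> s \<in> I U}" by (rule e)
        qed (use oU t scale_one in auto)
      qed simp
      then have gen: "(\<lambda>t\<in>?U. s (q t)) \<in> pullback_subsheaf sc T X q I' ?U" using pb[OF oU] by simp
      note gen' = gen[unfolded pullback_subsheaf_def]
      show "s \<in> I' U"
      proof (rule ax(5)[OF U sext], intro ballI)
        fix x assume x: "x \<in> U"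
        then have "x \<in> pts X" using openin_subset[OF U] by auto
        from sec[OF this] obtain N \<tau> where N: "x \<in> N" "local_morphism X N T \<tau>" "\<forall>z\<in>N. q (\<tau> z) = z"
          by (elim exE conjE)
        have "\<tau> x \<in> ?U" using local_morphism_pts[OF N(2,1)] N(1,3) x by simp
        from bspec[OF gen'[unfolded generated_def, THEN CollectD, THEN conjunct2] this]
        obtain V n f e where V: "is_open T V" "\<tau> x \<in> V" "V \<subseteq> ?U"
          "\<forall>i<(n::nat). f i \<in> reg T V \<and> e i \<in> {\<lambda>y\<in>V. s (q y) |s U. is_open X U \<and> q ` V \<subseteq> U \<and> s \<in> I' U}"
          "\<forall>y\<in>V. (\<lambda>t\<in>?U. s (q t)) y = (\<Sum>i<n. sc (f i y) (e i y))"
          by (elim exE conjE)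
        \<comment> \<open>Each generator \<open>e i\<close> is the pull-back of a section
          \<open>s' i\<close> of \<open>I'\<close> over an open set \<open>U' i\<close> that
          contains the image of \<open>V\<close>.\<close>
        define P where "P i s' U' \<longleftrightarrow> e i = (\<lambda>y\<in>V. s' (q y)) \<and> is_open X U' \<and> q ` V \<subseteq> U' \<and> s' \<in> I' U'" for i s' U'
        have "\<exists>s' U'. P i s' U'" if "i < n" for i
        proof -
          have "e i \<in> {\<lambda>y\<in>V. s (q y) |s U. is_open X U \<and> q ` V \<subseteq> U \<and> s \<in> I' U}" using V(4) that by simp
          then show ?thesis unfolding P_def by (elim CollectE exE conjE) (intro exI conjI)
        qed
        then obtain s' U' where "\<And>i. i < n \<Longrightarrow> P i (s' i) (U' i)" by metis
        note s' = this[unfolded P_def]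
        \<comment> \<open>Here \<open>\<tau>\<close> takes values in \<open>V\<close>, so the
          relation on \<open>V\<close> can be pulled back along \<open>\<tau>\<close>; since
          \<open>\<tau>\<close> is a section of \<open>q\<close>, it becomes a relation between
          \<open>s\<close> and the \<open>s' i\<close> with coefficients
          \<open>f i (\<tau> z)\<close>.\<close>
        let ?W = "{z \<in> N. \<tau> z \<in> V}"
        have oW: "is_open X ?W" by (rule local_morphism_vimage[OF N(2) V(1)])
        have WU: "?W \<subseteq> U" using V(3) N(3) by auto
        have sW: "s z = (\<Sum>i<n. sc (f i (\<tau> z)) (s' i z))" if z: "z \<in> ?W" for z
        proof -
          have "\<tau> z \<in> V" "\<tau> z \<in> ?U" "q (\<tau> z) = z" using V(3) N(3) z by auto
          then have "s z = (\<Sum>i<n. sc (f i (\<tau> z)) (e i (\<tau> z)))" using bspec[OF V(5), of "\<tau> z"] by simp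
          also have "\<dots> = (\<Sum>i<n. sc (f i (\<tau> z)) (s' i z))"
            using s' z N(3) by (intro sum.cong) auto
          finally show ?thesis .
        qed
        \<comment> \<open>The axioms of a subsheaf give binary sums, hence the induction over
          partial sums.\<close>
        have part: "(\<lambda>z\<in>?W. \<Sum>i<k. sc (f i (\<tau> z)) (s' i z)) \<in> I' ?W" if "k \<le> n" for k
          using that
        proof (induction k)
          case 0
          show ?case using ax(1)[OF oW] by (simp only: lessThan_0 sum.empty)
        next
          case (Suc k)
          then have k: "k < n" by simp
          have Wk: "?W \<subseteq> U' k"
          proof
            fix z assume "z \<in> ?W"
            then have "q (\<tau> z) \<in> U' k" "q (\<tau> z) = z" using s'[OF k] N(3) by auto
            then show "z \<in> U' k" by simp
          qed
          have "restrict (s' k) ?W \<in> I' ?W" using ax(4)[OF _ oW Wk] s'[OF k] by simp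
          moreover have "(\<lambda>z. f k (\<tau> z)) \<in> reg X ?W"
            using local_morphism_reg[OF N(2) V(1)] V(4) k by simp
          ultimately have 1: "(\<lambda>z\<in>?W. sc (f k (\<tau> z)) (restrict (s' k) ?W z)) \<in> I' ?W" by (rule ax(3)[OF oW, rotated])
          have 2: "(\<lambda>z\<in>?W. \<Sum>i<k. sc (f i (\<tau> z)) (s' i z)) \<in> I' ?W"
            by (rule Suc.IH) (use k in simp)
          have "(\<lambda>z\<in>?W. \<Sum>i<Suc k. sc (f i (\<tau> z)) (s' i z)) =
            (\<lambda>z\<in>?W. (\<lambda>z\<in>?W. \<Sum>i<k. sc (f i (\<tau> z)) (s' i z)) z +
              (\<lambda>z\<in>?W. sc (f k (\<tau> z)) (restrict (s' k) ?W z)) z)"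
            by (rule restrict_ext) simp
          then show ?case using ax(2)[OF oW 2 1] by (simp only:)
        qed
        have "restrict s ?W = (\<lambda>z\<in>?W. \<Sum>i<n. sc (f i (\<tau> z)) (s' i z))" using sW by (intro restrict_ext)
        then have "restrict s ?W \<in> I' ?W" by (simp only: part[OF order_refl])
        then show "\<exists>V. is_open X V \<and> x \<in> V \<and> V \<subseteq> U \<and> restrict s V \<in> I' V"
          using oW WU N(1) V(2) by (intro exI[of _ ?W]) simp
      qed
    qed
  qed
qed

locale image_setup = orbit scW H act r \<epsilon> + extension_module scW H act n e m
  for scW :: "'k::alg_closed_field \<Rightarrow> 'w::ab_group_add \<Rightarrow> 'w" and H :: "('h, 'k) grp_scheme"
    and act r \<epsilon> n e m +
  fixes B :: "(('w \<times> 'h \<Rightarrow> 'k) \<Rightarrow> 'k) set"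
  assumes B: "basis_of fun_scale B (lcar (Lie G))"
begin

abbreviation "L \<equiv> Lie G"

text \<open>A linear retraction of \<open>D\<close> on the entire space of functionals. It will
  provide the morphism from \<open>Z\<close> back to \<open>Y\<close>.\<close>

definition "ret = (SOME g. Vector_Spaces.linear fun_scale scW g \<and> g \<circ> D = id)"

definition "Z = sub_space (elem_variety L r) ((\<lambda>y. D ` y) ` pts Y)"

abbreviation "TZ \<equiv> torsor L r Z"

abbreviation "q \<equiv> tuple_span (fun_scale :: 'k \<Rightarrow> (('w \<times> 'h \<Rightarrow> 'k) \<Rightarrow> 'k) \<Rightarrow> ('w \<times> 'h \<Rightarrow> 'k) \<Rightarrow> 'k) r"

text \<open>For \<open>E\<close> the image of \<open>y\<close> under \<open>D\<close> this is the
  copy of \<open>y\<close> in the summand \<open>W\<close> of \<open>M\<close>, the expected fibre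
  of the image sheaf at \<open>E\<close>.\<close>

definition "PZ E = \<kappa> ` ret ` E"

text \<open>The candidate for the image sheaf. It is empty on sets that are not open, following the
  normalisation in \<open>coherent_subsheaf\<close>, so that it can be the value of the
  \<open>THE\<close> in \<open>image_sheaf\<close>.\<close>

definition "J U = (if is_open Z U then family_sections fun_scale Z PZ U else {})"

lemma lscale_L: "lscale L = fun_scale"
  by (simp add: Lie_def)

lemma linear_ret: "Vector_Spaces.linear fun_scale scW ret" and ret_D: "ret (D u) = u"
proof -
  interpret p: vector_space_pair scW "fun_scale :: 'k \<Rightarrow> (('w \<times> 'h \<Rightarrow> 'k) \<Rightarrow> 'k) \<Rightarrow> ('w \<times> 'h \<Rightarrow> 'k) \<Rightarrow> 'k"
    by unfold_locales
  have "\<exists>g. Vector_Spaces.linear fun_scale scW g \<and> g \<circ> D = id"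
    by (rule p.linear_injective_left_inverse[OF linear_D inj_D])
  from someI_ex[OF this] have *: "Vector_Spaces.linear fun_scale scW ret" "ret \<circ> D = id"
    unfolding ret_def by auto
  show "Vector_Spaces.linear fun_scale scW ret" by fact
  show "ret (D u) = u" using fun_cong[OF *(2), of u] by simp
qed

lemma ret_image: "ret ` D ` y = y"
  by (force simp: image_image ret_D)

lemma subspace_L: "FL.subspace (lcar L)"
  using B FL.subspace_span[of B] unfolding basis_of_def by simp

lemma D_subset: "D ` y \<subseteq> lcar L"
  using D_mem by auto

lemma indep_D: "T \<in> indep_tuples scW UNIV r \<Longrightarrow> (\<lambda>t\<in>{..<r}. D (T t)) \<in> indep_tuples fun_scale (lcar L) r"
  by (rule linear_indep_tuples[OF linear_D _ inj_on_subset[OF inj_D subset_UNIV] D_subset])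

text \<open>By \<open>bracket_D\<close> and \<open>lpow_D\<close> the image of each \<open>y\<close>
  is an elementary subalgebra, so no point is lost when \<open>Z\<close> is cut out of
  \<open>elem_variety\<close>.\<close>

lemma pts_Z: "pts Z = (\<lambda>y. D ` y) ` pts Y"
proof -
  interpret lD: Vector_Spaces.linear scW fun_scale D by (rule linear_D)
  have "D ` y \<in> pts (elem_variety L r)" if y: "y \<in> pts Y" for y
  proof -
    have "elementary_subalgebra L (D ` y)"
      unfolding elementary_subalgebra_def lscale_L
      using D_subset lD.subspace_image[OF subspace_Y[OF y]] bracket_D lpow_D by auto
    moreover have "D ` y \<in> pts (grass fun_scale (lcar L) r)"
    proof -
      obtain T where T: "T \<in> indep_tuples scW UNIV r" "y = tuple_span scW r T"
        using y unfolding pts_Y pts_grass by auto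
      then show ?thesis
        unfolding pts_grass using linear_tuple_span[OF linear_D, of r T] indep_D[OF T(1)] by (metis imageI)
    qed
    ultimately show ?thesis unfolding elem_variety_def lscale_L by simp
  qed
  then show ?thesis unfolding Z_def by auto
qed

lemma ringed_Z: "ringed Z"
  unfolding Z_def elem_variety_def by (intro ringed_sub_space ringed_grass)

lemma local_morphism_Z_grass: "local_morphism Z (pts Z) (grass fun_scale (lcar L) r) (\<lambda>E. E)"
proof -
  have 1: "local_morphism (elem_variety L r) (pts (elem_variety L r)) (grass fun_scale (lcar L) r) (\<lambda>E. E)"
    unfolding elem_variety_def lscale_L by (rule local_morphism_incl[OF ringed_grass])
  have 2: "local_morphism Z (pts Z) (elem_variety L r) (\<lambda>E. E)"
    unfolding Z_def by (rule local_morphism_incl) (simp add: elem_variety_def ringed_sub_space ringed_grass)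
  show ?thesis by (rule local_morphism_comp'[OF 2 1]) (use local_morphism_pts[OF 2] in auto)
qed

lemma local_morphism_into_Z:
  assumes X: "ringed X" and f: "local_morphism X N (grass fun_scale (lcar L) r) f" and N: "f ` N \<subseteq> pts Z"
  shows "local_morphism X N Z f"
proof -
  have "f ` N \<subseteq> {E. elementary_subalgebra L E}" "f ` N \<subseteq> (\<lambda>y. D ` y) ` pts Y"
    using N unfolding Z_def elem_variety_def by auto
  then show ?thesis
    unfolding Z_def elem_variety_def lscale_L
    by (intro local_morphism_into_sub[OF X] f)
qed

lemma local_morphism_iota: "local_morphism Y (pts Y) Z (\<lambda>y. D ` y)"
proof (rule local_morphism_into_Z[OF ringed_Y])
  show "local_morphism Y (pts Y) (grass fun_scale (lcar L) r) (\<lambda>y. D ` y)"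
    by (rule local_morphism_grass_image[OF ringed_Y vector_space_axioms subspace_UNIV local_morphism_Y_grass linear_D])
      (auto intro: vreg_linear[OF linear_D] indep_D)
  show "(\<lambda>y. D ` y) ` pts Y \<subseteq> pts Z" unfolding pts_Z ..
qed

lemma D_ret: "E \<in> pts Z \<Longrightarrow> v \<in> E \<Longrightarrow> D (ret v) = v"
  unfolding pts_Z by (auto simp: ret_D)

text \<open>On a point of \<open>Z\<close> the map \<open>ret\<close> inverts \<open>D\<close>,
  hence is injective there and preserves independent tuples. With \<open>local_morphism_iota\<close>
  this makes \<open>Y\<close> and \<open>Z\<close> isomorphic.\<close>

lemma local_morphism_ret: "local_morphism Z (pts Z) Y (\<lambda>E. ret ` E)"
  unfolding Y_def
proof (rule local_morphism_into_sub[OF ringed_Z])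
  show "local_morphism Z (pts Z) (grass scW UNIV r) (\<lambda>E. ret ` E)"
  proof (rule local_morphism_grass_image[OF ringed_Z vector_space_fun_scale subspace_L local_morphism_Z_grass linear_ret])
    fix N' and F :: "_ \<Rightarrow> (('w \<times> 'h \<Rightarrow> 'k) \<Rightarrow> 'k)"
    assume "vreg fun_scale Z N' F"
    then show "vreg scW Z N' (\<lambda>x. ret (F x))" by (rule vreg_linear[OF linear_ret])
  next
    fix E and T :: "nat \<Rightarrow> (('w \<times> 'h \<Rightarrow> 'k) \<Rightarrow> 'k)"
    assume E: "E \<in> pts Z" and T: "T \<in> indep_tuples fun_scale (lcar L) r" "q T = E"
    have "inj_on ret (q T)" unfolding T(2) by (rule inj_on_inverseI[of _ D]) (rule D_ret[OF E])
    then show "(\<lambda>t\<in>{..<r}. ret (T t)) \<in> indep_tuples scW UNIV r"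
      by (rule linear_indep_tuples[OF linear_ret T(1)]) simp
  qed
  show "(\<lambda>E. ret ` E) ` pts Z \<subseteq> range (\<lambda>h. act h ` \<epsilon>)"
    unfolding pts_Z image_image[of "\<lambda>E. ret ` E"] ret_image using pts_Y by auto
qed

lemma open_iota:
  assumes U: "is_open Y U"
  shows "is_open Z ((\<lambda>y. D ` y) ` U)"
proof -
  have "(\<lambda>y. D ` y) ` U = {E \<in> pts Z. ret ` E \<in> U}"
    using openin_subset[OF U] unfolding pts_Z by (auto simp: ret_image)
  then show ?thesis using local_morphism_vimage[OF local_morphism_ret U] by simp
qed

lemma ringed_TZ: "ringed TZ"
  unfolding torsor_def by (intro ringed_sub_space ringed_tuple_space)

text \<open>The entries of a tuple that spans a point of \<open>Z\<close> have the form
  \<open>D u\<close>, so they commute and have zero \<open>p\<close>-power automatically.\<close>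

lemma pts_TZ: "pts TZ = {T \<in> indep_tuples fun_scale (lcar L) r. q T \<in> pts Z}"
proof -
  have "T \<in> elem_tuples L r" if T: "T \<in> indep_tuples fun_scale (lcar L) r" "q T \<in> pts Z" for T
  proof -
    have "\<exists>u. T s = D u" if "s < r" for s
      using FL.tuple_span_base[OF that, of T] T(2) unfolding pts_Z by auto
    then show ?thesis
      unfolding elem_tuples_def lscale_L using T(1) bracket_D lpow_D by auto metis+
  qed
  then show ?thesis unfolding torsor_def lscale_L by (auto simp: elem_tuples_def lscale_L)
qed

lemma vreg_TZ: "s < r \<Longrightarrow> vreg fun_scale TZ (pts TZ) (\<lambda>T. T s)"
proof -
  assume s: "s < r"
  have i: "local_morphism TZ (pts TZ) (tuple_space fun_scale r) (\<lambda>T. T)"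
    unfolding torsor_def lscale_L by (rule local_morphism_incl[OF ringed_tuple_space])
  show ?thesis
    by (rule vreg_comp'[OF i vreg_tuple_space[OF s], where U = UNIV])
      (use openin_topspace[of "top (tuple_space fun_scale r)"] in auto)
qed

lemma local_morphism_TZ: "local_morphism TZ (pts TZ) (tuple_variety fun_scale (lcar L) r) (\<lambda>T. T)"
  by (rule local_morphism_tuple_variety[OF ringed_TZ openin_topspace vreg_TZ]) (simp_all add: pts_TZ)

lemma local_morphism_q: "local_morphism TZ (pts TZ) Z q"
proof (rule local_morphism_into_Z[OF ringed_TZ])
  show "local_morphism TZ (pts TZ) (grass fun_scale (lcar L) r) q"
    by (rule local_morphism_comp'[OF local_morphism_TZ local_morphism_tuple_span]) (auto simp: pts_TZ)
  show "q ` pts TZ \<subseteq> pts Z" by (auto simp: pts_TZ)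
qed

lemma subspace_PZ: "E \<in> pts Z \<Longrightarrow> FM.subspace (PZ E)"
proof -
  assume "E \<in> pts Z"
  then obtain y where "y \<in> pts Y" "E = D ` y" unfolding pts_Z by auto
  then show ?thesis
    using Vector_Spaces.linear.axioms(3)[OF linear_kappa, THEN module_hom.subspace_image] subspace_Y
    unfolding PZ_def by (simp add: ret_image)
qed

lemma PZ_subset: "PZ E \<subseteq> M"
  unfolding PZ_def using kappa_mem by auto

lemma linear_pr: "Vector_Spaces.linear fun_scale scW pr"
  unfolding Vector_Spaces.linear_iff
  using vector_space_axioms vector_space_fun_scale pr_add pr_scale by blast

lemma PZ_dest: "E \<in> pts Z \<Longrightarrow> v \<in> PZ E \<Longrightarrow> D (pr v) \<in> E \<and> v = \<kappa> (ret (D (pr v)))"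
  unfolding PZ_def by (auto simp: pr_kappa D_ret)

lemma linear_form_D_pr: "linear_form fun_scale l \<Longrightarrow> linear_form fun_scale (\<lambda>v. l (D (pr v)))"
  using Vector_Spaces.linear_compose[OF Vector_Spaces.linear_compose[OF linear_pr linear_D]]
  unfolding linear_form_def by (fastforce simp: comp_def)

lemma linear_kappa_ret: "Vector_Spaces.linear fun_scale fun_scale (\<lambda>x. \<kappa> (ret x))"
  using Vector_Spaces.linear_compose[OF linear_ret linear_kappa] by (simp add: comp_def)

lemma kappa_ret_sum: "\<kappa> (ret (\<Sum>i\<in>I. fun_scale (c i) (x i))) = (\<Sum>i\<in>I. fun_scale (c i) (\<kappa> (ret (x i))))"
proof -
  interpret l: Vector_Spaces.linear fun_scale fun_scale "\<lambda>x. \<kappa> (ret x)" by (rule linear_kappa_ret)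
  show ?thesis by (simp add: l.sum l.scale)
qed

text \<open>\<open>grass_chart\<close> cut down to \<open>Z\<close> and to its torsor: a local
  section \<open>\<tau>\<close> of the torsor, coordinate forms for it, and the regular matrix
  \<open>b\<close> that expresses it through any nearby tuple.\<close>

lemma Z_chart:
  assumes T0: "T0 \<in> pts TZ"
  shows "\<exists>N \<tau> l. is_open Z N \<and> q T0 \<in> N \<and> local_morphism Z N TZ \<tau> \<and>
    (\<forall>s<r. linear_form fun_scale (l s)) \<and>
    (\<forall>E\<in>N. q (\<tau> E) = E \<and> (\<forall>v\<in>E. v = (\<Sum>t<r. fun_scale (l t v) (\<tau> E t)))) \<and>
    (\<exists>N' b. is_open TZ N' \<and> T0 \<in> N' \<and> (\<forall>u<r. \<forall>t<r. b u t \<in> reg TZ N') \<and>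
      (\<forall>T\<in>N'. q T \<in> N \<and> (\<forall>t<r. \<tau> (q T) t = (\<Sum>u<r. fun_scale (b u t T) (T u)))))"
proof -
  let ?TV = "tuple_variety fun_scale (lcar L) r" and ?GL = "grass fun_scale (lcar L) r"
  have T0': "T0 \<in> indep_tuples fun_scale (lcar L) r" "q T0 \<in> pts Z" using T0 unfolding pts_TZ by auto
  obtain l where l: "\<forall>s<r. linear_form fun_scale (l s) \<and> (\<forall>t<r. l s (T0 t) = of_bool (s = t))"
    using FL.dual_forms[OF T0'(1)] by blast
  have l1: "\<And>s. s < r \<Longrightarrow> linear_form fun_scale (l s)"
    and l2: "\<And>s t. s < r \<Longrightarrow> t < r \<Longrightarrow> l s (T0 t) = of_bool (s = t)" using l by auto
  obtain N \<tau> where N: "is_open ?GL N" "q T0 \<in> N" "local_morphism ?GL N ?TV \<tau>"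
    "\<forall>E\<in>N. \<tau> E \<in> indep_tuples fun_scale (lcar L) r \<and> q (\<tau> E) = E \<and>
      (\<forall>s<r. \<forall>t<r. l s (\<tau> E t) = of_bool (s = t))"
    "\<forall>T\<in>indep_tuples fun_scale (lcar L) r. q T \<in> N \<longrightarrow>
      (\<exists>N' b. is_open ?TV N' \<and> T \<in> N' \<and> (\<forall>u<r. \<forall>t<r. b u t \<in> reg ?TV N') \<and>
        (\<forall>T'\<in>N'. q T' \<in> N \<and> (\<forall>t<r. \<tau> (q T') t = (\<Sum>u<r. fun_scale (b u t T') (T' u)))))"
    by (rule FL.grass_chart[where l = l, OF subspace_L T0'(1), THEN exE])
      (rule l1, assumption, rule l2, assumption, assumption, elim exE conjE, rule that, assumption+)
  obtain N' b where N': "is_open ?TV N'" "T0 \<in> N'" "\<forall>u<r. \<forall>t<r. b u t \<in> reg ?TV N'"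
    "\<forall>T\<in>N'. q T \<in> N \<and> (\<forall>t<r. \<tau> (q T) t = (\<Sum>u<r. fun_scale (b u t T) (T u)))"
    using bspec[OF N(5) T0'(1), THEN mp, OF N(2)] by (elim exE conjE)
  let ?N = "{E \<in> pts Z. E \<in> N}"
  have oN: "is_open Z ?N" by (rule local_morphism_vimage[OF local_morphism_Z_grass N(1)])
  have s1: "local_morphism Z ?N ?TV \<tau>" by (rule local_morphism_comp[OF local_morphism_Z_grass N(3)])
  have s2: "local_morphism Z ?N (tuple_space fun_scale r) \<tau>"
    by (rule local_morphism_comp'[OF s1 local_morphism_incl[OF ringed_tuple_space]])
      (use local_morphism_pts[OF s1] in auto)
  have s3: "local_morphism Z ?N TZ \<tau>"
    unfolding torsor_def lscale_L
  proof (rule local_morphism_into_sub[OF ringed_Z s2], rule subsetI)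
    fix T assume "T \<in> \<tau> ` ?N"
    then have "T \<in> pts TZ" using N(4) unfolding pts_TZ by auto
    then show "T \<in> {T \<in> elem_tuples L r. q T \<in> pts Z}" unfolding torsor_def lscale_L by simp
  qed
  let ?N' = "{T \<in> pts TZ. T \<in> N'}"
  have oN': "is_open TZ ?N'" by (rule local_morphism_vimage[OF local_morphism_TZ N'(1)])
  have b: "b u t \<in> reg TZ ?N'" if "u < r" "t < r" for u t
    using local_morphism_reg[OF local_morphism_TZ N'(1)] N'(3) that by simp
  have ex: "v = (\<Sum>t<r. fun_scale (l t v) (\<tau> E t))" if E: "E \<in> ?N" and v: "v \<in> E" for E v
  proof (rule FL.dual_forms_expand[OF l1])
    show "l s (\<tau> E t) = of_bool (s = t)" if "s < r" "t < r" for s t using N(4) E that by simp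
    show "v \<in> q (\<tau> E)" using N(4) E v by simp
  qed
  have 1: "\<forall>E\<in>?N. q (\<tau> E) = E \<and> (\<forall>v\<in>E. v = (\<Sum>t<r. fun_scale (l t v) (\<tau> E t)))"
    using N(4) ex by simp
  have 2: "\<forall>T\<in>?N'. q T \<in> ?N \<and> (\<forall>t<r. \<tau> (q T) t = (\<Sum>u<r. fun_scale (b u t T) (T u)))"
    using N'(4) unfolding pts_TZ by simp
  show ?thesis
    by (rule exI[of _ ?N], rule exI[of _ \<tau>], rule exI[of _ l], intro conjI,
        rule oN, use T0' N(2) in simp, rule s3, use l1 in simp, rule 1,
        rule exI[of _ ?N'], rule exI[of _ b], intro conjI,
        rule oN', use T0 N'(2) in simp, use b in simp, rule 2)
qed

lemma Z_point:
  assumes "E \<in> pts Z"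
  obtains T0 where "T0 \<in> pts TZ" "q T0 = E"
proof -
  have "E \<in> pts (grass fun_scale (lcar L) r)" by (rule local_morphism_pts[OF local_morphism_Z_grass assms])
  then obtain T0 where "T0 \<in> indep_tuples fun_scale (lcar L) r" "q T0 = E" unfolding pts_grass by auto
  then show thesis using that assms unfolding pts_TZ by simp
qed

end

lemma frame_forms:
  assumes "is_open X N" "\<And>i. i < n \<Longrightarrow> vreg sc X N (e i)" "\<And>i x. i < n \<Longrightarrow> x \<in> N \<Longrightarrow> e i x \<in> P x"
    and "\<And>i. i < n \<Longrightarrow> linear_form sc (l i)"
    and "\<And>x v. x \<in> N \<Longrightarrow> v \<in> P x \<Longrightarrow> v = (\<Sum>i<n. sc (l i v) (e i x))"
  shows "frame sc X P N n e (\<lambda>i _. l i)"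
  unfolding frame_def
  by (intro conjI allI impI ballI) (rule assms(1), erule assms(2), erule (1) assms(3), erule (1) assms(5),
      rule vregD, assumption, erule assms(4))

lemma frame_restrict_mem:
  assumes X: "ringed X" and fr: "frame sc X P N n e \<gamma>" and i: "i < n" and V: "is_open X V" "V \<subseteq> N"
  shows "restrict (e i) V \<in> family_sections sc X P V"
proof -
  have "vreg sc X V (e i)" by (rule vreg_restrict[OF X frame_vreg[OF fr i] frame_open[OF fr] V])
  then have "vreg sc X V (restrict (e i) V)" by (rule vreg_cong[OF X]) simp
  then show ?thesis unfolding family_sections_def using frame_mem[OF fr i] V(2) by auto
qed

context image_setup
begin

lemma vreg_section:
  assumes "is_open Z N" "local_morphism Z N TZ \<tau>" "t < r"
  shows "vreg fun_scale Z N (\<lambda>E. \<kappa> (ret (\<tau> E t)))"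
proof -
  have "vreg fun_scale Z N (\<lambda>E. \<tau> E t)"
    by (rule vreg_comp'[OF assms(2) vreg_TZ[OF assms(3)] openin_topspace])
      (use local_morphism_pts[OF assms(2)] in auto)
  then show ?thesis by (rule vreg_linear[OF linear_kappa_ret])
qed

lemma PZ_expand:
  assumes E: "E \<in> pts Z" and v: "v \<in> PZ E"
    and ex: "\<And>x. x \<in> E \<Longrightarrow> x = (\<Sum>t<r. fun_scale (l t x) (T t))"
  shows "v = (\<Sum>t<r. fun_scale (l t (D (pr v))) (\<kappa> (ret (T t))))"
proof -
  have "D (pr v) \<in> E" and 1: "v = \<kappa> (ret (D (pr v)))" using PZ_dest[OF E v] by auto
  then have "D (pr v) = (\<Sum>t<r. fun_scale (l t (D (pr v))) (T t))" using ex by blast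
  then have "\<kappa> (ret (D (pr v))) = \<kappa> (ret (\<Sum>t<r. fun_scale (l t (D (pr v))) (T t)))" by simp
  with 1 have "v = \<kappa> (ret (\<Sum>t<r. fun_scale (l t (D (pr v))) (T t)))" by (rule trans)
  then show ?thesis by (rule trans[OF _ kappa_ret_sum])
qed

text \<open>Three frames for one family: \<open>e\<close> on \<open>Z\<close> from a local section
  of the torsor, its pull-back for \<open>pullback_J\<close>, and the tautological frame made of the
  entries of the tuple for \<open>image_on_torsor_eq\<close>. The last one obtains its coefficients
  from the first through the matrix \<open>b\<close>.\<close>

lemma Z_frames:
  assumes T0: "T0 \<in> pts TZ"
  shows "\<exists>N e l. q T0 \<in> N \<and> frame fun_scale Z PZ N r e (\<lambda>i _. l i) \<and>
    frame fun_scale TZ (\<lambda>T. PZ (q T)) {T \<in> pts TZ. q T \<in> N} r (\<lambda>t T. e t (q T)) (\<lambda>i _. l i) \<and>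
    (\<exists>N' \<gamma>. T0 \<in> N' \<and> frame fun_scale TZ (\<lambda>T. PZ (q T)) N' r (\<lambda>u T. \<kappa> (ret (T u))) \<gamma>)"
proof -
  obtain N \<tau> l N' b where N: "is_open Z N" "q T0 \<in> N" "local_morphism Z N TZ \<tau>"
    "\<forall>s<r. linear_form fun_scale (l s)"
    "\<forall>E\<in>N. q (\<tau> E) = E \<and> (\<forall>v\<in>E. v = (\<Sum>t<r. fun_scale (l t v) (\<tau> E t)))"
    and N': "is_open TZ N'" "T0 \<in> N'" "\<forall>u<r. \<forall>t<r. b u t \<in> reg TZ N'"
      "\<forall>T\<in>N'. q T \<in> N \<and> (\<forall>t<r. \<tau> (q T) t = (\<Sum>u<r. fun_scale (b u t T) (T u)))"
    using Z_chart[OF T0] by (elim exE conjE)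
  define e where "e t E = \<kappa> (ret (\<tau> E t))" for t E
  define l' where "l' t v = l t (D (pr v))" for t v
  have l': "linear_form fun_scale (l' t)" if "t < r" for t
    unfolding l'_def[abs_def] by (rule linear_form_D_pr) (use N(4) that in simp)
  have ve: "vreg fun_scale Z N (e t)" if "t < r" for t
    unfolding e_def[abs_def] by (rule vreg_section[OF N(1,3) that])
  have NZ: "E \<in> pts Z" if "E \<in> N" for E using openin_subset[OF N(1)] that by auto
  have eP: "e t E \<in> PZ E" if "t < r" "E \<in> N" for t E
    using FL.tuple_span_base[OF that(1), of "\<tau> E"] N(5) that(2) unfolding e_def PZ_def by auto
  have ex: "v = (\<Sum>t<r. fun_scale (l' t v) (e t E))" if "E \<in> N" "v \<in> PZ E" for E v
    unfolding l'_def e_def by (rule PZ_expand[OF NZ[OF that(1)] that(2)]) (use N(5) that(1) in blast)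
  have f1: "frame fun_scale Z PZ N r e (\<lambda>i _. l' i)"
    by (rule frame_forms[OF N(1) ve eP l' ex])
  let ?N = "{T \<in> pts TZ. q T \<in> N}"
  have oN: "is_open TZ ?N" by (rule local_morphism_vimage[OF local_morphism_q N(1)])
  have f2: "frame fun_scale TZ (\<lambda>T. PZ (q T)) ?N r (\<lambda>t T. e t (q T)) (\<lambda>i _. l' i)"
  proof (rule frame_forms[OF oN])
    show "vreg fun_scale TZ ?N (\<lambda>T. e i (q T))" if "i < r" for i
      by (rule vreg_comp[OF local_morphism_q ve[OF that] N(1)])
    show "e i (q T) \<in> PZ (q T)" if "i < r" "T \<in> ?N" for i T using eP that by simp
    show "linear_form fun_scale (l' i)" if "i < r" for i by (rule l'[OF that])
    show "v = (\<Sum>i<r. fun_scale (l' i v) (e i (q T)))" if "T \<in> ?N" "v \<in> PZ (q T)" for T v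
      using ex that by simp
  qed
  \<comment> \<open>Change of frame: coefficients with respect to \<open>e\<close> are multiplied by
    the matrix that writes \<open>e\<close> in terms of the entries of \<open>T\<close>.\<close>
  define \<gamma> where "\<gamma> u T v = (\<Sum>t<r. b u t T * l' t v)" for u T v
  have N'p: "N' \<subseteq> pts TZ" by (rule openin_subset[OF N'(1)])
  have f3: "frame fun_scale TZ (\<lambda>T. PZ (q T)) N' r (\<lambda>u T. \<kappa> (ret (T u))) \<gamma>"
    unfolding frame_def
  proof (intro conjI allI impI ballI)
    show "is_open TZ N'" by fact
    fix u assume u: "u < r"
    show "vreg fun_scale TZ N' (\<lambda>T. \<kappa> (ret (T u)))"
      by (rule vreg_linear[OF linear_kappa_ret vreg_restrict[OF ringed_TZ vreg_TZ[OF u] openin_topspace N'(1) N'p]])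
    show "\<kappa> (ret (T u)) \<in> PZ (q T)" if "T \<in> N'" for T
      using FL.tuple_span_base[OF u, of T] unfolding PZ_def by auto
    show "(\<lambda>T. \<gamma> u T (s T)) \<in> reg TZ V" if V: "is_open TZ V" "V \<subseteq> N'" and s: "vreg fun_scale TZ V s" for V s
      unfolding \<gamma>_def
    proof (intro reg_sum[OF ringed_TZ V(1)] reg_mult[OF ringed_TZ V(1)])
      fix t assume "t \<in> {..<r}"
      then have t: "t < r" by simp
      show "b u t \<in> reg TZ V" by (rule reg_restrict[OF ringed_TZ _ N'(1) V]) (use N'(3) u t in simp)
      show "(\<lambda>T. l' t (s T)) \<in> reg TZ V" by (rule vregD[OF s l'[OF t]])
    qed
  next
    fix T v assume T: "T \<in> N'" and v: "v \<in> PZ (q T)"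
    have qT: "q T \<in> N" and \<tau>: "\<And>t. t < r \<Longrightarrow> \<tau> (q T) t = (\<Sum>u<r. fun_scale (b u t T) (T u))" using N'(4) T by auto
    have "v = (\<Sum>t<r. fun_scale (l' t v) (e t (q T)))" by (rule ex[OF qT v])
    also have "\<dots> = (\<Sum>t<r. \<Sum>u<r. fun_scale (b u t T * l' t v) (\<kappa> (ret (T u))))"
      by (rule sum.cong) (simp_all add: e_def \<tau> kappa_ret_sum FM.scale_sum_right mult.commute)
    also have "\<dots> = (\<Sum>u<r. fun_scale (\<gamma> u T v) (\<kappa> (ret (T u))))"
      unfolding \<gamma>_def by (subst sum.swap) (simp only: FM.scale_sum_left)
    finally show "v = (\<Sum>u<r. fun_scale (\<gamma> u T v) (\<kappa> (ret (T u))))" .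
  qed
  show ?thesis
    by (rule exI[of _ N], rule exI[of _ e], rule exI[of _ l'], intro conjI, rule N(2), rule f1, rule f2,
        rule exI[of _ N'], rule exI[of _ \<gamma>], intro conjI, rule N'(2), rule f3)
qed

text \<open>The frame \<open>e\<close> consists of sections of \<open>J\<close>, so its pull-back
  belongs to the generators.\<close>

lemma pullback_J:
  assumes U: "is_open TZ U"
  shows "pullback_subsheaf fun_scale TZ Z q J U = family_sections fun_scale TZ (\<lambda>T. PZ (q T)) U"
  unfolding pullback_subsheaf_def
proof (rule FM.generated_eq_family_sections[OF ringed_TZ U])
  let ?S = "\<lambda>V. {\<lambda>y\<in>V. s (q y) | s U. is_open Z U \<and> q ` V \<subseteq> U \<and> s \<in> J U}"
  fix T assume T: "T \<in> U"
  then have T': "T \<in> pts TZ" using openin_subset[OF U] by auto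
  show "FM.subspace (PZ (q T))"
    by (rule subspace_PZ[OF local_morphism_pts[OF local_morphism_q T']])
  from Z_frames[OF T'] obtain N e l where N: "q T \<in> N" "frame fun_scale Z PZ N r e (\<lambda>i _. l i)"
    "frame fun_scale TZ (\<lambda>T. PZ (q T)) {T \<in> pts TZ. q T \<in> N} r (\<lambda>t T. e t (q T)) (\<lambda>i _. l i)"
    by (elim exE conjE)
  have "restrict (\<lambda>T. e i (q T)) V \<in> ?S V" if "V \<subseteq> {T \<in> pts TZ. q T \<in> N}" "i < r" for V i
  proof -
    have "restrict (e i) N \<in> J N"
      using frame_restrict_mem[OF ringed_Z N(2) that(2) frame_open[OF N(2)] order_refl] frame_open[OF N(2)]
      unfolding J_def by simp
    moreover have "restrict (\<lambda>T. e i (q T)) V = (\<lambda>T\<in>V. restrict (e i) N (q T))"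
      using that(1) by (intro restrict_ext) auto
    moreover have "q ` V \<subseteq> N" using that(1) by auto
    ultimately show ?thesis using frame_open[OF N(2)] by blast
  qed
  then show "\<exists>N n e \<gamma>. T \<in> N \<and> frame fun_scale TZ (\<lambda>T. PZ (q T)) N n e \<gamma> \<and>
      (\<forall>V. is_open TZ V \<longrightarrow> V \<subseteq> N \<longrightarrow> V \<subseteq> U \<longrightarrow> (\<forall>i<n. restrict (e i) V \<in> ?S V))"
    using T' N(1,3) by - (rule exI[of _ "{T \<in> pts TZ. q T \<in> N}"], rule exI[of _ r],
      rule exI[of _ "\<lambda>t T. e t (q T)"], rule exI[of _ "\<lambda>i _. l i"], simp)
next
  let ?S = "\<lambda>V. {\<lambda>y\<in>V. s (q y) | s U. is_open Z U \<and> q ` V \<subseteq> U \<and> s \<in> J U}"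
  fix V assume V: "is_open TZ V" "V \<subseteq> U"
  show "?S V \<subseteq> family_sections fun_scale TZ (\<lambda>T. PZ (q T)) V"
  proof
    fix t assume "t \<in> ?S V"
    then obtain s U' where s: "t = (\<lambda>y\<in>V. s (q y))" "is_open Z U'" "q ` V \<subseteq> U'" "s \<in> J U'"
      by (elim CollectE exE conjE)
    then have s': "vreg fun_scale Z U' s" "\<forall>E\<in>U'. s E \<in> PZ E" unfolding J_def family_sections_def by auto
    have "local_morphism TZ V Z q"
      by (rule local_morphism_restrict[OF ringed_TZ local_morphism_q V(1) openin_subset[OF V(1)]])
    from vreg_comp'[OF this s'(1) s(2,3)] have "vreg fun_scale TZ V (\<lambda>y. s (q y))" .
    then have "vreg fun_scale TZ V t" by (rule vreg_cong[OF ringed_TZ]) (simp add: s(1))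
    then show "t \<in> family_sections fun_scale TZ (\<lambda>T. PZ (q T)) V"
      unfolding family_sections_def s(1) using s'(2) s(3) by auto
  qed
qed

lemma Theta_PZ:
  assumes T: "T \<in> pts TZ" and s: "s < r"
  shows "Theta L B fun_scale \<sigma> s F T = fun_scale (F T 0) (\<kappa> (ret (T s)))" "\<kappa> (ret (T s)) \<in> PZ (q T)"
proof -
  have Ts: "T s \<in> q T" by (rule FL.tuple_span_base[OF s])
  have "q T \<in> pts Z" using T pts_TZ by auto
  then obtain u where u: "T s = D u" using Ts unfolding pts_Z by auto
  show "Theta L B fun_scale \<sigma> s F T = fun_scale (F T 0) (\<kappa> (ret (T s)))"
    using Theta_eq[OF B, of T s F] D_mem[of u] unfolding u by (simp add: lie_action_D ret_D kappa_scale)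
  show "\<kappa> (ret (T s)) \<in> PZ (q T)" unfolding PZ_def using Ts by auto
qed

lemma image_on_torsor_eq:
  assumes U: "is_open TZ U"
  shows "image_on_torsor L B fun_scale M \<sigma> r Z U = family_sections fun_scale TZ (\<lambda>T. PZ (q T)) U"
  unfolding image_on_torsor_def
proof (rule FM.generated_eq_family_sections[OF ringed_TZ U])
  let ?S = "\<lambda>V. \<Union>s\<in>{..<r}. (\<lambda>F. restrict (Theta L B fun_scale \<sigma> s F) V) ` free_sections fun_scale M TZ V"
  fix T assume T: "T \<in> U"
  then have T': "T \<in> pts TZ" using openin_subset[OF U] by auto
  show "FM.subspace (PZ (q T))"
    by (rule subspace_PZ[OF local_morphism_pts[OF local_morphism_q T']])
  from Z_frames[OF T'] obtain N' \<gamma> where N': "T \<in> N'"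
    "frame fun_scale TZ (\<lambda>T. PZ (q T)) N' r (\<lambda>u T. \<kappa> (ret (T u))) \<gamma>"
    by (elim exE conjE)
  have "restrict (\<lambda>T. \<kappa> (ret (T i))) V \<in> ?S V" if V: "is_open TZ V" and i: "i < r" for V i
  proof -
    \<comment> \<open>The constant section \<open>e0\<close> has first coordinate 1, so
      \<open>Theta\<close> with index \<open>i\<close> maps it to the member \<open>i\<close> of the
      tautological frame.\<close>
    have "vreg fun_scale TZ V (\<lambda>_\<in>V. e0)"
      by (rule vreg_cong[OF ringed_TZ FM.vreg_const[OF ringed_TZ V, of e0]]) simp
    then have "(\<lambda>_\<in>V. e0) \<in> free_sections fun_scale M TZ V"
      unfolding FM.free_sections_eq[OF ringed_TZ V fin_dim_M] family_sections_def using e0_mem by simp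
    moreover have "restrict (\<lambda>T. \<kappa> (ret (T i))) V = restrict (Theta L B fun_scale \<sigma> i (\<lambda>_\<in>V. e0)) V"
    proof (rule restrict_ext)
      fix T assume T: "T \<in> V"
      then have "T \<in> pts TZ" using openin_subset[OF V] by auto
      from Theta_PZ(1)[OF this i] T show "\<kappa> (ret (T i)) = Theta L B fun_scale \<sigma> i (\<lambda>_\<in>V. e0) T"
        by (simp add: e0_def fun_scale_def)
    qed
    ultimately show ?thesis using i by blast
  qed
  then show "\<exists>N n e \<gamma>. T \<in> N \<and> frame fun_scale TZ (\<lambda>T. PZ (q T)) N n e \<gamma> \<and>
      (\<forall>V. is_open TZ V \<longrightarrow> V \<subseteq> N \<longrightarrow> V \<subseteq> U \<longrightarrow> (\<forall>i<n. restrict (e i) V \<in> ?S V))"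
    using N' by - (rule exI[of _ N'], rule exI[of _ r],
      rule exI[of _ "\<lambda>u T. \<kappa> (ret (T u))"], rule exI[of _ \<gamma>], simp)
next
  let ?S = "\<lambda>V. \<Union>s\<in>{..<r}. (\<lambda>F. restrict (Theta L B fun_scale \<sigma> s F) V) ` free_sections fun_scale M TZ V"
  fix V assume V: "is_open TZ V" "V \<subseteq> U"
  have Vp: "V \<subseteq> pts TZ" by (rule openin_subset[OF V(1)])
  show "?S V \<subseteq> family_sections fun_scale TZ (\<lambda>T. PZ (q T)) V"
  proof
    fix t assume "t \<in> ?S V"
    then obtain s F where s: "s < r" "F \<in> free_sections fun_scale M TZ V"
      "t = restrict (Theta L B fun_scale \<sigma> s F) V" by auto
    have "vreg fun_scale TZ V F"
      using s(2) unfolding FM.free_sections_eq[OF ringed_TZ V(1) fin_dim_M] family_sections_def by simp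
    moreover have "linear_form fun_scale (\<lambda>v :: nat \<Rightarrow> 'k. v 0)"
      unfolding FM.linear_form_iff by (simp add: fun_scale_def)
    ultimately have F: "(\<lambda>T. F T 0) \<in> reg TZ V" by (rule vregD)
    have e: "t T = fun_scale (F T 0) (\<kappa> (ret (T s)))" "\<kappa> (ret (T s)) \<in> PZ (q T)" "FM.subspace (PZ (q T))"
      if T: "T \<in> V" for T
      using Theta_PZ[OF subsetD[OF Vp T] s(1)] T subspace_PZ[OF local_morphism_pts[OF local_morphism_q subsetD[OF Vp T]]]
      unfolding s(3) by simp_all
    have "vreg fun_scale TZ V (\<lambda>T. \<kappa> (ret (T s)))"
      by (rule vreg_linear[OF linear_kappa_ret vreg_restrict[OF ringed_TZ vreg_TZ[OF s(1)] openin_topspace V(1) Vp]])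
    from FM.vreg_scale[OF ringed_TZ V(1) F this]
    have "vreg fun_scale TZ V t" by (rule vreg_cong[OF ringed_TZ]) (simp add: e(1))
    moreover have "t T \<in> PZ (q T)" if "T \<in> V" for T
      unfolding e(1)[OF that] by (rule FM.subspace_scale[OF e(3)[OF that] e(2)[OF that]])
    ultimately show "t \<in> family_sections fun_scale TZ (\<lambda>T. PZ (q T)) V"
      unfolding family_sections_def s(3) by simp
  qed
qed

lemma coherent_J: "coherent_subsheaf fun_scale M Z J"
  unfolding coherent_subsheaf_def
proof (intro conjI allI impI)
  show "J U = {}" if "\<not> is_open Z U" for U using that by (simp add: J_def)
next
  fix U assume U: "is_open Z U"
  have J: "J U = family_sections fun_scale Z PZ U" using U by (simp add: J_def)
  have sub: "FM.subspace (PZ E)" if "E \<in> U" for E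
    by (rule subspace_PZ[OF subsetD[OF openin_subset[OF U] that]])
  show "J U \<subseteq> free_sections fun_scale M Z U"
    unfolding J FM.free_sections_eq[OF ringed_Z U fin_dim_M] family_sections_def using PZ_subset by auto
  show "(\<lambda>x\<in>U. 0) \<in> J U"
    unfolding J by (rule FM.family_sections_zero[OF ringed_Z U sub])
  show "\<forall>s\<in>J U. \<forall>t\<in>J U. (\<lambda>x\<in>U. s x + t x) \<in> J U"
    unfolding J by (intro ballI) (rule FM.family_sections_add[OF ringed_Z U sub])
  show "\<forall>f\<in>reg Z U. \<forall>s\<in>J U. (\<lambda>x\<in>U. fun_scale (f x) (s x)) \<in> J U"
    unfolding J by (intro ballI) (rule FM.family_sections_scale[OF ringed_Z U sub])
  show "\<forall>s\<in>J U. restrict s V \<in> J V" if V: "is_open Z V" "V \<subseteq> U" for V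
  proof
    fix s assume "s \<in> J U"
    then show "restrict s V \<in> J V"
      using restrict_family_sections[OF ringed_Z U V, of s fun_scale PZ] V(1) unfolding J by (simp add: J_def)
  qed
  show "\<forall>s\<in>extensional U. (\<forall>x\<in>U. \<exists>V. is_open Z V \<and> x \<in> V \<and> V \<subseteq> U \<and> restrict s V \<in> J V) \<longrightarrow> s \<in> J U"
  proof (intro ballI impI)
    fix s assume s: "s \<in> extensional U"
      and loc: "\<forall>x\<in>U. \<exists>V. is_open Z V \<and> x \<in> V \<and> V \<subseteq> U \<and> restrict s V \<in> J V"
    show "s \<in> J U" unfolding J
    proof (rule FM.family_sections_local[OF ringed_Z U s])
      fix x assume "x \<in> U"
      from bspec[OF loc this] obtain V where V: "is_open Z V" "x \<in> V" "V \<subseteq> U" "restrict s V \<in> J V"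
        by (elim exE conjE)
      then have "restrict s V \<in> family_sections fun_scale Z PZ V" by (simp add: J_def)
      with V show "\<exists>V. is_open Z V \<and> x \<in> V \<and> V \<subseteq> U \<and> restrict s V \<in> family_sections fun_scale Z PZ V"
        by (intro exI conjI)
    qed
  qed
next
  show "\<forall>x\<in>pts Z. \<exists>U E. is_open Z U \<and> x \<in> U \<and> finite E \<and> E \<subseteq> J U \<and>
      (\<forall>V. is_open Z V \<longrightarrow> V \<subseteq> U \<longrightarrow> J V = generated fun_scale Z (\<lambda>V'. (\<lambda>e. restrict e V') ` E) V)"
  proof
    fix x assume x: "x \<in> pts Z"
    obtain T0 where T0: "T0 \<in> pts TZ" "q T0 = x" by (rule Z_point[OF x])
    obtain N e l where N: "q T0 \<in> N" "frame fun_scale Z PZ N r e (\<lambda>i _. l i)"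
      using Z_frames[OF T0(1)] by (elim exE conjE)
    have oN: "is_open Z N" by (rule frame_open[OF N(2)])
    \<comment> \<open>The members of the frame over \<open>N\<close> are the finitely many
      generators required for coherence.\<close>
    let ?E = "(\<lambda>i. restrict (e i) N) ` {..<r}"
    have mem: "restrict (e i) V \<in> family_sections fun_scale Z PZ V" if "i < r" "is_open Z V" "V \<subseteq> N" for i V
      by (rule frame_restrict_mem[OF ringed_Z N(2) that])
    have rr: "restrict (restrict (e i) N) V = restrict (e i) V" if "V \<subseteq> N" for i V
      using that by (intro ext) auto
    have "J V = generated fun_scale Z (\<lambda>V'. (\<lambda>e. restrict e V') ` ?E) V"
      if V: "is_open Z V" "V \<subseteq> N" for V
    proof -
      have "generated fun_scale Z (\<lambda>V'. (\<lambda>e. restrict e V') ` ?E) V = family_sections fun_scale Z PZ V"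
      proof (rule FM.generated_eq_family_sections[OF ringed_Z V(1)])
        show "FM.subspace (PZ E)" if "E \<in> V" for E
          by (rule subspace_PZ[OF subsetD[OF openin_subset[OF V(1)] that]])
        show "(\<lambda>e. restrict e V') ` ?E \<subseteq> family_sections fun_scale Z PZ V'"
          if V': "is_open Z V'" "V' \<subseteq> V" for V'
        proof -
          have "V' \<subseteq> N" using V'(2) V(2) by auto
          then show ?thesis using mem[OF _ V'(1)] rr by auto
        qed
        show "\<exists>N n e \<gamma>. E \<in> N \<and> frame fun_scale Z PZ N n e \<gamma> \<and>
          (\<forall>V'. is_open Z V' \<longrightarrow> V' \<subseteq> N \<longrightarrow> V' \<subseteq> V \<longrightarrow> (\<forall>i<n. restrict (e i) V' \<in> (\<lambda>e. restrict e V') ` ?E))"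
          if "E \<in> V" for E
        proof (rule exI[of _ N], rule exI[of _ r], rule exI[of _ e], rule exI[of _ "\<lambda>i _. l i"],
            intro conjI allI impI)
          show "E \<in> N" using that V(2) by auto
          show "frame fun_scale Z PZ N r e (\<lambda>i _. l i)" by (rule N(2))
          show "restrict (e i) V' \<in> (\<lambda>e. restrict e V') ` ?E" if "V' \<subseteq> N" "i < r" for V' i
            unfolding rr[OF that(1), symmetric] using that(2) by blast
        qed
      qed
      then show ?thesis using V(1) by (simp add: J_def)
    qed
    moreover have "?E \<subseteq> J N" using mem[OF _ oN order_refl] oN by (auto simp: J_def)
    ultimately show "\<exists>U E. is_open Z U \<and> x \<in> U \<and> finite E \<and> E \<subseteq> J U \<and>
      (\<forall>V. is_open Z V \<longrightarrow> V \<subseteq> U \<longrightarrow> J V = generated fun_scale Z (\<lambda>V'. (\<lambda>e. restrict e V') ` E) V)"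
      using oN N(1) T0(2) by - (rule exI[of _ N], rule exI[of _ ?E], simp)
  qed
qed

text \<open>\<open>J\<close> solves the descent problem because its pull-back and the image on the
  torsor are the same family of sections. It is the only solution because the torsor has local
  sections, which force both inclusions between two coherent subsheaves with equal
  pull-backs.\<close>

lemma image_sheaf_eq: "image_sheaf L B fun_scale M \<sigma> r Z = J"
  unfolding image_sheaf_def lscale_L
proof (rule the_equality)
  show "coherent_subsheaf fun_scale M Z J \<and>
    (\<forall>V. is_open TZ V \<longrightarrow> pullback_subsheaf fun_scale TZ Z q J V = image_on_torsor L B fun_scale M \<sigma> r Z V)"
    using coherent_J pullback_J image_on_torsor_eq by simp
  have lsec: "\<exists>N \<tau>. x \<in> N \<and> local_morphism Z N TZ \<tau> \<and> (\<forall>z\<in>N. q (\<tau> z) = z)" if x: "x \<in> pts Z" for x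
  proof -
    obtain T0 where T0: "T0 \<in> pts TZ" "q T0 = x" by (rule Z_point[OF x])
    obtain N \<tau> where "q T0 \<in> N" "local_morphism Z N TZ \<tau>" and N: "\<forall>E\<in>N. q (\<tau> E) = E \<and> E = E"
      using Z_chart[OF T0(1)] by (elim exE conjE) (rule that, assumption, assumption, blast)
    then show ?thesis using T0(2) by auto
  qed
  fix I assume I: "coherent_subsheaf fun_scale M Z I \<and>
    (\<forall>V. is_open TZ V \<longrightarrow> pullback_subsheaf fun_scale TZ Z q I V = image_on_torsor L B fun_scale M \<sigma> r Z V)"
  then have cI: "coherent_subsheaf fun_scale M Z I"
    and pI: "\<And>V. is_open TZ V \<Longrightarrow> pullback_subsheaf fun_scale TZ Z q I V = pullback_subsheaf fun_scale TZ Z q J V"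
    using pullback_J image_on_torsor_eq by simp_all
  show "I = J"
  proof
    fix U
    show "I U = J U"
    proof
      show "I U \<subseteq> J U"
        by (rule coherent_subsheaf_pullback_subset[OF vector_space_fun_scale ringed_Z ringed_TZ local_morphism_q
              lsec cI coherent_J pI])
      show "J U \<subseteq> I U"
        by (rule coherent_subsheaf_pullback_subset[OF vector_space_fun_scale ringed_Z ringed_TZ local_morphism_q
              lsec coherent_J cI pI[symmetric]])
    qed
  qed
qed

section \<open>The image bundle over the orbit\<close>

abbreviation "IB \<equiv> transport (\<lambda>y. D ` y) (image_bundle G B fun_scale M \<rho> r Z)"

text \<open>Sections pass from \<open>Z\<close> to \<open>Y\<close> by composing with the embedding
  by \<open>D\<close> and applying \<open>pr\<close>, and back by composing with \<open>ret\<close>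
  and applying \<open>\<kappa>\<close>; so regularity of the maps between \<open>Y\<close> and
  \<open>Z\<close> is used in both directions.\<close>

lemma sec_image_bundle:
  assumes U: "is_open Y U"
  shows "sec IB U = (\<lambda>t. \<lambda>y\<in>U. \<kappa> (t y)) ` K U"
proof -
  let ?V = "(\<lambda>y. D ` y) ` U"
  have Up: "U \<subseteq> pts Y" by (rule openin_subset[OF U])
  have V: "is_open Z ?V" by (rule open_iota[OF U])
  have s: "sec IB U = {\<lambda>y\<in>U. s (D ` y) | s. s \<in> family_sections fun_scale Z PZ ?V}"
    unfolding transport_def image_bundle_def image_sheaf_eq using V by (simp add: J_def)
  show ?thesis unfolding s
  proof (intro equalityI subsetI)
    fix s' assume "s' \<in> {\<lambda>y\<in>U. s (D ` y) | s. s \<in> family_sections fun_scale Z PZ ?V}"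
    then obtain s where s: "s' = (\<lambda>y\<in>U. s (D ` y))" "vreg fun_scale Z ?V s" "\<forall>E\<in>?V. s E \<in> PZ E"
      unfolding family_sections_def by auto
    define t where "t = (\<lambda>y\<in>U. pr (s (D ` y)))"
    have st: "t y \<in> y \<and> \<kappa> (t y) = s (D ` y)" if y: "y \<in> U" for y
    proof -
      have "s (D ` y) \<in> \<kappa> ` y" using s(3) y unfolding PZ_def by (auto simp: ret_image)
      then show ?thesis using y by (auto simp: t_def pr_kappa)
    qed
    have "local_morphism Y U Z (\<lambda>y. D ` y)" by (rule local_morphism_restrict[OF ringed_Y local_morphism_iota U Up])
    from vreg_linear[OF linear_pr vreg_comp'[OF this s(2) V order_refl]]
    have "vreg scW Y U t" by (rule vreg_cong[OF ringed_Y]) (simp add: t_def)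
    then have "t \<in> K U" unfolding family_sections_def using st by (simp add: t_def)
    moreover have "s' = (\<lambda>y\<in>U. \<kappa> (t y))" unfolding s(1) using st by (intro restrict_ext) simp
    ultimately show "s' \<in> (\<lambda>t. \<lambda>y\<in>U. \<kappa> (t y)) ` K U" by blast
  next
    fix s' assume "s' \<in> (\<lambda>t. \<lambda>y\<in>U. \<kappa> (t y)) ` K U"
    then obtain t where t: "s' = (\<lambda>y\<in>U. \<kappa> (t y))" "vreg scW Y U t" "\<forall>y\<in>U. t y \<in> y"
      unfolding family_sections_def by auto
    define s where "s = (\<lambda>E\<in>?V. \<kappa> (t (ret ` E)))"
    have "local_morphism Z ?V Y (\<lambda>E. ret ` E)"
      by (rule local_morphism_restrict[OF ringed_Z local_morphism_ret V openin_subset[OF V]])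
    moreover have "(\<lambda>E. ret ` E) ` ?V \<subseteq> U" by (auto simp: ret_image)
    ultimately have "vreg fun_scale Z ?V (\<lambda>E. \<kappa> (t (ret ` E)))"
      by (intro vreg_linear[OF linear_kappa] vreg_comp'[OF _ t(2) U])
    then have "vreg fun_scale Z ?V s" by (rule vreg_cong[OF ringed_Z]) (simp add: s_def)
    moreover have "s E \<in> PZ E" if "E \<in> ?V" for E
      using that t(3) unfolding s_def PZ_def by (auto simp: ret_image)
    ultimately have "s \<in> family_sections fun_scale Z PZ ?V" unfolding family_sections_def by (simp add: s_def)
    moreover have "s' = (\<lambda>y\<in>U. s (D ` y))" unfolding t(1) s_def by (intro restrict_ext) (simp add: ret_image)
    ultimately show "s' \<in> {\<lambda>y\<in>U. s (D ` y) | s. s \<in> family_sections fun_scale Z PZ ?V}" by blast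
  qed
qed

lemma image_iso_canonical:
  "equivariant_iso H Y (\<lambda>h y. act h ` y) IB (canonical_bundle scW act r Y)"
proof (rule equivariant_iso_sym)
  let ?F = "canonical_bundle scW act r Y" and ?b = "\<lambda>h y. act h ` y"
  have F: "fib ?F = (\<lambda>y. y)" "fadd ?F = (+)" "fscale ?F = scW" "fzero ?F = (\<lambda>_. 0)" "fact ?F = act"
    by (simp_all add: canonical_bundle_def)
  have F': "fib IB = (\<lambda>_. M)" "fadd IB = (+)" "fscale IB = fun_scale" "fzero IB = (\<lambda>_. 0)"
    "fact IB = (\<lambda>h. \<rho> (0, h))"
    by (simp_all add: transport_def image_bundle_def)
  show "equivariant_iso H Y ?b ?F IB"
  proof (rule equivariant_transfer[where \<theta> = "\<lambda>_. \<kappa>", OF equivariant_canonical_bundle])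
    show "fibre_axioms H Y ?b IB"
      unfolding fibre_axioms_def F'
    proof (intro conjI ballI allI)
      show "vector_space_on M (+) fun_scale 0"
        by (rule vector_space_on_subspace[OF vector_space_fun_scale subspace_M])
      show "\<rho> (0, h) u \<in> M" for h u by (rule rho_mem)
      show "\<rho> (0, h) (u + v) = \<rho> (0, h) u + \<rho> (0, h) v" for h u v by (rule rho_add)
      show "\<rho> (0, h) (fun_scale c u) = fun_scale c (\<rho> (0, h) u)" for h c u by (rule rho_scale)
      show "\<rho> (0, gone H) u = u" if "u \<in> M" for u using rho_one[OF that] by (simp add: G_simps)
      show "\<rho> (0, gmult H g h) u = \<rho> (0, g) (\<rho> (0, h) u)" for g h u
        using rho_mult[of "(0, g)" "(0, h)" u] by (simp add: G_simps act_zero)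
    qed
    show "inj_on \<kappa> (fib ?F y)" for y by (rule inj_on_inverseI[of _ pr]) (rule pr_kappa)
    show "sec IB U = (\<lambda>s. \<lambda>y\<in>U. \<kappa> (s y)) ` sec ?F U" if "is_open Y U" for U
      unfolding sec_canonical_bundle[OF that] by (rule sec_image_bundle[OF that])
  qed (simp_all add: F F' kappa_mem kappa_add kappa_scale kappa_zero rho_kappa)
qed

end

theorem corollary6p10:
  fixes H :: "('h, 'k::alg_closed_field) grp_scheme"
    and scW :: "'k \<Rightarrow> 'w::ab_group_add \<Rightarrow> 'w"
    and BW :: "'w set"
    and act :: "'h \<Rightarrow> 'w \<Rightarrow> 'w"
    and \<epsilon> :: "'w set"
    and r :: nat
    and S :: "'h set"
    and Y :: "('w set, 'k) fspace"
    and \<phi> :: "'h set \<Rightarrow> 'w set"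
    and G :: "('w \<times> 'h, 'k) grp_scheme"
    and \<iota> :: "'w set \<Rightarrow> (('w \<times> 'h \<Rightarrow> 'k) \<Rightarrow> 'k) set"
    and B :: "(('w \<times> 'h \<Rightarrow> 'k) \<Rightarrow> 'k) set"
  assumes char: "CHAR('k) > 0"
    and H: "affine_algebraic_group H"
    and W: "finite_dimensional_vector_space scW BW" "rational_module H scW UNIV act"
    and G_def: "G = G_WH scW act H"
    and r: "0 < r" "r < vector_space.dim fun_scale (lcar (Lie G))"
    and eps: "module.subspace scW \<epsilon>" "vector_space.dim scW \<epsilon> = r"
    and S_def: "S = {h. act h ` \<epsilon> = \<epsilon>}"
    and Y_def: "Y = sub_space (grass scW UNIV r) (range (\<lambda>h. act h ` \<epsilon>))"
    and phi_def: "\<phi> = (\<lambda>c. \<Union>h\<in>c. act h ` \<epsilon>)"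
    and phi_iso: "isomorphism (homogeneous_space H S) Y \<phi>"
    and iota_def: "\<iota> = (\<lambda>y. lie_W scW act H ` y)"
    and B: "basis_of fun_scale B (lcar (Lie G))"
  shows "\<exists>(M :: (nat \<Rightarrow> 'k) set) \<rho>.
    rational_module G fun_scale M \<rho> \<and>
    equivariant_iso H Y (\<lambda>h y. act h ` y)
      (transport \<iota> (image_bundle G B fun_scale M \<rho> r
         (sub_space (elem_variety (Lie G) r) (\<iota> ` pts Y))))
      (canonical_bundle scW act r Y) \<and>
    equivariant_iso H Y (\<lambda>h y. act h ` y)
      (canonical_bundle scW act r Y)
      (transport (inv_into (pts (homogeneous_space H S)) \<phi>)
         (associated_bundle H S scW act \<epsilon>))"
proof -
  interpret W: finite_dimensional_vector_space scW BW by (rule W(1))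
  have fin: "fin_dim_subspace scW UNIV"
    unfolding fin_dim_subspace_def
    by (rule exI[of _ BW], rule conjI, rule W.finite_Basis, rule W.span_Basis[symmetric])
  interpret rational_rep scW H act by unfold_locales (fact H, fact fin, fact W(2))
  obtain n :: nat and e l where el: "\<forall>i<n. e i \<in> (UNIV :: 'w set) \<and> linear_form scW (l i)"
    "\<forall>i<n. \<forall>j<n. l i (e j) = of_bool (i = j)" "\<forall>v\<in>UNIV. v = (\<Sum>i<n. scW (l i v) (e i))"
    using W.fin_dim_coords[OF fin] by (elim exE conjE)
  interpret orb: orbit scW H act r \<epsilon> by unfold_locales (fact r(1), fact eps(1), fact eps(2))
  have Y: "Y = orb.Y" unfolding Y_def orb.Y_def by (rule refl)
  interpret hom: homogeneous_orbit scW H act r \<epsilon> S \<phi>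
    by unfold_locales (rule S_def, rule phi_def, rule phi_iso[unfolded Y])
  have B': "basis_of fun_scale B (lcar (Lie (G_WH scW act H)))" using B unfolding G_def .
  interpret img: image_setup scW H act r \<epsilon> n e l B
    by unfold_locales (use char el B' in blast)+
  show ?thesis
    unfolding G_def Y iota_def img.Z_def[symmetric]
    by (rule exI[of _ img.M], rule exI[of _ img.\<rho>], intro conjI, rule img.rational_module_M,
        rule img.image_iso_canonical, rule hom.canonical_iso_associated)
qed

end
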